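(* For every directed $\Sigma$-labeled tree $T$ and every two (possibly equal) vertices $x$ and $y$ of $T$ there is an associated $\mathbf{Z}$-valued measure $\mu_{T,x,y}$ for $H$ (the measure determined by $\mu_{T,x,y}(I^w)=\nu^{T,x,y}_{a,b}(w)$ for all $w\in\Sigma^{\star}$ and all intervals $I$ of $\mathbf{L}$ with left endpoint of type $a$ and right endpoint of type $b$). Identify $\mu_{T,x,y}$ with the corresponding ring homomorphism $\Theta(H)\to\mathbf{Z}$. The product of these homomorphisms, over isomorphism classes of triples $(T,x,y)$, is a ring isomorphism $$\Theta(H)\longrightarrow\prod_{T,x,y}\mathbf{Z}.$$ In particular, $\Theta(H)\cong\mathbf{Z}^M$, where $M=(2n+2)^n$ and $n=\#\Sigma$.
   Context: **The group.** $\Sigma$ is a non-empty finite set (of colors). $\mathbf{S}$ is a countably infinite set with a cyclic order (a ternary relation, written $x<y<z$, satisfying the usual axioms) that is everywhere dense: for $x\neq y$ the set $\{z : x<z<y\}$ is non-empty; $\sigma\colon\mathbf{S}\to\Sigma$ is a function such that each $\sigma^{-1}(a)$, $a\in\Sigma$, meets every such set. Fix $\infty\in\mathbf{S}$ and let $\mathbf{L}=\mathbf{S}\setminus\{\infty\}$, with its induced total order and coloring (as an ordered set $\mathbf{L}\cong\mathbf{Q}$, and each color is dense). $H$ is the group of all bijections $\mathbf{L}\to\mathbf{L}$ preserving the total order and coloring. For finite $A\subset\mathbf{L}$, $H(A)$ is the subgroup fixing each element of $A$; these form a neighborhood basis of the identity for the topology on $H$. An interval of $\mathbf{L}$ is a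 set $(p,q)=\{z\in\mathbf{L}: p<z<q\}$ with $p\in\mathbf{L}\cup\{-\infty\}$, $q\in\mathbf{L}\cup\{+\infty\}$, $p<q$. The type of an endpoint in $\mathbf{L}$ is its color, and the type of $\pm\infty$ is $\pm\infty$. $\Sigma^{\star}$ is the set of finite words in $\Sigma$. For $w=w_1\cdots w_n\in\Sigma^{\star}$, $I^w$ is the set of tuples $(x_1,\dots,x_n)\in I^n$ with $x_1<\cdots<x_n$ and $\sigma(x_i)=w_i$. **Measures.** For an open subgroup $U\subset H$, a $U$-set is a set with an action of $U$ such that all stabilizers are open; it is finitary if it has finitely many orbits. An $\hat{H}$-set is a $U$-set for some open subgroup $U$ (a group of definition); shrinking $U$ does not change the $\hat H$-set, and two $\hat H$-sets are isomorphic if they are isomorphic as $U$-sets for some sufficiently small open $U$. It is finitary if it is so for some (equivalently any) group of definition. For $g\in H$, $X^g$ is the conjugate $\hat H$-set. A measure for $H$ valued in a commutative ring $k$ is a rule $\mu$ assigning to each finitary $\hat H$-set $X$ an element $\mu(X)\in k$ such that: (a) $\mu(X)=\mu(Y)$ if $X\cong Y$; (b) $\mu(\mathbf 1)=1$ for the one-point set $\mathbf 1$; (c) $\mu(X^g)=\mu(X)$ for $g\in H$; (d) $\mu(X\amalg Y)=\mu(X)+\mu(Y)$; (e) if $X\to Y$ is a map of transitive $U$-sets, for some open subgroup $U$, with fiber $F$ over some point, then $\mu(X)=\mu(F)\mu(Y)$. $\Theta(H)$ is the commutative ring generated by symbols $[X]$, for $X$ an isomorphism class of finitary $\hat H$-sets,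 modulo the relations corresponding to (b)–(e). Thus $k$-valued measures $\mu$ correspond to ring homomorphisms $\Theta(H)\to k$, $[X]\mapsto\mu(X)$. **Trees.** A tree is a finite simple connected graph with no cycles. A directed $\Sigma$-labeled tree is a tree in which each edge is given a direction, together with a bijection between $\Sigma$ and the edge set; isomorphisms respect directions and labels (and, for triples $(T,x,y)$, the vertices $x$ and $y$). Deleting an edge $c$ (but not its vertices) leaves two components; $c$ points towards one of them. Given $(T,x,y)$, define $S\colon\Sigma\times(\Sigma\cup\{\pm\infty\})\to\{0,1\}$ as follows. $S_{c,c}=0$. For $c\neq a$ in $\Sigma$, $S_{c,a}=1$ if $c$ points towards the component containing edge $a$, and $S_{c,a}=0$ otherwise. $S_{c,+\infty}=1$ if $c$ points towards the component containing $x$, and $0$ otherwise. $S_{c,-\infty}=1$ if $c$ points towards the component containing $y$, and $0$ otherwise. For $a\in\Sigma\cup\{-\infty\}$, $b\in\Sigma\cup\{+\infty\}$, $c\in\Sigma$, put $\eta_{a,b}(c)=S_{c,a}-S_{c,b}-\delta_{b,c}\in\mathbf{Z}$, where $\delta$ is the Kronecker delta. Define $\nu^{T,x,y}_{a,b}(w)\in\mathbf Z$ recursively by $\nu^{T,x,y}_{a,b}(\emptyset)=1$ and $\nu^{T,x,y}_{a,b}(w_1\cdots w_n)=\eta_{a,b}(w_n)\,\nu^{T,x,y}_{a,w_n}(w_1\cdots w_{n-1})$ for $n\ge1$. *)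

theory Defs
  imports
    "HOL-Algebra.Group_Action"
    "HOL-Algebra.IntRing"
    "HOL-Library.Poly_Mapping"
    "HOL-Library.Extended"
    "HOL-Library.Countable_Set"
begin

section \<open>Measures for a permutation group\<close>

text \<open>
  Throughout, \<open>G\<close> is a set of bijections of \<open>\<Omega>\<close> closed under composition and inverses
  (extensional functions, as in \<^const>\<open>Bij\<close>), with the topology in which the pointwise
  stabilizers of finite subsets of \<open>\<Omega>\<close> are a neighborhood basis of the identity.
\<close>

definition perm_group :: "'s set \<Rightarrow> ('s \<Rightarrow> 's) set \<Rightarrow> ('s \<Rightarrow> 's) monoid" where
  "perm_group \<Omega> U = (BijGroup \<Omega>)\<lparr>carrier := U\<rparr>"

definition pointwise_stab :: "('s \<Rightarrow> 's) set \<Rightarrow> 's set \<Rightarrow> ('s \<Rightarrow> 's) set" where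
  "pointwise_stab G A = {g \<in> G. \<forall>a\<in>A. g a = a}"

definition open_subgroup :: "'s set \<Rightarrow> ('s \<Rightarrow> 's) set \<Rightarrow> ('s \<Rightarrow> 's) set \<Rightarrow> bool" where
  "open_subgroup \<Omega> G U \<longleftrightarrow>
     subgroup U (perm_group \<Omega> G) \<and>
     (\<forall>u\<in>U. \<exists>A. finite A \<and> A \<subseteq> \<Omega> \<and> u <#\<^bsub>perm_group \<Omega> G\<^esub> pointwise_stab G A \<subseteq> U)"

text \<open>A hat-set over \<open>G\<close>: a set together with an action of one group of definition.
  Two such data describe the same object only up to shrinking this group; this is taken
  into account by \<open>gset_iso\<close> below.\<close>

record ('s, 'x) gset =
  defgrp :: "('s \<Rightarrow> 's) set"
  pts :: "'x set"
  act :: "('s \<Rightarrow> 's) \<Rightarrow> 'x \<Rightarrow> 'x"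

definition finitary_gset :: "'s set \<Rightarrow> ('s \<Rightarrow> 's) set \<Rightarrow> ('s, 'x) gset \<Rightarrow> bool" where
  "finitary_gset \<Omega> G X \<longleftrightarrow>
     open_subgroup \<Omega> G (defgrp X) \<and>
     group_action (perm_group \<Omega> (defgrp X)) (pts X) (act X) \<and>
     (\<forall>x\<in>pts X. open_subgroup \<Omega> G (stabilizer (perm_group \<Omega> (defgrp X)) (act X) x)) \<and>
     finite (orbits (perm_group \<Omega> (defgrp X)) (pts X) (act X))"

definition gset_iso ::
  "'s set \<Rightarrow> ('s \<Rightarrow> 's) set \<Rightarrow> ('s, 'x) gset \<Rightarrow> ('s, 'y) gset \<Rightarrow> bool" where
  "gset_iso \<Omega> G X Y \<longleftrightarrow>
     (\<exists>W f. open_subgroup \<Omega> G W \<and> W \<subseteq> defgrp X \<and> W \<subseteq> defgrp Y \<and>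
        bij_betw f (pts X) (pts Y) \<and>
        (\<forall>g\<in>W. \<forall>x\<in>pts X. f (act X g x) = act Y g (f x)))"

definition gset_one :: "'s set \<Rightarrow> ('s \<Rightarrow> 's) set \<Rightarrow> ('s, unit) gset" where
  "gset_one \<Omega> G = \<lparr>defgrp = G, pts = {()}, act = (\<lambda>g x. x)\<rparr>"

definition gset_conj ::
  "'s set \<Rightarrow> ('s \<Rightarrow> 's) set \<Rightarrow> ('s \<Rightarrow> 's) \<Rightarrow> ('s, 'x) gset \<Rightarrow> ('s, 'x) gset" where
  "gset_conj \<Omega> G g X =
     (let P = perm_group \<Omega> G in
      \<lparr>defgrp = (\<lambda>u. g \<otimes>\<^bsub>P\<^esub> u \<otimes>\<^bsub>P\<^esub> inv\<^bsub>P\<^esub> g) ` defgrp X, pts = pts X,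
       act = (\<lambda>h. act X (inv\<^bsub>P\<^esub> g \<otimes>\<^bsub>P\<^esub> h \<otimes>\<^bsub>P\<^esub> g))\<rparr>)"

definition gset_coprod :: "('s, 'x) gset \<Rightarrow> ('s, 'y) gset \<Rightarrow> ('s, 'x + 'y) gset" where
  "gset_coprod X Y =
     \<lparr>defgrp = defgrp X \<inter> defgrp Y, pts = pts X <+> pts Y,
      act = (\<lambda>g. restrict (map_sum (act X g) (act Y g)) (pts X <+> pts Y))\<rparr>"

definition transitive_gset ::
  "'s set \<Rightarrow> ('s \<Rightarrow> 's) set \<Rightarrow> ('s \<Rightarrow> 's) set \<Rightarrow> ('s, 'x) gset \<Rightarrow> bool" where
  "transitive_gset \<Omega> G U X \<longleftrightarrow>
     finitary_gset \<Omega> G X \<and> defgrp X = U \<and> pts X \<noteq> {} \<and>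
     transitive_action (perm_group \<Omega> U) (pts X) (act X)"

definition gset_map ::
  "('s \<Rightarrow> 's) set \<Rightarrow> ('x \<Rightarrow> 'y) \<Rightarrow> ('s, 'x) gset \<Rightarrow> ('s, 'y) gset \<Rightarrow> bool" where
  "gset_map U f X Y \<longleftrightarrow>
     f \<in> pts X \<rightarrow> pts Y \<and> (\<forall>g\<in>U. \<forall>x\<in>pts X. f (act X g x) = act Y g (f x))"

definition gset_fiber ::
  "'s set \<Rightarrow> ('x \<Rightarrow> 'y) \<Rightarrow> ('s, 'x) gset \<Rightarrow> ('s, 'y) gset \<Rightarrow> 'y \<Rightarrow> ('s, 'x) gset" where
  "gset_fiber \<Omega> f X Y y =
     \<lparr>defgrp = stabilizer (perm_group \<Omega> (defgrp Y)) (act Y) y, pts = {x \<in> pts X. f x = y},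
      act = (\<lambda>g. restrict (act X g) {x \<in> pts X. f x = y})\<rparr>"

text \<open>
  When \<open>\<Omega>\<close> is countable, every finitary object is countable: each orbit is the set of cosets of
  a subgroup containing some \<open>pointwise_stab G A\<close> with \<open>A\<close> finite, and so has at most as many
  points as \<open>\<Omega>\<close> has finite sequences. Hence finitary objects with points in \<^typ>\<open>nat\<close> represent
  all isomorphism classes (lemma \<open>finitary_gset_nat_copy\<close> below), and a measure may be taken to
  be defined on these. On other point types its value is that of any isomorphic copy.
\<close>

lemma finitary_gset_countable:
  assumes "countable \<Omega>" and G: "subgroup G (BijGroup \<Omega>)" and X: "finitary_gset \<Omega> G X"
  shows "countable (pts X)"
proof -
  let ?U = "defgrp X"
  let ?P = "perm_group \<Omega> ?U"
  interpret group_action ?P "pts X" "act X"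
    using X by (simp add: finitary_gset_def)
  interpret P: group ?P
    using group_hom by (simp add: group_hom_def)
  have cU: "carrier ?P = ?U"
    by (simp add: perm_group_def)
  have G_Bij: "G \<subseteq> Bij \<Omega>"
    using subgroup.subset[OF G] by (simp add: BijGroup_def)
  have U_G: "?U \<subseteq> G"
    using X subgroup.subset[of ?U "perm_group \<Omega> G"]
    by (auto simp: finitary_gset_def open_subgroup_def perm_group_def)
  have mult: "u \<otimes>\<^bsub>perm_group \<Omega> W\<^esub> v = compose \<Omega> u v" if "u \<in> G" "v \<in> G" for u v W
    using that G_Bij by (auto simp: perm_group_def BijGroup_def)
  have one: "\<one>\<^bsub>perm_group \<Omega> W\<^esub> = (\<lambda>x\<in>\<Omega>. x)" for W
    by (simp add: perm_group_def BijGroup_def)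
  have orbit: "countable (orbit ?P (act X) x)" if x: "x \<in> pts X" for x
  proof -
    let ?V = "stabilizer ?P (act X) x"
    have V: "open_subgroup \<Omega> G ?V"
      using X x by (simp add: finitary_gset_def)
    have "(\<lambda>x\<in>\<Omega>. x) \<in> ?V"
      using V subgroup.one_closed[of ?V "perm_group \<Omega> G"] by (simp add: open_subgroup_def one)
    then obtain A where A: "finite A" "A \<subseteq> \<Omega>"
      and sub: "(\<lambda>x\<in>\<Omega>. x) <#\<^bsub>perm_group \<Omega> G\<^esub> pointwise_stab G A \<subseteq> ?V" and idV: "(\<lambda>x\<in>\<Omega>. x) \<in> ?V"
      using V unfolding open_subgroup_def by blast
    obtain as where as: "set as = A"
      using finite_list[OF A(1)] by blast
    have idG: "(\<lambda>x\<in>\<Omega>. x) \<in> G"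
      using subgroup.one_closed[OF G] by (simp add: BijGroup_def)
    have stab: "h \<in> ?V" if h: "h \<in> pointwise_stab G A" for h
    proof -
      have hG: "h \<in> G" using h by (simp add: pointwise_stab_def)
      then have "h \<in> Bij \<Omega>" using G_Bij by blast
      then have "compose \<Omega> (\<lambda>x\<in>\<Omega>. x) h = h"
        by (intro Id_compose) (auto simp: Bij_def bij_betw_def)
      with h sub mult[OF idG hG, of G] show ?thesis
        by (auto simp: l_coset_def)
    qed
    have eq: "act X g x = act X h x"
      if g: "g \<in> ?U" and h: "h \<in> ?U" and e: "map g as = map h as" for g h
    proof -
      let ?i = "inv\<^bsub>?P\<^esub> g"
      have i: "?i \<in> ?U" using P.inv_closed[of g] g cU by simp
      have "compose \<Omega> ?i g = (\<lambda>x\<in>\<Omega>. x)"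
        using P.l_inv[of g] g i cU mult[of ?i g ?U] one by (simp add: subsetD[OF U_G])
      then have ig: "?i (g a) = a" if "a \<in> A" for a
        using that A(2) by (metis compose_eq restrict_apply' subsetD)
      have ih: "?i \<otimes>\<^bsub>?P\<^esub> h \<in> ?U"
        using P.m_closed[of ?i h] i h cU by simp
      have "?i \<otimes>\<^bsub>?P\<^esub> h \<in> pointwise_stab G A"
        unfolding pointwise_stab_def
      proof (intro CollectI conjI ballI)
        show "?i \<otimes>\<^bsub>?P\<^esub> h \<in> G" using ih U_G by blast
        fix a assume a: "a \<in> A"
        have "h a = g a" using e a as by auto
        then show "(?i \<otimes>\<^bsub>?P\<^esub> h) a = a"
          using mult[of ?i h ?U] i h a ig[OF a]
            by (simp add: subsetD[OF U_G] subsetD[OF A(2)] compose_eq)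
      qed
      then have "act X (?i \<otimes>\<^bsub>?P\<^esub> h) x = x"
        using stab by (auto simp: stabilizer_def)
      then have "act X ?i (act X h x) = x"
        using composition_rule[OF x, of ?i h] i h cU by simp
      then show ?thesis
        using orbit_sym_aux[of ?i "act X h x" x] i h cU x g element_image P.inv_inv
        by (metis)
    qed
    have "countable ((\<lambda>g. map g as) ` ?U)"
    proof (rule countable_subset)
      have "g a \<in> \<Omega>" if "g \<in> ?U" "a \<in> A" for g a
      proof -
        have "bij_betw g \<Omega> \<Omega>"
          using that(1) U_G G_Bij by (auto simp: Bij_def)
        then show ?thesis
          using that(2) A(2) by (meson bij_betwE subsetD)
      qed
      then show "(\<lambda>g. map g as) ` ?U \<subseteq> lists \<Omega>"
        using as by auto
      show "countable (lists \<Omega>)"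
        using assms(1) by simp
    qed
    moreover have "act X g x = act X (inv_into ?U (\<lambda>g. map g as) (map g as)) x"
      if "g \<in> ?U" for g
    proof (rule eq[OF that])
      have "map g as \<in> (\<lambda>g. map g as) ` ?U" using that by blast
      then show "inv_into ?U (\<lambda>g. map g as) (map g as) \<in> ?U"
        and "map g as = map (inv_into ?U (\<lambda>g. map g as) (map g as)) as"
        using inv_into_into f_inv_into_f[of "map g as" "\<lambda>g. map g as" ?U] by metis+
    qed
    then have "orbit ?P (act X) x \<subseteq>
        (\<lambda>r. act X (inv_into ?U (\<lambda>g. map g as) r) x) ` (\<lambda>g. map g as) ` ?U"
      by (auto simp: orbit_def cU)
    ultimately show ?thesis
      by (meson countable_image countable_subset)
  qed
  have "pts X = \<Union> (orbits ?P (pts X) (act X))"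
    using orbits_coverture by simp
  moreover have "countable (\<Union>B\<in>orbits ?P (pts X) (act X). B)"
    using X orbit by (intro countable_UN) (auto simp: finitary_gset_def orbits_def intro: countable_finite)
  ultimately show ?thesis by simp
qed

lemma finitary_gset_nat_copy:
  assumes "countable \<Omega>" and "subgroup G (BijGroup \<Omega>)" and X: "finitary_gset \<Omega> G X"
  shows "\<exists>Y :: ('s, nat) gset. finitary_gset \<Omega> G Y \<and> gset_iso \<Omega> G X Y"
proof -
  obtain f :: "_ \<Rightarrow> nat" where inj: "inj_on f (pts X)"
    using finitary_gset_countable[OF assms] by (auto simp: countable_def)
  let ?P = "perm_group \<Omega> (defgrp X)"
  let ?i = "inv_into (pts X) f"
  define b where "b g = (\<lambda>n\<in>f ` pts X. f (act X g (?i n)))" for g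
  define Y where "Y = \<lparr>defgrp = defgrp X, pts = f ` pts X, act = b\<rparr>"
  interpret group_action ?P "pts X" "act X"
    using X by (simp add: finitary_gset_def)
  interpret P: group ?P
    using group_hom by (simp add: group_hom_def)
  have cP: "carrier ?P = defgrp X"
    by (simp add: perm_group_def)
  have bf: "b g (f x) = f (act X g x)" if "x \<in> pts X" for g x
    using that inj by (simp add: b_def)
  have closed: "act X g x \<in> pts X" if "x \<in> pts X" "g \<in> defgrp X" for g x
    using that element_image cP by blast
  have bBij: "b g \<in> Bij (f ` pts X)" if g: "g \<in> defgrp X" for g
  proof -
    have "bij_betw (act X g) (pts X) (pts X)"
      using bij_prop0[of g] g cP by (simp add: Bij_def)
    then have "bij_betw (f \<circ> act X g \<circ> ?i) (f ` pts X) (f ` pts X)"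
      using inj by (meson bij_betw_imageI bij_betw_inv_into bij_betw_trans)
    then have "bij_betw (b g) (f ` pts X) (f ` pts X)"
      by (rule bij_betw_cong[THEN iffD1, rotated]) (simp add: b_def)
    then show ?thesis by (simp add: Bij_def b_def)
  qed
  have "b \<in> hom ?P (BijGroup (f ` pts X))"
  proof (rule homI)
    fix g assume "g \<in> carrier ?P"
    then show "b g \<in> carrier (BijGroup (f ` pts X))"
      using bBij cP by (simp add: BijGroup_def)
  next
    fix g h assume gh: "g \<in> carrier ?P" "h \<in> carrier ?P"
    have "b (g \<otimes>\<^bsub>?P\<^esub> h) = compose (f ` pts X) (b g) (b h)"
    proof
      fix n show "b (g \<otimes>\<^bsub>?P\<^esub> h) n = compose (f ` pts X) (b g) (b h) n"
      proof (cases "n \<in> f ` pts X")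
        case True
        then obtain x where "x \<in> pts X" "n = f x" by blast
        then show ?thesis
          using gh closed[of x h] composition_rule[of x g h] cP by (simp add: compose_eq bf)
      qed (simp add: b_def compose_def)
    qed
    then show "b (g \<otimes>\<^bsub>?P\<^esub> h) = b g \<otimes>\<^bsub>BijGroup (f ` pts X)\<^esub> b h"
      using gh bBij cP by (simp add: BijGroup_def)
  qed
  then have act: "group_action ?P (f ` pts X) b"
    by (simp add: group_action_def group_hom_def group_hom_axioms_def P.is_group group_BijGroup)
  have stab: "stabilizer ?P b (f x) = stabilizer ?P (act X) x" if "x \<in> pts X" for x
    using that closed inj cP by (auto simp: stabilizer_def bf dest: inj_onD)
  have "orbit ?P b (f x) = f ` orbit ?P (act X) x" if "x \<in> pts X" for x
    using that by (auto simp: orbit_def bf)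
  then have "orbits ?P (f ` pts X) b \<subseteq> (`) f ` orbits ?P (pts X) (act X)"
    by (auto simp: orbits_def)
  then have "finite (orbits ?P (f ` pts X) b)"
    using X by (meson finitary_gset_def finite_imageI finite_subset)
  with X act stab have "finitary_gset \<Omega> G Y"
    by (simp add: finitary_gset_def Y_def)
  moreover have "gset_iso \<Omega> G X Y"
    unfolding gset_iso_def using X inj
    by (intro exI[of _ "defgrp X"] exI[of _ f])
       (auto simp: finitary_gset_def Y_def bf bij_betw_def)
  ultimately show ?thesis by blast
qed

definition is_measure ::
  "'s set \<Rightarrow> ('s \<Rightarrow> 's) set \<Rightarrow> (('s, nat) gset \<Rightarrow> 'k::comm_ring_1) \<Rightarrow> bool" where
  "is_measure \<Omega> G \<mu> \<longleftrightarrow>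
     (\<forall>X Y. finitary_gset \<Omega> G X \<and> finitary_gset \<Omega> G Y \<and> gset_iso \<Omega> G X Y \<longrightarrow> \<mu> X = \<mu> Y) \<and>
     (\<forall>X. finitary_gset \<Omega> G X \<and> gset_iso \<Omega> G X (gset_one \<Omega> G) \<longrightarrow> \<mu> X = 1) \<and>
     (\<forall>X. \<forall>g\<in>G. finitary_gset \<Omega> G X \<longrightarrow> \<mu> (gset_conj \<Omega> G g X) = \<mu> X) \<and>
     (\<forall>X Y Z. finitary_gset \<Omega> G X \<and> finitary_gset \<Omega> G Y \<and> finitary_gset \<Omega> G Z \<and>
        gset_iso \<Omega> G Z (gset_coprod X Y) \<longrightarrow> \<mu> Z = \<mu> X + \<mu> Y) \<and>
     (\<forall>U X Y f. transitive_gset \<Omega> G U X \<and> transitive_gset \<Omega> G U Y \<and> gset_map U f X Y \<longrightarrow>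
        (\<forall>y\<in>pts Y. \<mu> X = \<mu> (gset_fiber \<Omega> f X Y y) * \<mu> Y))"


section \<open>The ring \<open>\<Theta>(G)\<close>\<close>

text \<open>The polynomial ring over the integers in the variables \<open>V\<close>; the type of all polynomials
  has a variable for every element of \<^typ>\<open>'v\<close>.\<close>

definition int_poly_ring :: "'v set \<Rightarrow> (('v \<Rightarrow>\<^sub>0 nat) \<Rightarrow>\<^sub>0 int) ring" where
  "int_poly_ring V =
     \<lparr>carrier = {p. \<forall>m\<in>Poly_Mapping.keys p. Poly_Mapping.keys m \<subseteq> V},
      monoid.mult = (*), one = 1, zero = 0, add = (+)\<rparr>"

definition poly_var :: "'v \<Rightarrow> (('v \<Rightarrow>\<^sub>0 nat) \<Rightarrow>\<^sub>0 int)" where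
  "poly_var v = Poly_Mapping.single (Poly_Mapping.single v 1) 1"

definition gset_class ::
  "'s set \<Rightarrow> ('s \<Rightarrow> 's) set \<Rightarrow> ('s, 'x) gset \<Rightarrow> ('s, nat) gset set" where
  "gset_class \<Omega> G X = {Y. finitary_gset \<Omega> G Y \<and> gset_iso \<Omega> G X Y}"

definition gset_var ::
  "'s set \<Rightarrow> ('s \<Rightarrow> 's) set \<Rightarrow> ('s, 'x) gset \<Rightarrow> ((('s, nat) gset set \<Rightarrow>\<^sub>0 nat) \<Rightarrow>\<^sub>0 int)" where
  "gset_var \<Omega> G X = poly_var (gset_class \<Omega> G X)"

definition theta_poly_ring ::
  "'s set \<Rightarrow> ('s \<Rightarrow> 's) set \<Rightarrow> ((('s, nat) gset set \<Rightarrow>\<^sub>0 nat) \<Rightarrow>\<^sub>0 int) ring" where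
  "theta_poly_ring \<Omega> G =
     int_poly_ring {gset_class \<Omega> G X | X :: ('s, nat) gset. finitary_gset \<Omega> G X}"

definition theta_relations ::
  "'s set \<Rightarrow> ('s \<Rightarrow> 's) set \<Rightarrow> ((('s, nat) gset set \<Rightarrow>\<^sub>0 nat) \<Rightarrow>\<^sub>0 int) set" where
  "theta_relations \<Omega> G =
     {gset_var \<Omega> G (gset_one \<Omega> G) - 1} \<union>
     {gset_var \<Omega> G (gset_conj \<Omega> G g X) - gset_var \<Omega> G X | g (X :: ('s, nat) gset).
        g \<in> G \<and> finitary_gset \<Omega> G X} \<union>
     {gset_var \<Omega> G (gset_coprod X Y) - (gset_var \<Omega> G X + gset_var \<Omega> G Y)
        | (X :: ('s, nat) gset) (Y :: ('s, nat) gset).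
        finitary_gset \<Omega> G X \<and> finitary_gset \<Omega> G Y} \<union>
     {gset_var \<Omega> G X - gset_var \<Omega> G (gset_fiber \<Omega> f X Y y) * gset_var \<Omega> G Y
        | U (X :: ('s, nat) gset) (Y :: ('s, nat) gset) f y.
        transitive_gset \<Omega> G U X \<and> transitive_gset \<Omega> G U Y \<and> gset_map U f X Y \<and> y \<in> pts Y}"

definition theta_ideal ::
  "'s set \<Rightarrow> ('s \<Rightarrow> 's) set \<Rightarrow> ((('s, nat) gset set \<Rightarrow>\<^sub>0 nat) \<Rightarrow>\<^sub>0 int) set" where
  "theta_ideal \<Omega> G = Idl\<^bsub>theta_poly_ring \<Omega> G\<^esub> (theta_relations \<Omega> G)"

definition Theta ::
  "'s set \<Rightarrow> ('s \<Rightarrow> 's) set \<Rightarrow> ((('s, nat) gset set \<Rightarrow>\<^sub>0 nat) \<Rightarrow>\<^sub>0 int) set ring" where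
  "Theta \<Omega> G = theta_poly_ring \<Omega> G Quot theta_ideal \<Omega> G"

definition theta_symbol ::
  "'s set \<Rightarrow> ('s \<Rightarrow> 's) set \<Rightarrow> ('s, 'x) gset \<Rightarrow> ((('s, nat) gset set \<Rightarrow>\<^sub>0 nat) \<Rightarrow>\<^sub>0 int) set" where
  "theta_symbol \<Omega> G X = theta_ideal \<Omega> G +>\<^bsub>theta_poly_ring \<Omega> G\<^esub> gset_var \<Omega> G X"

text \<open>\<open>h\<close> is the ring homomorphism that corresponds to the integer-valued measure \<open>\<mu>\<close>.\<close>

definition measure_hom ::
  "'s set \<Rightarrow> ('s \<Rightarrow> 's) set \<Rightarrow> (('s, nat) gset \<Rightarrow> int) \<Rightarrow>
   (((('s, nat) gset set \<Rightarrow>\<^sub>0 nat) \<Rightarrow>\<^sub>0 int) set \<Rightarrow> int) \<Rightarrow> bool" where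
  "measure_hom \<Omega> G \<mu> h \<longleftrightarrow>
     h \<in> ring_hom (Theta \<Omega> G) \<Z> \<and>
     (\<forall>X. finitary_gset \<Omega> G X \<longrightarrow> h (theta_symbol \<Omega> G X) = \<mu> X)"

definition int_power_ring :: "'i set \<Rightarrow> ('i \<Rightarrow> int) ring" where
  "int_power_ring I =
     \<lparr>carrier = I \<rightarrow>\<^sub>E UNIV, monoid.mult = (\<lambda>f g. \<lambda>i\<in>I. f i * g i), one = (\<lambda>i\<in>I. 1),
      zero = (\<lambda>i\<in>I. 0), add = (\<lambda>f g. \<lambda>i\<in>I. f i + g i)\<rparr>"


section \<open>The colored line and its automorphism group\<close>

text \<open>\<open>cyc x y z\<close> is the cyclic order \<open>x < y < z\<close> on the whole type, \<open>\<sigma>\<close> the coloring. Density of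
  the order follows from the density of any single color.\<close>

locale colored_circle =
  fixes cyc :: "'s \<Rightarrow> 's \<Rightarrow> 's \<Rightarrow> bool" and \<sigma> :: "'s \<Rightarrow> 'c::finite"
  assumes countable: "countable (UNIV :: 's set)"
    and infinite: "infinite (UNIV :: 's set)"
    and cyclic: "cyc x y z \<Longrightarrow> cyc y z x"
    and asym: "cyc x y z \<Longrightarrow> \<not> cyc z y x"
    and trans: "cyc x y z \<Longrightarrow> cyc x z w \<Longrightarrow> cyc x y w"
    and total: "x \<noteq> y \<Longrightarrow> y \<noteq> z \<Longrightarrow> x \<noteq> z \<Longrightarrow> cyc x y z \<or> cyc z y x"
    and dense: "x \<noteq> y \<Longrightarrow> \<exists>z. cyc x z y"
    and color_dense: "x \<noteq> y \<Longrightarrow> \<exists>z. cyc x z y \<and> \<sigma> z = a"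

definition line :: "'s \<Rightarrow> 's set" where
  "line p = UNIV - {p}"

definition line_less :: "('s \<Rightarrow> 's \<Rightarrow> 's \<Rightarrow> bool) \<Rightarrow> 's \<Rightarrow> 's \<Rightarrow> 's \<Rightarrow> bool" where
  "line_less cyc p x y \<longleftrightarrow> cyc p x y"

definition line_auts ::
  "('s \<Rightarrow> 's \<Rightarrow> 's \<Rightarrow> bool) \<Rightarrow> ('s \<Rightarrow> 'c) \<Rightarrow> 's \<Rightarrow> ('s \<Rightarrow> 's) set" where
  "line_auts cyc \<sigma> p =
     {g \<in> Bij (line p).
        (\<forall>x\<in>line p. \<forall>y\<in>line p. line_less cyc p x y \<longrightarrow> line_less cyc p (g x) (g y)) \<and>
        (\<forall>x\<in>line p. \<sigma> (g x) = \<sigma> x)}"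

text \<open>The order on the line with \<open>\<plusminus>\<infinity>\<close> adjoined. (The order instance of \<^typ>\<open>'s extended\<close> is not
  used, since the order on the line is not a type class order.)\<close>

fun ext_less :: "('s \<Rightarrow> 's \<Rightarrow> 's \<Rightarrow> bool) \<Rightarrow> 's \<Rightarrow> 's extended \<Rightarrow> 's extended \<Rightarrow> bool" where
  "ext_less cyc p (Fin x) (Fin y) \<longleftrightarrow> line_less cyc p x y"
| "ext_less cyc p Minf y \<longleftrightarrow> y \<noteq> Minf"
| "ext_less cyc p Pinf y \<longleftrightarrow> False"
| "ext_less cyc p (Fin x) Pinf \<longleftrightarrow> True"
| "ext_less cyc p (Fin x) Minf \<longleftrightarrow> False"

definition interval_ends ::
  "('s \<Rightarrow> 's \<Rightarrow> 's \<Rightarrow> bool) \<Rightarrow> 's \<Rightarrow> 's extended \<Rightarrow> 's extended \<Rightarrow> bool" where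
  "interval_ends cyc p l r \<longleftrightarrow>
     l \<in> insert Minf (Fin ` line p) \<and> r \<in> insert Pinf (Fin ` line p) \<and> ext_less cyc p l r"

definition line_interval ::
  "('s \<Rightarrow> 's \<Rightarrow> 's \<Rightarrow> bool) \<Rightarrow> 's \<Rightarrow> 's extended \<Rightarrow> 's extended \<Rightarrow> 's set" where
  "line_interval cyc p l r =
     {z \<in> line p. ext_less cyc p l (Fin z) \<and> ext_less cyc p (Fin z) r}"

definition word_tuples ::
  "('s \<Rightarrow> 's \<Rightarrow> 's \<Rightarrow> bool) \<Rightarrow> ('s \<Rightarrow> 'c) \<Rightarrow> 's \<Rightarrow> 's extended \<Rightarrow> 's extended \<Rightarrow> 'c list \<Rightarrow>
   's list set" where
  "word_tuples cyc \<sigma> p l r w =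
     {xs. set xs \<subseteq> line_interval cyc p l r \<and> sorted_wrt (line_less cyc p) xs \<and> map \<sigma> xs = w}"

text \<open>\<open>I\<^sup>w\<close> for \<open>I = (l, r)\<close>, with the stabilizer of the endpoints as group of definition.\<close>

definition word_gset ::
  "('s \<Rightarrow> 's \<Rightarrow> 's \<Rightarrow> bool) \<Rightarrow> ('s \<Rightarrow> 'c) \<Rightarrow> 's \<Rightarrow> 's extended \<Rightarrow> 's extended \<Rightarrow> 'c list \<Rightarrow>
   ('s, 's list) gset" where
  "word_gset cyc \<sigma> p l r w =
     \<lparr>defgrp = pointwise_stab (line_auts cyc \<sigma> p) {x. Fin x \<in> {l, r}},
      pts = word_tuples cyc \<sigma> p l r w,
      act = (\<lambda>g. restrict (map g) (word_tuples cyc \<sigma> p l r w))\<rparr>"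


section \<open>Directed labeled trees\<close>

definition adjacency :: "'v set set \<Rightarrow> ('v \<times> 'v) set" where
  "adjacency E = {(u, v). {u, v} \<in> E}"

definition graph_cycle :: "'v set set \<Rightarrow> 'v list \<Rightarrow> bool" where
  "graph_cycle E vs \<longleftrightarrow>
     3 \<le> length vs \<and> distinct vs \<and>
     (\<forall>i<length vs. {vs ! i, vs ! (Suc i mod length vs)} \<in> E)"

definition is_tree :: "'v set \<Rightarrow> 'v set set \<Rightarrow> bool" where
  "is_tree V E \<longleftrightarrow>
     finite V \<and> V \<noteq> {} \<and> (\<forall>e\<in>E. e \<subseteq> V \<and> card e = 2) \<and>
     (\<forall>u\<in>V. \<forall>v\<in>V. (u, v) \<in> (adjacency E)\<^sup>*) \<and> \<not> (\<exists>vs. graph_cycle E vs)"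

text \<open>The edge with label \<open>c\<close> joins \<open>tail T c\<close> to \<open>head T c\<close> and is directed towards the latter.\<close>

record ('v, 'c) dtree =
  vertices :: "'v set"
  tail :: "'c \<Rightarrow> 'v"
  head :: "'c \<Rightarrow> 'v"

definition edge :: "('v, 'c) dtree \<Rightarrow> 'c \<Rightarrow> 'v set" where
  "edge T c = {tail T c, head T c}"

definition edges :: "('v, 'c) dtree \<Rightarrow> 'v set set" where
  "edges T = edge T ` UNIV"

definition directed_labeled_tree :: "('v, 'c) dtree \<Rightarrow> bool" where
  "directed_labeled_tree T \<longleftrightarrow>
     is_tree (vertices T) (edges T) \<and> bij_betw (edge T) UNIV (edges T)"

definition tree_triples :: "(('v, 'c) dtree \<times> 'v \<times> 'v) set" where
  "tree_triples = {(T, x, y). directed_labeled_tree T \<and> x \<in> vertices T \<and> y \<in> vertices T}"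

definition triple_iso_rel ::
  "((('v, 'c) dtree \<times> 'v \<times> 'v) \<times> (('v, 'c) dtree \<times> 'v \<times> 'v)) set" where
  "triple_iso_rel =
     {((T, x, y), (T', x', y')). (T, x, y) \<in> tree_triples \<and> (T', x', y') \<in> tree_triples \<and>
        (\<exists>f. bij_betw f (vertices T) (vertices T') \<and> f x = x' \<and> f y = y' \<and>
           (\<forall>c. f (tail T c) = tail T' c \<and> f (head T c) = head T' c))}"

text \<open>Isomorphism classes of triples; every finite tree has a copy with vertices in \<^typ>\<open>nat\<close>.\<close>

definition triple_classes :: "((nat, 'c) dtree \<times> nat \<times> nat) set set" where
  "triple_classes = tree_triples // triple_iso_rel"

text \<open>The vertices of the component, after deletion of the edge \<open>c\<close>, towards which \<open>c\<close> points.\<close>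

definition pointed_component :: "('v, 'c) dtree \<Rightarrow> 'c \<Rightarrow> 'v set" where
  "pointed_component T c =
     {v \<in> vertices T. (head T c, v) \<in> (adjacency (edges T - {edge T c}))\<^sup>*}"

fun S_table :: "('v, 'c) dtree \<Rightarrow> 'v \<Rightarrow> 'v \<Rightarrow> 'c \<Rightarrow> 'c extended \<Rightarrow> int" where
  "S_table T x y c (Fin a) = (if c \<noteq> a \<and> edge T a \<subseteq> pointed_component T c then 1 else 0)"
| "S_table T x y c Pinf = (if x \<in> pointed_component T c then 1 else 0)"
| "S_table T x y c Minf = (if y \<in> pointed_component T c then 1 else 0)"

definition eta :: "('v, 'c) dtree \<Rightarrow> 'v \<Rightarrow> 'v \<Rightarrow> 'c extended \<Rightarrow> 'c extended \<Rightarrow> 'c \<Rightarrow> int" where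
  "eta T x y a b c =
     S_table T x y c a - S_table T x y c b - (if b = Fin c then 1 else 0)"

text \<open>The recursion for \<open>\<nu>\<close> removes the last letter, so it is run on the reversed word.\<close>

primrec nu_rev ::
  "('v, 'c) dtree \<Rightarrow> 'v \<Rightarrow> 'v \<Rightarrow> 'c extended \<Rightarrow> 'c extended \<Rightarrow> 'c list \<Rightarrow> int" where
  "nu_rev T x y a b [] = 1"
| "nu_rev T x y a b (c # u) = eta T x y a b c * nu_rev T x y a (Fin c) u"

definition nu ::
  "('v, 'c) dtree \<Rightarrow> 'v \<Rightarrow> 'v \<Rightarrow> 'c extended \<Rightarrow> 'c extended \<Rightarrow> 'c list \<Rightarrow> int" where
  "nu T x y a b w = nu_rev T x y a b (rev w)"

lemma nu_simps:
  "nu T x y a b [] = 1"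
  "nu T x y a b (w @ [c]) = eta T x y a b c * nu T x y a (Fin c) w"
  by (simp_all add: nu_def)

definition is_tree_measure ::
  "('s \<Rightarrow> 's \<Rightarrow> 's \<Rightarrow> bool) \<Rightarrow> ('s \<Rightarrow> 'c) \<Rightarrow> 's \<Rightarrow> ('v, 'c) dtree \<Rightarrow> 'v \<Rightarrow> 'v \<Rightarrow>
   (('s, nat) gset \<Rightarrow> int) \<Rightarrow> bool" where
  "is_tree_measure cyc \<sigma> p T x y \<mu> \<longleftrightarrow>
     is_measure (line p) (line_auts cyc \<sigma> p) \<mu> \<and>
     (\<forall>l r w X. interval_ends cyc p l r \<and> finitary_gset (line p) (line_auts cyc \<sigma> p) X \<and>
        gset_iso (line p) (line_auts cyc \<sigma> p) X (word_gset cyc \<sigma> p l r w) \<longrightarrow>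
        \<mu> X = nu T x y (map_extended \<sigma> l) (map_extended \<sigma> r) w)"

end

theory Submission
  imports Defs
begin

text \<open>
  Open subgroups of \<open>H\<close> are the pointwise stabilizers \<open>stab A\<close> of finite sets \<open>A\<close>
  (\<open>open_subgroup_iff\<close>), and an order automorphism that preserves a finite set fixes its points. So a
  transitive \<open>stab A\<close>-set is the set of translates of a finite set \<open>B \<supseteq> A\<close>
  (\<open>transitive_iso_translates\<close>). Adding the points of \<open>B - A\<close> to \<open>A\<close> one at a time writes its class in
  \<open>\<Theta>(H)\<close> as a product of classes of orbits of single points (\<open>var_coset_mult\<close>). By homogeneity of the
  colored line, the class of such an orbit depends only on the colors \<open>a\<close>, \<open>b\<close> of the ends of the interval
  in which the point lies and on the color \<open>c\<close> of the point (\<open>point_var_cong\<close>). Hence \<open>\<Theta>(H)\<close> is generated by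
  elements \<open>t\<^bsub>ab\<^esub>(c)\<close> (\<open>typed_var\<close>). Cutting an interval at a point, and adding two points of an interval
  in either order, gives
  \<open>t\<^bsub>ab\<^esub>(d) = t\<^bsub>ac\<^esub>(d) + t\<^bsub>cb\<^esub>(d) + \<delta>\<^bsub>cd\<^esub>\<close> and \<open>t\<^bsub>ab\<^esub>(c) t\<^bsub>cb\<^esub>(d) = t\<^bsub>ab\<^esub>(d) t\<^bsub>ad\<^esub>(c)\<close>
  (\<open>typed_var_split\<close>, \<open>typed_var_swap\<close>).

  The linear relations are solved by \<open>t\<^bsub>ab\<^esub>(c) = S\<^bsub>ca\<^esub> - S\<^bsub>cb\<^esub> - \<delta>\<^bsub>bc\<^esub>\<close> with \<open>S\<^bsub>cc\<^esub> = 0\<close>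
  (\<open>typed_var_toward\<close>). The quadratic ones then say that every \<open>S\<^bsub>ca\<^esub>\<close> is idempotent (\<open>toward_idem\<close>) and
  that, for \<open>c \<noteq> d\<close>, on each idempotent of the Boolean algebra that they generate \<open>S\<^bsub>ca\<^esub> = S\<^bsub>cd\<^esub>\<close> or
  \<open>S\<^bsub>da\<^esub> = S\<^bsub>dc\<^esub>\<close>. So \<open>\<Theta>(H)\<close> is spanned by the idempotents of the 0/1-tables \<open>S\<close> that satisfy these
  conditions (\<open>valid_table\<close>, \<open>table_idem_invalid\<close>, \<open>table_expansion\<close>).

  Conversely, every valid table comes from a measure. The weight of an extension \<open>A \<subseteq> B\<close> is the product of
  the values \<open>\<eta>\<^bsub>ab\<^esub>(c)\<close> along a chain of one-point extensions, and the measure of a set is the sum of the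
  weights of its orbits. The quadratic relation makes the weight independent of the chain
  (\<open>chain_independent\<close>); the linear relation makes the sum independent of the group of definition
  (\<open>total_restrict\<close>), because a point orbit splits under a smaller stabilizer just as an interval is cut.
  Evaluation at these measures separates the idempotents, so \<open>\<Theta>(H)\<close> is a product of copies of the integers
  indexed by the valid tables (\<open>theta_iso\<close>).

  Finally, valid tables are the tables \<open>S\<close> of triples \<open>(T, x, y)\<close>, and the table determines the triple up to
  isomorphism (\<open>triple_classes_tables\<close>). The table condition expresses that two edges \<open>c \<noteq> d\<close> cut a tree
  into three parts, one of which touches both of them. In the other direction, the edges separating \<open>a\<close> from
  the root \<open>x\<close> form a chain in a forest order on \<open>\<Sigma>\<close> which recovers the tree. A triple amounts to a rooted
  forest on \<open>\<Sigma>\<close>, a direction for each edge and a choice of \<open>y\<close> among \<open>n + 1\<close> vertices. With Cayley's formula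
  the count is \<open>(n + 1) ^ (n - 1) * 2 ^ n * (n + 1) = (2 n + 2) ^ n\<close> (\<open>card_triple_classes\<close>).
\<close>

section \<open>The colored line\<close>

locale colored_line = colored_circle cyc \<sigma>
  for cyc :: "'s \<Rightarrow> 's \<Rightarrow> 's \<Rightarrow> bool" and \<sigma> :: "'s \<Rightarrow> 'c::finite" +
  fixes p :: 's
begin

abbreviation less (infix "\<prec>" 50) where "x \<prec> y \<equiv> line_less cyc p x y"
abbreviation "L \<equiv> line p"
abbreviation "H \<equiv> line_auts cyc \<sigma> p"

lemma less_in_line: "x \<prec> y \<Longrightarrow> x \<in> L \<and> y \<in> L"
  using asym cyclic unfolding line_less_def line_def by blast

lemma less_irrefl [simp]: "\<not> x \<prec> x"
  using asym cyclic unfolding line_less_def by blast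

lemma less_trans: "x \<prec> y \<Longrightarrow> y \<prec> z \<Longrightarrow> x \<prec> z"
  using trans unfolding line_less_def by blast

lemma less_asym: "x \<prec> y \<Longrightarrow> \<not> y \<prec> x"
  using less_trans less_irrefl by blast

lemma less_total: "x \<in> L \<Longrightarrow> y \<in> L \<Longrightarrow> x \<noteq> y \<Longrightarrow> x \<prec> y \<or> y \<prec> x"
  using total[of p x y] cyclic unfolding line_less_def line_def by blast

lemma color_between: "x \<prec> y \<Longrightarrow> \<exists>z. x \<prec> z \<and> z \<prec> y \<and> \<sigma> z = a"
proof -
  assume xy: "x \<prec> y"
  then have "x \<noteq> y" by auto
  then obtain z where z: "cyc x z y" "\<sigma> z = a" using color_dense by blast
  have "cyc x y p" "cyc y p x" using xy cyclic unfolding line_less_def by blast+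
  then have "cyc x z p" "cyc y p z" using z trans cyclic by blast+
  then show ?thesis using z(2) cyclic unfolding line_less_def by blast
qed

lemma color_below: "y \<in> L \<Longrightarrow> \<exists>z. z \<prec> y \<and> \<sigma> z = a"
  using color_dense[of p y a] by (auto simp: line_less_def line_def)

lemma color_above: "x \<in> L \<Longrightarrow> \<exists>z. x \<prec> z \<and> \<sigma> z = a"
  using color_dense[of x p a] cyclic unfolding line_less_def line_def by blast

lemma line_nonempty: "L \<noteq> {}"
  using infinite by (metis finite.emptyI finite_Diff2 finite_insert line_def)

lemma finite_has_greatest:
  assumes "finite A" "A \<subseteq> L" "A \<noteq> {}" shows "\<exists>m\<in>A. \<forall>a\<in>A. a = m \<or> a \<prec> m"
  using assms(1,3,2)
proof (induction rule: finite_ne_induct)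
  case (insert x A)
  then obtain m where m: "m \<in> A" "\<forall>a\<in>A. a = m \<or> a \<prec> m" by auto
  have "x \<prec> m \<or> m \<prec> x" using less_total[of x m] insert m by auto
  then show ?case using m less_trans by (metis insert_iff)
qed auto

lemma finite_has_least:
  assumes "finite A" "A \<subseteq> L" "A \<noteq> {}" shows "\<exists>m\<in>A. \<forall>a\<in>A. a = m \<or> m \<prec> a"
  using assms(1,3,2)
proof (induction rule: finite_ne_induct)
  case (insert x A)
  then obtain m where m: "m \<in> A" "\<forall>a\<in>A. a = m \<or> m \<prec> a" by auto
  have "x \<prec> m \<or> m \<prec> x" using less_total[of x m] insert m by auto
  then show ?case using m less_trans by (metis insert_iff)
qed auto

text \<open>Density, absence of endpoints and non-emptiness in one statement: the extension property
  that drives the back-and-forth argument.\<close>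

lemma color_between_finite:
  assumes "finite A" "finite B" "A \<subseteq> L" "B \<subseteq> L" "\<And>a b. a \<in> A \<Longrightarrow> b \<in> B \<Longrightarrow> a \<prec> b"
  shows "\<exists>z\<in>L. \<sigma> z = c \<and> (\<forall>a\<in>A. a \<prec> z) \<and> (\<forall>b\<in>B. z \<prec> b)"
proof -
  consider "A = {}" "B = {}" | "A \<noteq> {}" "B = {}" | "A = {}" "B \<noteq> {}" | "A \<noteq> {}" "B \<noteq> {}" by blast
  then show ?thesis
  proof cases
    case 1
    obtain y where "y \<in> L" using line_nonempty by blast
    then obtain z where "z \<prec> y" "\<sigma> z = c" using color_below[of y c] by blast
    moreover have "z \<in> L" using less_in_line \<open>z \<prec> y\<close> by blast
    ultimately have "z \<in> L \<and> \<sigma> z = c \<and> (\<forall>a\<in>{}. a \<prec> z) \<and> (\<forall>b\<in>{}. z \<prec> b)" by blast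
    then show ?thesis unfolding 1 by blast
  next
    case 2
    then obtain m where m: "m \<in> A" "\<forall>a\<in>A. a = m \<or> a \<prec> m" using finite_has_greatest[OF assms(1,3)] by blast
    obtain z where "m \<prec> z" "\<sigma> z = c" using color_above[of m c] m assms(3) by blast
    moreover have "\<forall>a\<in>A. a \<prec> z" using m(2) less_trans \<open>m \<prec> z\<close> by metis
    moreover have "z \<in> L" using less_in_line \<open>m \<prec> z\<close> by blast
    ultimately show ?thesis using 2 \<open>\<sigma> z = c\<close> by blast
  next
    case 3
    then obtain m where m: "m \<in> B" "\<forall>a\<in>B. a = m \<or> m \<prec> a" using finite_has_least[OF assms(2,4)] by blast
    obtain z where "z \<prec> m" "\<sigma> z = c" using color_below[of m c] m assms(4) by blast
    moreover have "\<forall>b\<in>B. z \<prec> b" using m(2) less_trans \<open>z \<prec> m\<close> by metis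
    moreover have "z \<in> L" using less_in_line \<open>z \<prec> m\<close> by blast
    ultimately show ?thesis using 3 \<open>\<sigma> z = c\<close> by blast
  next
    case 4
    then obtain m where m: "m \<in> A" "\<forall>a\<in>A. a = m \<or> a \<prec> m" using finite_has_greatest[OF assms(1,3)] by blast
    obtain n where n: "n \<in> B" "\<forall>a\<in>B. a = n \<or> n \<prec> a" using finite_has_least[OF assms(2,4)] 4 by blast
    obtain z where "m \<prec> z" "z \<prec> n" "\<sigma> z = c" using color_between[of m n c] assms(5) m n by blast
    moreover have "\<forall>a\<in>A. a \<prec> z" using m(2) less_trans \<open>m \<prec> z\<close> by metis
    moreover have "\<forall>b\<in>B. z \<prec> b" using n(2) less_trans \<open>z \<prec> n\<close> by metis
    moreover have "z \<in> L" using less_in_line \<open>m \<prec> z\<close> by blast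
    ultimately show ?thesis using \<open>\<sigma> z = c\<close> by blast
  qed
qed

subsection \<open>Extending finite partial isomorphisms\<close>

definition partial_iso :: "('s \<times> 's) set \<Rightarrow> bool" where
  "partial_iso r \<longleftrightarrow> finite r \<and> r \<subseteq> L \<times> L \<and> (\<forall>(x, y)\<in>r. \<sigma> x = \<sigma> y) \<and>
     (\<forall>(x, y)\<in>r. \<forall>(x', y')\<in>r. x \<prec> x' \<longleftrightarrow> y \<prec> y')"

lemma partial_iso_inj:
  assumes "partial_iso r" "(x, y) \<in> r" "(x', y') \<in> r" shows "x = x' \<longleftrightarrow> y = y'"
proof -
  have "x \<prec> x' \<longleftrightarrow> y \<prec> y'" "x' \<prec> x \<longleftrightarrow> y' \<prec> y" "x \<in> L" "x' \<in> L" "y \<in> L" "y' \<in> L"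
    using assms unfolding partial_iso_def by fast+
  then show ?thesis using less_total less_irrefl by metis
qed

lemma partial_iso_converse: "partial_iso r \<Longrightarrow> partial_iso (r\<inverse>)"
  unfolding partial_iso_def by auto

lemma partial_iso_forth:
  assumes r: "partial_iso r" and x: "x \<in> L"
  shows "\<exists>y. partial_iso (insert (x, y) r)"
proof (cases "x \<in> Domain r")
  case True
  then show ?thesis using r by (metis Domain.cases insert_absorb)
next
  case False
  define A where "A = {y. \<exists>a. (a, y) \<in> r \<and> a \<prec> x}"
  define B where "B = {y. \<exists>a. (a, y) \<in> r \<and> x \<prec> a}"
  have fr: "finite r" and rL: "r \<subseteq> L \<times> L" using r by (auto simp: partial_iso_def)
  have "A \<subseteq> snd ` r" "B \<subseteq> snd ` r" unfolding A_def B_def by force+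
  moreover have "snd ` r \<subseteq> L" using rL by auto
  ultimately have fin: "finite A" "finite B" "A \<subseteq> L" "B \<subseteq> L"
    using fr finite_subset[OF _ finite_imageI[OF fr, of snd]] by blast+
  have "a \<prec> b" if "a \<in> A" "b \<in> B" for a b
  proof -
    obtain u v where "(u, a) \<in> r" "u \<prec> x" "(v, b) \<in> r" "x \<prec> v" using \<open>a \<in> A\<close> \<open>b \<in> B\<close> A_def B_def by blast
    then show ?thesis using r less_trans unfolding partial_iso_def by fast
  qed
  then obtain z where z: "z \<in> L" "\<sigma> z = \<sigma> x" "\<forall>a\<in>A. a \<prec> z" "\<forall>b\<in>B. z \<prec> b"
    using color_between_finite[OF fin] by blast
  have "(u \<prec> x \<longleftrightarrow> v \<prec> z) \<and> (x \<prec> u \<longleftrightarrow> z \<prec> v)" if uv: "(u, v) \<in> r" for u v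
  proof -
    have "u \<in> L" "u \<noteq> x" using uv rL False by auto
    then consider "u \<prec> x" | "x \<prec> u" using less_total x by blast
    then show ?thesis
    proof cases
      case 1
      then have "v \<prec> z" using z uv A_def by blast
      then show ?thesis using 1 less_asym by blast
    next
      case 2
      then have "z \<prec> v" using z uv B_def by blast
      then show ?thesis using 2 less_asym by blast
    qed
  qed
  then have "partial_iso (insert (x, z) r)"
    using r x z(1,2) unfolding partial_iso_def by (auto simp: case_prod_unfold)
  then show ?thesis by blast
qed

lemma partial_iso_back:
  assumes r: "partial_iso r" and y: "y \<in> L"
  shows "\<exists>x. partial_iso (insert (x, y) r)"
proof -
  obtain x where "partial_iso (insert (y, x) (r\<inverse>))"
    using partial_iso_forth[OF partial_iso_converse[OF r] y] by blast
  moreover have "(insert (y, x) (r\<inverse>))\<inverse> = insert (x, y) r" by auto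
  ultimately have "partial_iso (insert (x, y) r)" using partial_iso_converse by metis
  then show ?thesis by blast
qed

text \<open>Back and forth along an enumeration of the line: each finite partial isomorphism extends to one with
  any further point in its domain or range.\<close>

lemma homogeneous:
  assumes r: "partial_iso r"
  shows "\<exists>g\<in>H. \<forall>x y. (x, y) \<in> r \<longrightarrow> g x = y"
proof -
  have "countable L" by (rule countable_subset[OF subset_UNIV countable])
  then obtain e :: "nat \<Rightarrow> 's" where e: "range e = L"
    using range_from_nat_into[OF line_nonempty] by blast
  have "\<exists>R. (\<forall>n. partial_iso (R n)) \<and> R 0 = r \<and>
      (\<forall>n. R n \<subseteq> R (Suc n) \<and> e n \<in> Domain (R (Suc n)) \<and> e n \<in> Range (R (Suc n)))"
  proof -
    have "\<exists>R'. partial_iso R' \<and> R \<subseteq> R' \<and> e n \<in> Domain R' \<and> e n \<in> Range R'" if "partial_iso R" for R n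
    proof -
      have "e n \<in> L" using e by blast
      then obtain y where y: "partial_iso (insert (e n, y) R)" using partial_iso_forth \<open>partial_iso R\<close> by blast
      then obtain x where "partial_iso (insert (x, e n) (insert (e n, y) R))"
        using partial_iso_back \<open>e n \<in> L\<close> by blast
      then show ?thesis by blast
    qed
    then show ?thesis
      using dependent_nat_choice[of "\<lambda>n R. partial_iso R \<and> (n = 0 \<longrightarrow> R = r)"
          "\<lambda>n R R'. R \<subseteq> R' \<and> e n \<in> Domain R' \<and> e n \<in> Range R'"] r
      by (smt (verit, best) nat.distinct(1))
  qed
  then obtain R where R: "\<And>n. partial_iso (R n)" "R 0 = r" "\<And>n. R n \<subseteq> R (Suc n)"
    "\<And>n. e n \<in> Domain (R (Suc n))" "\<And>n. e n \<in> Range (R (Suc n))" by blast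
  define U where "U = (\<Union>n. R n)"
  have mono: "R m \<subseteq> R n" if "m \<le> n" for m n
    using R(3) that by (rule lift_Suc_mono_le)
  have common: "\<exists>n. u \<in> R n \<and> v \<in> R n" if uv: "u \<in> U" "v \<in> U" for u v
  proof -
    obtain i j where "u \<in> R i" "v \<in> R j" using uv U_def by blast
    then show ?thesis using mono[of i "max i j"] mono[of j "max i j"] by auto
  qed
  have UL: "U \<subseteq> L \<times> L" and Uc: "(x, y) \<in> U \<Longrightarrow> \<sigma> x = \<sigma> y" for x y
    using R(1) unfolding U_def partial_iso_def by fast+
  have Uo: "x \<prec> x' \<longleftrightarrow> y \<prec> y'" and Ui: "x = x' \<longleftrightarrow> y = y'" if xy: "(x, y) \<in> U" "(x', y') \<in> U" for x y x' y'
  proof -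
    obtain n where "(x, y) \<in> R n" "(x', y') \<in> R n" using common[OF xy] by blast
    then show "x \<prec> x' \<longleftrightarrow> y \<prec> y'" "x = x' \<longleftrightarrow> y = y'"
      using R(1)[of n] partial_iso_inj[OF R(1)[of n]] unfolding partial_iso_def by fast+
  qed
  have dom: "\<exists>y. (x, y) \<in> U" and ran: "\<exists>y. (y, x) \<in> U" if "x \<in> L" for x
    using that e R(4,5) unfolding U_def by (metis Domain.cases Range.cases UN_I rangeE UNIV_I)+
  define g where "g = (\<lambda>x\<in>L. THE y. (x, y) \<in> U)"
  have gU: "g x = y" if "(x, y) \<in> U" for x y
  proof -
    have "x \<in> L" using that UL by blast
    then have "g x = (THE y. (x, y) \<in> U)" by (simp add: g_def)
    also have "\<dots> = y" using that Ui by blast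
    finally show ?thesis .
  qed
  have Ug: "(x, g x) \<in> U" if "x \<in> L" for x using dom[OF that] gU by blast
  have "bij_betw g L L"
  proof (rule bij_betw_imageI)
    show "inj_on g L" using Ug Ui by (metis inj_onI)
    show "g ` L = L"
    proof (intro equalityI subsetI)
      fix y assume "y \<in> L"
      then obtain x where "(x, y) \<in> U" using ran by blast
      then show "y \<in> g ` L" using gU UL by blast
    qed (use Ug UL in blast)
  qed
  then have "g \<in> Bij L" by (simp add: Bij_def g_def)
  moreover have "g x \<prec> g y" if "x \<in> L" "y \<in> L" "x \<prec> y" for x y
    using Uo[OF Ug Ug] that by blast
  moreover have "\<sigma> (g x) = \<sigma> x" if "x \<in> L" for x
    using Uc[OF Ug[OF that]] by simp
  ultimately have "g \<in> H" unfolding line_auts_def by blast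
  moreover have "\<forall>x y. (x, y) \<in> r \<longrightarrow> g x = y" using gU R(2) unfolding U_def by blast
  ultimately show ?thesis by blast
qed

subsection \<open>The group and its open subgroups\<close>

abbreviation "cmp g h \<equiv> compose L g h"
definition "ident = (\<lambda>x\<in>L. x)"
definition "inverse_aut g = (\<lambda>x\<in>L. inv_into L g x)"

lemma H_Bij: "g \<in> H \<Longrightarrow> g \<in> Bij L" by (simp add: line_auts_def)
lemma H_bij: "g \<in> H \<Longrightarrow> bij_betw g L L" by (simp add: line_auts_def Bij_def)
lemma H_in_line [simp]: "g \<in> H \<Longrightarrow> x \<in> L \<Longrightarrow> g x \<in> L" using H_bij bij_betwE by blast
lemma H_inj: "g \<in> H \<Longrightarrow> inj_on g L" using H_bij bij_betw_def by blast
lemma H_color [simp]: "g \<in> H \<Longrightarrow> x \<in> L \<Longrightarrow> \<sigma> (g x) = \<sigma> x" by (simp add: line_auts_def)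
lemma H_extensional: "g \<in> H \<Longrightarrow> g \<in> extensional L" by (rule Bij_imp_extensional[OF H_Bij])

lemma H_eq_iff [simp]: "g \<in> H \<Longrightarrow> x \<in> L \<Longrightarrow> y \<in> L \<Longrightarrow> g x = g y \<longleftrightarrow> x = y"
  by (rule inj_on_eq_iff[OF H_inj])

lemma H_less_iff [simp]:
  assumes g: "g \<in> H" and x: "x \<in> L" and y: "y \<in> L"
  shows "g x \<prec> g y \<longleftrightarrow> x \<prec> y"
proof -
  have mono: "u \<prec> v \<Longrightarrow> g u \<prec> g v" for u v
    using g less_in_line[of u v] unfolding line_auts_def by blast
  consider "x = y" | "x \<prec> y" | "y \<prec> x" using less_total[OF x y] by blast
  then show ?thesis using mono[of x y] mono[of y x] less_asym[of x y] less_asym[of "g x" "g y"] by cases auto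
qed

lemma H_image_subset [simp]: "g \<in> H \<Longrightarrow> A \<subseteq> L \<Longrightarrow> g ` A \<subseteq> L"
  using H_in_line by blast

lemma H_eqI: "g \<in> H \<Longrightarrow> h \<in> H \<Longrightarrow> (\<And>x. x \<in> L \<Longrightarrow> g x = h x) \<Longrightarrow> g = h"
  by (rule extensionalityI[of g L h]) (simp_all add: H_extensional)

lemma ident_H [simp]: "ident \<in> H"
  using id_Bij[of L] unfolding line_auts_def ident_def by auto

lemma ident_apply [simp]: "x \<in> L \<Longrightarrow> ident x = x" by (simp add: ident_def)

lemma comp_apply [simp]: "x \<in> L \<Longrightarrow> cmp g h x = g (h x)" by (simp add: compose_eq)

lemma comp_H [simp]:
  assumes g: "g \<in> H" and h: "h \<in> H" shows "cmp g h \<in> H"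
  unfolding line_auts_def
proof (intro CollectI conjI ballI impI)
  show "cmp g h \<in> Bij L" by (rule compose_Bij[OF H_Bij[OF g] H_Bij[OF h]])
  show "cmp g h x \<prec> cmp g h y" if "x \<in> L" "y \<in> L" "x \<prec> y" for x y
    using that g h H_in_line[OF h] by (simp add: compose_eq)
  show "\<sigma> (cmp g h x) = \<sigma> x" if "x \<in> L" for x
    using that g h H_in_line[OF h that] by (simp add: compose_eq)
qed

lemma inverse_H [simp]: assumes g: "g \<in> H" shows "inverse_aut g \<in> H"
  and inverse_left [simp]: "x \<in> L \<Longrightarrow> inverse_aut g (g x) = x"
  and inverse_right [simp]: "x \<in> L \<Longrightarrow> g (inverse_aut g x) = x"
proof -
  have b: "bij_betw g L L" using H_bij g .
  have l: "inverse_aut g (g x) = x" if "x \<in> L" for x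
    using b g that by (simp add: inverse_aut_def bij_betw_inv_into_left)
  have r: "g (inverse_aut g x) = x" if "x \<in> L" for x
    using b g that by (simp add: inverse_aut_def bij_betw_inv_into_right)
  have B: "inverse_aut g \<in> Bij L"
    unfolding inverse_aut_def by (rule restrict_inv_into_Bij[OF H_Bij[OF g]])
  then have c: "inverse_aut g x \<in> L" if "x \<in> L" for x
    using that Bij_imp_funcset by blast
  show "inverse_aut g \<in> H"
    unfolding line_auts_def
  proof (intro CollectI conjI ballI impI)
    fix x y assume "x \<in> L" "y \<in> L" "x \<prec> y"
    then show "inverse_aut g x \<prec> inverse_aut g y"
      using H_less_iff[OF g c c, of x y] r by simp
  next
    fix x assume "x \<in> L" then show "\<sigma> (inverse_aut g x) = \<sigma> x"
      using H_color[OF g c, of x] r by simp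
  qed (rule B)
  show "x \<in> L \<Longrightarrow> inverse_aut g (g x) = x" "x \<in> L \<Longrightarrow> g (inverse_aut g x) = x" using l r by auto
qed

lemma comp_ident [simp]: "g \<in> H \<Longrightarrow> cmp g ident = g" "g \<in> H \<Longrightarrow> cmp ident g = g"
  "g \<in> H \<Longrightarrow> cmp g (inverse_aut g) = ident" "g \<in> H \<Longrightarrow> cmp (inverse_aut g) g = ident"
  by (rule H_eqI; simp)+

lemma comp_assoc: "f \<in> H \<Longrightarrow> g \<in> H \<Longrightarrow> h \<in> H \<Longrightarrow> cmp (cmp f g) h = cmp f (cmp g h)"
  by (rule H_eqI; simp)

lemma inverse_inverse [simp]: "g \<in> H \<Longrightarrow> inverse_aut (inverse_aut g) = g"
  by (rule H_eqI) (simp_all, metis H_in_line inverse_H inverse_left inverse_right)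

lemma image_comp [simp]: "A \<subseteq> L \<Longrightarrow> cmp g h ` A = g ` h ` A"
  by (force simp: compose_eq image_iff subset_iff)

lemma image_ident [simp]: "A \<subseteq> L \<Longrightarrow> ident ` A = A"
  by (force simp: image_iff subset_iff)

lemma image_inverse [simp]: "g \<in> H \<Longrightarrow> A \<subseteq> L \<Longrightarrow> inverse_aut g ` g ` A = A"
  "g \<in> H \<Longrightarrow> A \<subseteq> L \<Longrightarrow> g ` inverse_aut g ` A = A"
  by (force simp: image_iff subset_iff)+

lemma subgroup_H: "subgroup H (BijGroup L)"
proof (rule subgroup.intro)
  show "H \<subseteq> carrier (BijGroup L)" by (auto simp: BijGroup_def dest: H_Bij)
  show "x \<otimes>\<^bsub>BijGroup L\<^esub> y \<in> H" if "x \<in> H" "y \<in> H" for x y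
    using that H_Bij by (simp add: BijGroup_def)
  show "\<one>\<^bsub>BijGroup L\<^esub> \<in> H" using ident_H by (simp add: BijGroup_def ident_def)
  show "inv\<^bsub>BijGroup L\<^esub> x \<in> H" if "x \<in> H" for x
    using that inverse_H[of x] H_Bij by (simp add: inv_BijGroup inverse_aut_def)
qed

definition fin :: "'s set \<Rightarrow> bool" where "fin A \<longleftrightarrow> finite A \<and> A \<subseteq> L"

abbreviation stab :: "'s set \<Rightarrow> ('s \<Rightarrow> 's) set" where "stab A \<equiv> pointwise_stab H A"

lemma fin_simps [simp]: "fin {}" "fin (insert x A) \<longleftrightarrow> x \<in> L \<and> fin A"
  "fin (A \<union> B) \<longleftrightarrow> fin A \<and> fin B" "g \<in> H \<Longrightarrow> fin A \<Longrightarrow> fin (g ` A)"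
  by (auto simp: fin_def)

lemma fin_finite: "fin A \<Longrightarrow> finite A" and fin_line: "fin A \<Longrightarrow> A \<subseteq> L"
  and fin_subset: "fin A \<Longrightarrow> B \<subseteq> A \<Longrightarrow> fin B" and fin_Diff: "fin A \<Longrightarrow> fin (A - B)"
  by (auto simp: fin_def intro: finite_subset)

lemma fin_mem: "fin A \<Longrightarrow> a \<in> A \<Longrightarrow> a \<in> L" using fin_line by blast

lemma stab_H: "g \<in> stab A \<Longrightarrow> g \<in> H" and stab_fix: "g \<in> stab A \<Longrightarrow> a \<in> A \<Longrightarrow> g a = a"
  and stabI: "g \<in> H \<Longrightarrow> (\<And>a. a \<in> A \<Longrightarrow> g a = a) \<Longrightarrow> g \<in> stab A"
  by (auto simp: pointwise_stab_def)

lemma stab_empty [simp]: "stab {} = H" by (auto simp: pointwise_stab_def)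
lemma stab_Un: "stab (A \<union> B) = stab A \<inter> stab B" by (auto simp: pointwise_stab_def)
lemma stab_antimono: "A \<subseteq> B \<Longrightarrow> stab B \<subseteq> stab A" by (auto simp: pointwise_stab_def)

lemma stab_ident [simp]: "A \<subseteq> L \<Longrightarrow> ident \<in> stab A"
  and stab_comp [simp]: "A \<subseteq> L \<Longrightarrow> g \<in> stab A \<Longrightarrow> h \<in> stab A \<Longrightarrow> cmp g h \<in> stab A"
  by (auto simp: pointwise_stab_def subset_iff)

lemma stab_inverse [simp]: "A \<subseteq> L \<Longrightarrow> g \<in> stab A \<Longrightarrow> inverse_aut g \<in> stab A"
  by (auto simp: pointwise_stab_def) (metis inverse_left subsetD)

lemma stab_image: "g \<in> stab A \<Longrightarrow> g ` A = A"
  by (force simp: pointwise_stab_def)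

text \<open>Two points off \<open>A\<close> in the same interval of the complement of \<open>A\<close>, of the same color, are
  in the same orbit of the stabilizer of \<open>A\<close>.\<close>

definition same_type :: "'s set \<Rightarrow> 's \<Rightarrow> 's \<Rightarrow> bool" where
  "same_type A x y \<longleftrightarrow> y \<in> L \<and> \<sigma> x = \<sigma> y \<and> (\<forall>a\<in>A. (a \<prec> x \<longleftrightarrow> a \<prec> y) \<and> (x \<prec> a \<longleftrightarrow> y \<prec> a))"

text \<open>The map \<open>g b \<mapsto> g' b\<close> together with the identity on \<open>E\<close> is a finite partial isomorphism.\<close>

lemma move_set:
  assumes "fin B" "fin E" "g \<in> H" "g' \<in> H"
    and same: "\<And>b. b \<in> B \<Longrightarrow> same_type E (g b) (g' b)"
  shows "\<exists>h\<in>stab E. \<forall>b\<in>B. h (g b) = g' b"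
proof -
  let ?r = "(\<lambda>b. (g b, g' b)) ` B \<union> (\<lambda>e. (e, e)) ` E"
  have "partial_iso ?r"
    unfolding partial_iso_def
    using assms(1-4) same
    by (auto simp: fin_def subset_iff same_type_def)
  then obtain h where h: "h \<in> H" "\<And>x y. (x, y) \<in> ?r \<Longrightarrow> h x = y" using homogeneous by blast
  have "h \<in> stab E" using h by (intro stabI) blast+
  moreover have "\<forall>b\<in>B. h (g b) = g' b" using h(2) by blast
  ultimately show ?thesis by blast
qed

lemma move_point:
  assumes "fin A" "x \<in> L" "same_type A x y"
  shows "\<exists>h\<in>stab A. h x = y"
proof -
  have "partial_iso (insert (x, y) ((\<lambda>e. (e, e)) ` A))"
    using assms by (auto simp: partial_iso_def fin_def subset_iff same_type_def)
  then obtain h where h: "h \<in> H" "\<And>u v. (u, v) \<in> insert (x, y) ((\<lambda>e. (e, e)) ` A) \<Longrightarrow> h u = v"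
    using homogeneous by blast
  have "h \<in> stab A" using h by (intro stabI) blast+
  then show ?thesis using h(2) by blast
qed

lemma same_type_refl [simp]: "x \<in> L \<Longrightarrow> same_type A x x" by (simp add: same_type_def)

lemma stab_same_type: "fin A \<Longrightarrow> h \<in> stab A \<Longrightarrow> x \<in> L \<Longrightarrow> same_type A x (h x)"
  unfolding same_type_def by (metis H_color H_in_line H_less_iff fin_mem stab_H stab_fix)

lemma same_type_both_sides:
  assumes B: "fin B" and a: "a \<in> L" "a \<notin> B"
  shows "\<exists>z. same_type B a z \<and> a \<prec> z" and "\<exists>z. same_type B a z \<and> z \<prec> a"
proof -
  let ?lo = "{b\<in>B. b \<prec> a}" and ?hi = "{b\<in>B. a \<prec> b}"
  have fin: "finite ?lo" "finite ?hi" "?lo \<subseteq> L" "?hi \<subseteq> L" using B by (auto simp: fin_def)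
  have lr: "x \<prec> y" if "x \<in> ?lo" "y \<in> ?hi" for x y using that less_trans by blast
  have type: "same_type B a z" if z: "z \<in> L" "\<sigma> z = \<sigma> a" "\<forall>b\<in>?lo. b \<prec> z" "\<forall>b\<in>?hi. z \<prec> b" for z
    unfolding same_type_def
  proof (intro conjI ballI)
    fix b assume b: "b \<in> B"
    then have "b \<prec> a \<or> a \<prec> b" using less_total[of b a] a fin_mem[OF B b] by blast
    then show "b \<prec> a \<longleftrightarrow> b \<prec> z" "a \<prec> b \<longleftrightarrow> z \<prec> b"
      using z(3,4) b less_asym by blast+
  qed (use z in simp_all)
  have "\<exists>z\<in>L. \<sigma> z = \<sigma> a \<and> (\<forall>b\<in>insert a ?lo. b \<prec> z) \<and> (\<forall>b\<in>?hi. z \<prec> b)"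
  proof (rule color_between_finite)
    show "x \<prec> y" if "x \<in> insert a ?lo" "y \<in> ?hi" for x y using that lr by blast
  qed (use fin a in simp_all)
  then obtain z where "z \<in> L" "\<sigma> z = \<sigma> a" "\<forall>b\<in>?lo. b \<prec> z" "\<forall>b\<in>?hi. z \<prec> b" "a \<prec> z" by auto
  then show "\<exists>z. same_type B a z \<and> a \<prec> z" using type by blast
  have "\<exists>z\<in>L. \<sigma> z = \<sigma> a \<and> (\<forall>b\<in>?lo. b \<prec> z) \<and> (\<forall>b\<in>insert a ?hi. z \<prec> b)"
  proof (rule color_between_finite)
    show "x \<prec> y" if "x \<in> ?lo" "y \<in> insert a ?hi" for x y using that lr by blast
  qed (use fin a in simp_all)
  then obtain z where "z \<in> L" "\<sigma> z = \<sigma> a" "\<forall>b\<in>?lo. b \<prec> z" "\<forall>b\<in>?hi. z \<prec> b" "z \<prec> a" by auto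
  then show "\<exists>z. same_type B a z \<and> z \<prec> a" using type by blast
qed

text \<open>A point outside \<open>A\<close> is moved by some element of \<open>stab A\<close>.\<close>

lemma stab_le_iff: "fin A \<Longrightarrow> fin B \<Longrightarrow> stab B \<subseteq> stab A \<longleftrightarrow> A \<subseteq> B"
proof
  assume fin: "fin A" "fin B" and le: "stab B \<subseteq> stab A"
  show "A \<subseteq> B"
  proof
    fix a assume a: "a \<in> A"
    then have aL: "a \<in> L" using fin fin_mem by blast
    show "a \<in> B"
    proof (rule ccontr)
      assume nB: "a \<notin> B"
      then obtain z where z: "same_type B a z" "a \<prec> z"
        using same_type_both_sides(1)[OF fin(2) aL] by blast
      from move_point[OF fin(2) aL z(1)] obtain h where h: "h \<in> stab B" "h a = z" by blast
      then have "h a = a" using le a stab_fix by blast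
      then show False using h z by simp
    qed
  qed
qed (use stab_antimono in blast)

lemma stab_eq_iff [simp]: "fin A \<Longrightarrow> fin B \<Longrightarrow> stab A = stab B \<longleftrightarrow> A = B"
  using stab_le_iff by blast

text \<open>Meaningful for open \<open>U\<close> only: the unique finite set whose pointwise stabilizer is \<open>U\<close>.\<close>

definition supp :: "('s \<Rightarrow> 's) set \<Rightarrow> 's set" where
  "supp U = (THE A. fin A \<and> U = stab A)"

lemma supp_stab [simp]: "fin A \<Longrightarrow> supp (stab A) = A"
  unfolding supp_def by (rule the_equality) auto

lemma perm_group_simps [simp]: "carrier (perm_group L U) = U" "\<one>\<^bsub>perm_group L U\<^esub> = ident"
  "g \<in> H \<Longrightarrow> h \<in> H \<Longrightarrow> g \<otimes>\<^bsub>perm_group L U\<^esub> h = cmp g h"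
  using H_Bij by (auto simp: perm_group_def BijGroup_def ident_def)

lemma group_H: "group (perm_group L H)"
  unfolding perm_group_def using subgroup.subgroup_is_group[OF subgroup_H group_BijGroup] .

lemma inv_H [simp]: "g \<in> H \<Longrightarrow> inv\<^bsub>perm_group L H\<^esub> g = inverse_aut g"
  by (rule group.inv_equality[OF group_H]) auto

lemma subgroup_stab: "fin A \<Longrightarrow> subgroup (stab A) (perm_group L H)"
  using fin_line stab_H by (auto intro!: subgroup.intro)

lemma group_stab: "fin A \<Longrightarrow> group (perm_group L (stab A))"
  using subgroup.subgroup_is_group[OF subgroup_stab group_H] by (simp add: perm_group_def)

lemma stab_open:
  assumes "fin A" shows "open_subgroup L H (stab A)"
  unfolding open_subgroup_def
proof (intro conjI ballI exI[of _ A])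
  fix u assume u: "u \<in> stab A"
  show "u <#\<^bsub>perm_group L H\<^esub> stab A \<subseteq> stab A"
  proof
    fix g assume "g \<in> u <#\<^bsub>perm_group L H\<^esub> stab A"
    then obtain h where "h \<in> stab A" "g = u \<otimes>\<^bsub>perm_group L H\<^esub> h" unfolding l_coset_def by blast
    then show "g \<in> stab A" using u fin_line[OF assms] stab_H[OF u] stab_H[of h A] by simp
  qed
qed (use assms subgroup_stab fin_def in auto)

text \<open>Otherwise let \<open>m\<close> be the least moved point of \<open>A\<close>. Its preimage is a larger moved point, so that
  \<open>g m \<prec> m\<close> is a smaller one.\<close>

lemma rigid:
  assumes A: "fin A" and g: "g \<in> H" "g ` A = A" and a: "a \<in> A"
  shows "g a = a"
proof (rule ccontr)
  assume ne: "g a \<noteq> a"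
  let ?B = "{b\<in>A. g b \<noteq> b}"
  obtain m where m: "m \<in> ?B" "\<forall>b\<in>?B. b = m \<or> m \<prec> b"
    using finite_has_least[of ?B] a ne fin_finite[OF A] fin_line[OF A] by auto
  have mL: "m \<in> L" using m fin_mem[OF A] by blast
  \<comment> \<open>the least moved point \<open>m\<close> and its preimage \<open>b\<close> are both moved\<close>
  obtain b where b: "b \<in> A" "g b = m" using g m by (metis (no_types, lifting) imageE mem_Collect_eq)
  have bL: "b \<in> L" using b fin_mem[OF A] by blast
  have "b \<noteq> m" using b m by auto
  moreover have "g b \<noteq> b" using b calculation by simp
  ultimately have "m \<prec> b" using m b by blast
  then have "g m \<prec> m" using H_less_iff[OF g(1) mL bL] b by simp
  moreover have "g m \<in> A" using g m by blast
  moreover have "g (g m) \<noteq> g m" using m mL g(1) H_in_line by simp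
  ultimately show False using m less_asym[of m "g m"] by auto
qed

text \<open>The stabilizer of a minimal finite set \<open>A\<close> with \<open>stab A \<subseteq> U\<close> is \<open>U\<close> itself. If some \<open>u \<in> U\<close>
  moves \<open>A\<close>, pick \<open>a \<in> A\<close> outside \<open>u ` A\<close>. Elements of \<open>stab (u ` A) \<subseteq> U\<close> shift \<open>a\<close> a little in both directions
  while fixing the rest of \<open>A\<close>; conjugating, \<open>U\<close> contains the stabilizers of the shifted sets. These
  move \<open>a\<close> to every point of its color in the interval of \<open>A - {a}\<close> around it, so that
  \<open>stab (A - {a}) \<subseteq> U\<close>, against minimality.\<close>

lemma open_subgroup_shrink:
  assumes U: "subgroup U (perm_group L H)" and A: "fin A" "stab A \<subseteq> U"
    and u: "u \<in> U" and a: "a \<in> A" "a \<notin> u ` A"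
  shows "stab (A - {a}) \<subseteq> U"
proof -
  let ?A = "A - {a}"
  have UH: "U \<subseteq> H" using subgroup.subset[OF U] by simp
  have Uc: "cmp g h \<in> U" if "g \<in> U" "h \<in> U" for g h
    using subgroup.m_closed[OF U that] that UH by (simp add: subset_iff)
  have Ui: "inverse_aut g \<in> U" if "g \<in> U" for g
    using subgroup.m_inv_closed[OF U that] that UH by (simp add: subset_iff)
  have aL: "a \<in> L" and AL: "A \<subseteq> L" using A(1) a(1) fin_mem fin_line by blast+
  have uH: "u \<in> H" using u UH by blast
  \<comment> \<open>conjugates of a stabilizer inside \<open>U\<close>\<close>
  have conj: "stab (g ` B) \<subseteq> U" if "g \<in> U" "fin B" "stab B \<subseteq> U" for g B
  proof
    fix h assume h: "h \<in> stab (g ` B)"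
    have gH: "g \<in> H" and hH: "h \<in> H" using that h UH stab_H by blast+
    have "cmp (inverse_aut g) (cmp h g) \<in> stab B"
      using gH hH h fin_mem[OF that(2)] by (auto simp: pointwise_stab_def)
    then have k: "cmp (inverse_aut g) (cmp h g) \<in> U" using that by blast
    have "h = cmp (cmp g (cmp (inverse_aut g) (cmp h g))) (inverse_aut g)"
      using gH hH by (intro H_eqI) auto
    then show "h \<in> U" using Uc[OF Uc[OF that(1) k] Ui[OF that(1)]] by simp
  qed
  have uA: "stab (u ` A) \<subseteq> U" by (rule conj[OF u A])
  \<comment> \<open>points reachable from \<open>a\<close> by elements of \<open>U\<close> fixing the rest of \<open>A\<close>\<close>
  define Orb where "Orb = {g a | g. g \<in> U \<inter> stab ?A}"
  have near: "z \<in> Orb" if nz: "same_type (?A \<union> u ` A) a z" for z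
  proof -
    have "fin (?A \<union> u ` A)" using A(1) uH fin_Diff[OF A(1)] by simp
    from move_point[OF this aL nz] obtain h where h: "h \<in> stab (?A \<union> u ` A)" "h a = z" by blast
    then show ?thesis using uA unfolding Orb_def stab_Un by blast
  qed
  have step: "z \<in> Orb" if bO: "b \<in> Orb" and nz: "same_type (insert b ?A) a z" for b z
  proof -
    obtain g where g: "g \<in> U" "g \<in> stab ?A" "g a = b" using bO unfolding Orb_def by blast
    have bL: "b \<in> L" using H_in_line[OF subsetD[OF UH g(1)] aL] g(3) by simp
    have "insert (g a) (g ` ?A) = g ` A" using a(1) by blast
    then have "insert b ?A = g ` A" using stab_image[OF g(2)] g(3) by simp
    then have sub: "stab (insert b ?A) \<subseteq> U" using conj[OF g(1) A] by simp
    have "fin (insert b ?A)" using bL fin_Diff[OF A(1)] by simp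
    from move_point[OF this aL nz] obtain h where h: "h \<in> stab (insert b ?A)" "h a = z" by blast
    have "h \<in> stab ?A" using h(1) stab_antimono[of ?A "insert b ?A"] by blast
    then show ?thesis unfolding Orb_def using h sub by blast
  qed
  \<comment> \<open>a reachable point on either side of \<open>a\<close>\<close>
  let ?B = "?A \<union> u ` A"
  have "fin ?B" "a \<notin> ?B" using A(1) uH a(2) fin_Diff[OF A(1)] by auto
  then obtain hi lo where hi: "same_type ?B a hi" "a \<prec> hi" and lo: "same_type ?B a lo" "lo \<prec> a"
    using same_type_both_sides aL by metis
  then have Orb: "hi \<in> Orb" "lo \<in> Orb" using near hi lo by blast+
  show ?thesis
  proof
    fix g assume g: "g \<in> stab ?A"
    have gH: "g \<in> H" using stab_H g by blast
    have t: "same_type ?A a (g a)" using stab_same_type[OF fin_Diff[OF A(1)] g aL] .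
    have "g a \<in> Orb"
    proof (cases "a \<prec> g a")
      case True
      then have "same_type (insert lo ?A) a (g a)"
        using t lo(2) less_trans[of lo a "g a"] less_asym unfolding same_type_def by (metis insert_iff)
      then show ?thesis using step Orb by blast
    next
      case False
      then have "g a = a \<or> g a \<prec> a" using less_total[OF H_in_line[OF gH aL] aL] by blast
      then have "same_type (insert hi ?A) a (g a)"
        using t hi(2) less_trans[of "g a" a hi] less_asym unfolding same_type_def by (metis insert_iff)
      then show ?thesis using step Orb by blast
    qed
    then obtain h where h: "h \<in> U" "h \<in> stab ?A" "h a = g a" unfolding Orb_def by force
    have hH: "h \<in> H" using h UH by blast
    have "cmp (inverse_aut h) g \<in> stab A"
    proof (rule stabI)
      fix b assume b: "b \<in> A"
      then have "b \<in> L" using AL by blast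
      moreover have "g b = h b" using b h g stab_fix by (metis Diff_iff singletonD)
      ultimately show "cmp (inverse_aut h) g b = b" using hH by simp
    qed (use hH gH in simp)
    then have "cmp h (cmp (inverse_aut h) g) \<in> U" using Uc h(1) A(2) by blast
    moreover have "cmp h (cmp (inverse_aut h) g) = g"
      using hH gH by (intro H_eqI) auto
    ultimately show "g \<in> U" by simp
  qed
qed

text \<open>A minimal finite set \<open>A\<close> with \<open>stab A \<subseteq> U\<close> cannot be shrunk, hence is preserved by \<open>U\<close>, hence is fixed
  pointwise by \<open>U\<close> because the group preserves the order.\<close>

theorem open_subgroup_iff: "open_subgroup L H U \<longleftrightarrow> (\<exists>A. fin A \<and> U = stab A)"
proof
  assume op: "open_subgroup L H U"
  then have U: "subgroup U (perm_group L H)" by (simp add: open_subgroup_def)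
  have "ident \<in> U" using subgroup.one_closed[OF U] by simp
  then obtain A0 where A0: "finite A0" "A0 \<subseteq> L" "ident <#\<^bsub>perm_group L H\<^esub> stab A0 \<subseteq> U"
    using op unfolding open_subgroup_def by blast
  have "stab A0 \<subseteq> U"
  proof
    fix g assume g: "g \<in> stab A0"
    then have "ident \<otimes>\<^bsub>perm_group L H\<^esub> g = g" using stab_H by simp
    then show "g \<in> U" using A0(3) g unfolding l_coset_def by blast
  qed
  with A0 have "\<exists>A. fin A \<and> stab A \<subseteq> U" by (auto simp: fin_def)
  then obtain A where A: "fin A" "stab A \<subseteq> U" and min: "\<And>B. fin B \<Longrightarrow> stab B \<subseteq> U \<Longrightarrow> card A \<le> card B"
    using exists_least_iff[of "\<lambda>n. \<exists>A. fin A \<and> stab A \<subseteq> U \<and> card A = n"] by (metis not_le_imp_less)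
  have "U \<subseteq> stab A"
  proof
    fix u assume u: "u \<in> U"
    have uH: "u \<in> H" using subgroup.subset[OF U] u by auto
    have sub: "A \<subseteq> u ` A"
    proof (rule ccontr)
      assume "\<not> A \<subseteq> u ` A"
      then obtain a where a: "a \<in> A" "a \<notin> u ` A" by blast
      have "card A \<le> card (A - {a})"
        using min[OF fin_Diff[OF A(1)] open_subgroup_shrink[OF U A u a]] .
      then show False using a(1) fin_finite[OF A(1)] by (meson card_Diff1_less not_le)
    qed
    have eq: "u ` A = A"
      using card_subset_eq[OF finite_imageI[OF fin_finite[OF A(1)]] sub]
        card_image_le[OF fin_finite[OF A(1)], of u] card_mono[OF finite_imageI[OF fin_finite[OF A(1)]] sub] by auto
    show "u \<in> stab A" using rigid[OF A(1) uH eq] uH by (intro stabI) auto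
  qed
  then show "\<exists>A. fin A \<and> U = stab A" using A by blast
qed (use stab_open in blast)

end

section \<open>Actions of open subgroups\<close>

context colored_line
begin

definition acts :: "('s \<Rightarrow> 's) set \<Rightarrow> 'x set \<Rightarrow> (('s \<Rightarrow> 's) \<Rightarrow> 'x \<Rightarrow> 'x) \<Rightarrow> bool" where
  "acts U X a \<longleftrightarrow> (\<forall>g\<in>U. \<forall>x\<in>X. a g x \<in> X) \<and> (\<forall>x\<in>X. a ident x = x) \<and>
     (\<forall>g\<in>U. \<forall>h\<in>U. \<forall>x\<in>X. a (cmp g h) x = a g (a h x))"

definition point_stab :: "('s \<Rightarrow> 's) set \<Rightarrow> (('s \<Rightarrow> 's) \<Rightarrow> 'x \<Rightarrow> 'x) \<Rightarrow> 'x \<Rightarrow> ('s \<Rightarrow> 's) set" where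
  "point_stab U a x = {g \<in> U. a g x = x}"

definition orb :: "('s \<Rightarrow> 's) set \<Rightarrow> (('s \<Rightarrow> 's) \<Rightarrow> 'x \<Rightarrow> 'x) \<Rightarrow> 'x \<Rightarrow> 'x set" where
  "orb U a x = (\<lambda>g. a g x) ` U"

text \<open>Openness of the point stabilizers, in the form given by \<open>open_subgroup_iff\<close>.\<close>

definition smooth :: "'s set \<Rightarrow> 'x set \<Rightarrow> (('s \<Rightarrow> 's) \<Rightarrow> 'x \<Rightarrow> 'x) \<Rightarrow> bool" where
  "smooth A X a \<longleftrightarrow> fin A \<and> acts (stab A) X a \<and>
     (\<forall>x\<in>X. \<exists>B. fin B \<and> point_stab (stab A) a x = stab B)"

definition pt_supp :: "'s set \<Rightarrow> (('s \<Rightarrow> 's) \<Rightarrow> 'x \<Rightarrow> 'x) \<Rightarrow> 'x \<Rightarrow> 's set" where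
  "pt_supp A a x = supp (point_stab (stab A) a x)"

lemma acts_closed: "acts U X a \<Longrightarrow> g \<in> U \<Longrightarrow> x \<in> X \<Longrightarrow> a g x \<in> X"
  and acts_ident: "acts U X a \<Longrightarrow> x \<in> X \<Longrightarrow> a ident x = x"
  and acts_comp: "acts U X a \<Longrightarrow> g \<in> U \<Longrightarrow> h \<in> U \<Longrightarrow> x \<in> X \<Longrightarrow> a (cmp g h) x = a g (a h x)"
  unfolding acts_def by blast+

lemma acts_inverse:
  assumes "fin A" "acts (stab A) X a" "g \<in> stab A" "x \<in> X"
  shows "a (inverse_aut g) (a g x) = x" "a g (a (inverse_aut g) x) = x"
proof -
  have i: "inverse_aut g \<in> stab A" by (rule stab_inverse[OF fin_line[OF assms(1)] assms(3)])
  show "a (inverse_aut g) (a g x) = x"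
    using acts_comp[OF assms(2) i assms(3,4)] acts_ident[OF assms(2,4)] stab_H[OF assms(3)] by simp
  show "a g (a (inverse_aut g) x) = x"
    using acts_comp[OF assms(2,3) i assms(4)] acts_ident[OF assms(2,4)] stab_H[OF assms(3)] by simp
qed

lemma group_action_iff:
  assumes A: "fin A"
  shows "group_action (perm_group L (stab A)) X a \<longleftrightarrow>
    acts (stab A) X a \<and> (\<forall>g\<in>stab A. a g \<in> extensional X)"
proof
  assume "group_action (perm_group L (stab A)) X a"
  then interpret group_action "perm_group L (stab A)" X a .
  have B: "a g \<in> Bij X" if "g \<in> stab A" for g using bij_prop0[of g] that by simp
  have "a ident = (\<lambda>x\<in>X. x)" using id_eq_one by simp
  moreover have "a (cmp g h) x = a g (a h x)" if "g \<in> stab A" "h \<in> stab A" "x \<in> X" for g h x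
    using composition_rule[of x g h] that stab_H[of g A] stab_H[of h A] by simp
  moreover have "a g x \<in> X" if "g \<in> stab A" "x \<in> X" for g x
    using Bij_imp_funcset[OF B[OF that(1)]] that(2) by blast
  ultimately show "acts (stab A) X a \<and> (\<forall>g\<in>stab A. a g \<in> extensional X)"
    using Bij_imp_extensional[OF B] unfolding acts_def by auto
next
  assume asm: "acts (stab A) X a \<and> (\<forall>g\<in>stab A. a g \<in> extensional X)"
  then have a: "acts (stab A) X a" and e: "\<And>g. g \<in> stab A \<Longrightarrow> a g \<in> extensional X" by auto
  have B: "a g \<in> Bij X" if g: "g \<in> stab A" for g
  proof -
    have i: "inverse_aut g \<in> stab A" by (rule stab_inverse[OF fin_line[OF A] g])
    have "bij_betw (a g) X X"
      by (rule bij_betw_byWitness[of X "a (inverse_aut g)"])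
        (use acts_inverse[OF A a g] acts_closed[OF a g] acts_closed[OF a i] in auto)
    then show ?thesis using e[OF g] by (simp add: Bij_def)
  qed
  have "a \<in> hom (perm_group L (stab A)) (BijGroup X)"
  proof (rule homI)
    show "a g \<in> carrier (BijGroup X)" if "g \<in> carrier (perm_group L (stab A))" for g
      using B that by (simp add: BijGroup_def)
    fix g h assume gh: "g \<in> carrier (perm_group L (stab A))" "h \<in> carrier (perm_group L (stab A))"
    then have gh: "g \<in> stab A" "h \<in> stab A" by simp_all
    have "a (cmp g h) = compose X (a g) (a h)"
    proof (rule extensionalityI[of _ X])
      show "a (cmp g h) \<in> extensional X" by (rule e[OF stab_comp[OF fin_line[OF A] gh]])
      show "compose X (a g) (a h) \<in> extensional X" by (simp add: compose_def)
      show "a (cmp g h) x = compose X (a g) (a h) x" if "x \<in> X" for x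
        using acts_comp[OF a gh that] that by (simp add: compose_eq)
    qed
    then show "a (g \<otimes>\<^bsub>perm_group L (stab A)\<^esub> h) = a g \<otimes>\<^bsub>BijGroup X\<^esub> a h"
      using gh stab_H[OF gh(1)] stab_H[OF gh(2)] B[OF gh(1)] B[OF gh(2)] by (simp add: BijGroup_def)
  qed
  then show "group_action (perm_group L (stab A)) X a"
    by (simp add: group_action_def group_hom_def group_hom_axioms_def group_stab[OF A] group_BijGroup)
qed

lemma orbit_eq_orb [simp]: "orbit (perm_group L U) a x = orb U a x"
  unfolding orbit_def orb_def perm_group_simps by blast

lemma orbits_eq_orb [simp]: "orbits (perm_group L U) X a = orb U a ` X"
  unfolding orbits_def by auto

lemma stabilizer_eq [simp]: "stabilizer (perm_group L U) a x = point_stab U a x"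
  unfolding stabilizer_def point_stab_def by simp

lemma finitary_iff:
  "finitary_gset L H X \<longleftrightarrow>
     (\<exists>A. defgrp X = stab A \<and> smooth A (pts X) (act X) \<and>
        (\<forall>g\<in>stab A. act X g \<in> extensional (pts X)) \<and> finite (orb (stab A) (act X) ` pts X))"
    (is "?l \<longleftrightarrow> ?r")
proof
  assume l: ?l
  then obtain A where A: "fin A" "defgrp X = stab A" unfolding finitary_gset_def open_subgroup_iff by blast
  then have "smooth A (pts X) (act X) \<and> (\<forall>g\<in>stab A. act X g \<in> extensional (pts X)) \<and>
      finite (orb (stab A) (act X) ` pts X)"
    using l group_action_iff[OF A(1), of "pts X" "act X"]
    unfolding finitary_gset_def open_subgroup_iff smooth_def by simp
  with A show ?r by blast
next
  assume ?r
  then obtain A where A: "defgrp X = stab A" "smooth A (pts X) (act X)"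
    "\<forall>g\<in>stab A. act X g \<in> extensional (pts X)" "finite (orb (stab A) (act X) ` pts X)" by blast
  then have "fin A" by (simp add: smooth_def)
  with A group_action_iff[OF this, of "pts X" "act X"] show ?l
    unfolding finitary_gset_def open_subgroup_iff smooth_def by auto
qed

lemma conj_stab_iff:
  assumes g: "g \<in> H" and B: "fin B" and h: "h \<in> H"
  shows "h \<in> stab (g ` B) \<longleftrightarrow> cmp (inverse_aut g) (cmp h g) \<in> stab B"
proof -
  have "h (g b) = g b \<longleftrightarrow> inverse_aut g (h (g b)) = b" if "b \<in> B" for b
  proof -
    have bL: "b \<in> L" using fin_mem[OF B that] .
    have "h (g b) \<in> L" using bL g h by simp
    then show ?thesis using bL inverse_left[OF g bL] inverse_right[OF g, of "h (g b)"] by metis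
  qed
  then show ?thesis using fin_mem[OF B] g h by (auto simp: pointwise_stab_def)
qed

lemma smooth_fin: "smooth A X a \<Longrightarrow> fin A" and smooth_acts: "smooth A X a \<Longrightarrow> acts (stab A) X a"
  by (simp_all add: smooth_def)

lemma pt_supp_props:
  assumes "smooth A X a" "x \<in> X"
  shows "fin (pt_supp A a x)" "point_stab (stab A) a x = stab (pt_supp A a x)" "A \<subseteq> pt_supp A a x"
proof -
  obtain B where B: "fin B" "point_stab (stab A) a x = stab B" using assms unfolding smooth_def by blast
  then have "pt_supp A a x = B" by (simp add: pt_supp_def)
  then show "fin (pt_supp A a x)" "point_stab (stab A) a x = stab (pt_supp A a x)" using B by auto
  have "stab B \<subseteq> stab A" using B(2) unfolding point_stab_def by blast
  then show "A \<subseteq> pt_supp A a x" using stab_le_iff[OF smooth_fin[OF assms(1)] B(1)] \<open>pt_supp A a x = B\<close> by simp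
qed

lemma pt_suppI: "fin B \<Longrightarrow> point_stab (stab A) a x = stab B \<Longrightarrow> pt_supp A a x = B"
  by (simp add: pt_supp_def)

text \<open>So a point of the orbit of \<open>x\<close> is the same as the tuple of images of the support of \<open>x\<close>.\<close>

lemma act_eq_iff:
  assumes s: "smooth A X a" and x: "x \<in> X" and g: "g \<in> stab A" and h: "h \<in> stab A"
  shows "a g x = a h x \<longleftrightarrow> (\<forall>b\<in>pt_supp A a x. g b = h b)"
proof -
  note A = smooth_fin[OF s] and ac = smooth_acts[OF s]
  have i: "inverse_aut h \<in> stab A" by (rule stab_inverse[OF fin_line[OF A] h])
  have k: "cmp (inverse_aut h) g \<in> stab A" by (rule stab_comp[OF fin_line[OF A] i g])
  have gH: "g \<in> H" and hH: "h \<in> H" using stab_H g h by blast+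
  have c: "a (cmp (inverse_aut h) g) x = a (inverse_aut h) (a g x)" by (rule acts_comp[OF ac i g x])
  have "a (inverse_aut h) (a g x) = x \<Longrightarrow> a g x = a h x"
    using acts_inverse(2)[OF A ac h acts_closed[OF ac g x]] by simp
  then have "a g x = a h x \<longleftrightarrow> a (cmp (inverse_aut h) g) x = x"
    using c acts_inverse(1)[OF A ac h x] by auto
  also have "\<dots> \<longleftrightarrow> cmp (inverse_aut h) g \<in> stab (pt_supp A a x)"
    using k pt_supp_props(2)[OF s x] unfolding point_stab_def by blast
  also have "\<dots> \<longleftrightarrow> (\<forall>b\<in>pt_supp A a x. inverse_aut h (g b) = b)"
    using fin_mem[OF pt_supp_props(1)[OF s x]] gH hH by (auto simp: pointwise_stab_def)
  also have "\<dots> \<longleftrightarrow> (\<forall>b\<in>pt_supp A a x. g b = h b)"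
  proof (rule ball_cong[OF refl])
    fix b assume "b \<in> pt_supp A a x"
    then have bL: "b \<in> L" using fin_mem[OF pt_supp_props(1)[OF s x]] by blast
    then have "g b \<in> L" using gH by simp
    then show "inverse_aut h (g b) = b \<longleftrightarrow> g b = h b"
      using inverse_left[OF hH bL] inverse_right[OF hH, of "g b"] by metis
  qed
  finally show ?thesis .
qed

lemma pt_supp_act:
  assumes s: "smooth A X a" and x: "x \<in> X" and g: "g \<in> stab A"
  shows "pt_supp A a (a g x) = g ` pt_supp A a x"
proof (rule pt_suppI)
  let ?B = "pt_supp A a x"
  note A = smooth_fin[OF s] and ac = smooth_acts[OF s] and B = pt_supp_props[OF s x]
  have gH: "g \<in> H" by (rule stab_H[OF g])
  have i: "inverse_aut g \<in> stab A" by (rule stab_inverse[OF fin_line[OF A] g])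
  show "fin (g ` ?B)" using gH B(1) by simp
  show "point_stab (stab A) a (a g x) = stab (g ` ?B)"
  proof (rule Set.set_eqI)
    fix h
    show "h \<in> point_stab (stab A) a (a g x) \<longleftrightarrow> h \<in> stab (g ` ?B)"
    proof (cases "h \<in> stab A")
      case True
      have hH: "h \<in> H" by (rule stab_H[OF True])
      have hg: "cmp h g \<in> stab A" by (rule stab_comp[OF fin_line[OF A] True g])
      have "h \<in> point_stab (stab A) a (a g x) \<longleftrightarrow> a (cmp h g) x = a g x"
        unfolding point_stab_def using True acts_comp[OF ac True g x] by simp
      also have "\<dots> \<longleftrightarrow> (\<forall>b\<in>?B. cmp h g b = g b)" by (rule act_eq_iff[OF s x hg g])
      also have "\<dots> \<longleftrightarrow> h \<in> stab (g ` ?B)"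
        using fin_mem[OF B(1)] hH unfolding pointwise_stab_def by simp
      finally show ?thesis .
    next
      case False
      have "A \<subseteq> g ` ?B" using stab_image[OF g] B(3) by blast
      then have "h \<notin> stab (g ` ?B)" using False stab_antimono by blast
      then show ?thesis using False by (simp add: point_stab_def)
    qed
  qed
qed

lemma smooth_restrict:
  assumes s: "smooth A X a" and E: "fin E" "A \<subseteq> E"
  shows "smooth E X a" and "x \<in> X \<Longrightarrow> pt_supp E a x = E \<union> pt_supp A a x"
proof -
  have ac: "acts (stab E) X a"
    using smooth_acts[OF s] stab_antimono[OF E(2)] unfolding acts_def by blast
  have ps: "point_stab (stab E) a x = stab (E \<union> pt_supp A a x)" if "x \<in> X" for x
    using pt_supp_props(2)[OF s that] stab_antimono[OF E(2)] unfolding point_stab_def stab_Un by blast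
  have f: "fin (E \<union> pt_supp A a x)" if "x \<in> X" for x using E pt_supp_props(1)[OF s that] by simp
  show "smooth E X a" using E ac ps f unfolding smooth_def by blast
  show "pt_supp E a x = E \<union> pt_supp A a x" if "x \<in> X" by (rule pt_suppI[OF f[OF that] ps[OF that]])
qed

lemma smooth_subset: "smooth A X a \<Longrightarrow> Y \<subseteq> X \<Longrightarrow> (\<And>g y. g \<in> stab A \<Longrightarrow> y \<in> Y \<Longrightarrow> a g y \<in> Y) \<Longrightarrow> smooth A Y a"
  unfolding smooth_def acts_def by blast

subsection \<open>Orbits\<close>

lemma orb_refl: "fin A \<Longrightarrow> acts (stab A) X a \<Longrightarrow> x \<in> X \<Longrightarrow> x \<in> orb (stab A) a x"
  unfolding orb_def using acts_ident stab_ident[OF fin_line] by (metis imageI)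

lemma orb_subset: "acts U X a \<Longrightarrow> x \<in> X \<Longrightarrow> orb U a x \<subseteq> X"
  unfolding orb_def acts_def by blast

lemma orb_eq:
  assumes A: "fin A" and ac: "acts (stab A) X a" and x: "x \<in> X" and y: "y \<in> orb (stab A) a x"
  shows "orb (stab A) a y = orb (stab A) a x"
proof -
  obtain g where g: "g \<in> stab A" "y = a g x" using y unfolding orb_def by blast
  have i: "inverse_aut g \<in> stab A" by (rule stab_inverse[OF fin_line[OF A] g(1)])
  have yX: "y \<in> X" using acts_closed[OF ac g(1) x] g(2) by simp
  have 1: "a h y \<in> orb (stab A) a x" if h: "h \<in> stab A" for h
    using acts_comp[OF ac h g(1) x] g(2) stab_comp[OF fin_line[OF A] h g(1)] unfolding orb_def by force
  have 2: "a h x \<in> orb (stab A) a y" if h: "h \<in> stab A" for h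
  proof -
    have "a (cmp h (inverse_aut g)) y = a h x"
      using acts_comp[OF ac h i yX] acts_inverse(1)[OF A ac g(1) x] g(2) by simp
    then show ?thesis using stab_comp[OF fin_line[OF A] h i] unfolding orb_def by force
  qed
  show ?thesis using 1 2 unfolding orb_def by blast
qed

lemma orb_act: "fin A \<Longrightarrow> acts (stab A) X a \<Longrightarrow> x \<in> X \<Longrightarrow> g \<in> stab A \<Longrightarrow> orb (stab A) a (a g x) = orb (stab A) a x"
  using orb_eq[of A X a x "a g x"] unfolding orb_def by blast

text \<open>The group is oligomorphic: an orbit of \<open>stab A\<close> is a family of images \<open>g ` B\<close> of a finite set, and
  the orbit of \<open>g ` B\<close> under \<open>stab E\<close> is determined by the position of each \<open>g b\<close> relative to \<open>E\<close>.\<close>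

lemma finite_orbits_restrict:
  assumes s: "smooth A X a" and f: "finite (orb (stab A) a ` X)" and E: "fin E" "A \<subseteq> E"
  shows "finite (orb (stab E) a ` X)"
proof -
  note A = smooth_fin[OF s] and ac = smooth_acts[OF s]
  note sE = smooth_restrict(1)[OF s E]
  note acE = smooth_acts[OF sE]
  have single: "finite (orb (stab E) a ` orb (stab A) a x)" if x: "x \<in> X" for x
  proof -
    let ?B = "pt_supp A a x"
    note B = pt_supp_props[OF s x]
    define code where "code g = (\<lambda>b\<in>?B. ({e\<in>E. e \<prec> g b}, {e\<in>E. g b \<prec> e}))" for g
    have fc: "finite (code ` stab A)"
    proof (rule finite_subset)
      show "code ` stab A \<subseteq> ?B \<rightarrow>\<^sub>E (Pow E \<times> Pow E)" by (auto simp: code_def)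
      show "finite (?B \<rightarrow>\<^sub>E (Pow E \<times> Pow E))"
        using fin_finite[OF B(1)] fin_finite[OF E(1)] by (intro finite_PiE) auto
    qed
    have same: "orb (stab E) a (a g x) = orb (stab E) a (a g' x)"
      if g: "g \<in> stab A" "g' \<in> stab A" and c: "code g = code g'" for g g'
    proof -
      have gH: "g \<in> H" "g' \<in> H" using g stab_H by blast+
      have "same_type E (g b) (g' b)" if b: "b \<in> ?B" for b
      proof -
        have bL: "b \<in> L" by (rule fin_mem[OF B(1) b])
        have "code g b = code g' b" using c by simp
        then have "{e\<in>E. e \<prec> g b} = {e\<in>E. e \<prec> g' b}" "{e\<in>E. g b \<prec> e} = {e\<in>E. g' b \<prec> e}"
          using b by (simp_all add: code_def)
        then show ?thesis unfolding same_type_def using bL gH by auto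
      qed
      from move_set[OF B(1) E(1) gH this] obtain h where h: "h \<in> stab E" "\<forall>b\<in>?B. h (g b) = g' b" by blast
      have hA: "h \<in> stab A" using h(1) stab_antimono[OF E(2)] by blast
      have hg: "cmp h g \<in> stab A" by (rule stab_comp[OF fin_line[OF A] hA g(1)])
      have "a (cmp h g) x = a g' x"
        using act_eq_iff[OF s x hg g(2)] h(2) fin_mem[OF B(1)] by simp
      then have "a g' x = a h (a g x)" using acts_comp[OF ac hA g(1) x] by simp
      then show ?thesis using orb_act[OF E(1) acE acts_closed[OF ac g(1) x] h(1)] by simp
    qed
    define F where "F c = orb (stab E) a (a (SOME g. g \<in> stab A \<and> code g = c) x)" for c
    have "orb (stab E) a (a g x) = F (code g)" if g: "g \<in> stab A" for g
    proof -
      have w: "(SOME g'. g' \<in> stab A \<and> code g' = code g) \<in> stab A \<and> code (SOME g'. g' \<in> stab A \<and> code g' = code g) = code g"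
        by (rule someI[of _ g]) (use g in simp)
      show ?thesis unfolding F_def by (rule same[OF g conjunct1[OF w] conjunct2[OF w, symmetric]])
    qed
    then have "(\<lambda>g. orb (stab E) a (a g x)) ` stab A \<subseteq> F ` code ` stab A" by blast
    then have "orb (stab E) a ` orb (stab A) a x \<subseteq> F ` code ` stab A"
      unfolding orb_def[of "stab A"] image_image .
    then show ?thesis by (rule finite_subset[OF _ finite_imageI[OF fc]])
  qed
  have "orb (stab E) a ` X \<subseteq> (\<Union>O'\<in>orb (stab A) a ` X. orb (stab E) a ` O')"
  proof
    fix Q assume "Q \<in> orb (stab E) a ` X"
    then obtain x where x: "x \<in> X" "Q = orb (stab E) a x" by blast
    then show "Q \<in> (\<Union>O'\<in>orb (stab A) a ` X. orb (stab E) a ` O')"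
      using orb_refl[OF A ac x(1)] by blast
  qed
  moreover have "finite (\<Union>O'\<in>orb (stab A) a ` X. orb (stab E) a ` O')"
    using f single by blast
  ultimately show ?thesis using finite_subset by blast
qed

subsection \<open>Sums over orbits\<close>

text \<open>Used for functions \<open>\<phi>\<close> that are constant on orbits (\<open>invariant\<close>); then the choice of representatives is
  immaterial.\<close>

definition orbit_sum :: "('s \<Rightarrow> 's) set \<Rightarrow> (('s \<Rightarrow> 's) \<Rightarrow> 'x \<Rightarrow> 'x) \<Rightarrow> 'x set \<Rightarrow> ('x \<Rightarrow> 'k::comm_ring_1) \<Rightarrow> 'k" where
  "orbit_sum U a X \<phi> = (\<Sum>Q\<in>orb U a ` X. \<phi> (SOME x. x \<in> Q))"

definition invariant :: "('s \<Rightarrow> 's) set \<Rightarrow> (('s \<Rightarrow> 's) \<Rightarrow> 'x \<Rightarrow> 'x) \<Rightarrow> 'x set \<Rightarrow> ('x \<Rightarrow> 'k) \<Rightarrow> bool" where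
  "invariant U a X \<phi> \<longleftrightarrow> (\<forall>g\<in>U. \<forall>x\<in>X. \<phi> (a g x) = \<phi> x)"

lemma orbit_rep:
  assumes A: "fin A" and ac: "acts (stab A) X a" and x: "x \<in> X"
  shows "(SOME y. y \<in> orb (stab A) a x) \<in> orb (stab A) a x"
  using orb_refl[OF A ac x] by (rule someI)

lemma invariant_rep:
  assumes A: "fin A" and ac: "acts (stab A) X a" and x: "x \<in> X" and i: "invariant (stab A) a X \<phi>"
  shows "\<phi> (SOME y. y \<in> orb (stab A) a x) = \<phi> x"
  using orbit_rep[OF A ac x] i x unfolding orb_def invariant_def by fastforce

lemma orbit_sum_cong:
  assumes "fin A" "acts (stab A) X a" "\<And>x. x \<in> X \<Longrightarrow> \<phi> x = \<psi> x"
  shows "orbit_sum (stab A) a X \<phi> = orbit_sum (stab A) a X \<psi>"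
  unfolding orbit_sum_def
proof (rule sum.cong[OF refl])
  fix Q assume "Q \<in> orb (stab A) a ` X"
  then obtain x where x: "x \<in> X" "Q = orb (stab A) a x" by blast
  have "(SOME y. y \<in> Q) \<in> X" using orbit_rep[OF assms(1,2) x(1)] orb_subset[OF assms(2) x(1)] x(2) by blast
  then show "\<phi> (SOME x. x \<in> Q) = \<psi> (SOME x. x \<in> Q)" by (rule assms(3))
qed

lemma orbit_sum_single:
  assumes "fin A" "acts (stab A) X a" "invariant (stab A) a X \<phi>" "x \<in> X" "orb (stab A) a x = X"
  shows "orbit_sum (stab A) a X \<phi> = \<phi> x"
proof -
  have "orb (stab A) a ` X = {X}" using orb_eq[OF assms(1,2,4)] assms(4,5) by auto
  then show ?thesis unfolding orbit_sum_def using invariant_rep[OF assms(1,2,4,3)] assms(5) by simp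
qed

lemma orbit_sum_Un:
  assumes A: "fin A" and X: "acts (stab A) X a" "finite (orb (stab A) a ` X)"
    and Y: "acts (stab A) Y a" "finite (orb (stab A) a ` Y)" and disj: "X \<inter> Y = {}"
  shows "orbit_sum (stab A) a (X \<union> Y) \<phi> = orbit_sum (stab A) a X \<phi> + orbit_sum (stab A) a Y \<phi>"
proof -
  have "orb (stab A) a ` X \<inter> orb (stab A) a ` Y = {}"
  proof (rule ccontr)
    assume "\<not> ?thesis"
    then obtain x y where xy: "x \<in> X" "y \<in> Y" "orb (stab A) a x = orb (stab A) a y" by auto
    then have "x \<in> Y" using orb_refl[OF A X(1)] orb_subset[OF Y(1)] by blast
    then show False using xy disj by blast
  qed
  then show ?thesis unfolding orbit_sum_def image_Un using X(2) Y(2) by (intro sum.union_disjoint)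
qed

lemma orbit_sum_iso:
  assumes A: "fin A" and X: "acts (stab A) X a" and Y: "acts (stab A) Y b" and f: "bij_betw f X Y"
    and eq: "\<And>g x. g \<in> stab A \<Longrightarrow> x \<in> X \<Longrightarrow> f (a g x) = b g (f x)"
    and inv: "invariant (stab A) b Y \<psi>" and val: "\<And>x. x \<in> X \<Longrightarrow> \<phi> x = \<psi> (f x)"
  shows "orbit_sum (stab A) a X \<phi> = orbit_sum (stab A) b Y \<psi>"
proof -
  have fX: "f x \<in> Y" if "x \<in> X" for x using f that bij_betwE by blast
  have of: "f ` orb (stab A) a x = orb (stab A) b (f x)" if "x \<in> X" for x
    unfolding orb_def image_image using eq that by (intro image_cong) auto
  have invX: "invariant (stab A) a X \<phi>"
    unfolding invariant_def using inv eq val fX acts_closed[OF X] by (simp add: invariant_def)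
  have "(\<Sum>Q\<in>orb (stab A) a ` X. \<phi> (SOME x. x \<in> Q)) = (\<Sum>P\<in>(\<lambda>Q. f ` Q) ` (orb (stab A) a ` X). \<psi> (SOME y. y \<in> P))"
  proof (rule sum.reindex_cong[symmetric, OF _ refl])
    show "inj_on ((`) f) (orb (stab A) a ` X)"
    proof (rule inj_onI)
      fix P Q assume "P \<in> orb (stab A) a ` X" "Q \<in> orb (stab A) a ` X" "f ` P = f ` Q"
      moreover from this have "P \<subseteq> X" "Q \<subseteq> X" using orb_subset[OF X] by blast+
      ultimately show "P = Q" using f inj_on_image_eq_iff[of f X P Q] bij_betw_imp_inj_on by blast
    qed
    fix Q assume "Q \<in> orb (stab A) a ` X"
    then obtain x where x: "x \<in> X" "Q = orb (stab A) a x" by blast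
    show "\<psi> (SOME y. y \<in> f ` Q) = \<phi> (SOME x. x \<in> Q)"
      using invariant_rep[OF A Y fX[OF x(1)] inv] invariant_rep[OF A X x(1) invX] of[OF x(1)] val[OF x(1)] x(2) by simp
  qed
  moreover have "(\<lambda>Q. f ` Q) ` (orb (stab A) a ` X) = orb (stab A) b ` Y"
  proof -
    have "(\<lambda>Q. f ` Q) ` (orb (stab A) a ` X) = (\<lambda>x. orb (stab A) b (f x)) ` X"
      unfolding image_image using of by (intro image_cong) auto
    also have "\<dots> = orb (stab A) b ` f ` X" by (simp add: image_image)
    finally show ?thesis using f by (simp add: bij_betw_def)
  qed
  ultimately show ?thesis unfolding orbit_sum_def by simp
qed

lemma orbit_sum_refine:
  assumes s: "smooth A X a" and f: "finite (orb (stab A) a ` X)" and E: "fin E" "A \<subseteq> E"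
  shows "orbit_sum (stab E) a X \<phi> = (\<Sum>Q\<in>orb (stab A) a ` X. orbit_sum (stab E) a Q \<phi>)"
proof -
  note A = smooth_fin[OF s] and ac = smooth_acts[OF s]
  note acE = smooth_acts[OF smooth_restrict(1)[OF s E]]
  define \<pi> where "\<pi> Q = orb (stab A) a (SOME x. x \<in> Q)" for Q
  have pi: "\<pi> (orb (stab E) a x) = orb (stab A) a x" if x: "x \<in> X" for x
  proof -
    have "orb (stab E) a x \<subseteq> orb (stab A) a x" using stab_antimono[OF E(2)] unfolding orb_def by blast
    then have "(SOME y. y \<in> orb (stab E) a x) \<in> orb (stab A) a x" using orbit_rep[OF E(1) acE x] by blast
    then show ?thesis unfolding \<pi>_def by (rule orb_eq[OF A ac x])
  qed
  have "orbit_sum (stab E) a X \<phi> = (\<Sum>Q\<in>orb (stab A) a ` X. \<Sum>P | P \<in> orb (stab E) a ` X \<and> \<pi> P = Q. \<phi> (SOME x. x \<in> P))"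
    unfolding orbit_sum_def
    by (rule sum.group[symmetric]) (use finite_orbits_restrict[OF s f E] f pi in auto)
  also have "\<dots> = (\<Sum>Q\<in>orb (stab A) a ` X. orbit_sum (stab E) a Q \<phi>)"
  proof (rule sum.cong[OF refl])
    fix Q assume "Q \<in> orb (stab A) a ` X"
    then obtain x where x: "x \<in> X" "Q = orb (stab A) a x" by blast
    have "{P. P \<in> orb (stab E) a ` X \<and> \<pi> P = Q} = orb (stab E) a ` Q"
    proof (intro equalityI subsetI)
      fix P assume "P \<in> {P. P \<in> orb (stab E) a ` X \<and> \<pi> P = Q}"
      then obtain y where y: "y \<in> X" "P = orb (stab E) a y" "\<pi> P = Q" by blast
      then have "y \<in> Q" using pi orb_refl[OF A ac] by metis
      then show "P \<in> orb (stab E) a ` Q" using y by blast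
    next
      fix P assume "P \<in> orb (stab E) a ` Q"
      then obtain y where y: "y \<in> Q" "P = orb (stab E) a y" by blast
      then have "y \<in> X" using x orb_subset[OF ac x(1)] by blast
      moreover have "orb (stab A) a y = Q" using orb_eq[OF A ac x(1)] y x by blast
      ultimately show "P \<in> {P. P \<in> orb (stab E) a ` X \<and> \<pi> P = Q}" using pi y by blast
    qed
    then show "(\<Sum>P | P \<in> orb (stab E) a ` X \<and> \<pi> P = Q. \<phi> (SOME x. x \<in> P)) = orbit_sum (stab E) a Q \<phi>"
      unfolding orbit_sum_def by simp
  qed
  finally show ?thesis .
qed

text \<open>Fubini for orbit sums: orbits on the total space of an equivariant map are orbits of point
  stabilizers on fibers.\<close>

lemma orbit_sum_fibers:
  assumes sX: "smooth E X a" and fX: "finite (orb (stab E) a ` X)"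
    and sY: "smooth E Y b" and fY: "finite (orb (stab E) b ` Y)"
    and pX: "\<And>x. x \<in> X \<Longrightarrow> \<pi> x \<in> Y" and eq: "\<And>g x. g \<in> stab E \<Longrightarrow> x \<in> X \<Longrightarrow> \<pi> (a g x) = b g (\<pi> x)"
    and inv: "invariant (stab E) a X \<phi>"
  shows "orbit_sum (stab E) a X \<phi> =
    orbit_sum (stab E) b Y (\<lambda>y. orbit_sum (stab (pt_supp E b y)) a {x\<in>X. \<pi> x = y} \<phi>)"
proof -
  note E = smooth_fin[OF sX] and acX = smooth_acts[OF sX] and acY = smooth_acts[OF sY]
  define \<rho> where "\<rho> Q = orb (stab E) b (\<pi> (SOME x. x \<in> Q))" for Q
  have rho: "\<rho> (orb (stab E) a x) = orb (stab E) b (\<pi> x)" if x: "x \<in> X" for x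
  proof -
    obtain g where g: "g \<in> stab E" "(SOME y. y \<in> orb (stab E) a x) = a g x"
      using orbit_rep[OF E acX x] unfolding orb_def by blast
    then show ?thesis unfolding \<rho>_def using eq[OF g(1) x] orb_act[OF E acY pX[OF x] g(1)] by simp
  qed
  have "orbit_sum (stab E) a X \<phi> = (\<Sum>P\<in>orb (stab E) b ` Y. \<Sum>Q | Q \<in> orb (stab E) a ` X \<and> \<rho> Q = P. \<phi> (SOME x. x \<in> Q))"
    unfolding orbit_sum_def
    by (rule sum.group[symmetric]) (use fX fY rho pX in auto)
  also have "\<dots> = (\<Sum>P\<in>orb (stab E) b ` Y. orbit_sum (stab (pt_supp E b (SOME y. y \<in> P))) a {x\<in>X. \<pi> x = (SOME y. y \<in> P)} \<phi>)"
  proof (rule sum.cong[OF refl])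
    fix P assume "P \<in> orb (stab E) b ` Y"
    then obtain y0 where y0: "y0 \<in> Y" "P = orb (stab E) b y0" by blast
    define y where "y = (SOME y. y \<in> P)"
    have yP: "y \<in> P" unfolding y_def y0(2) by (rule orbit_rep[OF E acY y0(1)])
    have y: "y \<in> Y" using yP y0 orb_subset[OF acY y0(1)] by blast
    have P: "P = orb (stab E) b y" using orb_eq[OF E acY y0(1)] yP y0(2) by blast
    let ?F = "{x\<in>X. \<pi> x = y}" and ?S = "stab (pt_supp E b y)"
    note S = pt_supp_props[OF sY y]
    have SE: "?S \<subseteq> stab E" using stab_antimono[OF S(3)] .
    have Sfix: "g \<in> ?S \<longleftrightarrow> g \<in> stab E \<and> b g y = y" for g using S(2) unfolding point_stab_def by blast
    have acF: "acts ?S ?F a" using acX SE eq Sfix unfolding acts_def by auto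
    have invF: "invariant ?S a ?F \<phi>" using inv SE unfolding invariant_def by blast
    have "(\<Sum>Q | Q \<in> orb (stab E) a ` X \<and> \<rho> Q = P. \<phi> (SOME x. x \<in> Q)) = (\<Sum>R\<in>orb ?S a ` ?F. \<phi> (SOME x. x \<in> R))"
    proof (rule sum.reindex_bij_witness[of _ "\<lambda>R. orb (stab E) a (SOME x. x \<in> R)" "\<lambda>Q. Q \<inter> ?F"])
      fix Q assume "Q \<in> {Q. Q \<in> orb (stab E) a ` X \<and> \<rho> Q = P}"
      then obtain x where x: "x \<in> X" "Q = orb (stab E) a x" "\<rho> Q = P" by blast
      then have "y \<in> orb (stab E) b (\<pi> x)" using rho yP by simp
      then obtain g where g: "g \<in> stab E" "y = b g (\<pi> x)" unfolding orb_def by blast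
      define z where "z = a g x"
      have z: "z \<in> X" "\<pi> z = y" "Q = orb (stab E) a z"
        using acts_closed[OF acX g(1) x(1)] eq[OF g(1) x(1)] g(2) orb_act[OF E acX x(1) g(1)] x(2)
        unfolding z_def by simp_all
      then have zF: "z \<in> ?F" by simp
      have QF: "Q \<inter> ?F = orb ?S a z"
      proof (intro equalityI subsetI)
        fix w assume "w \<in> Q \<inter> ?F"
        then obtain h where h: "h \<in> stab E" "w = a h z" "\<pi> w = y" using z(3) unfolding orb_def by blast
        then have "h \<in> ?S" using eq[OF h(1) z(1)] z(2) Sfix by simp
        then show "w \<in> orb ?S a z" using h unfolding orb_def by blast
      next
        fix w assume w: "w \<in> orb ?S a z"
        then have "w \<in> ?F" using orb_subset[OF acF zF] by blast
        moreover have "w \<in> Q" using w SE z(3) unfolding orb_def by blast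
        ultimately show "w \<in> Q \<inter> ?F" by blast
      qed
      have rep: "(SOME x. x \<in> Q \<inter> ?F) \<in> orb ?S a z" unfolding QF by (rule orbit_rep[OF S(1) acF zF])
      show "orb (stab E) a (SOME x. x \<in> Q \<inter> ?F) = Q"
        using rep SE orb_eq[OF E acX z(1)] z(3) unfolding orb_def[of ?S] orb_def[of "stab E" a z] by blast
      show "Q \<inter> ?F \<in> orb ?S a ` ?F" using QF zF by blast
      show "\<phi> (SOME x. x \<in> Q \<inter> ?F) = \<phi> (SOME x. x \<in> Q)"
        using invariant_rep[OF S(1) acF zF invF] invariant_rep[OF E acX z(1) inv] QF z(3) by simp
    next
      fix R assume "R \<in> orb ?S a ` ?F"
      then obtain z where z: "z \<in> ?F" "R = orb ?S a z" by blast
      then have zX: "z \<in> X" and pz: "\<pi> z = y" by auto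
      have rep: "(SOME x. x \<in> R) \<in> orb ?S a z" unfolding z(2) by (rule orbit_rep[OF S(1) acF z(1)])
      then have eqE: "orb (stab E) a (SOME x. x \<in> R) = orb (stab E) a z"
        using SE orb_eq[OF E acX zX] unfolding orb_def[of ?S] orb_def[of "stab E" a z] by blast
      show "orb (stab E) a (SOME x. x \<in> R) \<in> {Q. Q \<in> orb (stab E) a ` X \<and> \<rho> Q = P}"
        using eqE rho[OF zX] zX pz P by simp
      show "orb (stab E) a (SOME x. x \<in> R) \<inter> ?F = R"
        unfolding eqE
      proof (intro equalityI subsetI)
        fix w assume "w \<in> orb (stab E) a z \<inter> ?F"
        then obtain h where h: "h \<in> stab E" "w = a h z" "\<pi> w = y" unfolding orb_def by blast
        then have "h \<in> ?S" using eq[OF h(1) zX] pz Sfix by simp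
        then show "w \<in> R" using h z(2) unfolding orb_def by blast
      next
        fix w assume w: "w \<in> R"
        then have "w \<in> ?F" using orb_subset[OF acF z(1)] z(2) by blast
        moreover have "w \<in> orb (stab E) a z" using w SE z(2) unfolding orb_def by blast
        ultimately show "w \<in> orb (stab E) a z \<inter> ?F" by blast
      qed
    qed
    then show "(\<Sum>Q | Q \<in> orb (stab E) a ` X \<and> \<rho> Q = P. \<phi> (SOME x. x \<in> Q)) =
        orbit_sum (stab (pt_supp E b (SOME y. y \<in> P))) a {x\<in>X. \<pi> x = (SOME y. y \<in> P)} \<phi>"
      unfolding orbit_sum_def[of ?S] y_def[symmetric] by simp
  qed
  also have "\<dots> = orbit_sum (stab E) b Y (\<lambda>y. orbit_sum (stab (pt_supp E b y)) a {x\<in>X. \<pi> x = y} \<phi>)"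
    by (simp add: orbit_sum_def[of "stab E" b])
  finally show ?thesis .
qed

end

context colored_line
begin

lemma smooth_transfer:
  assumes s: "smooth A X a" and f: "bij_betw f X Y"
    and eq: "\<And>g x. g \<in> stab A \<Longrightarrow> x \<in> X \<Longrightarrow> f (a g x) = b g (f x)"
  shows "smooth A Y b" and "x \<in> X \<Longrightarrow> pt_supp A b (f x) = pt_supp A a x"
    and "finite (orb (stab A) a ` X) \<Longrightarrow> finite (orb (stab A) b ` Y)"
proof -
  note A = smooth_fin[OF s] and ac = smooth_acts[OF s]
  have fY: "f ` X = Y" and inj: "inj_on f X" using f by (auto simp: bij_betw_def)
  have ps: "point_stab (stab A) b (f x) = point_stab (stab A) a x" if x: "x \<in> X" for x
    unfolding point_stab_def using eq[OF _ x] inj_on_eq_iff[OF inj acts_closed[OF ac _ x] x] by auto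
  have "acts (stab A) Y b"
    unfolding acts_def
  proof (intro conjI ballI)
    fix y assume "y \<in> Y"
    then obtain x where x: "x \<in> X" "y = f x" using fY by blast
    show "b ident y = y" using eq[OF stab_ident[OF fin_line[OF A]] x(1)] acts_ident[OF ac x(1)] x(2) by simp
    fix g assume g: "g \<in> stab A"
    show "b g y \<in> Y" using eq[OF g x(1)] acts_closed[OF ac g x(1)] fY x(2) by (metis imageI)
    fix h assume h: "h \<in> stab A"
    show "b (cmp g h) y = b g (b h y)"
      using eq[OF stab_comp[OF fin_line[OF A] g h] x(1)] acts_comp[OF ac g h x(1)] eq[OF h x(1)]
        eq[OF g acts_closed[OF ac h x(1)]] x(2) by simp
  qed
  moreover have "\<exists>B. fin B \<and> point_stab (stab A) b y = stab B" if y: "y \<in> Y" for y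
  proof -
    obtain x where x: "x \<in> X" "y = f x" using fY y by blast
    then show ?thesis using ps[OF x(1)] pt_supp_props(1,2)[OF s x(1)] by blast
  qed
  ultimately show "smooth A Y b" using A unfolding smooth_def by blast
  show "x \<in> X \<Longrightarrow> pt_supp A b (f x) = pt_supp A a x" unfolding pt_supp_def using ps by simp
  have "orb (stab A) b (f x) = f ` orb (stab A) a x" if "x \<in> X" for x
    unfolding orb_def image_image using eq that by (intro image_cong) auto
  then have "orb (stab A) b ` Y = (\<lambda>Q. f ` Q) ` (orb (stab A) a ` X)"
    unfolding fY[symmetric] image_image by (intro image_cong) auto
  then show "finite (orb (stab A) a ` X) \<Longrightarrow> finite (orb (stab A) b ` Y)" by simp
qed

lemma acts_Un: "acts U X a \<Longrightarrow> acts U Y a \<Longrightarrow> acts U (X \<union> Y) a"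
  unfolding acts_def by blast

lemma smooth_Un: "smooth A X a \<Longrightarrow> smooth A Y a \<Longrightarrow> smooth A (X \<union> Y) a"
  unfolding smooth_def acts_def by blast

subsection \<open>Translates of a finite set\<close>

text \<open>A transitive set with point stabilizer \<open>stab B\<close> is the family of translates of \<open>B\<close>: since the group
  preserves the order, a translate determines the translated tuple.\<close>

definition translates :: "'s set \<Rightarrow> 's set \<Rightarrow> 's set set" where
  "translates A B = (\<lambda>g. g ` B) ` stab A"

text \<open>By \<open>rigid\<close>, applied to \<open>h\<inverse> g\<close>.\<close>

lemma image_rigid:
  assumes "fin B" "g \<in> H" "h \<in> H" "g ` B = h ` B" "b \<in> B" shows "g b = h b"
proof -
  have bL: "b \<in> L" and BL: "B \<subseteq> L" using assms fin_mem fin_line by blast+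
  have "cmp (inverse_aut h) g ` B = B"
    using image_comp[OF BL, of "inverse_aut h" g] assms(4) image_inverse(1)[OF assms(3) BL] by simp
  then have "cmp (inverse_aut h) g b = b" using rigid[OF assms(1) _ _ assms(5)] assms(2,3) by simp
  then have "inverse_aut h (g b) = b" using bL by simp
  then show ?thesis using inverse_right[OF assms(3), of "g b"] assms(2) bL by simp
qed

lemma translates_fin: "fin B \<Longrightarrow> S \<in> translates A B \<Longrightarrow> fin S"
  unfolding translates_def using stab_H by auto

lemma translates_self: "fin A \<Longrightarrow> B \<subseteq> L \<Longrightarrow> B \<in> translates A B"
  unfolding translates_def using stab_ident[OF fin_line] image_ident by (metis image_eqI)

lemma translates_sup: "A \<subseteq> B \<Longrightarrow> S \<in> translates A B \<Longrightarrow> A \<subseteq> S"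
  unfolding translates_def using stab_image by blast

lemma translates_action:
  assumes B: "fin B" "A \<subseteq> B"
  shows "smooth A (translates A B) (`)"
    and "S \<in> translates A B \<Longrightarrow> pt_supp A (`) S = S"
    and "S \<in> translates A B \<Longrightarrow> orb (stab A) (`) S = translates A B"
    and "orb (stab A) (`) ` translates A B = {translates A B}"
proof -
  have A: "fin A" using fin_subset[OF B] .
  have ac: "acts (stab A) (translates A B) (`)"
    unfolding acts_def
  proof (intro conjI ballI)
    fix S assume S: "S \<in> translates A B"
    then have SL: "S \<subseteq> L" using translates_fin[OF B(1)] fin_line by blast
    show "ident ` S = S" using SL by simp
    fix g assume g: "g \<in> stab A"
    obtain k where k: "k \<in> stab A" "S = k ` B" using S unfolding translates_def by blast
    have "g ` S = cmp g k ` B" using k fin_line[OF B(1)] by simp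
    then show "g ` S \<in> translates A B"
      unfolding translates_def using stab_comp[OF fin_line[OF A] g k(1)] by blast
    fix h assume "h \<in> stab A"
    show "cmp g h ` S = g ` h ` S" using SL by simp
  qed
  have ps: "point_stab (stab A) (`) S = stab S" if S: "S \<in> translates A B" for S
  proof -
    have f: "fin S" and AS: "A \<subseteq> S" using translates_fin[OF B(1) S] translates_sup[OF B(2) S] .
    show ?thesis
    proof (intro equalityI subsetI)
      fix g assume "g \<in> point_stab (stab A) (`) S"
      then have "g \<in> H" "g ` S = S" unfolding point_stab_def using stab_H by auto
      then show "g \<in> stab S" using rigid[OF f] by (intro stabI) auto
    next
      fix g assume g: "g \<in> stab S"
      then show "g \<in> point_stab (stab A) (`) S"
        unfolding point_stab_def using stab_image[OF g] stab_antimono[OF AS] by blast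
    qed
  qed
  show "smooth A (translates A B) (`)"
    unfolding smooth_def using A ac ps translates_fin[OF B(1)] by blast
  show "S \<in> translates A B \<Longrightarrow> pt_supp A (`) S = S" by (rule pt_suppI[OF translates_fin[OF B(1)] ps])
  have "orb (stab A) (`) B = translates A B" unfolding orb_def translates_def by simp
  then show o: "S \<in> translates A B \<Longrightarrow> orb (stab A) (`) S = translates A B" for S
    using orb_eq[OF A ac translates_self[OF A fin_line[OF B(1)]]] by simp
  show "orb (stab A) (`) ` translates A B = {translates A B}"
    using o translates_self[OF A fin_line[OF B(1)]] by auto
qed

text \<open>The projection from translates of \<open>B\<close> to translates of a subset \<open>B'\<close>; it is well defined by \<open>image_rigid\<close>.\<close>

definition subtranslate :: "'s set \<Rightarrow> 's set \<Rightarrow> 's set \<Rightarrow> 's set \<Rightarrow> 's set" where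
  "subtranslate A B B' S = (THE S'. \<exists>g\<in>stab A. S = g ` B \<and> S' = g ` B')"

lemma subtranslate_image:
  assumes B: "fin B" "B' \<subseteq> B" and g: "g \<in> stab A"
  shows "subtranslate A B B' (g ` B) = g ` B'"
  unfolding subtranslate_def
proof (rule the_equality)
  fix S' assume "\<exists>h\<in>stab A. g ` B = h ` B \<and> S' = h ` B'"
  then obtain h where h: "h \<in> stab A" "g ` B = h ` B" "S' = h ` B'" by blast
  have "g b = h b" if "b \<in> B'" for b
    using image_rigid[OF B(1) stab_H[OF g] stab_H[OF h(1)] h(2)] that B(2) by blast
  then show "S' = g ` B'" using h(3) by auto
qed (use g in blast)

lemma subtranslate_equivariant:
  assumes A: "fin A" and B: "fin B" "B' \<subseteq> B" and g: "g \<in> stab A" and S: "S \<in> translates A B"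
  shows "subtranslate A B B' S \<in> translates A B'" "subtranslate A B B' (g ` S) = g ` subtranslate A B B' S"
proof -
  obtain h where h: "h \<in> stab A" "S = h ` B" using S unfolding translates_def by blast
  show "subtranslate A B B' S \<in> translates A B'"
    using subtranslate_image[OF B h(1)] h unfolding translates_def by auto
  have "g ` S = cmp g h ` B" using h fin_line[OF B(1)] by simp
  then have "subtranslate A B B' (g ` S) = cmp g h ` B'"
    using subtranslate_image[OF B stab_comp[OF fin_line[OF A] g h(1)]] by simp
  then show "subtranslate A B B' (g ` S) = g ` subtranslate A B B' S"
    using subtranslate_image[OF B h(1)] h(2) fin_line[OF fin_subset[OF B]] by simp
qed

text \<open>The isomorphism sends a point to its support.\<close>

lemma transitive_iso_translates:
  assumes s: "smooth A X a" and x: "x \<in> X"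
  shows "bij_betw (pt_supp A a) (orb (stab A) a x) (translates A (pt_supp A a x))"
    and "smooth A (orb (stab A) a x) a"
proof -
  note A = smooth_fin[OF s] and ac = smooth_acts[OF s]
  have sp: "pt_supp A a (a g x) = g ` pt_supp A a x" if "g \<in> stab A" for g by (rule pt_supp_act[OF s x that])
  show "bij_betw (pt_supp A a) (orb (stab A) a x) (translates A (pt_supp A a x))"
  proof (rule bij_betw_imageI)
    show "inj_on (pt_supp A a) (orb (stab A) a x)"
    proof (rule inj_onI)
      fix y z assume "y \<in> orb (stab A) a x" "z \<in> orb (stab A) a x" and e: "pt_supp A a y = pt_supp A a z"
      then obtain g h where g: "g \<in> stab A" "y = a g x" and h: "h \<in> stab A" "z = a h x" unfolding orb_def by blast
      then have "g ` pt_supp A a x = h ` pt_supp A a x" using e sp by simp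
      then have "\<forall>b\<in>pt_supp A a x. g b = h b"
        using image_rigid[OF pt_supp_props(1)[OF s x] stab_H[OF g(1)] stab_H[OF h(1)]] by blast
      then show "y = z" using act_eq_iff[OF s x g(1) h(1)] g h by simp
    qed
    show "pt_supp A a ` orb (stab A) a x = translates A (pt_supp A a x)"
      unfolding orb_def translates_def image_image using sp by (intro image_cong) auto
  qed
  show "smooth A (orb (stab A) a x) a"
  proof (rule smooth_subset[OF s orb_subset[OF ac x]])
    fix g y assume "g \<in> stab A" "y \<in> orb (stab A) a x"
    then obtain h where h: "h \<in> stab A" "y = a h x" "g \<in> stab A" unfolding orb_def by blast
    then have "a g y = a (cmp g h) x" using acts_comp[OF ac h(3,1) x] by simp
    then show "a g y \<in> orb (stab A) a x" using stab_comp[OF fin_line[OF A] h(3,1)] unfolding orb_def by blast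
  qed
qed

subsection \<open>Colors of the neighbors of a point\<close>

text \<open>The color of the greatest element of a finite set, with \<open>Minf\<close> standing for the missing left neighbor of
  a point below which there is none.\<close>

definition lower_type :: "'s set \<Rightarrow> 'c extended" where
  "lower_type S = (if S = {} then Minf else Fin (\<sigma> (THE m. m \<in> S \<and> (\<forall>a\<in>S. a = m \<or> a \<prec> m))))"

definition upper_type :: "'s set \<Rightarrow> 'c extended" where
  "upper_type S = (if S = {} then Pinf else Fin (\<sigma> (THE m. m \<in> S \<and> (\<forall>a\<in>S. a = m \<or> m \<prec> a))))"

definition lo :: "'s set \<Rightarrow> 's \<Rightarrow> 'c extended" where "lo C x = lower_type {a\<in>C. a \<prec> x}"
definition hi :: "'s set \<Rightarrow> 's \<Rightarrow> 'c extended" where "hi C x = upper_type {a\<in>C. x \<prec> a}"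

lemma lower_typeI: "m \<in> S \<Longrightarrow> (\<And>a. a \<in> S \<Longrightarrow> a = m \<or> a \<prec> m) \<Longrightarrow> lower_type S = Fin (\<sigma> m)"
proof -
  assume m: "m \<in> S" "\<And>a. a \<in> S \<Longrightarrow> a = m \<or> a \<prec> m"
  have "n = m" if n: "n \<in> S \<and> (\<forall>a\<in>S. a = n \<or> a \<prec> n)" for n
    using m(2)[of n] m(1) n less_asym[of n m] by auto
  then have "(THE m. m \<in> S \<and> (\<forall>a\<in>S. a = m \<or> a \<prec> m)) = m"
    using m by (intro the_equality) auto
  then show ?thesis using m(1) unfolding lower_type_def by auto
qed

lemma upper_typeI: "m \<in> S \<Longrightarrow> (\<And>a. a \<in> S \<Longrightarrow> a = m \<or> m \<prec> a) \<Longrightarrow> upper_type S = Fin (\<sigma> m)"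
proof -
  assume m: "m \<in> S" "\<And>a. a \<in> S \<Longrightarrow> a = m \<or> m \<prec> a"
  have "n = m" if n: "n \<in> S \<and> (\<forall>a\<in>S. a = n \<or> n \<prec> a)" for n
    using m(2)[of n] m(1) n less_asym[of n m] by auto
  then have "(THE m. m \<in> S \<and> (\<forall>a\<in>S. a = m \<or> m \<prec> a)) = m"
    using m by (intro the_equality) auto
  then show ?thesis using m(1) unfolding upper_type_def by auto
qed

lemma type_empty [simp]: "lower_type {} = Minf" "upper_type {} = Pinf"
  by (simp_all add: lower_type_def upper_type_def)

lemma lower_type_insert: assumes S: "fin S" and e: "e \<in> S" "x \<prec> e" shows "lower_type (insert x S) = lower_type S"
proof -
  obtain m where m: "m \<in> S" "\<forall>a\<in>S. a = m \<or> a \<prec> m"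
    using finite_has_greatest[OF fin_finite[OF S] fin_line[OF S]] e by blast
  have "x \<prec> m" using m(2) e less_trans[of x e m] by auto
  then have "lower_type (insert x S) = Fin (\<sigma> m)" using m by (intro lower_typeI) auto
  then show ?thesis using lower_typeI[of m S] m by simp
qed

lemma upper_type_insert: assumes S: "fin S" and e: "e \<in> S" "e \<prec> x" shows "upper_type (insert x S) = upper_type S"
proof -
  obtain m where m: "m \<in> S" "\<forall>a\<in>S. a = m \<or> m \<prec> a"
    using finite_has_least[OF fin_finite[OF S] fin_line[OF S]] e by blast
  have "m \<prec> x" using m(2) e less_trans[of m e x] by auto
  then have "upper_type (insert x S) = Fin (\<sigma> m)" using m by (intro upper_typeI) auto
  then show ?thesis using upper_typeI[of m S] m by simp
qed

lemma lower_type_image: assumes g: "g \<in> H" and S: "fin S" shows "lower_type (g ` S) = lower_type S"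
proof (cases "S = {}")
  case False
  then obtain m where m: "m \<in> S" "\<forall>a\<in>S. a = m \<or> a \<prec> m"
    using finite_has_greatest[OF fin_finite[OF S] fin_line[OF S]] by blast
  have "a = g m \<or> a \<prec> g m" if a: "a \<in> g ` S" for a
  proof -
    obtain b where b: "b \<in> S" "a = g b" using a by blast
    then show ?thesis using bspec[OF m(2) b(1)] H_less_iff[OF g fin_mem[OF S b(1)] fin_mem[OF S m(1)]] by auto
  qed
  then have "lower_type (g ` S) = Fin (\<sigma> (g m))" using m(1) by (intro lower_typeI) auto
  then show ?thesis using lower_typeI[of m S] m H_color[OF g fin_mem[OF S m(1)]] by simp
qed simp

lemma upper_type_image: assumes g: "g \<in> H" and S: "fin S" shows "upper_type (g ` S) = upper_type S"
proof (cases "S = {}")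
  case False
  then obtain m where m: "m \<in> S" "\<forall>a\<in>S. a = m \<or> m \<prec> a"
    using finite_has_least[OF fin_finite[OF S] fin_line[OF S]] by blast
  have "a = g m \<or> g m \<prec> a" if a: "a \<in> g ` S" for a
  proof -
    obtain b where b: "b \<in> S" "a = g b" using a by blast
    then show ?thesis using bspec[OF m(2) b(1)] H_less_iff[OF g fin_mem[OF S m(1)] fin_mem[OF S b(1)]] by auto
  qed
  then have "upper_type (g ` S) = Fin (\<sigma> (g m))" using m(1) by (intro upper_typeI) auto
  then show ?thesis using upper_typeI[of m S] m H_color[OF g fin_mem[OF S m(1)]] by simp
qed simp

lemma lo_hi_image:
  assumes g: "g \<in> H" and C: "fin C" and x: "x \<in> L"
  shows "lo (g ` C) (g x) = lo C x" "hi (g ` C) (g x) = hi C x"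
proof -
  have "{a\<in>g ` C. a \<prec> g x} = g ` {a\<in>C. a \<prec> x}" "{a\<in>g ` C. g x \<prec> a} = g ` {a\<in>C. x \<prec> a}"
    using H_less_iff[OF g fin_mem[OF C] x] H_less_iff[OF g x fin_mem[OF C]] by blast+
  then show "lo (g ` C) (g x) = lo C x" "hi (g ` C) (g x) = hi C x"
    unfolding lo_def hi_def using lower_type_image[OF g fin_subset[OF C]] upper_type_image[OF g fin_subset[OF C]]
    by simp_all
qed

text \<open>A new point \<open>e\<close> affects the neighbors of \<open>x\<close> only if it lies in the same interval as \<open>x\<close>.\<close>

lemma lo_hi_insert_far:
  assumes C: "fin C" and x: "x \<in> L" and e: "e \<in> L" "e \<noteq> x"
    and c: "c \<in> C" "(e = c \<or> e \<prec> c) \<and> c \<prec> x \<or> (e = c \<or> c \<prec> e) \<and> x \<prec> c"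
  shows "lo (insert e C) x = lo C x" "hi (insert e C) x = hi C x"
proof -
  have f: "fin {a\<in>C. a \<prec> x}" "fin {a\<in>C. x \<prec> a}" using fin_subset[OF C] by auto
  consider "e \<in> C" | "e \<prec> c" "c \<prec> x" | "c \<prec> e" "x \<prec> c" using c by blast
  then have "lo (insert e C) x = lo C x \<and> hi (insert e C) x = hi C x"
  proof cases
    case 1 then show ?thesis by (simp add: insert_absorb)
  next
    case 2
    then have ex: "e \<prec> x" using less_trans by blast
    then have "{a\<in>insert e C. a \<prec> x} = insert e {a\<in>C. a \<prec> x}" "{a\<in>insert e C. x \<prec> a} = {a\<in>C. x \<prec> a}"
      using less_asym by blast+
    then show ?thesis unfolding lo_def hi_def using lower_type_insert[OF f(1), of c e] 2 c(1) by simp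
  next
    case 3
    then have ex: "x \<prec> e" using less_trans by blast
    then have "{a\<in>insert e C. x \<prec> a} = insert e {a\<in>C. x \<prec> a}" "{a\<in>insert e C. a \<prec> x} = {a\<in>C. a \<prec> x}"
      using less_asym by blast+
    then show ?thesis unfolding lo_def hi_def using upper_type_insert[OF f(2), of c e] 3 c(1) by simp
  qed
  then show "lo (insert e C) x = lo C x" "hi (insert e C) x = hi C x" by auto
qed

definition same_cut :: "'s set \<Rightarrow> 's \<Rightarrow> 's \<Rightarrow> bool" where
  "same_cut C x y \<longleftrightarrow> (\<forall>a\<in>C. (a \<prec> x \<longleftrightarrow> a \<prec> y) \<and> (x \<prec> a \<longleftrightarrow> y \<prec> a))"

lemma same_type_cut: "same_type C x y \<longleftrightarrow> y \<in> L \<and> \<sigma> x = \<sigma> y \<and> same_cut C x y"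
  by (simp add: same_type_def same_cut_def)

lemma same_cut_lo_hi: "same_cut C x y \<Longrightarrow> lo C x = lo C y" "same_cut C x y \<Longrightarrow> hi C x = hi C y"
  unfolding same_cut_def lo_def hi_def by (metis (mono_tags, lifting) Collect_cong)+

text \<open>Between \<open>x\<close> and \<open>e\<close>, or at \<open>e\<close>, there is a point of \<open>C\<close>.\<close>

lemma not_same_cut:
  assumes C: "fin C" and x: "x \<in> L" "x \<notin> C" and e: "e \<in> L" and n: "\<not> same_cut C x e"
  shows "\<exists>c\<in>C. (e = c \<or> e \<prec> c) \<and> c \<prec> x \<or> (e = c \<or> c \<prec> e) \<and> x \<prec> c"
proof -
  obtain c where c: "c \<in> C" "\<not> ((c \<prec> x \<longleftrightarrow> c \<prec> e) \<and> (x \<prec> c \<longleftrightarrow> e \<prec> c))"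
    using n unfolding same_cut_def by blast
  have cL: "c \<in> L" using c fin_mem[OF C] by blast
  have "c \<prec> x \<or> x \<prec> c" using less_total[OF cL x(1)] c x by blast
  moreover have "e = c \<or> e \<prec> c \<or> c \<prec> e" using less_total[OF e cL] by blast
  ultimately show ?thesis using c less_asym by blast
qed

lemma lo_hi_insert_near:
  assumes C: "fin C" and cut: "same_cut C x e"
  shows "e \<prec> x \<Longrightarrow> lo (insert e C) x = Fin (\<sigma> e)" "x \<prec> e \<Longrightarrow> hi (insert e C) x = Fin (\<sigma> e)"
    "\<not> e \<prec> x \<Longrightarrow> lo (insert e C) x = lo C x" "\<not> x \<prec> e \<Longrightarrow> hi (insert e C) x = hi C x"
proof -
  show "lo (insert e C) x = Fin (\<sigma> e)" if "e \<prec> x"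
    unfolding lo_def by (rule lower_typeI) (use that cut in \<open>auto simp: same_cut_def\<close>)
  show "hi (insert e C) x = Fin (\<sigma> e)" if "x \<prec> e"
    unfolding hi_def by (rule upper_typeI) (use that cut in \<open>auto simp: same_cut_def\<close>)
  show "lo (insert e C) x = lo C x" if "\<not> e \<prec> x"
  proof -
    have "{a\<in>insert e C. a \<prec> x} = {a\<in>C. a \<prec> x}" using that by blast
    then show ?thesis by (simp add: lo_def)
  qed
  show "hi (insert e C) x = hi C x" if "\<not> x \<prec> e"
  proof -
    have "{a\<in>insert e C. x \<prec> a} = {a\<in>C. x \<prec> a}" using that by blast
    then show ?thesis by (simp add: hi_def)
  qed
qed

lemma orb_point:
  assumes E: "fin E" and y: "y \<in> L"
  shows "orb (stab E) (\<lambda>g x. g x) y = {z. same_type E y z}"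
proof (intro equalityI subsetI)
  fix z assume "z \<in> orb (stab E) (\<lambda>g x. g x) y"
  then obtain g where "g \<in> stab E" "z = g y" unfolding orb_def by blast
  then show "z \<in> {z. same_type E y z}" using stab_same_type[OF E _ y] by simp
next
  fix z assume "z \<in> {z. same_type E y z}"
  then have "same_type E y z" by simp
  from move_point[OF E y this] obtain h where "h \<in> stab E" "h y = z" by blast
  then show "z \<in> orb (stab E) (\<lambda>g x. g x) y" unfolding orb_def by blast
qed

lemma acts_points:
  assumes C: "fin C" "C \<subseteq> E" "fin E" and y: "y \<in> L"
  shows "acts (stab E) {z. same_type C y z} (\<lambda>g x. g x)"
  unfolding acts_def
proof (intro conjI ballI)
  fix z assume z: "z \<in> {z. same_type C y z}"
  then have zL: "z \<in> L" by (simp add: same_type_def)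
  show "ident z = z" using zL by simp
  fix g assume g: "g \<in> stab E"
  then have "g \<in> stab C" using stab_antimono[OF C(2)] by blast
  then have "same_type C z (g z)" using stab_same_type[OF C(1) _ zL] by blast
  then show "g z \<in> {z. same_type C y z}" using z unfolding same_type_def by simp
  fix h assume "h \<in> stab E"
  show "cmp g h z = g (h z)" using zL by simp
qed

lemma orbit_sum_point:
  assumes E: "fin E" and z: "z \<in> L" and inv: "invariant (stab E) (\<lambda>g x. g x) {w. same_type E z w} \<phi>"
  shows "orbit_sum (stab E) (\<lambda>g x. g x) {w. same_type E z w} \<phi> = \<phi> z"
proof -
  let ?X = "{w. same_type E z w}"
  have "acts (stab E) ?X (\<lambda>g x. g x)" by (rule acts_points[OF E order_refl E z])
  then show ?thesis using orbit_sum_single[OF E _ inv _ orb_point[OF E z]] z by simp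
qed

text \<open>Adding to \<open>C\<close> a point \<open>e\<close> in the interval of \<open>y\<close> cuts the orbit of \<open>y\<close> into the points below \<open>e\<close>,
  the points above \<open>e\<close>, and \<open>e\<close> itself if it has the right color.\<close>

lemma point_orbits:
  assumes C: "fin C" and y: "y \<in> L" "y \<notin> C" and e: "e \<in> L" and cut0: "same_cut C y e"
  defines "E \<equiv> insert e C"
  shows "\<exists>y1 y2. (y1 \<in> L \<and> y1 \<notin> E \<and> \<sigma> y1 = \<sigma> y \<and> lo E y1 = lo C y \<and> hi E y1 = Fin (\<sigma> e)) \<and>
    (y2 \<in> L \<and> y2 \<notin> E \<and> \<sigma> y2 = \<sigma> y \<and> lo E y2 = Fin (\<sigma> e) \<and> hi E y2 = hi C y) \<and>
    (\<forall>\<phi> :: 's \<Rightarrow> 'k::comm_ring_1. invariant (stab E) (\<lambda>g x. g x) {z. same_type C y z} \<phi> \<longrightarrow>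
      orbit_sum (stab E) (\<lambda>g x. g x) {z. same_type C y z} \<phi> = \<phi> y1 + \<phi> y2 + (if \<sigma> e = \<sigma> y then \<phi> e else 0))"
proof -
  let ?a = "\<lambda>g x :: 's. g x :: 's" and ?D = "{z. same_type C y z}"
  have E: "fin E" "C \<subseteq> E" using C e by (auto simp: E_def)
  have DL: "?D \<subseteq> L" by (auto simp: same_type_def)
  have enC: "e \<notin> C"
  proof
    assume "e \<in> C"
    then have "\<not> e \<prec> y" "\<not> y \<prec> e" using cut0 unfolding same_cut_def by auto
    then show False using less_total[OF e y(1)] \<open>e \<in> C\<close> y(2) by blast
  qed
  let ?lo = "{c\<in>C. c \<prec> e}" and ?hi = "{c\<in>C. e \<prec> c}"
  have fin: "finite ?lo" "finite ?hi" "?lo \<subseteq> L" "?hi \<subseteq> L" using C by (auto simp: fin_def)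
  have lr: "u \<prec> v" if "u \<in> ?lo" "v \<in> ?hi" for u v using that less_trans by blast
  have "\<exists>z\<in>L. \<sigma> z = \<sigma> y \<and> (\<forall>b\<in>?lo. b \<prec> z) \<and> (\<forall>b\<in>insert e ?hi. z \<prec> b)"
  proof (rule color_between_finite)
    show "u \<prec> v" if "u \<in> ?lo" "v \<in> insert e ?hi" for u v using that lr by blast
  qed (use fin e in simp_all)
  then obtain y1 where y1: "y1 \<in> L" "\<sigma> y1 = \<sigma> y" "\<forall>b\<in>?lo. b \<prec> y1" "\<forall>b\<in>?hi. y1 \<prec> b" "y1 \<prec> e" by auto
  have "\<exists>z\<in>L. \<sigma> z = \<sigma> y \<and> (\<forall>b\<in>insert e ?lo. b \<prec> z) \<and> (\<forall>b\<in>?hi. z \<prec> b)"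
  proof (rule color_between_finite)
    show "u \<prec> v" if "u \<in> insert e ?lo" "v \<in> ?hi" for u v using that lr by blast
  qed (use fin e in simp_all)
  then obtain y2 where y2: "y2 \<in> L" "\<sigma> y2 = \<sigma> y" "\<forall>b\<in>?lo. b \<prec> y2" "\<forall>b\<in>?hi. y2 \<prec> b" "e \<prec> y2" by auto
  have cut: "same_cut C y z" if z: "\<forall>b\<in>?lo. b \<prec> z" "\<forall>b\<in>?hi. z \<prec> b" for z
    unfolding same_cut_def
  proof (intro ballI)
    fix a assume a: "a \<in> C"
    have "a \<prec> e \<or> e \<prec> a" using less_total[OF fin_mem[OF C a] e] a enC by blast
    moreover have "(a \<prec> y \<longleftrightarrow> a \<prec> e) \<and> (y \<prec> a \<longleftrightarrow> e \<prec> a)" using cut0 a unfolding same_cut_def by blast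
    ultimately show "(a \<prec> y \<longleftrightarrow> a \<prec> z) \<and> (y \<prec> a \<longleftrightarrow> z \<prec> a)" using z a less_asym by blast
  qed
  note c1 = cut[OF y1(3,4)] and c2 = cut[OF y2(3,4)]
  have e1: "same_cut C y1 e" and e2: "same_cut C y2 e" using c1 c2 cut0 unfolding same_cut_def by blast+
  have n1: "\<not> e \<prec> y1" and n2: "\<not> y2 \<prec> e" using less_asym y1(5) y2(5) by blast+
  let ?D1 = "{w. same_type E y1 w}" and ?D2 = "{w. same_type E y2 w}" and ?De = "{w. w = e \<and> \<sigma> e = \<sigma> y}"
  have insert_cut: "same_cut E u z \<longleftrightarrow> (e \<prec> u \<longleftrightarrow> e \<prec> z) \<and> (u \<prec> e \<longleftrightarrow> z \<prec> e) \<and> same_cut C u z" for u z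
    unfolding E_def same_cut_def by simp
  have q1: "same_cut C y1 z \<longleftrightarrow> same_cut C y z" and q2: "same_cut C y2 z \<longleftrightarrow> same_cut C y z" for z
    using c1 c2 unfolding same_cut_def by simp_all
  have t1: "same_type E y1 z \<longleftrightarrow> same_type C y z \<and> z \<prec> e" for z
    unfolding same_type_cut insert_cut q1 using y1(2,5) n1 less_asym[of z e] by auto
  have t2: "same_type E y2 z \<longleftrightarrow> same_type C y z \<and> e \<prec> z" for z
    unfolding same_type_cut insert_cut q2 using y2(2,5) n2 less_asym[of z e] by auto
  have t0: "z = e \<and> \<sigma> e = \<sigma> y \<longleftrightarrow> same_type C y z \<and> z = e" for z
  proof (cases "z = e")
    case z: True
    have "same_type C y e \<longleftrightarrow> \<sigma> e = \<sigma> y" by (simp add: same_type_cut cut0 e eq_commute[of "\<sigma> y"])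
    then show ?thesis unfolding z by simp
  qed simp
  have D: "?D = (?D1 \<union> ?D2) \<union> ?De"
  proof (intro equalityI subsetI)
    fix z assume z: "z \<in> ?D"
    then have "z \<in> L" by (simp add: same_type_def)
    then have "z = e \<or> z \<prec> e \<or> e \<prec> z" using less_total[OF _ e, of z] by blast
    then show "z \<in> (?D1 \<union> ?D2) \<union> ?De" using z t1[of z] t2[of z] t0[of z] by auto
  next
    fix z assume "z \<in> (?D1 \<union> ?D2) \<union> ?De"
    then show "z \<in> ?D" using t1[of z] t2[of z] t0[of z] by auto
  qed
  have "y1 \<notin> C"
  proof
    assume "y1 \<in> C"
    then have "y1 \<prec> y1 \<longleftrightarrow> y1 \<prec> e" using e1 unfolding same_cut_def by blast
    then show False using y1(5) by simp
  qed
  then have y1C: "y1 \<notin> E" using y1(5) unfolding E_def by auto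
  have "y2 \<notin> C"
  proof
    assume "y2 \<in> C"
    then have "y2 \<prec> y2 \<longleftrightarrow> e \<prec> y2" using e2 unfolding same_cut_def by blast
    then show False using y2(5) by simp
  qed
  then have y2C: "y2 \<notin> E" using y2(5) unfolding E_def by auto
  have ac: "acts (stab E) {w. same_type E z w} ?a" and fo: "finite (orb (stab E) ?a ` {w. same_type E z w})"
    if z: "z \<in> L" for z
  proof -
    show ac: "acts (stab E) {w. same_type E z w} ?a" by (rule acts_points[OF E(1) order_refl E(1) z])
    have "orb (stab E) ?a w = {w. same_type E z w}" if "w \<in> {w. same_type E z w}" for w
      using orb_eq[OF E(1) ac, of z w] orb_point[OF E(1) z] z that by simp
    then have "orb (stab E) ?a ` {w. same_type E z w} \<subseteq> {{w. same_type E z w}}" by blast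
    from finite_subset[OF this] show "finite (orb (stab E) ?a ` {w. same_type E z w})" by simp
  qed
  have De: "?De = (if \<sigma> e = \<sigma> y then {w. same_type E e w} else {})"
  proof -
    have "same_type E e w \<longleftrightarrow> w = e" for w
      using less_total[OF e, of w] same_type_refl[OF e, of E] unfolding same_type_def E_def by auto
    then show ?thesis by simp
  qed
  have ace: "acts (stab E) ?De ?a" "finite (orb (stab E) ?a ` ?De)" unfolding De using ac[OF e] fo[OF e] by (auto simp: acts_def)
  have ac12: "acts (stab E) (?D1 \<union> ?D2) ?a" by (rule acts_Un[OF ac[OF y1(1)] ac[OF y2(1)]])
  have f12: "finite (orb (stab E) ?a ` (?D1 \<union> ?D2))" using fo[OF y1(1)] fo[OF y2(1)] by (simp add: image_Un)
  have dj: "(?D1 \<union> ?D2) \<inter> ?De = {}" "?D1 \<inter> ?D2 = {}" unfolding t1 t2 t0 by (auto dest: less_asym)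
  have sum: "orbit_sum (stab E) ?a ?D \<phi> = \<phi> y1 + \<phi> y2 + (if \<sigma> e = \<sigma> y then \<phi> e else 0)"
    if inv: "invariant (stab E) ?a ?D \<phi>" for \<phi> :: "'s \<Rightarrow> 'k"
  proof -
    have sub: "?D1 \<subseteq> ?D" "?D2 \<subseteq> ?D" "?De \<subseteq> ?D" using D by blast+
    have i: "invariant (stab E) ?a X \<phi>" if "X \<subseteq> ?D" for X using inv that unfolding invariant_def by blast
    have se: "orbit_sum (stab E) ?a ?De \<phi> = (if \<sigma> e = \<sigma> y then \<phi> e else 0)"
    proof (cases "\<sigma> e = \<sigma> y")
      case True
      then have De': "?De = {w. same_type E e w}" unfolding De by simp
      show ?thesis using orbit_sum_point[OF E(1) e i[OF sub(3), unfolded De']] True unfolding De' by simp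
    next
      case False
      then have "?De = {}" by simp
      then show ?thesis using False unfolding orbit_sum_def by simp
    qed
    have "orbit_sum (stab E) ?a ?D \<phi> = orbit_sum (stab E) ?a (?D1 \<union> ?D2) \<phi> + orbit_sum (stab E) ?a ?De \<phi>"
      using orbit_sum_Un[OF E(1) ac12 f12 ace dj(1), of \<phi>] unfolding D[symmetric] .
    also have "orbit_sum (stab E) ?a (?D1 \<union> ?D2) \<phi> = orbit_sum (stab E) ?a ?D1 \<phi> + orbit_sum (stab E) ?a ?D2 \<phi>"
      by (rule orbit_sum_Un[OF E(1) ac[OF y1(1)] fo[OF y1(1)] ac[OF y2(1)] fo[OF y2(1)] dj(2)])
    finally show ?thesis
      using orbit_sum_point[OF E(1) y1(1) i[OF sub(1)]] orbit_sum_point[OF E(1) y2(1) i[OF sub(2)]] se by simp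
  qed
  have "lo E y1 = lo C y" "hi E y1 = Fin (\<sigma> e)"
    unfolding E_def using lo_hi_insert_near(2)[OF C e1 y1(5)] lo_hi_insert_near(3)[OF C e1 n1] same_cut_lo_hi(1)[OF c1] by simp_all
  moreover have "lo E y2 = Fin (\<sigma> e)" "hi E y2 = hi C y"
    unfolding E_def using lo_hi_insert_near(1)[OF C e2 y2(5)] lo_hi_insert_near(4)[OF C e2 n2] same_cut_lo_hi(2)[OF c2] by simp_all
  ultimately show ?thesis
    using sum y1(1,2) y2(1,2) y1C y2C by (intro exI[of _ y1] exI[of _ y2] conjI allI impI) simp_all
qed

end

section \<open>Weights of finite extensions\<close>

text \<open>The values \<open>\<eta>\<^bsub>ab\<^esub>(c)\<close> of a measure on the points of color \<open>c\<close> in an interval with ends of type \<open>a\<close> and \<open>b\<close>.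
  The first law is additivity for an interval cut at a point of color \<open>c\<close>; the second counts the pairs of
  points of colors \<open>c\<close>, \<open>d\<close> in increasing order by fixing either of the two first.\<close>

locale measure_table = colored_line cyc \<sigma> p
  for cyc :: "'s \<Rightarrow> 's \<Rightarrow> 's \<Rightarrow> bool" and \<sigma> :: "'s \<Rightarrow> 'c::finite" and p :: 's +
  fixes \<eta> :: "'c extended \<Rightarrow> 'c extended \<Rightarrow> 'c \<Rightarrow> int"
  assumes eta_split: "\<eta> a b d = \<eta> a (Fin c) d + \<eta> (Fin c) b d + (if c = d then 1 else 0)"
    and eta_swap: "\<eta> a b c * \<eta> (Fin c) b d = \<eta> a b d * \<eta> a (Fin d) c"
begin

definition weight1 :: "'s set \<Rightarrow> 's \<Rightarrow> int" where
  "weight1 C x = \<eta> (lo C x) (hi C x) (\<sigma> x)"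

primrec chain :: "'s set \<Rightarrow> 's list \<Rightarrow> int" where
  "chain A [] = 1"
| "chain A (x # xs) = weight1 A x * chain (insert x A) xs"

text \<open>The measure of the set of translates of \<open>B\<close> under \<open>stab A\<close>; by \<open>chain_independent\<close> any enumeration of
  \<open>B - A\<close> computes it.\<close>

definition weight :: "'s set \<Rightarrow> 's set \<Rightarrow> int" where
  "weight A B = chain A (SOME xs. distinct xs \<and> set xs = B - A)"

text \<open>If \<open>x\<close> and \<open>y\<close> lie in the same interval of the complement of \<open>A\<close>, this is the law \<open>eta_swap\<close>. Otherwise
  neither point is a neighbor of the other and both weights remain unchanged.\<close>

lemma weight1_swap_less:
  assumes A: "fin A" and x: "x \<in> L" "x \<notin> A" and y: "y \<in> L" "y \<notin> A" and xy: "x \<prec> y"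
  shows "weight1 A x * weight1 (insert x A) y = weight1 A y * weight1 (insert y A) x"
proof -
  have ne: "x \<noteq> y" "y \<noteq> x" and nyx: "\<not> y \<prec> x" using xy less_asym by auto
  show ?thesis
  proof (cases "same_cut A x y")
    case True
    then have c': "same_cut A y x" unfolding same_cut_def by blast
    show ?thesis
      unfolding weight1_def
      using lo_hi_insert_near(1)[OF A c' xy] lo_hi_insert_near(4)[OF A c' nyx]
        lo_hi_insert_near(2)[OF A True xy] lo_hi_insert_near(3)[OF A True nyx]
        same_cut_lo_hi[OF True] eta_swap by simp
  next
    case False
    then have F': "\<not> same_cut A y x" unfolding same_cut_def by blast
    obtain c where c: "c \<in> A" "(y = c \<or> y \<prec> c) \<and> c \<prec> x \<or> (y = c \<or> c \<prec> y) \<and> x \<prec> c"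
      using not_same_cut[OF A x y(1) False] by blast
    obtain d where d: "d \<in> A" "(x = d \<or> x \<prec> d) \<and> d \<prec> y \<or> (x = d \<or> d \<prec> x) \<and> y \<prec> d"
      using not_same_cut[OF A y x(1) F'] by blast
    show ?thesis
      unfolding weight1_def
      using lo_hi_insert_far[OF A x(1) y(1) ne(2) c] lo_hi_insert_far[OF A y(1) x(1) ne(1) d] by simp
  qed
qed

lemma weight1_swap:
  assumes "fin A" "x \<in> L" "x \<notin> A" "y \<in> L" "y \<notin> A" "x \<noteq> y"
  shows "weight1 A x * weight1 (insert x A) y = weight1 A y * weight1 (insert y A) x"
  using less_total[OF assms(2,4,6)] weight1_swap_less[OF assms(1-5)] weight1_swap_less[OF assms(1,4,5,2,3)] by auto

text \<open>By the swapping relation the product along a chain of one-point extensions does not depend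
  on the order in which the points are added.\<close>

lemma chain_independent:
  assumes "fin A" "set xs \<subseteq> L" "set xs \<inter> A = {}" "distinct xs" "distinct ys" "set xs = set ys"
  shows "chain A xs = chain A ys"
  using assms
proof (induction "length xs" arbitrary: A xs ys rule: less_induct)
  case less
  show ?case
  proof (cases xs)
    case Nil then show ?thesis using less.prems by simp
  next
    case (Cons x xs')
    then obtain y ys' where ys: "ys = y # ys'" using less.prems by (cases ys) auto
    have IH: "chain B us = chain B vs"
      if "fin B" "set us \<subseteq> L" "set us \<inter> B = {}" "distinct us" "distinct vs" "set us = set vs" "length us < length xs"
      for B us vs using less.hyps[OF that(7) that(1-6)] .
    have len: "length ys = length xs" using less.prems(4-6) by (metis distinct_card)
    show ?thesis
    proof (cases "x = y")
      case True
      have "set xs' = set xs - {x}" "set ys' = set xs - {x}" using less.prems Cons ys True by auto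
      then have "chain (insert x A) xs' = chain (insert x A) ys'"
        using less.prems Cons ys True by (intro IH) auto
      then show ?thesis using Cons ys True by simp
    next
      case False
      obtain zs where zs: "set zs = set xs - {x, y}" "distinct zs"
        using finite_distinct_list[of "set xs - {x, y}"] by auto
      have mem: "x \<in> L" "y \<in> L" "x \<notin> A" "y \<notin> A" "y \<in> set xs" "x \<in> set ys" using less.prems Cons ys by auto
      have sx: "set xs' = set xs - {x}" and sy: "set ys' = set xs - {y}" using less.prems Cons ys by auto
      have 1: "chain (insert x A) xs' = chain (insert x A) (y # zs)"
      proof (rule IH)
        show "set xs' = set (y # zs)" using sx zs(1) mem(5) False by auto
        show "set xs' \<inter> insert x A = {}" using sx less.prems(3) by auto
        show "distinct xs'" using less.prems(4) Cons by simp
        show "distinct (y # zs)" using zs by simp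
      qed (use less.prems(1,2) mem Cons in auto)
      have 2: "chain (insert y A) ys' = chain (insert y A) (x # zs)"
      proof (rule IH)
        show "set ys' = set (x # zs)" using sy zs(1) Cons False by auto
        show "set ys' \<inter> insert y A = {}" using sy less.prems(3) by auto
        show "set ys' \<subseteq> L" using sy less.prems(2) by auto
        show "distinct ys'" using less.prems(5) ys by simp
        show "distinct (x # zs)" using zs by simp
        show "length ys' < length xs" using len ys by simp
      qed (use less.prems(1) mem in auto)
      have "chain A xs = weight1 A x * weight1 (insert x A) y * chain (insert x (insert y A)) zs"
        using Cons 1 by (simp add: insert_commute)
      also have "\<dots> = weight1 A y * weight1 (insert y A) x * chain (insert x (insert y A)) zs"
        using weight1_swap[OF less.prems(1) mem(1,3,2,4) False] by simp
      also have "\<dots> = chain A ys" using ys 2 by simp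
      finally show ?thesis .
    qed
  qed
qed

lemma weight_eq_chain:
  assumes "fin B" "A \<subseteq> B" "distinct xs" "set xs = B - A"
  shows "weight A B = chain A xs"
proof -
  have s: "distinct (SOME xs. distinct xs \<and> set xs = B - A) \<and> set (SOME xs. distinct xs \<and> set xs = B - A) = B - A"
    by (rule someI[of _ xs]) (use assms in simp)
  show ?thesis unfolding weight_def
    by (rule chain_independent) (use assms s fin_subset[OF assms(1,2)] fin_line[OF assms(1)] in auto)
qed

lemma weight_self [simp]: "weight A A = 1"
proof -
  have "(SOME xs. distinct xs \<and> set xs = A - A) = []" by (rule some_equality) auto
  then show ?thesis by (simp add: weight_def)
qed

lemma weight_insert:
  assumes B: "fin B" "A \<subseteq> B" and c: "c \<in> B" "c \<notin> A"
  shows "weight A B = weight1 A c * weight (insert c A) B"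
proof -
  obtain xs where xs: "set xs = B - insert c A" "distinct xs"
    using finite_distinct_list[of "B - insert c A"] fin_finite[OF B(1)] by auto
  have "weight A B = chain A (c # xs)" using xs c by (intro weight_eq_chain[OF B]) auto
  moreover have "weight (insert c A) B = chain (insert c A) xs"
    using xs c B by (intro weight_eq_chain) auto
  ultimately show ?thesis by simp
qed

lemma weight_one: "fin C \<Longrightarrow> y \<in> L \<Longrightarrow> y \<notin> C \<Longrightarrow> weight C (insert y C) = weight1 C y"
  using weight_insert[of "insert y C" C y] by (simp add: subset_insertI)

lemma weight_trans:
  assumes "fin B" "A \<subseteq> C" "C \<subseteq> B" shows "weight A B = weight A C * weight C B"
  using assms
proof (induction "card (C - A)" arbitrary: A)
  case 0
  then have "C - A = {}" using fin_finite[OF fin_Diff[OF fin_subset[OF 0(2,4)]], of A] by simp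
  then have "A = C" using 0 by blast
  then show ?case by simp
next
  case (Suc n)
  then obtain c where c: "c \<in> C" "c \<notin> A" by (metis Diff_iff all_not_in_conv card.empty nat.distinct(1))
  have fC: "fin C" using fin_subset[OF Suc.prems(1,3)] .
  have "card (C - insert c A) = n"
    using Suc.hyps(2) c fin_finite[OF fC] by (metis Diff_insert card_Diff_singleton diff_Suc_1 Diff_iff finite_Diff)
  then have "weight (insert c A) B = weight (insert c A) C * weight C B"
    using Suc.hyps(1)[of "insert c A"] Suc.prems c by simp
  moreover have "weight A B = weight1 A c * weight (insert c A) B"
    using Suc.prems c by (intro weight_insert) auto
  moreover have "weight A C = weight1 A c * weight (insert c A) C"
    using Suc.prems c fC by (intro weight_insert) auto
  ultimately show ?case by simp
qed

lemma chain_image: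
  assumes "g \<in> H" "fin A" "set xs \<subseteq> L" shows "chain (g ` A) (map g xs) = chain A xs"
  using assms(2,3)
proof (induction xs arbitrary: A)
  case (Cons x xs)
  have "weight1 (g ` A) (g x) = weight1 A x"
    unfolding weight1_def using lo_hi_image[OF assms(1) Cons.prems(1), of x] Cons.prems H_color[OF assms(1), of x] by simp
  moreover have "chain (g ` insert x A) (map g xs) = chain (insert x A) xs"
    using Cons.prems by (intro Cons.IH) auto
  ultimately show ?case by simp
qed simp

lemma weight_image:
  assumes g: "g \<in> H" and B: "fin B" "A \<subseteq> B" shows "weight (g ` A) (g ` B) = weight A B"
proof -
  obtain xs where xs: "set xs = B - A" "distinct xs"
    using finite_distinct_list[of "B - A"] fin_finite[OF B(1)] by auto
  have inj: "inj_on g B" using H_inj[OF g] fin_line[OF B(1)] by (rule inj_on_subset)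
  have "weight (g ` A) (g ` B) = chain (g ` A) (map g xs)"
  proof (rule weight_eq_chain)
    show "distinct (map g xs)" using xs inj by (simp add: distinct_map inj_on_subset[OF inj])
    show "set (map g xs) = g ` B - g ` A" using xs B(2) inj by (simp add: inj_on_image_set_diff[OF inj])
  qed (use B g in auto)
  also have "\<dots> = chain A xs" using g xs fin_subset[OF B] fin_line[OF B(1)] by (intro chain_image) auto
  also have "\<dots> = weight A B" using weight_eq_chain[OF B xs(2,1)] by simp
  finally show ?thesis .
qed

subsection \<open>Invariance under shrinking the group\<close>

text \<open>If \<open>e\<close> lies in the interval of \<open>y\<close>, the orbit of \<open>y\<close> is cut at \<open>e\<close> and the law \<open>eta_split\<close> applies.
  Otherwise \<open>stab E\<close> is still transitive on it and \<open>e\<close> is no neighbor of its points.\<close>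

lemma point_orbit_sum:
  assumes C: "fin C" and y: "y \<in> L" "y \<notin> C" and e: "e \<in> L"
  defines "E \<equiv> insert e C"
  shows "orbit_sum (stab E) (\<lambda>g x. g x) {z. same_type C y z} (\<lambda>z. weight E (insert z E)) = weight1 C y"
proof -
  let ?a = "\<lambda>g x :: 's. g x :: 's" and ?D = "{z. same_type C y z}" and ?\<phi> = "\<lambda>z. weight E (insert z E)"
  have E: "fin E" "C \<subseteq> E" using C e by (auto simp: E_def)
  have inv: "invariant (stab E) ?a ?D ?\<phi>"
    unfolding invariant_def
  proof (intro ballI)
    fix g x assume g: "g \<in> stab E" and x: "x \<in> ?D"
    then have "weight (g ` E) (g ` insert x E) = weight E (insert x E)"
      using E(1) by (intro weight_image[OF stab_H[OF g]]) (auto simp: same_type_def)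
    then show "weight E (insert (g x) E) = weight E (insert x E)" using stab_image[OF g] by simp
  qed
  show ?thesis
  proof (cases "same_cut C y e")
    case False
    then obtain c where c: "c \<in> C" "(e = c \<or> e \<prec> c) \<and> c \<prec> y \<or> (e = c \<or> c \<prec> e) \<and> y \<prec> c"
      using not_same_cut[OF C y e] by blast
    have ne: "e \<noteq> y" using c y(2) less_asym less_irrefl by blast
    have side: "(e \<prec> y \<longleftrightarrow> e \<prec> z) \<and> (y \<prec> e \<longleftrightarrow> z \<prec> e)" if z: "same_type C y z" for z
    proof -
      have "(c \<prec> y \<longleftrightarrow> c \<prec> z) \<and> (y \<prec> c \<longleftrightarrow> z \<prec> c)" using z c(1) unfolding same_type_def by blast
      then have "e \<prec> y \<and> e \<prec> z \<or> y \<prec> e \<and> z \<prec> e"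
        using c(2) less_trans[of e c y] less_trans[of e c z] less_trans[of y c e] less_trans[of z c e] by auto
      then show ?thesis using less_asym by blast
    qed
    have D: "?D = {w. same_type E y w}"
      unfolding E_def using side by (auto simp: same_type_def)
    have "orbit_sum (stab E) ?a ?D ?\<phi> = ?\<phi> y"
      using orbit_sum_point[OF E(1) y(1), of ?\<phi>] inv unfolding D by simp
    also have "\<dots> = weight1 E y" using y ne E by (intro weight_one) (auto simp: E_def)
    also have "\<dots> = weight1 C y"
      unfolding weight1_def E_def using lo_hi_insert_far[OF C y(1) e ne c] by simp
    finally show ?thesis .
  next
    case True
    from point_orbits[OF C y e True, folded E_def] obtain y1 y2 where
      y1: "y1 \<in> L" "y1 \<notin> E" "\<sigma> y1 = \<sigma> y" "lo E y1 = lo C y" "hi E y1 = Fin (\<sigma> e)"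
      and y2: "y2 \<in> L" "y2 \<notin> E" "\<sigma> y2 = \<sigma> y" "lo E y2 = Fin (\<sigma> e)" "hi E y2 = hi C y"
      and sum: "\<And>\<phi> :: 's \<Rightarrow> int. invariant (stab E) ?a ?D \<phi> \<Longrightarrow>
        orbit_sum (stab E) ?a ?D \<phi> = \<phi> y1 + \<phi> y2 + (if \<sigma> e = \<sigma> y then \<phi> e else 0)"
      by metis
    have "orbit_sum (stab E) ?a ?D ?\<phi> = weight1 E y1 + weight1 E y2 + (if \<sigma> e = \<sigma> y then 1 else 0)"
      using sum[OF inv] weight_one[OF E(1) y1(1,2)] weight_one[OF E(1) y2(1,2)] by (simp add: E_def)
    then show ?thesis
      unfolding weight1_def y1(3-5) y2(3-5) using eta_split[of "lo C y" "hi C y" "\<sigma> y" "\<sigma> e"] by simp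
  qed
qed

lemma orbit_sum_mult: "orbit_sum U a X (\<lambda>x. c * \<phi> x) = c * orbit_sum U a X \<phi>"
  by (simp add: orbit_sum_def sum_distrib_left)

lemma weight_invariant:
  assumes E: "fin E" and X: "\<And>S. S \<in> X \<Longrightarrow> fin S"
  shows "invariant (stab E) (`) X (\<lambda>S. weight E (E \<union> S))"
  unfolding invariant_def
proof (intro ballI)
  fix g S assume g: "g \<in> stab E" and S: "S \<in> X"
  have "weight (g ` E) (g ` (E \<union> S)) = weight E (E \<union> S)"
    using X[OF S] E by (intro weight_image[OF stab_H[OF g]]) auto
  then show "weight E (E \<union> g ` S) = weight E (E \<union> S)" using stab_image[OF g] by (simp add: image_Un)
qed

text \<open>The general case follows from \<open>point_orbit_sum\<close> by adding the points of \<open>B\<close> one at a time: translates of \<open>insert z B\<close>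
  fiber over translates of \<open>B\<close>, and each fiber is an orbit of points.\<close>

lemma translates_orbit_sum:
  assumes "fin B" "A \<subseteq> B" "e \<in> L"
  shows "orbit_sum (stab (insert e A)) (`) (translates A B) (\<lambda>S. weight (insert e A) (insert e A \<union> S)) = weight A B"
  using assms(1,2)
proof (induction "card (B - A)" arbitrary: B)
  case 0
  then have "B - A = {}" using fin_finite[OF fin_Diff[OF 0(2), of A]] by simp
  then have BA: "B = A" using 0 by blast
  have A: "fin A" using 0 BA by simp
  have E: "fin (insert e A)" "A \<subseteq> insert e A" using A assms(3) by auto
  have T: "translates A A = {A}" unfolding translates_def using stab_image stab_ident[OF fin_line[OF A]] by blast
  have "orb (stab (insert e A)) (`) A = {A}"
    unfolding orb_def using stab_image stab_antimono[OF E(2)] stab_ident[OF fin_line[OF E(1)]] by blast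
  then show ?case unfolding orbit_sum_def BA T by (simp add: insert_absorb sup_absorb1 subset_insertI)
next
  case (Suc n)
  let ?E = "insert e A"
  obtain z where z: "z \<in> B" "z \<notin> A" using Suc.hyps(2) by (metis Diff_iff all_not_in_conv card.empty nat.distinct(1))
  define B' where "B' = B - {z}"
  have B: "B = insert z B'" "z \<notin> B'" "A \<subseteq> B'" using z Suc.prems unfolding B'_def by auto
  have fB': "fin B'" unfolding B'_def by (rule fin_Diff[OF Suc.prems(1)])
  have zL: "z \<in> L" by (rule fin_mem[OF Suc.prems(1) z(1)])
  have A: "fin A" by (rule fin_subset[OF Suc.prems])
  have E: "fin ?E" "A \<subseteq> ?E" using A assms(3) by auto
  have "B - A = insert z (B' - A)" "z \<notin> B' - A" using B z by auto
  then have "n = card (B' - A)" using Suc.hyps(2) fin_finite[OF fin_Diff[OF fB', of A]] by simp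
  then have IH: "orbit_sum (stab ?E) (`) (translates A B') (\<lambda>S. weight ?E (?E \<union> S)) = weight A B'"
    using Suc.hyps(1) fB' B(3) by blast
  note tB = translates_action[OF Suc.prems] and tB' = translates_action[OF fB' B(3)]
  define \<pi> where "\<pi> = subtranslate A B B'"
  have BB: "B' \<subseteq> B" using B(1) by blast
  have pi: "\<pi> (g ` B) = g ` B'" if "g \<in> stab A" for g
    unfolding \<pi>_def by (rule subtranslate_image[OF Suc.prems(1) BB that])
  have piT: "\<pi> S \<in> translates A B'" if "S \<in> translates A B" for S
    unfolding \<pi>_def using subtranslate_equivariant(1)[OF A Suc.prems(1) BB stab_ident[OF fin_line[OF A]] that] .
  have pieq: "\<pi> (g ` S) = g ` \<pi> S" if g: "g \<in> stab ?E" and S: "S \<in> translates A B" for g S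
    unfolding \<pi>_def using g stab_antimono[OF E(2)] by (intro subtranslate_equivariant(2)[OF A Suc.prems(1) BB _ S]) blast
  note sB = smooth_restrict[OF tB(1) E] and sB' = smooth_restrict[OF tB'(1) E]
  have fo: "finite (orb (stab ?E) (`) ` translates A B)" "finite (orb (stab ?E) (`) ` translates A B')"
    by (rule finite_orbits_restrict[OF tB(1) _ E], simp add: tB(4))
      (rule finite_orbits_restrict[OF tB'(1) _ E], simp add: tB'(4))
  let ?\<phi> = "\<lambda>S. weight ?E (?E \<union> S)"
  have inv: "invariant (stab ?E) (`) (translates A B) ?\<phi>"
    by (rule weight_invariant[OF E(1)]) (rule translates_fin[OF Suc.prems(1)])
  have "orbit_sum (stab ?E) (`) (translates A B) ?\<phi> =
    orbit_sum (stab ?E) (`) (translates A B') (\<lambda>y. orbit_sum (stab (pt_supp ?E (`) y)) (`) {x\<in>translates A B. \<pi> x = y} ?\<phi>)"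
    by (rule orbit_sum_fibers[OF sB(1) fo(1) sB'(1) fo(2) piT pieq inv])
  also have "\<dots> = orbit_sum (stab ?E) (`) (translates A B') (\<lambda>S'. weight1 B' z * ?\<phi> S')"
  proof (rule orbit_sum_cong[OF E(1) smooth_acts[OF sB'(1)]])
    fix S' assume S': "S' \<in> translates A B'"
    then obtain g where g: "g \<in> stab A" "S' = g ` B'" unfolding translates_def by blast
    note gH = stab_H[OF g(1)]
    define F where "F = ?E \<union> S'"
    have fS': "fin S'" by (rule translates_fin[OF fB' S'])
    have F: "F = insert e S'" unfolding F_def using translates_sup[OF B(3) S'] by blast
    have fF: "fin F" unfolding F using fS' assms(3) by simp
    have supp: "pt_supp ?E (`) S' = F" unfolding F_def using sB'(2)[OF S'] tB'(2)[OF S'] by simp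
    have gz: "g z \<in> L" "g z \<notin> S'"
      using zL gH B(2) H_eq_iff[OF gH zL fin_mem[OF fB']] unfolding g(2) by auto
    let ?D = "{y. same_type S' (g z) y}" and ?Fib = "{x\<in>translates A B. \<pi> x = S'}"
    have nS: "y \<notin> S'" if "y \<in> ?D" for y
    proof
      assume y: "y \<in> S'"
      then have "\<not> y \<prec> g z" "\<not> g z \<prec> y" using that unfolding same_type_def by auto
      then show False using less_total[OF fin_mem[OF fS' y] gz(1)] gz(2) y by blast
    qed
    have bij: "bij_betw (\<lambda>y. insert y S') ?D ?Fib"
    proof (rule bij_betw_imageI)
      show "inj_on (\<lambda>y. insert y S') ?D" using nS by (intro inj_onI) blast
      show "(\<lambda>y. insert y S') ` ?D = ?Fib"
      proof (intro equalityI subsetI)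
        fix S assume "S \<in> (\<lambda>y. insert y S') ` ?D"
        then obtain y where y: "same_type S' (g z) y" "S = insert y S'" by blast
        from move_point[OF fS' gz(1) y(1)] obtain k where k: "k \<in> stab S'" "k (g z) = y" by blast
        have kA: "k \<in> stab A" using k(1) stab_antimono[OF translates_sup[OF B(3) S']] by blast
        have kg: "cmp k g \<in> stab A" by (rule stab_comp[OF fin_line[OF A] kA g(1)])
        have "cmp k g ` B' = S'" using stab_image[OF k(1)] g(2) fin_line[OF fB'] by simp
        moreover have "cmp k g ` B = insert y (cmp k g ` B')" using B(1) k(2) zL by simp
        ultimately have "S = cmp k g ` B" "\<pi> S = S'" using y(2) pi[OF kg] by simp_all
        then show "S \<in> ?Fib" using kg unfolding translates_def by blast
      next
        fix S assume "S \<in> ?Fib"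
        then obtain h where h: "h \<in> stab A" "S = h ` B" "h ` B' = S'" unfolding translates_def using pi by auto
        note hH = stab_H[OF h(1)]
        have hb: "h b = g b" if "b \<in> B'" for b
          using image_rigid[OF fB' hH gH _ that] h(3) g(2) by simp
        have "same_type S' (g z) (h z)"
          unfolding same_type_def g(2)
        proof (intro conjI ballI)
          fix a assume "a \<in> g ` B'"
          then obtain b where b: "b \<in> B'" "a = g b" by blast
          have bL: "b \<in> L" by (rule fin_mem[OF fB' b(1)])
          show "a \<prec> g z \<longleftrightarrow> a \<prec> h z" "g z \<prec> a \<longleftrightarrow> h z \<prec> a"
            using H_less_iff[OF gH bL zL] H_less_iff[OF hH bL zL] H_less_iff[OF gH zL bL] H_less_iff[OF hH zL bL]
              hb[OF b(1)] b(2) by simp_all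
        qed (use zL gH hH in simp_all)
        moreover have "S = insert (h z) S'" using h(2,3) B(1) by simp
        ultimately show "S \<in> (\<lambda>y. insert y S') ` ?D" by blast
      qed
    qed
    have acF: "acts (stab F) ?Fib (`)"
    proof -
      have sub: "stab F \<subseteq> stab ?E" "stab F \<subseteq> stab S'" 
      proof -
        have "?E \<subseteq> F" "S' \<subseteq> F" by (auto simp: F_def)
        then show "stab F \<subseteq> stab ?E" "stab F \<subseteq> stab S'"
          using stab_antimono[of ?E F] stab_antimono[of S' F] by simp_all
      qed
      show ?thesis
        unfolding acts_def
      proof (intro conjI ballI)
        fix S assume S: "S \<in> ?Fib"
        then have ST: "S \<in> translates A B" and pS: "\<pi> S = S'" by auto
        show "ident ` S = S" using acts_ident[OF smooth_acts[OF sB(1)] ST] .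
        fix k assume k: "k \<in> stab F"
        then have k': "k \<in> stab ?E" "k \<in> stab S'" using sub by auto
        show "k ` S \<in> ?Fib"
          using acts_closed[OF smooth_acts[OF sB(1)] k'(1) ST] pieq[OF k'(1) ST] pS stab_image[OF k'(2)] by simp
        fix l assume l: "l \<in> stab F"
        then have l': "l \<in> stab ?E" using sub by auto
        show "cmp k l ` S = k ` l ` S" by (rule acts_comp[OF smooth_acts[OF sB(1)] k'(1) l' ST])
      qed
    qed
    have val: "weight ?E F * weight F (insert y F) = ?\<phi> (insert y S')" if "y \<in> ?D" for y
    proof -
      have "y \<in> L" using that by (simp add: same_type_def)
      then have "weight ?E (insert y F) = weight ?E F * weight F (insert y F)"
        using fF by (intro weight_trans) (auto simp: F_def)
      moreover have "insert y F = ?E \<union> insert y S'" unfolding F_def by blast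
      ultimately show ?thesis by simp
    qed
    have "orbit_sum (stab F) (\<lambda>g x. g x) ?D (\<lambda>y. weight ?E F * weight F (insert y F)) = orbit_sum (stab F) (`) ?Fib ?\<phi>"
    proof (rule orbit_sum_iso[OF fF _ acF bij])
      show "acts (stab F) ?D (\<lambda>g x. g x)" by (rule acts_points[OF fS' _ fF gz(1)]) (auto simp: F)
      show "insert (k y) S' = k ` insert y S'" if "k \<in> stab F" "y \<in> ?D" for k y
      proof -
        have "k \<in> stab S'" using that(1) stab_antimono[of S' F] unfolding F_def by auto
        then show ?thesis using stab_image by simp
      qed
      show "invariant (stab F) (`) ?Fib ?\<phi>"
        using inv stab_antimono[of ?E F] unfolding invariant_def F_def by blast
    qed (use val in blast)
    moreover have "orbit_sum (stab F) (\<lambda>g x. g x) ?D (\<lambda>y. weight F (insert y F)) = weight1 S' (g z)"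
      unfolding F by (rule point_orbit_sum[OF fS' gz assms(3)])
    moreover have "weight1 S' (g z) = weight1 B' z"
      unfolding weight1_def g(2) using lo_hi_image[OF gH fB' zL] H_color[OF gH zL] by simp
    ultimately show "orbit_sum (stab (pt_supp ?E (`) S')) (`) ?Fib ?\<phi> = weight1 B' z * ?\<phi> S'"
      unfolding supp orbit_sum_mult F_def by (simp add: mult.commute)
  qed
  also have "\<dots> = weight1 B' z * weight A B'" unfolding orbit_sum_mult IH ..
  also have "\<dots> = weight A B"
  proof -
    have "B' \<subseteq> B" using B(1) by blast
    from weight_trans[OF Suc.prems(1) B(3) this] show ?thesis
      using weight_one[OF fB' zL B(2)] B(1) by (simp add: mult.commute)
  qed
  finally show ?case .
qed

definition total :: "'s set \<Rightarrow> 'x set \<Rightarrow> (('s \<Rightarrow> 's) \<Rightarrow> 'x \<Rightarrow> 'x) \<Rightarrow> int" where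
  "total A X a = orbit_sum (stab A) a X (\<lambda>x. weight A (pt_supp A a x))"

lemma pt_weight_invariant:
  assumes s: "smooth A X a" shows "invariant (stab A) a X (\<lambda>x. weight A (pt_supp A a x))"
  unfolding invariant_def
proof (intro ballI)
  fix g x assume g: "g \<in> stab A" and x: "x \<in> X"
  show "weight A (pt_supp A a (a g x)) = weight A (pt_supp A a x)"
    using pt_supp_act[OF s x g] weight_image[OF stab_H[OF g] pt_supp_props(1,3)[OF s x]] stab_image[OF g] by simp
qed

text \<open>Each orbit of \<open>stab A\<close> is a set of translates, for which this is \<open>translates_orbit_sum\<close>.\<close>

lemma total_insert:
  assumes s: "smooth A X a" and f: "finite (orb (stab A) a ` X)" and e: "e \<in> L"
  shows "total (insert e A) X a = total A X a"
proof -
  let ?E = "insert e A"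
  note A = smooth_fin[OF s] and ac = smooth_acts[OF s]
  have E: "fin ?E" "A \<subseteq> ?E" using A e by auto
  note sE = smooth_restrict[OF s E]
  have "total ?E X a = (\<Sum>Q\<in>orb (stab A) a ` X. orbit_sum (stab ?E) a Q (\<lambda>x. weight ?E (pt_supp ?E a x)))"
    unfolding total_def by (rule orbit_sum_refine[OF s f E])
  also have "\<dots> = (\<Sum>Q\<in>orb (stab A) a ` X. weight A (pt_supp A a (SOME x. x \<in> Q)))"
  proof (rule sum.cong[OF refl])
    fix Q assume "Q \<in> orb (stab A) a ` X"
    then obtain x where x: "x \<in> X" "Q = orb (stab A) a x" by blast
    let ?B = "pt_supp A a x"
    note B = pt_supp_props[OF s x(1)] and iso = transitive_iso_translates[OF s x(1)]
    have QX: "Q \<subseteq> X" using x orb_subset[OF ac x(1)] by simp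
    have "orbit_sum (stab ?E) a Q (\<lambda>x. weight ?E (pt_supp ?E a x)) =
      orbit_sum (stab ?E) (`) (translates A ?B) (\<lambda>S. weight ?E (?E \<union> S))"
      unfolding x(2)
    proof (rule orbit_sum_iso[OF E(1) _ _ iso(1)])
      show "acts (stab ?E) (orb (stab A) a x) a" by (rule smooth_acts[OF smooth_restrict(1)[OF iso(2) E]])
      show "acts (stab ?E) (translates A ?B) (`)"
        by (rule smooth_acts[OF smooth_restrict(1)[OF translates_action(1)[OF B(1,3)] E]])
      show "pt_supp A a (a g y) = g ` pt_supp A a y" if "g \<in> stab ?E" "y \<in> orb (stab A) a x" for g y
        using pt_supp_act[OF s] that QX x(2) stab_antimono[OF E(2)] by blast
      show "invariant (stab ?E) (`) (translates A ?B) (\<lambda>S. weight ?E (?E \<union> S))"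
        by (rule weight_invariant[OF E(1)]) (rule translates_fin[OF B(1)])
      show "weight ?E (pt_supp ?E a y) = weight ?E (?E \<union> pt_supp A a y)" if "y \<in> orb (stab A) a x" for y
        using sE(2)[of y] that QX x(2) by auto
    qed
    also have "\<dots> = weight A ?B" by (rule translates_orbit_sum[OF B(1,3) e])
    also have "\<dots> = weight A (pt_supp A a (SOME x. x \<in> Q))"
      using invariant_rep[OF A ac x(1) pt_weight_invariant[OF s]] x(2) by simp
    finally show "orbit_sum (stab ?E) a Q (\<lambda>x. weight ?E (pt_supp ?E a x)) = weight A (pt_supp A a (SOME x. x \<in> Q))" .
  qed
  also have "\<dots> = total A X a" by (simp add: total_def orbit_sum_def)
  finally show ?thesis .
qed

lemma total_restrict:
  assumes s: "smooth A X a" and f: "finite (orb (stab A) a ` X)" and E: "fin E" "A \<subseteq> E"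
  shows "total E X a = total A X a"
proof -
  have "finite F \<Longrightarrow> F \<subseteq> L \<Longrightarrow> total (A \<union> F) X a = total A X a" for F
  proof (induction rule: finite_induct)
    case (insert e F)
    have AF: "fin (A \<union> F)" "A \<subseteq> A \<union> F" using smooth_fin[OF s] insert by (auto simp: fin_def)
    have "total (insert e (A \<union> F)) X a = total (A \<union> F) X a"
      using insert.prems by (intro total_insert[OF smooth_restrict(1)[OF s AF] finite_orbits_restrict[OF s f AF]]) simp
    then show ?case using insert by simp
  qed simp
  from this[of "E - A"] show ?thesis using E fin_finite[OF fin_Diff[OF E(1)]] fin_line[OF E(1)] by (auto simp: Un_absorb1)
qed

end

section \<open>Operations on finitary sets\<close>

context colored_line
begin

text \<open>A finitary hat-set over the open subgroup \<open>stab A\<close>, with no condition on the values of the action outside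
  the set of points.\<close>

definition hat :: "'s set \<Rightarrow> ('s, 'x) gset \<Rightarrow> bool" where
  "hat A X \<longleftrightarrow> defgrp X = stab A \<and> smooth A (pts X) (act X) \<and> finite (orb (stab A) (act X) ` pts X)"

lemma hatD: "hat A X \<Longrightarrow> defgrp X = stab A" "hat A X \<Longrightarrow> smooth A (pts X) (act X)"
  "hat A X \<Longrightarrow> finite (orb (stab A) (act X) ` pts X)" "hat A X \<Longrightarrow> fin A"
  by (simp_all add: hat_def smooth_def)

lemma finitary_hat:
  "finitary_gset L H X \<longleftrightarrow> (\<exists>A. hat A X \<and> (\<forall>g\<in>stab A. act X g \<in> extensional (pts X)))"
  unfolding finitary_iff hat_def by blast

lemma finitaryI: "hat A X \<Longrightarrow> (\<And>g. g \<in> stab A \<Longrightarrow> act X g \<in> extensional (pts X)) \<Longrightarrow> finitary_gset L H X"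
  unfolding finitary_hat by blast

lemma finitaryE:
  assumes "finitary_gset L H X"
  obtains A where "hat A X" "\<And>g. g \<in> stab A \<Longrightarrow> act X g \<in> extensional (pts X)"
  using assms unfolding finitary_hat by blast

lemma hat_one: "hat {} (gset_one L H)"
proof -
  have "smooth {} {()} (\<lambda>g x. x)"
    unfolding smooth_def acts_def point_stab_def by (intro conjI ballI exI[of _ "{}"]) simp_all
  then show ?thesis by (simp add: hat_def gset_one_def)
qed

lemma finitary_one: "finitary_gset L H (gset_one L H)"
  by (rule finitaryI[OF hat_one]) (simp add: gset_one_def extensional_def)

subsection \<open>Conjugation\<close>

definition conj_by :: "('s \<Rightarrow> 's) \<Rightarrow> ('s \<Rightarrow> 's) \<Rightarrow> 's \<Rightarrow> 's" where
  "conj_by g h = cmp (cmp (inverse_aut g) h) g"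

lemma conj_by_stab:
  assumes "g \<in> H" "fin B" "h \<in> H" shows "conj_by g h \<in> stab B \<longleftrightarrow> h \<in> stab (g ` B)"
  unfolding conj_by_def using conj_stab_iff[OF assms] comp_assoc[of "inverse_aut g" h g] assms by simp

lemma conj_by_onto:
  assumes "g \<in> H" "u \<in> H"
  shows "cmp (cmp g u) (inverse_aut g) \<in> H" "conj_by g (cmp (cmp g u) (inverse_aut g)) = u"
  unfolding conj_by_def using assms by (simp, intro H_eqI) simp_all

lemma conj_by_back:
  assumes "g \<in> H" "h \<in> H" shows "conj_by g h \<in> H" "cmp (cmp g (conj_by g h)) (inverse_aut g) = h"
  unfolding conj_by_def using assms by (simp, intro H_eqI) simp_all

lemma conj_by_comp:
  assumes "g \<in> H" "h \<in> H" "k \<in> H" shows "conj_by g (cmp h k) = cmp (conj_by g h) (conj_by g k)"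
  unfolding conj_by_def using assms by (intro H_eqI) simp_all

lemma smooth_conj:
  assumes s: "smooth A X a" and g: "g \<in> H" and a': "\<And>h. h \<in> stab (g ` A) \<Longrightarrow> a' h = a (conj_by g h)"
  shows "smooth (g ` A) X a'" and "x \<in> X \<Longrightarrow> pt_supp (g ` A) a' x = g ` pt_supp A a x"
    and "orb (stab (g ` A)) a' x = orb (stab A) a x"
proof -
  note A = smooth_fin[OF s] and ac = smooth_acts[OF s]
  have gA: "fin (g ` A)" using A g by simp
  have k: "conj_by g h \<in> stab A" if "h \<in> stab (g ` A)" for h
    using conj_by_stab[OF g A stab_H[OF that]] that by simp
  have "acts (stab (g ` A)) X a'"
    unfolding acts_def
  proof (intro conjI ballI)
    fix x assume x: "x \<in> X"
    have "conj_by g ident = ident" unfolding conj_by_def using g by simp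
    then show "a' ident x = x" using a'[OF stab_ident[OF fin_line[OF gA]]] acts_ident[OF ac x] by simp
    fix h assume h: "h \<in> stab (g ` A)"
    show "a' h x \<in> X" using a'[OF h] acts_closed[OF ac k[OF h] x] by simp
    fix h' assume h': "h' \<in> stab (g ` A)"
    show "a' (cmp h h') x = a' h (a' h' x)"
      using a'[OF stab_comp[OF fin_line[OF gA] h h']] a'[OF h] a'[OF h']
        conj_by_comp[OF g stab_H[OF h] stab_H[OF h']] acts_comp[OF ac k[OF h] k[OF h'] x] by simp
  qed
  moreover have ps: "point_stab (stab (g ` A)) a' x = stab (g ` pt_supp A a x)" if x: "x \<in> X" for x
  proof (intro equalityI subsetI)
    note B = pt_supp_props[OF s x]
    fix h assume "h \<in> point_stab (stab (g ` A)) a' x"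
    then have h: "h \<in> stab (g ` A)" "a (conj_by g h) x = x" using a' unfolding point_stab_def by auto
    then have "conj_by g h \<in> stab (pt_supp A a x)" using k[OF h(1)] unfolding B(2)[symmetric] point_stab_def by simp
    then show "h \<in> stab (g ` pt_supp A a x)" using conj_by_stab[OF g B(1) stab_H[OF h(1)]] by simp
  next
    note B = pt_supp_props[OF s x]
    fix h assume h: "h \<in> stab (g ` pt_supp A a x)"
    then have "conj_by g h \<in> stab (pt_supp A a x)" using conj_by_stab[OF g B(1) stab_H[OF h]] by simp
    then have "a (conj_by g h) x = x" unfolding B(2)[symmetric] point_stab_def by simp
    moreover have "h \<in> stab (g ` A)" using h stab_antimono[OF image_mono[OF B(3)]] by blast
    ultimately show "h \<in> point_stab (stab (g ` A)) a' x" using a' unfolding point_stab_def by simp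
  qed
  moreover have f: "fin (g ` pt_supp A a x)" if "x \<in> X" for x using pt_supp_props(1)[OF s that] g by simp
  ultimately show "smooth (g ` A) X a'" using gA unfolding smooth_def by blast
  show "x \<in> X \<Longrightarrow> pt_supp (g ` A) a' x = g ` pt_supp A a x" by (rule pt_suppI[OF f ps])
  show "orb (stab (g ` A)) a' x = orb (stab A) a x"
  proof (intro equalityI subsetI)
    fix y assume "y \<in> orb (stab (g ` A)) a' x"
    then obtain h where "h \<in> stab (g ` A)" "y = a' h x" unfolding orb_def by blast
    then show "y \<in> orb (stab A) a x" using k a' unfolding orb_def by simp
  next
    fix y assume "y \<in> orb (stab A) a x"
    then obtain u where u: "u \<in> stab A" "y = a u x" unfolding orb_def by blast
    let ?h = "cmp (cmp g u) (inverse_aut g)"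
    have uH: "u \<in> H" by (rule stab_H[OF u(1)])
    have "?h \<in> stab (g ` A)" using conj_by_stab[OF g A conj_by_onto(1)[OF g uH]] conj_by_onto(2)[OF g uH] u(1) by simp
    then show "y \<in> orb (stab (g ` A)) a' x" using a' conj_by_onto(2)[OF g uH] u(2) unfolding orb_def by force
  qed
qed

lemma gset_conj_simps:
  assumes X: "hat A X" and g: "g \<in> H"
  shows "pts (gset_conj L H g X) = pts X" "defgrp (gset_conj L H g X) = stab (g ` A)"
    "h \<in> H \<Longrightarrow> act (gset_conj L H g X) h = act X (conj_by g h)"
proof -
  note A = hatD(4)[OF X]
  show "pts (gset_conj L H g X) = pts X" by (simp add: gset_conj_def Let_def)
  show "h \<in> H \<Longrightarrow> act (gset_conj L H g X) h = act X (conj_by g h)"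
    using g by (simp add: gset_conj_def Let_def conj_by_def)
  have "defgrp (gset_conj L H g X) = (\<lambda>u. cmp (cmp g u) (inverse_aut g)) ` stab A"
    using g stab_H[of _ A] by (simp add: gset_conj_def Let_def hatD(1)[OF X] cong: image_cong)
  also have "\<dots> = stab (g ` A)"
  proof (intro equalityI subsetI)
    fix h assume "h \<in> (\<lambda>u. cmp (cmp g u) (inverse_aut g)) ` stab A"
    then obtain u where u: "u \<in> stab A" "h = cmp (cmp g u) (inverse_aut g)" by blast
    have uH: "u \<in> H" by (rule stab_H[OF u(1)])
    show "h \<in> stab (g ` A)" using conj_by_stab[OF g A conj_by_onto(1)[OF g uH]] conj_by_onto(2)[OF g uH] u by simp
  next
    fix h assume h: "h \<in> stab (g ` A)"
    have hH: "h \<in> H" by (rule stab_H[OF h])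
    have "conj_by g h \<in> stab A" using conj_by_stab[OF g A hH] h by simp
    then show "h \<in> (\<lambda>u. cmp (cmp g u) (inverse_aut g)) ` stab A" using conj_by_back(2)[OF g hH] by (metis imageI)
  qed
  finally show "defgrp (gset_conj L H g X) = stab (g ` A)" .
qed

lemma hat_conj:
  assumes X: "hat A X" and g: "g \<in> H"
  shows "hat (g ` A) (gset_conj L H g X)"
    and "x \<in> pts X \<Longrightarrow> pt_supp (g ` A) (act (gset_conj L H g X)) x = g ` pt_supp A (act X) x"
    and "orb (stab (g ` A)) (act (gset_conj L H g X)) x = orb (stab A) (act X) x"
proof -
  note c = gset_conj_simps[OF X g]
  have a': "act (gset_conj L H g X) h = act X (conj_by g h)" if "h \<in> stab (g ` A)" for h
    by (rule c(3)[OF stab_H[OF that]])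
  note s = smooth_conj[OF hatD(2)[OF X] g a']
  have "orb (stab (g ` A)) (act (gset_conj L H g X)) = orb (stab A) (act X)" by (rule ext) (rule s(3))
  then show "hat (g ` A) (gset_conj L H g X)" unfolding hat_def c(1,2) using s(1) hatD(3)[OF X] by simp
  show "x \<in> pts X \<Longrightarrow> pt_supp (g ` A) (act (gset_conj L H g X)) x = g ` pt_supp A (act X) x" by (rule s(2))
  show "orb (stab (g ` A)) (act (gset_conj L H g X)) x = orb (stab A) (act X) x" by (rule s(3))
qed

lemma finitary_conj:
  assumes X: "finitary_gset L H X" and g: "g \<in> H" shows "finitary_gset L H (gset_conj L H g X)"
proof -
  obtain A where A: "hat A X" "\<And>h. h \<in> stab A \<Longrightarrow> act X h \<in> extensional (pts X)" using finitaryE[OF X] by blast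
  show ?thesis
  proof (rule finitaryI[OF hat_conj(1)[OF A(1) g]])
    fix h assume h: "h \<in> stab (g ` A)"
    have "conj_by g h \<in> stab A" using conj_by_stab[OF g hatD(4)[OF A(1)] stab_H[OF h]] h by simp
    then show "act (gset_conj L H g X) h \<in> extensional (pts (gset_conj L H g X))"
      using A(2) gset_conj_simps(1,3)[OF A(1) g] stab_H[OF h] by simp
  qed
qed

subsection \<open>Disjoint unions\<close>

lemma hat_coprod:
  assumes X: "hat A X" and Y: "hat B Y"
  shows "hat (A \<union> B) (gset_coprod X Y)"
    and "g \<in> stab (A \<union> B) \<Longrightarrow> x \<in> pts X \<Longrightarrow> Inl (act X g x) = act (gset_coprod X Y) g (Inl x)"
    and "g \<in> stab (A \<union> B) \<Longrightarrow> y \<in> pts Y \<Longrightarrow> Inr (act Y g y) = act (gset_coprod X Y) g (Inr y)"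
proof -
  let ?c = "act (gset_coprod X Y)" and ?E = "A \<union> B"
  have E: "fin ?E" "A \<subseteq> ?E" "B \<subseteq> ?E" using hatD(4)[OF X] hatD(4)[OF Y] by auto
  show eX: "Inl (act X g x) = ?c g (Inl x)" if "x \<in> pts X" for g x using that InlI[OF that, of "pts Y"] by (simp add: gset_coprod_def)
  show eY: "Inr (act Y g y) = ?c g (Inr y)" if "y \<in> pts Y" for g y using that InrI[OF that, of "pts X"] by (simp add: gset_coprod_def)
  have bX: "bij_betw Inl (pts X) (Inl ` pts X)" and bY: "bij_betw Inr (pts Y) (Inr ` pts Y)"
    by (auto simp: bij_betw_def)
  note sX = smooth_restrict(1)[OF hatD(2)[OF X] E(1,2)] and sY = smooth_restrict(1)[OF hatD(2)[OF Y] E(1,3)]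
  note fX = finite_orbits_restrict[OF hatD(2,3)[OF X] E(1,2)] and fY = finite_orbits_restrict[OF hatD(2,3)[OF Y] E(1,3)]
  have tX: "smooth ?E (Inl ` pts X) ?c" "finite (orb (stab ?E) ?c ` Inl ` pts X)"
    using smooth_transfer(1,3)[OF sX bX, of ?c] eX fX by simp_all
  have tY: "smooth ?E (Inr ` pts Y) ?c" "finite (orb (stab ?E) ?c ` Inr ` pts Y)"
    using smooth_transfer(1,3)[OF sY bY, of ?c] eY fY by simp_all
  have "pts (gset_coprod X Y) = Inl ` pts X \<union> Inr ` pts Y" by (simp add: gset_coprod_def Plus_def)
  moreover have "defgrp (gset_coprod X Y) = stab ?E"
    by (simp add: gset_coprod_def stab_Un hatD(1)[OF X] hatD(1)[OF Y])
  ultimately show "hat ?E (gset_coprod X Y)"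
    unfolding hat_def using smooth_Un[OF tX(1) tY(1)] tX(2) tY(2) by (simp add: image_Un)
qed

lemma finitary_coprod:
  assumes X: "finitary_gset L H X" and Y: "finitary_gset L H Y" shows "finitary_gset L H (gset_coprod X Y)"
proof -
  obtain A B where "hat A X" "hat B Y" using finitaryE[OF X] finitaryE[OF Y] by metis
  from hat_coprod(1)[OF this] show ?thesis by (rule finitaryI) (simp add: gset_coprod_def)
qed

subsection \<open>Fibers\<close>

lemma transitiveD:
  assumes "transitive_gset L H U X"
  obtains A where "U = stab A" "hat A X" "\<And>x. x \<in> pts X \<Longrightarrow> orb (stab A) (act X) x = pts X" "pts X \<noteq> {}"
    "finitary_gset L H X"
proof -
  have f: "finitary_gset L H X" and U: "defgrp X = U" and ne: "pts X \<noteq> {}"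
    and t: "transitive_action (perm_group L U) (pts X) (act X)"
    using assms by (auto simp: transitive_gset_def)
  obtain A where A: "hat A X" using finitaryE[OF f] by blast
  have UA: "U = stab A" using hatD(1)[OF A] U by simp
  have "orb (stab A) (act X) x = pts X" if x: "x \<in> pts X" for x
  proof (intro equalityI subsetI)
    show "y \<in> pts X" if "y \<in> orb (stab A) (act X) x" for y
      using that orb_subset[OF smooth_acts[OF hatD(2)[OF A]] x] by blast
    show "y \<in> orb (stab A) (act X) x" if y: "y \<in> pts X" for y
    proof -
      obtain g where "g \<in> carrier (perm_group L U)" "act X g x = y"
        using transitive_action.unique_orbit[OF t x y] by blast
      then show ?thesis unfolding orb_def UA perm_group_simps by blast
    qed
  qed
  then show ?thesis using that UA A ne f by blast
qed

text \<open>The fiber over \<open>y\<close> is a single orbit of the stabilizer of \<open>y\<close>: two points of the fiber differ by an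
  element of the group, which then fixes \<open>y\<close>.\<close>

lemma hat_fiber:
  assumes X: "hat A X" and oX: "\<And>x. x \<in> pts X \<Longrightarrow> orb (stab A) (act X) x = pts X"
    and Y: "hat A Y" and f: "gset_map (stab A) f X Y" and y: "y \<in> pts Y"
  defines "C \<equiv> pt_supp A (act Y) y" and "F \<equiv> gset_fiber L f X Y y"
  shows "hat C F" and "x \<in> pts F \<Longrightarrow> orb (stab C) (act F) x = pts F"
    and "x \<in> pts F \<Longrightarrow> pt_supp C (act F) x = pt_supp A (act X) x"
    and "x \<in> pts F \<Longrightarrow> C \<subseteq> pt_supp A (act X) x"
proof -
  note sX = hatD(2)[OF X] and sY = hatD(2)[OF Y]
  note Cp = pt_supp_props[OF sY y, folded C_def]
  let ?Fib = "{x \<in> pts X. f x = y}"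
  have pF: "pts F = ?Fib" and aF: "act F = (\<lambda>g. restrict (act X g) ?Fib)" and dF: "defgrp F = stab C"
    using Cp(2) hatD(1)[OF Y] by (simp_all add: F_def gset_fiber_def)
  have fe: "f (act X g x) = act Y g (f x)" if "g \<in> stab A" "x \<in> pts X" for g x
    using f that unfolding gset_map_def by blast
  have Cfix: "g \<in> stab C \<longleftrightarrow> g \<in> stab A \<and> act Y g y = y" for g using Cp(2) unfolding point_stab_def by blast
  have sFib: "smooth C ?Fib (act X)"
  proof (rule smooth_subset[OF smooth_restrict(1)[OF sX Cp(1,3)]])
    fix g x assume g: "g \<in> stab C" and x: "x \<in> ?Fib"
    then show "act X g x \<in> ?Fib" using fe Cfix acts_closed[OF smooth_acts[OF sX]] by simp
  qed blast
  have rest: "id (act X g x) = act F g (id x)" if "g \<in> stab C" "x \<in> ?Fib" for g x using that by (simp add: aF)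
  have tF: "smooth C ?Fib (act F)" "x \<in> ?Fib \<Longrightarrow> pt_supp C (act F) x = pt_supp C (act X) x" for x
    using smooth_transfer(1)[OF sFib bij_betw_id, where b = "act F"]
      smooth_transfer(2)[OF sFib bij_betw_id, where b = "act F" and x = x] rest by simp_all
  have sF: "smooth C (pts F) (act F)" using tF(1) pF by simp
  have supp: "C \<subseteq> pt_supp A (act X) x" "pt_supp C (act F) x = pt_supp A (act X) x" if x: "x \<in> ?Fib" for x
  proof -
    have xX: "x \<in> pts X" and fx: "f x = y" using x by auto
    note B = pt_supp_props[OF sX xX]
    have "stab (pt_supp A (act X) x) \<subseteq> stab C"
    proof
      fix g assume "g \<in> stab (pt_supp A (act X) x)"
      then have g: "g \<in> stab A" "act X g x = x" unfolding B(2)[symmetric] point_stab_def by auto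
      then show "g \<in> stab C" using Cfix fe[OF g(1) xX] fx by simp
    qed
    then show sub: "C \<subseteq> pt_supp A (act X) x" using stab_le_iff[OF Cp(1) B(1)] by simp
    have "pt_supp C (act X) x = C \<union> pt_supp A (act X) x" by (rule smooth_restrict(2)[OF sX Cp(1,3) xX])
    then show "pt_supp C (act F) x = pt_supp A (act X) x" using tF(2)[OF x] sub by auto
  qed
  have o: "orb (stab C) (act F) x = pts F" if x: "x \<in> pts F" for x
  proof (intro equalityI subsetI)
    fix z assume z: "z \<in> pts F"
    then have zx: "z \<in> pts X" "f z = y" "x \<in> pts X" "f x = y" using x pF by auto
    then have "z \<in> orb (stab A) (act X) x" using oX by simp
    then obtain g where g: "g \<in> stab A" "z = act X g x" unfolding orb_def by blast
    then have "g \<in> stab C" using Cfix fe[OF g(1) zx(3)] zx by simp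
    moreover have "act F g x = z" using x pF g(2) by (simp add: aF)
    ultimately show "z \<in> orb (stab C) (act F) x" unfolding orb_def by blast
  qed (use orb_subset[OF smooth_acts[OF sF] x] in blast)
  have "orb (stab C) (act F) ` pts F \<subseteq> {pts F}" using o by blast
  then have "finite (orb (stab C) (act F) ` pts F)" by (rule finite_subset) simp
  then show "hat C F" unfolding hat_def using sF dF by simp
  show "x \<in> pts F \<Longrightarrow> orb (stab C) (act F) x = pts F" by (rule o)
  show "x \<in> pts F \<Longrightarrow> pt_supp C (act F) x = pt_supp A (act X) x" "x \<in> pts F \<Longrightarrow> C \<subseteq> pt_supp A (act X) x"
    using supp pF by simp_all
qed

lemma map_surj:
  assumes X: "hat A X" "pts X \<noteq> {}" and Y: "hat A Y" "\<And>y. y \<in> pts Y \<Longrightarrow> orb (stab A) (act Y) y = pts Y"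
    and f: "gset_map (stab A) f X Y" and y: "y \<in> pts Y"
  shows "\<exists>x\<in>pts X. f x = y"
proof -
  obtain x where x: "x \<in> pts X" using X(2) by blast
  then have fx: "f x \<in> pts Y" using f unfolding gset_map_def by blast
  then obtain g where g: "g \<in> stab A" "y = act Y g (f x)" using Y(2)[OF fx] y unfolding orb_def by blast
  then have "f (act X g x) = y" using f x unfolding gset_map_def by blast
  then show ?thesis using acts_closed[OF smooth_acts[OF hatD(2)[OF X(1)]] g(1) x] by blast
qed

lemma finitary_fiber:
  assumes "transitive_gset L H U X" "transitive_gset L H U Y" "gset_map U f X Y" "y \<in> pts Y"
  shows "finitary_gset L H (gset_fiber L f X Y y)"
proof -
  obtain A where A: "U = stab A" "hat A X" "\<And>x. x \<in> pts X \<Longrightarrow> orb (stab A) (act X) x = pts X"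
    using transitiveD[OF assms(1)] by metis
  obtain B where B: "U = stab B" "hat B Y" using transitiveD[OF assms(2)] by metis
  have "B = A" using A(1) B(1) stab_eq_iff[OF hatD(4)[OF A(2)] hatD(4)[OF B(2)]] by simp
  then have Y: "hat A Y" using B(2) by simp
  have f: "gset_map (stab A) f X Y" using assms(3) A(1) by simp
  show ?thesis
    by (rule finitaryI[OF hat_fiber(1)[OF A(2,3) Y f assms(4)]]) (simp_all add: gset_fiber_def)
qed

subsection \<open>Tuples in an interval\<close>

lemma ends_fin: "interval_ends cyc p l r \<Longrightarrow> fin {x. Fin x \<in> {l, r}}"
proof -
  assume i: "interval_ends cyc p l r"
  have "{x. Fin x \<in> {l, r}} \<subseteq> (case l of Fin x \<Rightarrow> {x} | _ \<Rightarrow> {}) \<union> (case r of Fin x \<Rightarrow> {x} | _ \<Rightarrow> {})"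
    by (auto split: extended.splits)
  then have "finite {x. Fin x \<in> {l, r}}" by (rule finite_subset) (auto split: extended.splits)
  then show ?thesis using i unfolding fin_def interval_ends_def by auto
qed

lemma interval_iff:
  assumes i: "interval_ends cyc p l r"
  shows "z \<in> line_interval cyc p l r \<longleftrightarrow> z \<in> L \<and> (\<forall>u. l = Fin u \<longrightarrow> u \<prec> z) \<and> (\<forall>u. r = Fin u \<longrightarrow> z \<prec> u)"
proof -
  have "ext_less cyc p l (Fin z) \<longleftrightarrow> (\<forall>u. l = Fin u \<longrightarrow> u \<prec> z)" using i by (cases l) (auto simp: interval_ends_def)
  moreover have "ext_less cyc p (Fin z) r \<longleftrightarrow> (\<forall>u. r = Fin u \<longrightarrow> z \<prec> u)" using i by (cases r) (auto simp: interval_ends_def)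
  ultimately show ?thesis unfolding line_interval_def by simp
qed

lemma interval_lo_hi:
  assumes i: "interval_ends cyc p l r" and z: "z \<in> line_interval cyc p l r"
  defines "B \<equiv> {x. Fin x \<in> {l, r}}"
  shows "lo B z = map_extended \<sigma> l" "hi B z = map_extended \<sigma> r" "z \<notin> B" "z \<in> L"
    and "z' \<in> line_interval cyc p l r \<Longrightarrow> same_cut B z z'"
proof -
  have lz: "\<And>u. l = Fin u \<Longrightarrow> u \<prec> z" and zr: "\<And>u. r = Fin u \<Longrightarrow> z \<prec> u" and zL: "z \<in> L"
    using z unfolding interval_iff[OF i] by auto
  have l: "{a\<in>B. a \<prec> z} = {a. l = Fin a}" unfolding B_def using lz zr less_asym by fastforce
  have r: "{a\<in>B. z \<prec> a} = {a. r = Fin a}" unfolding B_def using lz zr less_asym by fastforce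
  have lP: "l \<noteq> Pinf" and rM: "r \<noteq> Minf" using i by (auto simp: interval_ends_def)
  show "lo B z = map_extended \<sigma> l"
  proof (cases l)
    case (Fin u)
    then have "{a. l = Fin a} = {u}" by auto
    then show ?thesis unfolding lo_def l using lower_typeI[of u "{u}"] Fin by simp
  qed (use lP in \<open>simp_all add: lo_def l\<close>)
  show "hi B z = map_extended \<sigma> r"
  proof (cases r)
    case (Fin u)
    then have "{a. r = Fin a} = {u}" by auto
    then show ?thesis unfolding hi_def r using upper_typeI[of u "{u}"] Fin by simp
  qed (use rM in \<open>simp_all add: hi_def r\<close>)
  show "z \<notin> B" unfolding B_def using lz[of z] zr[of z] by auto
  show "z \<in> L" by (rule zL)
  assume z': "z' \<in> line_interval cyc p l r"
  have lz': "\<And>u. l = Fin u \<Longrightarrow> u \<prec> z'" and zr': "\<And>u. r = Fin u \<Longrightarrow> z' \<prec> u"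
    using z' unfolding interval_iff[OF i] by auto
  have l': "{a\<in>B. a \<prec> z'} = {a. l = Fin a}" unfolding B_def using lz' zr' less_asym by fastforce
  have r': "{a\<in>B. z' \<prec> a} = {a. r = Fin a}" unfolding B_def using lz' zr' less_asym by fastforce
  show "same_cut B z z'" unfolding same_cut_def using l l' r r' by blast
qed

text \<open>A tuple in \<open>I\<^sup>w\<close> is determined by its set of points, and any two tuples are related by a
  partial isomorphism that fixes the ends of the interval.\<close>

lemma hat_word:
  fixes w :: "'c list"
  assumes i: "interval_ends cyc p l r"
  defines "B \<equiv> {x. Fin x \<in> {l, r}}" and "X \<equiv> word_gset cyc \<sigma> p l r w"
  shows "hat B X" and "pts X \<noteq> {}" and "xs \<in> pts X \<Longrightarrow> pt_supp B (act X) xs = B \<union> set xs"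
    and "xs \<in> pts X \<Longrightarrow> orb (stab B) (act X) xs = pts X"
proof -
  let ?T = "word_tuples cyc \<sigma> p l r w"
  have pX: "pts X = ?T" and aX: "act X = (\<lambda>g. restrict (map g) ?T)" and dX: "defgrp X = stab B"
    by (simp_all add: X_def B_def word_gset_def)
  have B: "fin B" unfolding B_def by (rule ends_fin[OF i])
  have T: "xs \<in> ?T \<longleftrightarrow> set xs \<subseteq> line_interval cyc p l r \<and> sorted_wrt (\<prec>) xs \<and> map \<sigma> xs = w" for xs
    by (simp add: word_tuples_def)
  have TL: "set xs \<subseteq> L" if "xs \<in> ?T" for xs using that unfolding T line_interval_def by blast
  have int: "g z \<in> line_interval cyc p l r" if g: "g \<in> stab B" and z: "z \<in> line_interval cyc p l r" for g z
  proof -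
    have zL: "z \<in> L" using z unfolding interval_iff[OF i] by simp
    have "u \<prec> g z" if u: "l = Fin u" for u
    proof -
      have uB: "u \<in> B" using u by (simp add: B_def)
      have "u \<prec> z" using z u unfolding interval_iff[OF i] by simp
      then show ?thesis using H_less_iff[OF stab_H[OF g] fin_mem[OF B uB] zL] stab_fix[OF g uB] by simp
    qed
    moreover have "g z \<prec> u" if u: "r = Fin u" for u
    proof -
      have uB: "u \<in> B" using u by (simp add: B_def)
      have "z \<prec> u" using z u unfolding interval_iff[OF i] by simp
      then show ?thesis using H_less_iff[OF stab_H[OF g] zL fin_mem[OF B uB]] stab_fix[OF g uB] by simp
    qed
    ultimately show ?thesis unfolding interval_iff[OF i] using H_in_line[OF stab_H[OF g] zL] by simp
  qed
  have closed: "map g xs \<in> ?T" if g: "g \<in> stab B" and xs: "xs \<in> ?T" for g xs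
  proof -
    have "map \<sigma> (map g xs) = map \<sigma> xs" using TL[OF xs] H_color[OF stab_H[OF g]] by auto
    moreover have "sorted_wrt (\<prec>) (map g xs)"
    proof -
      have "g x \<prec> g y" if "x \<in> set xs" "y \<in> set xs" "x \<prec> y" for x y
        using H_less_iff[OF stab_H[OF g] subsetD[OF TL[OF xs] that(1)] subsetD[OF TL[OF xs] that(2)]] that(3) by simp
      moreover have "sorted_wrt (\<prec>) xs" using xs unfolding T by simp
      ultimately show ?thesis unfolding sorted_wrt_map by (rule sorted_wrt_mono_rel)
    qed
    moreover have "set (map g xs) \<subseteq> line_interval cyc p l r" using int[OF g] xs unfolding T by auto
    ultimately show ?thesis using xs unfolding T by simp
  qed
  have ac: "acts (stab B) ?T (act X)"
    unfolding acts_def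
  proof (intro conjI ballI)
    fix xs assume xs: "xs \<in> ?T"
    have "map ident xs = xs" using TL[OF xs] by (intro map_idI) auto
    then show "act X ident xs = xs" using xs by (simp add: aX)
    fix g assume g: "g \<in> stab B"
    show "act X g xs \<in> ?T" using closed[OF g xs] xs by (simp add: aX)
    fix h assume h: "h \<in> stab B"
    have "map (cmp g h) xs = map g (map h xs)" using TL[OF xs] by auto
    then show "act X (cmp g h) xs = act X g (act X h xs)" using xs closed[OF h xs] by (simp add: aX)
  qed
  have ps: "point_stab (stab B) (act X) xs = stab (B \<union> set xs)" if xs: "xs \<in> ?T" for xs
  proof -
    have "map g xs = xs \<longleftrightarrow> (\<forall>x\<in>set xs. g x = x)" for g by (induction xs) auto
    then show ?thesis using xs unfolding point_stab_def stab_Un aX pointwise_stab_def by auto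
  qed
  have f: "fin (B \<union> set xs)" if "xs \<in> ?T" for xs using B TL[OF that] by (simp add: fin_def)
  have s: "smooth B ?T (act X)" unfolding smooth_def using B ac ps f by blast
  show "xs \<in> pts X \<Longrightarrow> pt_supp B (act X) xs = B \<union> set xs" unfolding pX by (rule pt_suppI[OF f ps])
  have trans: "\<exists>g\<in>stab B. map g xs = ys" if xs: "xs \<in> ?T" and ys: "ys \<in> ?T" for xs ys
  proof -
    have len: "length xs = length ys" using xs ys unfolding T by (metis length_map)
    let ?r = "set (zip xs ys) \<union> (\<lambda>b. (b, b)) ` B"
    have sx: "sorted_wrt (\<prec>) xs" and sy: "sorted_wrt (\<prec>) ys" using xs ys unfolding T by auto
    have idx: "xs ! m \<prec> xs ! n \<longleftrightarrow> m < n" "ys ! m \<prec> ys ! n \<longleftrightarrow> m < n" if "m < length xs" "n < length xs" for m n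
    proof -
      have "zs ! m \<prec> zs ! n \<longleftrightarrow> m < n" if z: "sorted_wrt (\<prec>) zs" "m < length zs" "n < length zs" for zs
      proof -
        consider "m < n" | "m = n" | "n < m" by linarith
        then show ?thesis using sorted_wrt_nth_less[OF z(1), of m n] sorted_wrt_nth_less[OF z(1), of n m] z less_asym
          by cases auto
      qed
      then show "xs ! m \<prec> xs ! n \<longleftrightarrow> m < n" "ys ! m \<prec> ys ! n \<longleftrightarrow> m < n" using sx sy len that by auto
    qed
    have cut: "(b \<prec> x \<longleftrightarrow> b \<prec> y) \<and> (x \<prec> b \<longleftrightarrow> y \<prec> b)" if "(x, y) \<in> set (zip xs ys)" "b \<in> B" for x y b
    proof -
      have "x \<in> line_interval cyc p l r" "y \<in> line_interval cyc p l r"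
        using set_zip_leftD[OF that(1)] set_zip_rightD[OF that(1)] xs ys unfolding T by auto
      then have "same_cut B x y" unfolding B_def using interval_lo_hi(5)[OF i] by blast
      then show ?thesis using that(2) unfolding same_cut_def by blast
    qed
    have "partial_iso ?r"
      unfolding partial_iso_def
    proof (intro conjI)
      show "finite ?r" using fin_finite[OF B] by simp
      show "?r \<subseteq> L \<times> L" using TL[OF xs] TL[OF ys] fin_line[OF B] by (auto dest: set_zip_leftD set_zip_rightD)
      have "\<sigma> x = \<sigma> y" if xy: "(x, y) \<in> set (zip xs ys)" for x y
      proof -
        obtain n where n: "n < length xs" "x = xs ! n" "y = ys ! n" using xy len by (auto simp: set_zip)
        have "map \<sigma> xs ! n = map \<sigma> ys ! n" using xs ys unfolding T by simp
        then show ?thesis using n len by simp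
      qed
      then show "\<forall>(x, y)\<in>?r. \<sigma> x = \<sigma> y" by auto
      have zz: "x \<prec> x' \<longleftrightarrow> y \<prec> y'" if xy: "(x, y) \<in> set (zip xs ys)" "(x', y') \<in> set (zip xs ys)" for x y x' y'
      proof -
        obtain m where m: "m < length xs" "x = xs ! m" "y = ys ! m" using xy(1) len by (auto simp: set_zip)
        obtain n where n: "n < length xs" "x' = xs ! n" "y' = ys ! n" using xy(2) len by (auto simp: set_zip)
        show ?thesis using idx[OF m(1) n(1)] m n by simp
      qed
      have "x \<prec> x' \<longleftrightarrow> y \<prec> y'" if xy: "(x, y) \<in> ?r" "(x', y') \<in> ?r" for x y x' y'
      proof -
        consider "(x, y) \<in> set (zip xs ys)" "(x', y') \<in> set (zip xs ys)" | "(x, y) \<in> set (zip xs ys)" "x' = y'" "x' \<in> B"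
          | "x = y" "x \<in> B" "(x', y') \<in> set (zip xs ys)" | "x = y" "x' = y'" using xy by blast
        then show ?thesis
        proof cases
          case 1 then show ?thesis by (rule zz)
        next
          case 2 then show ?thesis using cut[OF 2(1,3)] by simp
        next
          case 3 then show ?thesis using cut[OF 3(3,2)] by simp
        qed simp
      qed
      then show "\<forall>(x, y)\<in>?r. \<forall>(x', y')\<in>?r. x \<prec> x' \<longleftrightarrow> y \<prec> y'" by blast
    qed
    then obtain g where g: "g \<in> H" "\<And>x y. (x, y) \<in> ?r \<Longrightarrow> g x = y" using homogeneous by blast
    have "g \<in> stab B" by (rule stabI[OF g(1)]) (use g(2) in blast)
    moreover have "map g xs = ys"
    proof (rule nth_equalityI)
      fix n assume "n < length (map g xs)"
      then have "(xs ! n, ys ! n) \<in> set (zip xs ys)" using len by (auto simp: set_zip)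
      then show "map g xs ! n = ys ! n" using g(2) \<open>n < length (map g xs)\<close> by simp
    qed (simp add: len)
    ultimately show ?thesis by blast
  qed
  show o: "orb (stab B) (act X) xs = pts X" if xs: "xs \<in> pts X" for xs
  proof (intro equalityI subsetI)
    fix ys assume "ys \<in> pts X"
    then obtain g where "g \<in> stab B" "map g xs = ys" using trans xs pX by blast
    then show "ys \<in> orb (stab B) (act X) xs" using xs unfolding orb_def pX aX by force
  qed (use orb_subset[OF ac] xs pX in blast)
  have "orb (stab B) (act X) ` pts X \<subseteq> {pts X}" using o by blast
  then have "finite (orb (stab B) (act X) ` pts X)" by (rule finite_subset) simp
  then show "hat B X" unfolding hat_def using s dX pX by simp
  have "\<exists>xs. set xs \<subseteq> line_interval cyc p l r \<and> sorted_wrt (\<prec>) xs \<and> map \<sigma> xs = w"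
  proof (induction w rule: rev_induct)
    case (snoc c w)
    then obtain xs where xs: "set xs \<subseteq> line_interval cyc p l r" "sorted_wrt (\<prec>) xs" "map \<sigma> xs = w" by blast
    have "\<exists>z\<in>L. \<sigma> z = c \<and> (\<forall>a\<in>{a. l = Fin a} \<union> set xs. a \<prec> z) \<and> (\<forall>b\<in>{b. r = Fin b}. z \<prec> b)"
    proof (rule color_between_finite)
      show "finite ({a. l = Fin a} \<union> set xs)" "{a. l = Fin a} \<union> set xs \<subseteq> L" "finite {b. r = Fin b}" "{b. r = Fin b} \<subseteq> L"
      proof -
        have "{a. l = Fin a} \<subseteq> B" "{b. r = Fin b} \<subseteq> B" by (auto simp: B_def)
        then have "fin {a. l = Fin a}" "fin {b. r = Fin b}" using fin_subset[OF B] by auto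
        then show "finite ({a. l = Fin a} \<union> set xs)" "{a. l = Fin a} \<union> set xs \<subseteq> L" "finite {b. r = Fin b}" "{b. r = Fin b} \<subseteq> L"
          using xs(1) unfolding fin_def line_interval_def by auto
      qed
      show "a \<prec> b" if "a \<in> {a. l = Fin a} \<union> set xs" "b \<in> {b. r = Fin b}" for a b
      proof (cases "a \<in> set xs")
        case True
        then have "a \<in> line_interval cyc p l r" using xs(1) by blast
        then show ?thesis using that(2) unfolding interval_iff[OF i] by simp
      next
        case False
        then show ?thesis using that i by (simp add: interval_ends_def)
      qed
    qed
    then obtain z where z: "z \<in> L" "\<sigma> z = c" "\<forall>a\<in>{a. l = Fin a} \<union> set xs. a \<prec> z" "\<forall>b\<in>{b. r = Fin b}. z \<prec> b" by blast
    have "z \<in> line_interval cyc p l r" unfolding interval_iff[OF i] using z by simp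
    then show ?case using xs z by (intro exI[of _ "xs @ [z]"]) (simp add: sorted_wrt_append)
  qed (intro exI[of _ "[]"], simp)
  then show "pts X \<noteq> {}" unfolding pX word_tuples_def by blast
qed

end

section \<open>Integer polynomials\<close>

lemma int_poly_ring_simps:
  "p \<in> carrier (int_poly_ring V) \<longleftrightarrow> (\<forall>m\<in>Poly_Mapping.keys p. Poly_Mapping.keys m \<subseteq> V)"
  "p \<otimes>\<^bsub>int_poly_ring V\<^esub> q = p * q" "p \<oplus>\<^bsub>int_poly_ring V\<^esub> q = p + q"
  "\<one>\<^bsub>int_poly_ring V\<^esub> = 1" "\<zero>\<^bsub>int_poly_ring V\<^esub> = 0"
  by (simp_all add: int_poly_ring_def)

lemma of_int_poly: "(of_int n :: ('m::monoid_add \<Rightarrow>\<^sub>0 int)) = Poly_Mapping.single 0 n"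
proof -
  have "Poly_Mapping.single 0 (of_int n :: int) = (of_int n :: ('m \<Rightarrow>\<^sub>0 int))" by (rule single_of_int)
  then show ?thesis by (simp only: of_int_eq_id id_apply)
qed

lemma poly_closed:
  shows poly_add_closed: "p \<in> carrier (int_poly_ring V) \<Longrightarrow> q \<in> carrier (int_poly_ring V) \<Longrightarrow> p + q \<in> carrier (int_poly_ring V)"
    and poly_mult_closed: "p \<in> carrier (int_poly_ring V) \<Longrightarrow> q \<in> carrier (int_poly_ring V) \<Longrightarrow> p * q \<in> carrier (int_poly_ring V)"
    and poly_of_int_closed: "of_int n \<in> carrier (int_poly_ring V)"
    and poly_var_closed: "v \<in> V \<Longrightarrow> poly_var v \<in> carrier (int_poly_ring V)"
proof -
  show "p \<in> carrier (int_poly_ring V) \<Longrightarrow> q \<in> carrier (int_poly_ring V) \<Longrightarrow> p + q \<in> carrier (int_poly_ring V)"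
    using Poly_Mapping.keys_add[of p q] unfolding int_poly_ring_simps by blast
  show "p * q \<in> carrier (int_poly_ring V)" if p: "p \<in> carrier (int_poly_ring V)" and q: "q \<in> carrier (int_poly_ring V)"
    unfolding int_poly_ring_simps
  proof
    fix m assume "m \<in> Poly_Mapping.keys (p * q)"
    then obtain a b where ab: "a \<in> Poly_Mapping.keys p" "b \<in> Poly_Mapping.keys q" "m = a + b"
      using Poly_Mapping.keys_mult[of p q] by blast
    then show "Poly_Mapping.keys m \<subseteq> V"
      using Poly_Mapping.keys_add[of a b] p q unfolding int_poly_ring_simps by blast
  qed
  show "of_int n \<in> carrier (int_poly_ring V)" by (simp add: int_poly_ring_simps of_int_poly)
  show "v \<in> V \<Longrightarrow> poly_var v \<in> carrier (int_poly_ring V)" by (simp add: int_poly_ring_simps poly_var_def)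
qed

lemma poly_zero_closed: "0 \<in> carrier (int_poly_ring V)" and poly_one_closed: "1 \<in> carrier (int_poly_ring V)"
  using poly_of_int_closed[of 0 V] poly_of_int_closed[of 1 V] by simp_all

lemma poly_uminus_closed: "p \<in> carrier (int_poly_ring V) \<Longrightarrow> - p \<in> carrier (int_poly_ring V)"
  using poly_mult_closed[OF poly_of_int_closed[of "-1" V], of p] by simp

lemma poly_diff_closed: "p \<in> carrier (int_poly_ring V) \<Longrightarrow> q \<in> carrier (int_poly_ring V) \<Longrightarrow> p - q \<in> carrier (int_poly_ring V)"
  using poly_add_closed[OF _ poly_uminus_closed, of p V q] by simp

lemma poly_sum_closed: "(\<And>i. i \<in> I \<Longrightarrow> f i \<in> carrier (int_poly_ring V)) \<Longrightarrow> sum f I \<in> carrier (int_poly_ring V)"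
  by (induction I rule: infinite_finite_induct) (simp_all add: poly_add_closed poly_zero_closed)

lemma poly_prod_closed: "(\<And>i. i \<in> I \<Longrightarrow> f i \<in> carrier (int_poly_ring V)) \<Longrightarrow> prod f I \<in> carrier (int_poly_ring V)"
  by (induction I rule: infinite_finite_induct) (simp_all add: poly_mult_closed poly_one_closed)

lemma cring_int_poly_ring: "cring (int_poly_ring V)"
proof (rule cringI)
  show "abelian_group (int_poly_ring V)"
  proof (rule abelian_groupI)
    fix x assume "x \<in> carrier (int_poly_ring V)"
    then show "\<exists>y\<in>carrier (int_poly_ring V). y \<oplus>\<^bsub>int_poly_ring V\<^esub> x = \<zero>\<^bsub>int_poly_ring V\<^esub>"
      by (intro bexI[of _ "- x"]) (simp_all add: int_poly_ring_simps(2-) poly_uminus_closed)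
  qed (simp_all add: int_poly_ring_simps(2-) poly_add_closed poly_zero_closed add_ac)
  show "comm_monoid (int_poly_ring V)"
    by (rule comm_monoidI) (simp_all add: int_poly_ring_simps(2-) poly_mult_closed poly_one_closed mult_ac)
qed (simp add: int_poly_ring_simps(2-) distrib_right)

lemma poly_sum_monomials:
  fixes p :: "('m \<Rightarrow>\<^sub>0 'k::comm_monoid_add)"
  shows "p = (\<Sum>m\<in>Poly_Mapping.keys p. Poly_Mapping.single m (Poly_Mapping.lookup p m))"
proof (rule poly_mapping_eqI)
  fix k
  have "(\<Sum>m\<in>Poly_Mapping.keys p. Poly_Mapping.lookup (Poly_Mapping.single m (Poly_Mapping.lookup p m)) k) =
      (\<Sum>m\<in>Poly_Mapping.keys p. if m = k then Poly_Mapping.lookup p k else 0)"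
    by (rule sum.cong[OF refl]) (simp add: lookup_single when_def)
  also have "\<dots> = Poly_Mapping.lookup p k" by (simp add: in_keys_iff)
  finally show "Poly_Mapping.lookup p k = Poly_Mapping.lookup (\<Sum>m\<in>Poly_Mapping.keys p. Poly_Mapping.single m (Poly_Mapping.lookup p m)) k"
    by (simp add: lookup_sum)
qed

lemma poly_var_power: "poly_var v ^ k = Poly_Mapping.single (Poly_Mapping.single v k) 1"
proof (induction k)
  case 0
  have "(1 :: ('a \<Rightarrow>\<^sub>0 nat) \<Rightarrow>\<^sub>0 int) = Poly_Mapping.single 0 1" by simp
  then show ?case by simp
next
  case (Suc k)
  then show ?case by (simp add: poly_var_def mult_single single_add[symmetric])
qed

lemma monomial_prod:
  "Poly_Mapping.single m (1 :: int) = (\<Prod>v\<in>Poly_Mapping.keys m. poly_var v ^ Poly_Mapping.lookup m v)"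
proof -
  have "Poly_Mapping.single (\<Sum>v\<in>K. Poly_Mapping.single v (f v)) (1 :: int) = (\<Prod>v\<in>K. poly_var v ^ f v)"
    if "finite K" for K and f :: "'a \<Rightarrow> nat"
    using that
  proof (induction rule: finite_induct)
    case (insert v K)
    have "Poly_Mapping.single (\<Sum>v\<in>insert v K. Poly_Mapping.single v (f v)) (1 :: int) =
        Poly_Mapping.single (Poly_Mapping.single v (f v)) 1 * Poly_Mapping.single (\<Sum>v\<in>K. Poly_Mapping.single v (f v)) 1"
      using insert.hyps by (simp add: mult_single)
    then show ?case using insert by (simp add: poly_var_power)
  qed simp
  from this[of "Poly_Mapping.keys m" "Poly_Mapping.lookup m"] show ?thesis
    using poly_sum_monomials[of m] by simp
qed

lemma int_poly_induct:
  assumes p: "p \<in> carrier (int_poly_ring V)"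
    and const: "\<And>n. N (of_int n)" and var: "\<And>v. v \<in> V \<Longrightarrow> N (poly_var v)"
    and add: "\<And>p q. N p \<Longrightarrow> N q \<Longrightarrow> N (p + q)" and mult: "\<And>p q. N p \<Longrightarrow> N q \<Longrightarrow> N (p * q)"
  shows "N p"
proof -
  have N0: "N 0" and N1: "N 1" using const[of 0] const[of 1] by simp_all
  have pow: "N (q ^ k)" if "N q" for q k using that by (induction k) (simp_all add: N1 mult)
  have prod: "N (prod f K)" if "\<And>i. i \<in> K \<Longrightarrow> N (f i)" for f :: "'a \<Rightarrow> _" and K
    using that by (induction K rule: infinite_finite_induct) (simp_all add: N1 mult)
  have sum: "N (sum f K)" if "\<And>i. i \<in> K \<Longrightarrow> N (f i)" for f :: "('a \<Rightarrow>\<^sub>0 nat) \<Rightarrow> _" and K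
    using that by (induction K rule: infinite_finite_induct) (simp_all add: N0 add)
  have "N (Poly_Mapping.single m (Poly_Mapping.lookup p m))" if m: "m \<in> Poly_Mapping.keys p" for m
  proof -
    have "N (Poly_Mapping.single m 1)"
      unfolding monomial_prod using p m unfolding int_poly_ring_simps by (intro prod pow var) blast
    moreover have "Poly_Mapping.single m (Poly_Mapping.lookup p m) = of_int (Poly_Mapping.lookup p m) * Poly_Mapping.single m 1"
      by (simp add: of_int_poly mult_single)
    ultimately show ?thesis using mult[OF const] by simp
  qed
  then show ?thesis using sum[of "Poly_Mapping.keys p"] poly_sum_monomials[of p] by metis
qed

definition poly_eval :: "('v \<Rightarrow> int) \<Rightarrow> (('v \<Rightarrow>\<^sub>0 nat) \<Rightarrow>\<^sub>0 int) \<Rightarrow> int" where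
  "poly_eval x p = (\<Sum>m\<in>Poly_Mapping.keys p. Poly_Mapping.lookup p m *
     (\<Prod>v\<in>Poly_Mapping.keys m. x v ^ Poly_Mapping.lookup m v))"

lemma poly_eval_add: "poly_eval x (p + q) = poly_eval x p + poly_eval x q"
proof -
  let ?m = "\<lambda>m. \<Prod>v\<in>Poly_Mapping.keys m. x v ^ Poly_Mapping.lookup m v"
  have sup: "poly_eval x r = (\<Sum>m\<in>K. Poly_Mapping.lookup r m * ?m m)" if "finite K" "Poly_Mapping.keys r \<subseteq> K" for r K
    unfolding poly_eval_def by (rule sum.mono_neutral_left) (use that in \<open>auto simp: in_keys_iff\<close>)
  let ?K = "Poly_Mapping.keys p \<union> Poly_Mapping.keys q"
  have "poly_eval x (p + q) = (\<Sum>m\<in>?K. Poly_Mapping.lookup (p + q) m * ?m m)"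
    by (rule sup) (simp_all add: Poly_Mapping.keys_add)
  also have "\<dots> = (\<Sum>m\<in>?K. Poly_Mapping.lookup p m * ?m m) + (\<Sum>m\<in>?K. Poly_Mapping.lookup q m * ?m m)"
    by (simp add: lookup_add distrib_right sum.distrib)
  also have "\<dots> = poly_eval x p + poly_eval x q" using sup[of ?K p] sup[of ?K q] by simp
  finally show ?thesis .
qed

lemma poly_eval_single:
  "poly_eval x (Poly_Mapping.single m a) = a * (\<Prod>v\<in>Poly_Mapping.keys m. x v ^ Poly_Mapping.lookup m v)"
  by (simp add: poly_eval_def)

lemma poly_eval_zero: "poly_eval x 0 = 0" by (simp add: poly_eval_def)

lemma poly_eval_sum: "poly_eval x (sum f K) = (\<Sum>i\<in>K. poly_eval x (f i))"
  by (induction K rule: infinite_finite_induct) (simp_all add: poly_eval_zero poly_eval_add)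

lemma poly_eval_mult: "poly_eval x (p * q) = poly_eval x p * poly_eval x q"
proof -
  let ?m = "\<lambda>m. \<Prod>v\<in>Poly_Mapping.keys m. x v ^ Poly_Mapping.lookup m v"
  have mon: "?m (m + n) = ?m m * ?m n" for m n
  proof -
    let ?K = "Poly_Mapping.keys m \<union> Poly_Mapping.keys n"
    have sup: "?m r = (\<Prod>v\<in>?K. x v ^ Poly_Mapping.lookup r v)" if "Poly_Mapping.keys r \<subseteq> ?K" for r
      by (rule prod.mono_neutral_left) (use that in \<open>auto simp: in_keys_iff\<close>)
    have "?m (m + n) = (\<Prod>v\<in>?K. x v ^ Poly_Mapping.lookup (m + n) v)" by (rule sup) (rule Poly_Mapping.keys_add)
    also have "\<dots> = (\<Prod>v\<in>?K. x v ^ Poly_Mapping.lookup m v) * (\<Prod>v\<in>?K. x v ^ Poly_Mapping.lookup n v)"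
      by (simp add: lookup_add power_add prod.distrib)
    also have "\<dots> = ?m m * ?m n" using sup[of m] sup[of n] by simp
    finally show ?thesis .
  qed
  let ?s = "\<lambda>p m. Poly_Mapping.single m (Poly_Mapping.lookup p m)"
  have "poly_eval x (p * q) = poly_eval x ((\<Sum>m\<in>Poly_Mapping.keys p. ?s p m) * (\<Sum>n\<in>Poly_Mapping.keys q. ?s q n))"
    using poly_sum_monomials[of p] poly_sum_monomials[of q] by simp
  also have "\<dots> = (\<Sum>m\<in>Poly_Mapping.keys p. \<Sum>n\<in>Poly_Mapping.keys q.
      (Poly_Mapping.lookup p m * ?m m) * (Poly_Mapping.lookup q n * ?m n))"
    unfolding sum_product poly_eval_sum mult_single poly_eval_single mon by (simp add: mult_ac)
  also have "\<dots> = poly_eval x p * poly_eval x q" unfolding poly_eval_def by (simp add: sum_product)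
  finally show ?thesis .
qed

lemma poly_eval_of_int: "poly_eval x (of_int n) = n"
  by (simp add: of_int_poly poly_eval_single)

lemma poly_eval_one: "poly_eval x 1 = 1" using poly_eval_of_int[of x 1] by simp

lemma poly_eval_var: "poly_eval x (poly_var v) = x v" by (simp add: poly_var_def poly_eval_single)

lemma poly_eval_uminus: "poly_eval x (- p) = - poly_eval x p"
  using poly_eval_mult[of x "of_int (-1)" p] poly_eval_of_int[of x "-1"] by simp

lemma poly_eval_diff: "poly_eval x (p - q) = poly_eval x p - poly_eval x q"
  using poly_eval_add[of x p "- q"] by (simp add: poly_eval_uminus)

lemma poly_eval_prod: "poly_eval x (prod f K) = (\<Prod>i\<in>K. poly_eval x (f i))"
  by (induction K rule: infinite_finite_induct) (simp_all add: poly_eval_one poly_eval_mult)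

lemma cring_int_power_ring: "cring (int_power_ring I)"
proof (rule cringI)
  show "abelian_group (int_power_ring I)"
  proof (rule abelian_groupI)
    fix f assume "f \<in> carrier (int_power_ring I)"
    then show "\<exists>g\<in>carrier (int_power_ring I). g \<oplus>\<^bsub>int_power_ring I\<^esub> f = \<zero>\<^bsub>int_power_ring I\<^esub>"
      by (intro bexI[of _ "\<lambda>i\<in>I. - f i"]) (auto simp: int_power_ring_def fun_eq_iff)
  qed (auto simp: int_power_ring_def fun_eq_iff PiE_iff extensional_def)
  show "comm_monoid (int_power_ring I)"
    by (rule comm_monoidI) (auto simp: int_power_ring_def fun_eq_iff PiE_iff extensional_def)
qed (auto simp: int_power_ring_def fun_eq_iff distrib_right)

lemma eval_hom: "ring_hom_ring (int_poly_ring V) (int_power_ring I) (\<lambda>p. \<lambda>i\<in>I. poly_eval (x i) p)"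
  by (rule ring_hom_ringI[OF cring.axioms(1)[OF cring_int_poly_ring] cring.axioms(1)[OF cring_int_power_ring]])
    (simp_all add: int_poly_ring_simps(2-) int_power_ring_def poly_eval_add poly_eval_mult poly_eval_one cong: restrict_cong)

lemma int_power_ring_reindex:
  assumes f: "bij_betw f I J"
  shows "(\<lambda>u. \<lambda>j\<in>J. u (inv_into I f j)) \<in> ring_iso (int_power_ring I) (int_power_ring J)"
proof -
  have inv: "inv_into I f j \<in> I" "f (inv_into I f j) = j" if "j \<in> J" for j
    using f that by (auto simp: bij_betw_def inv_into_into f_inv_into_f)
  have inv': "inv_into I f (f i) = i" "f i \<in> J" if "i \<in> I" for i
    using f that by (auto simp: bij_betw_def inv_into_f_f)
  have "bij_betw (\<lambda>u. \<lambda>j\<in>J. u (inv_into I f j)) (I \<rightarrow>\<^sub>E UNIV) (J \<rightarrow>\<^sub>E UNIV :: (_ \<Rightarrow> int) set)"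
    by (rule bij_betw_byWitness[of _ "\<lambda>w. \<lambda>i\<in>I. w (f i)"])
      (use inv inv' in \<open>auto simp: fun_eq_iff PiE_iff extensional_def\<close>)
  moreover have "(\<lambda>u. \<lambda>j\<in>J. u (inv_into I f j)) \<in> ring_hom (int_power_ring I) (int_power_ring J)"
    by (rule ring_hom_memI) (use inv in \<open>auto simp: int_power_ring_def fun_eq_iff\<close>)
  ultimately show ?thesis by (simp add: ring_iso_def int_power_ring_def)
qed

section \<open>Trees and tables\<close>

lemma adjacency_iff [simp]: "(u, v) \<in> adjacency F \<longleftrightarrow> {u, v} \<in> F"
  by (simp add: adjacency_def)

lemma connected_sym: "(u, v) \<in> (adjacency F)\<^sup>* \<Longrightarrow> (v, u) \<in> (adjacency F)\<^sup>*"
proof -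
  have "sym (adjacency F)" by (rule symI) (simp add: insert_commute)
  then show "(u, v) \<in> (adjacency F)\<^sup>* \<Longrightarrow> (v, u) \<in> (adjacency F)\<^sup>*" by (meson sym_rtrancl symD)
qed

lemma connected_mono: "(u, v) \<in> (adjacency F)\<^sup>* \<Longrightarrow> F \<subseteq> G \<Longrightarrow> (u, v) \<in> (adjacency G)\<^sup>*"
proof -
  assume c: "(u, v) \<in> (adjacency F)\<^sup>*" and "F \<subseteq> G"
  then have "adjacency F \<subseteq> adjacency G" by (auto simp: adjacency_def)
  from rtrancl_mono[OF this] c show ?thesis by blast
qed

lemma connected_simple_path:
  assumes "(u, v) \<in> (adjacency F)\<^sup>*"
  shows "\<exists>vs. vs \<noteq> [] \<and> distinct vs \<and> hd vs = u \<and> last vs = v \<and> (\<forall>i. Suc i < length vs \<longrightarrow> {vs ! i, vs ! Suc i} \<in> F)"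
  using assms
proof (induction rule: rtrancl_induct)
  case base
  show ?case by (rule exI[of _ "[u]"]) simp
next
  case (step y z)
  then obtain vs where vs: "vs \<noteq> []" "distinct vs" "hd vs = u" "last vs = y"
    "\<forall>i. Suc i < length vs \<longrightarrow> {vs ! i, vs ! Suc i} \<in> F" by blast
  show ?case
  proof (cases "z \<in> set vs")
    case True
    then obtain i where i: "i < length vs" "vs ! i = z" by (auto simp: in_set_conv_nth)
    have "last (take (Suc i) vs) = z" using i by (simp add: take_Suc_conv_app_nth)
    moreover have "hd (take (Suc i) vs) = u" "take (Suc i) vs \<noteq> []" using vs by auto
    ultimately show ?thesis using vs(2,5) by (intro exI[of _ "take (Suc i) vs"]) simp
  next
    case False
    have "{(vs @ [z]) ! i, (vs @ [z]) ! Suc i} \<in> F" if i: "Suc i < length (vs @ [z])" for i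
    proof (cases "Suc i < length vs")
      case True
      then show ?thesis using vs(5) by (simp add: nth_append)
    next
      case False
      then have e: "Suc i = length vs" using i by simp
      then have "i = length vs - 1" by simp
      then have "vs ! i = y" using vs(1,4) by (simp add: last_conv_nth)
      then show ?thesis using e step.hyps(2) by (simp add: nth_append)
    qed
    then show ?thesis using vs False by (intro exI[of _ "vs @ [z]"]) simp
  qed
qed

text \<open>A simple path that joins the ends of an edge and avoids it would close up to a cycle.\<close>

lemma tree_bridge:
  assumes T: "is_tree V E" and uv: "{u, v} \<in> E"
  shows "(u, v) \<notin> (adjacency (E - {{u, v}}))\<^sup>*"
proof
  assume c: "(u, v) \<in> (adjacency (E - {{u, v}}))\<^sup>*"
  have ne: "u \<noteq> v" using T uv unfolding is_tree_def by force
  from connected_simple_path[OF c] obtain vs where vs: "vs \<noteq> []" "distinct vs" "hd vs = u" "last vs = v"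
    "\<forall>i. Suc i < length vs \<longrightarrow> {vs ! i, vs ! Suc i} \<in> E - {{u, v}}" by blast
  have h: "vs ! 0 = u" and l: "vs ! (length vs - 1) = v" using vs by (simp_all add: hd_conv_nth last_conv_nth)
  have n1: "length vs \<noteq> 1" using h l ne by auto
  have n2: "length vs \<noteq> 2"
  proof
    assume "length vs = 2"
    then have "{vs ! 0, vs ! Suc 0} \<in> E - {{u, v}}" "vs ! Suc 0 = v" using vs(5) l by auto
    then show False using h by simp
  qed
  have n0: "length vs \<noteq> 0" using vs(1) by simp
  have "3 \<le> length vs" using n0 n1 n2 by linarith
  moreover have "{vs ! i, vs ! (Suc i mod length vs)} \<in> E" if "i < length vs" for i
  proof (cases "Suc i < length vs")
    case True
    then show ?thesis using vs(5) by simp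
  next
    case False
    then have "Suc i = length vs" using that by simp
    then have "Suc i mod length vs = 0" "i = length vs - 1" by auto
    then show ?thesis using h l uv by (simp add: insert_commute)
  qed
  ultimately have "graph_cycle E vs" using vs(2) unfolding graph_cycle_def by blast
  then show False using T unfolding is_tree_def by blast
qed

lemma connected_cut:
  fixes p q :: 'v
  assumes "(u, v) \<in> (adjacency F)\<^sup>*"
  defines "R \<equiv> (adjacency (F - {{p, q}}))\<^sup>*"
  shows "(u, v) \<in> R \<or> (u, p) \<in> R \<and> (q, v) \<in> R \<or> (u, q) \<in> R \<and> (p, v) \<in> R"
  using assms(1)
proof (induction rule: rtrancl_induct)
  case base
  show ?case by (simp add: R_def)
next
  case (step y z)
  have refl: "(w, w) \<in> R" for w by (simp add: R_def)
  show ?case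
  proof (cases "{y, z} = {p, q}")
    case True
    then have "y = p \<and> z = q \<or> y = q \<and> z = p" by (auto simp: doubleton_eq_iff)
    then show ?thesis using step.IH refl by blast
  next
    case False
    then have "(y, z) \<in> adjacency (F - {{p, q}})" using step.hyps(2) by simp
    then have "(w, z) \<in> R" if "(w, y) \<in> R" for w using that unfolding R_def by (meson rtrancl.rtrancl_into_rtrancl)
    then show ?thesis using step.IH by blast
  qed
qed

subsection \<open>Sides of an edge\<close>

context
  fixes T :: "('v, 'c) dtree"
  assumes T: "directed_labeled_tree T"
begin

abbreviation (input) "side c \<equiv> (adjacency (edges T - {edge T c}))\<^sup>*"
abbreviation (input) "P c \<equiv> pointed_component T c"

lemma tree: "is_tree (vertices T) (edges T)" using T by (simp add: directed_labeled_tree_def)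

lemma edge_inj: "edge T c = edge T d \<longleftrightarrow> c = d"
  using T unfolding directed_labeled_tree_def bij_betw_def by (metis UNIV_I inj_onD)

lemma edge_in: "edge T c \<in> edges T" by (simp add: edges_def)

lemma tail_in: "tail T c \<in> vertices T" and head_in: "head T c \<in> vertices T"
proof -
  have "edge T c \<subseteq> vertices T" using tree edge_in unfolding is_tree_def by blast
  then show "tail T c \<in> vertices T" "head T c \<in> vertices T" by (auto simp: edge_def)
qed

lemma connected: "u \<in> vertices T \<Longrightarrow> v \<in> vertices T \<Longrightarrow> (u, v) \<in> (adjacency (edges T))\<^sup>*"
  using tree unfolding is_tree_def by blast

lemma bridge: "(head T c, tail T c) \<notin> side c"
  using tree_bridge[OF tree, of "head T c" "tail T c"] edge_in[of c] by (simp add: edge_def insert_commute)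

lemma other_side:
  assumes v: "v \<in> vertices T"
  shows "v \<notin> P c \<longleftrightarrow> (tail T c, v) \<in> side c"
proof
  assume "v \<notin> P c"
  then have "(head T c, v) \<notin> side c" using v by (simp add: pointed_component_def)
  then show "(tail T c, v) \<in> side c"
    using connected_cut[OF connected[OF head_in[of c] v], of "tail T c" "head T c"] bridge[of c]
    unfolding edge_def by blast
next
  assume t: "(tail T c, v) \<in> side c"
  show "v \<notin> P c"
  proof
    assume "v \<in> P c"
    then have "(head T c, v) \<in> side c" by (simp add: pointed_component_def)
    then show False using rtrancl_trans[OF _ connected_sym[OF t]] bridge by blast
  qed
qed

lemma same_side:
  assumes uv: "(u, v) \<in> side c" and u: "u \<in> vertices T" and v: "v \<in> vertices T"
  shows "u \<in> P c \<longleftrightarrow> v \<in> P c"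
  using rtrancl_trans[OF _ uv, of "head T c"] rtrancl_trans[OF _ connected_sym[OF uv], of "head T c"] u v
  unfolding pointed_component_def by blast

lemma head_pointed [simp]: "head T c \<in> P c" using head_in by (simp add: pointed_component_def)
lemma tail_pointed [simp]: "tail T c \<notin> P c" using other_side[OF tail_in[of c]] by simp

lemma edge_one_side: "c \<noteq> d \<Longrightarrow> tail T d \<in> P c \<longleftrightarrow> head T d \<in> P c"
proof -
  assume "c \<noteq> d"
  then have "(tail T d, head T d) \<in> adjacency (edges T - {edge T c})"
    using edge_in[of d] edge_inj[of d c] by (simp add: edge_def)
  then show ?thesis using same_side[OF _ tail_in head_in] by blast
qed

text \<open>If \<open>v\<close> is separated from the edge \<open>d\<close> by \<open>c\<close>, then \<open>v\<close> is connected to an endpoint of \<open>c\<close> without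
  using \<open>d\<close>, so that \<open>d\<close> does not separate \<open>v\<close> from the edge \<open>c\<close>.\<close>

lemma sides_compatible:
  assumes cd: "c \<noteq> d" and v: "v \<in> vertices T"
  shows "(v \<in> P c \<longleftrightarrow> head T d \<in> P c) \<or> (v \<in> P d \<longleftrightarrow> head T c \<in> P d)"
proof (rule disjCI)
  assume n: "\<not> (v \<in> P d \<longleftrightarrow> head T c \<in> P d)"
  show "v \<in> P c \<longleftrightarrow> head T d \<in> P c"
  proof (rule ccontr)
    assume opp: "\<not> (v \<in> P c \<longleftrightarrow> head T d \<in> P c)"
    define u where "u = (if v \<in> P c then head T c else tail T c)"
    have uV: "u \<in> vertices T" using head_in tail_in by (simp add: u_def)
    have uv: "(u, v) \<in> side c" using other_side[OF v, of c] by (auto simp: u_def pointed_component_def)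
    have "(u, v) \<in> side d"
      using uv
    proof (induction rule: rtrancl_induct)
      case (step y z)
      have e: "{y, z} \<in> edges T" "{y, z} \<noteq> edge T c" using step.hyps(2) by auto
      then have "{y, z} \<subseteq> vertices T" using tree unfolding is_tree_def by blast
      then have yz: "y \<in> vertices T" "z \<in> vertices T" by auto
      have "(u, z) \<in> side c" using step.hyps by (rule rtrancl_into_rtrancl)
      then have same: "y \<in> P c \<longleftrightarrow> v \<in> P c" "z \<in> P c \<longleftrightarrow> v \<in> P c"
        using same_side[OF step.hyps(1) uV yz(1)] same_side[OF _ uV yz(2)] same_side[OF uv uV v] by blast+
      have "{y, z} \<noteq> edge T d"
      proof
        assume "{y, z} = edge T d"
        then have "head T d = y \<or> head T d = z" by (auto simp: edge_def)
        then show False using same opp by blast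
      qed
      then have "(y, z) \<in> adjacency (edges T - {edge T d})" using e by simp
      then show ?case using step.IH by (rule rtrancl_into_rtrancl[rotated])
    qed simp
    then have "u \<in> P d \<longleftrightarrow> v \<in> P d" by (rule same_side[OF _ uV v])
    moreover have "u \<in> P d \<longleftrightarrow> head T c \<in> P d" using edge_one_side[of d c] cd by (auto simp: u_def)
    ultimately show False using n by blast
  qed
qed

text \<open>Some edge lies on the path from \<open>u\<close> to \<open>v\<close>: if no edge separated them, all edges could be deleted one
  after another without disconnecting \<open>u\<close> from \<open>v\<close>.\<close>

lemma sides_separate:
  assumes uv: "u \<in> vertices T" "v \<in> vertices T" "u \<noteq> v" and fin: "finite (edges T)"
  shows "\<exists>c. (u \<in> P c) \<noteq> (v \<in> P c)"
proof -
  define Q where "Q n \<longleftrightarrow> (\<exists>F\<subseteq>edges T. (u, v) \<in> (adjacency F)\<^sup>* \<and> card F = n)" for n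
  have "Q (card (edges T))" unfolding Q_def using connected[OF uv(1,2)] by blast
  then have "Q (LEAST n. Q n)" by (rule LeastI)
  then obtain F where F: "F \<subseteq> edges T" "(u, v) \<in> (adjacency F)\<^sup>*" "card F = (LEAST n. Q n)" unfolding Q_def by blast
  have "F \<noteq> {}" using F(2) uv(3) by (auto simp: adjacency_def)
  then obtain c where c: "edge T c \<in> F" using F(1) by (auto simp: edges_def)
  have fF: "finite F" using F(1) fin finite_subset by blast
  have "(u, v) \<notin> (adjacency (F - {edge T c}))\<^sup>*"
  proof
    assume "(u, v) \<in> (adjacency (F - {edge T c}))\<^sup>*"
    then have "Q (card (F - {edge T c}))" unfolding Q_def using F(1) by blast
    then have "card F \<le> card (F - {edge T c})" unfolding F(3) by (rule Least_le)
    then show False using card_Diff1_less[OF fF c] by simp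
  qed
  then consider "(u, tail T c) \<in> (adjacency (F - {edge T c}))\<^sup>*" "(head T c, v) \<in> (adjacency (F - {edge T c}))\<^sup>*"
    | "(u, head T c) \<in> (adjacency (F - {edge T c}))\<^sup>*" "(tail T c, v) \<in> (adjacency (F - {edge T c}))\<^sup>*"
    using connected_cut[OF F(2), of "tail T c" "head T c"] unfolding edge_def by blast
  moreover have "(a, b) \<in> side c" if "(a, b) \<in> (adjacency (F - {edge T c}))\<^sup>*" for a b
    using connected_mono[OF that] F(1) by blast
  ultimately show ?thesis
    using same_side[OF _ uv(1) tail_in] same_side[OF _ head_in uv(2)] same_side[OF _ uv(1) head_in]
      same_side[OF _ tail_in uv(2)] head_pointed tail_pointed by metis
qed

lemma vertex_incident:
  assumes "v \<in> vertices T" shows "\<exists>c. v = tail T c \<or> v = head T c"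
proof (cases "v = head T undefined")
  case False
  have "(v, head T undefined) \<in> (adjacency (edges T))\<^sup>*" using connected[OF assms head_in] .
  then obtain w where "(v, w) \<in> adjacency (edges T)" using False by (meson converse_rtranclE)
  then obtain c where "{v, w} = edge T c" by (auto simp: edges_def)
  then show ?thesis by (auto simp: edge_def)
qed blast

lemma S_table_Fin: "S_table T x y c (Fin d) = (if c \<noteq> d \<and> head T d \<in> P c then 1 else 0)"
  using edge_one_side[of c d] by (auto simp: edge_def)

end

definition table :: "('v, 'c) dtree \<Rightarrow> 'v \<Rightarrow> 'v \<Rightarrow> 'c \<Rightarrow> 'c extended \<Rightarrow> bool" where
  "table T x y c a \<longleftrightarrow> S_table T x y c a = 1"

text \<open>The conditions say which 0/1-tables arise from a tree with two marked vertices.\<close>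

definition valid_table :: "('c \<Rightarrow> 'c extended \<Rightarrow> bool) \<Rightarrow> bool" where
  "valid_table F \<longleftrightarrow> (\<forall>c. \<not> F c (Fin c)) \<and>
     (\<forall>c d a. c \<noteq> d \<longrightarrow> F c a = F c (Fin d) \<or> F d a = F d (Fin c))"

lemma table_simps:
  assumes "directed_labeled_tree T"
  shows "table T x y c (Fin d) \<longleftrightarrow> c \<noteq> d \<and> head T d \<in> pointed_component T c"
    "table T x y c Pinf \<longleftrightarrow> x \<in> pointed_component T c" "table T x y c Minf \<longleftrightarrow> y \<in> pointed_component T c"
  unfolding table_def S_table_Fin[OF assms] by auto

lemma tree_table_valid:
  assumes "(T, x, y) \<in> tree_triples" shows "valid_table (table T x y)"
proof -
  have T: "directed_labeled_tree T" and xy: "x \<in> vertices T" "y \<in> vertices T"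
    using assms by (auto simp: tree_triples_def)
  note t = table_simps[OF T]
  have "table T x y c a = table T x y c (Fin d) \<or> table T x y d a = table T x y d (Fin c)" if cd: "c \<noteq> d" for c d a
  proof (cases a)
    case (Fin b)
    show ?thesis
    proof (cases "b = c \<or> b = d")
      case True
      then show ?thesis using Fin by auto
    next
      case False
      then show ?thesis using sides_compatible[OF T cd head_in[OF T, of b]] cd unfolding Fin t by auto
    qed
  next
    case Pinf
    show ?thesis using sides_compatible[OF T cd xy(1)] cd unfolding Pinf t by auto
  next
    case Minf
    show ?thesis using sides_compatible[OF T cd xy(2)] cd unfolding Minf t by auto
  qed
  then show ?thesis unfolding valid_table_def using t(1) by blast
qed

text \<open>A vertex is determined by the set of edges that point towards it. These sets can be read off
  from the table: those of the endpoints of \<open>c\<close> differ in \<open>c\<close> alone.\<close>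

definition signature :: "('v, 'c) dtree \<Rightarrow> 'v \<Rightarrow> 'c set" where
  "signature T v = {c. v \<in> pointed_component T c}"

lemma signature_table:
  assumes T: "directed_labeled_tree T"
  shows "signature T (tail T c) = {d. table T x y d (Fin c)}"
    "signature T (head T c) = insert c {d. table T x y d (Fin c)}"
    "signature T x = {d. table T x y d Pinf}" "signature T y = {d. table T x y d Minf}"
proof -
  have "tail T c \<in> pointed_component T d \<longleftrightarrow> d \<noteq> c \<and> head T c \<in> pointed_component T d" for d
    using edge_one_side[OF T, of d c] tail_pointed[OF T, of c] by (cases "d = c") auto
  then show "signature T (tail T c) = {d. table T x y d (Fin c)}"
    unfolding signature_def table_simps[OF T] by simp
  have "head T c \<in> pointed_component T d \<longleftrightarrow> d = c \<or> d \<noteq> c \<and> head T c \<in> pointed_component T d" for d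
    using head_pointed[OF T, of c] by (cases "d = c") auto
  then show "signature T (head T c) = insert c {d. table T x y d (Fin c)}"
    unfolding signature_def table_simps[OF T] by auto
  show "signature T x = {d. table T x y d Pinf}" "signature T y = {d. table T x y d Minf}"
    unfolding signature_def table_simps[OF T] by simp_all
qed

lemma signature_inj:
  fixes T :: "('v, 'c::finite) dtree"
  assumes T: "directed_labeled_tree T" shows "inj_on (signature T) (vertices T)"
proof (rule inj_onI, rule ccontr)
  fix u v assume uv: "u \<in> vertices T" "v \<in> vertices T" "signature T u = signature T v" "u \<noteq> v"
  have "finite (edges T)" by (simp add: edges_def)
  then obtain c where "(u \<in> pointed_component T c) \<noteq> (v \<in> pointed_component T c)"
    using sides_separate[OF T uv(1,2,4)] by blast
  then show False using uv(3) unfolding signature_def by blast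
qed

lemma signature_image:
  assumes T: "directed_labeled_tree T"
  shows "signature T ` vertices T = (\<Union>c. {{d. table T x y d (Fin c)}, insert c {d. table T x y d (Fin c)}})"
proof -
  have "vertices T = (\<Union>c. {tail T c, head T c})"
    using vertex_incident[OF T] tail_in[OF T] head_in[OF T] by blast
  then have "signature T ` vertices T = (\<Union>c. {signature T (tail T c), signature T (head T c)})" by auto
  then show ?thesis by (simp only: signature_table(1,2)[OF T, of _ x y])
qed

lemma iso_same_table:
  assumes T: "directed_labeled_tree T" and T': "directed_labeled_tree T'"
    and f: "bij_betw f (vertices T) (vertices T')"
    and th: "\<And>c. f (tail T c) = tail T' c" "\<And>c. f (head T c) = head T' c"
    and xy: "x \<in> vertices T" "y \<in> vertices T"
  shows "table T x y = table T' (f x) (f y)"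
proof -
  have path: "(f u, f v) \<in> (adjacency (edges T' - {edge T' c}))\<^sup>*"
    if "(u, v) \<in> (adjacency (edges T - {edge T c}))\<^sup>*" for u v c
    using that
  proof (induction rule: rtrancl_induct)
    case (step y z)
    then obtain d where d: "{y, z} = edge T d" "d \<noteq> c" by (auto simp: edges_def)
    have "{f y, f z} = f ` {y, z}" by simp
    also have "\<dots> = edge T' d" unfolding d(1) by (simp add: edge_def th)
    finally have "(f y, f z) \<in> adjacency (edges T' - {edge T' c})"
      using d(2) edge_inj[OF T', of d c] edge_in[OF T', of d] by simp
    then show ?case using step.IH by (rule rtrancl_into_rtrancl[rotated])
  qed simp
  have comp: "f v \<in> pointed_component T' c \<longleftrightarrow> v \<in> pointed_component T c" if v: "v \<in> vertices T" for v c
  proof -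
    have fv: "f v \<in> vertices T'" by (rule bij_betw_apply[OF f v])
    show ?thesis
    proof (cases "v \<in> pointed_component T c")
      case True
      then have "(head T c, v) \<in> (adjacency (edges T - {edge T c}))\<^sup>*" by (simp add: pointed_component_def)
      from path[OF this] show ?thesis using True fv th by (simp add: pointed_component_def)
    next
      case False
      from path[OF other_side[OF T v, THEN iffD1, OF False]]
      show ?thesis using False other_side[OF T' fv] th by simp
    qed
  qed
  show ?thesis
  proof (intro ext)
    fix c a show "table T x y c a = table T' (f x) (f y) c a"
      using comp xy head_in[OF T] th(2) by (cases a) (auto simp: table_simps[OF T] table_simps[OF T'], metis+)
  qed
qed

text \<open>Match the vertices with equal signatures; by \<open>signature_image\<close> both trees have the same signatures.\<close>

lemma same_table_iso:
  fixes T :: "('v, 'c::finite) dtree" and T' :: "('w, 'c) dtree"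
  assumes T: "directed_labeled_tree T" and T': "directed_labeled_tree T'"
    and xy: "x \<in> vertices T" "y \<in> vertices T" "x' \<in> vertices T'" "y' \<in> vertices T'"
    and eq: "table T x y = table T' x' y'"
  shows "\<exists>f. bij_betw f (vertices T) (vertices T') \<and> f x = x' \<and> f y = y' \<and>
    (\<forall>c. f (tail T c) = tail T' c \<and> f (head T c) = head T' c)"
proof -
  note inj = signature_inj[OF T] and inj' = signature_inj[OF T']
  have im: "signature T ` vertices T = signature T' ` vertices T'"
    by (simp only: signature_image[OF T, of x y] signature_image[OF T', of x' y'] eq)
  define f where "f = inv_into (vertices T') (signature T') \<circ> signature T"
  have f: "f v = v'" if "v' \<in> vertices T'" "signature T v = signature T' v'" for v v'
    unfolding f_def using that inv_into_f_f[OF inj'] by simp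
  have "bij_betw (signature T) (vertices T) (signature T' ` vertices T')"
    using inj im by (simp add: bij_betw_def)
  moreover have "bij_betw (inv_into (vertices T') (signature T')) (signature T' ` vertices T') (vertices T')"
    using inj' by (intro bij_betw_inv_into) (simp add: bij_betw_def)
  ultimately have "bij_betw f (vertices T) (vertices T')" unfolding f_def by (rule bij_betw_trans)
  moreover have "f x = x'" using xy eq by (intro f) (simp_all add: signature_table(3)[OF T, of x y] signature_table(3)[OF T', of x' y'])
  moreover have "f y = y'" using xy eq by (intro f) (simp_all add: signature_table(4)[OF T, where x=x] signature_table(4)[OF T', where x=x'])
  moreover have "f (tail T c) = tail T' c" for c
    using eq tail_in[OF T'] by (intro f) (simp_all add: signature_table(1)[OF T, of _ x y] signature_table(1)[OF T', of _ x' y'])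
  moreover have "f (head T c) = head T' c" for c
    using eq head_in[OF T'] by (intro f) (simp_all add: signature_table(2)[OF T, of _ x y] signature_table(2)[OF T', of _ x' y'])
  ultimately show ?thesis by blast
qed

lemma triple_iso_iff:
  fixes T T' :: "('v, 'c::finite) dtree"
  shows "((T, x, y), (T', x', y')) \<in> triple_iso_rel \<longleftrightarrow>
    (T, x, y) \<in> tree_triples \<and> (T', x', y') \<in> tree_triples \<and> table T x y = table T' x' y'"
    (is "?l \<longleftrightarrow> ?r")
proof
  assume ?l
  then obtain f where "(T, x, y) \<in> tree_triples" "(T', x', y') \<in> tree_triples"
    "bij_betw f (vertices T) (vertices T')" "f x = x'" "f y = y'"
    "\<forall>c. f (tail T c) = tail T' c \<and> f (head T c) = head T' c" unfolding triple_iso_rel_def by blast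
  then show ?r using iso_same_table[of T T' f x y] unfolding tree_triples_def by auto
next
  assume r: ?r
  then show ?l using same_table_iso[of T T' x y x' y'] unfolding triple_iso_rel_def tree_triples_def by auto
qed

subsection \<open>The forest order of a table\<close>

text \<open>Taking the vertex at \<open>Pinf\<close> as root, \<open>ancestors F a\<close> are the edges that separate \<open>a\<close> from the root.\<close>

definition ancestors :: "('c \<Rightarrow> 'c extended \<Rightarrow> bool) \<Rightarrow> 'c extended \<Rightarrow> 'c set" where
  "ancestors F a = {d. a \<noteq> Fin d \<and> F d a \<noteq> F d Pinf}"

context
  fixes F :: "'c::finite \<Rightarrow> 'c extended \<Rightarrow> bool"
  assumes F: "valid_table F"
begin

lemma valid: "c \<noteq> d \<Longrightarrow> F c a = F c (Fin d) \<or> F d a = F d (Fin c)"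
  using F unfolding valid_table_def by blast

lemma anc_asym: "d \<in> ancestors F (Fin e) \<Longrightarrow> e \<notin> ancestors F (Fin d)"
  using valid[of d e Pinf] unfolding ancestors_def by auto

lemma anc_irrefl: "d \<notin> ancestors F (Fin d)" by (simp add: ancestors_def)

lemma anc_chain: "d \<in> ancestors F a \<Longrightarrow> e \<in> ancestors F a \<Longrightarrow> d \<noteq> e \<Longrightarrow> d \<in> ancestors F (Fin e) \<or> e \<in> ancestors F (Fin d)"
  using valid[of d e a] unfolding ancestors_def by auto

lemma anc_trans: "d \<in> ancestors F a \<Longrightarrow> e \<in> ancestors F (Fin d) \<Longrightarrow> e \<in> ancestors F a"
proof -
  assume d: "d \<in> ancestors F a" and e: "e \<in> ancestors F (Fin d)"
  have "d \<noteq> e" using e anc_irrefl by blast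
  moreover have "a \<noteq> Fin e" using anc_asym[of d e] d e by blast
  ultimately show ?thesis using d e valid[of d e a] valid[of d e Pinf] unfolding ancestors_def by auto
qed

text \<open>By \<open>anc_chain\<close> the ancestors of \<open>a\<close> are linearly ordered; the closest one is the parent.\<close>

lemma anc_parent:
  assumes "ancestors F a \<noteq> {}"
  shows "\<exists>!d. ancestors F a = insert d (ancestors F (Fin d))"
proof -
  let ?f = "\<lambda>d. card (ancestors F (Fin d))"
  have "Max (?f ` ancestors F a) \<in> ?f ` ancestors F a" using assms by (intro Max_in) auto
  then obtain d where d: "d \<in> ancestors F a" "?f d = Max (?f ` ancestors F a)" by auto
  have max: "?f e \<le> ?f d" if "e \<in> ancestors F a" for e unfolding d(2) using that by (intro Max_ge) auto
  have le: "e \<in> insert d (ancestors F (Fin d))" if e: "e \<in> ancestors F a" for e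
  proof (rule ccontr)
    assume n: "e \<notin> insert d (ancestors F (Fin d))"
    then have "d \<in> ancestors F (Fin e)" using anc_chain[OF d(1) e] by auto
    then have "insert d (ancestors F (Fin d)) \<subseteq> ancestors F (Fin e)" using anc_trans by blast
    then have "card (insert d (ancestors F (Fin d))) \<le> ?f e" by (intro card_mono) auto
    then show False using max[OF e] anc_irrefl by simp
  qed
  have eq: "ancestors F a = insert d (ancestors F (Fin d))"
  proof (intro equalityI subsetI)
    show "e \<in> ancestors F a" if "e \<in> insert d (ancestors F (Fin d))" for e
      using that d(1) anc_trans[OF d(1), of e] by auto
  qed (rule le)
  have uniq: "d' = d" if eq': "ancestors F a = insert d' (ancestors F (Fin d'))" for d'
  proof (rule ccontr)
    assume "d' \<noteq> d"
    then have "d \<in> ancestors F (Fin d')" "d' \<in> ancestors F (Fin d)" using eq eq' by auto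
    then show False using anc_asym by blast
  qed
  show ?thesis using eq uniq by (rule ex1I)
qed

end

text \<open>The tree of a valid table: its vertices are the sets \<open>ancestors F a\<close>, encoded by \<open>j\<close>, the root
  being the empty set. The edge \<open>c\<close> joins \<open>ancestors F (Fin c)\<close> to \<open>insert c (ancestors F (Fin c))\<close>.\<close>

definition table_tree :: "('c set \<Rightarrow> 'v) \<Rightarrow> ('c \<Rightarrow> 'c extended \<Rightarrow> bool) \<Rightarrow> ('v, 'c) dtree" where
  "table_tree j F =
     (let near = (\<lambda>c. j (ancestors F (Fin c))); far = (\<lambda>c. j (insert c (ancestors F (Fin c)))) in
      \<lparr>vertices = range near \<union> range far,
       tail = (\<lambda>c. if F c Pinf then far c else near c),
       head = (\<lambda>c. if F c Pinf then near c else far c)\<rparr>)"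

text \<open>Deleting the edge \<open>c\<close> separates the vertices whose set of ancestors contains \<open>c\<close> from the others, since
  the remaining edges join each vertex to its parent. So the tree has the prescribed table.\<close>

lemma table_tree_correct:
  fixes F :: "'c::finite \<Rightarrow> 'c extended \<Rightarrow> bool" and j :: "'c set \<Rightarrow> 'v"
  assumes F: "valid_table F" and j: "inj j"
  defines "T \<equiv> table_tree j F"
  shows "(T, j {}, j (ancestors F Minf)) \<in> tree_triples" and "table T (j {}) (j (ancestors F Minf)) = F"
proof -
  let ?anc = "\<lambda>c. ancestors F (Fin c)"
  define D where "D = inv_into UNIV j"
  have D [simp]: "D (j S) = S" for S using j by (simp add: D_def)
  have jeq [simp]: "j S = j S' \<longleftrightarrow> S = S'" for S S' using j by (simp add: inj_eq)
  define near where "near c = j (?anc c)" for c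
  define far where "far c = j (insert c (?anc c))" for c
  have V: "vertices T = range near \<union> range far" and t: "tail T c = (if F c Pinf then far c else near c)"
    and h: "head T c = (if F c Pinf then near c else far c)" for c
    by (simp_all add: T_def table_tree_def Let_def near_def far_def)
  have e: "edge T c = {near c, far c}" for c by (auto simp: edge_def t h)
  have irr: "c \<notin> ?anc c" for c by (rule anc_irrefl[OF F])
  have Dn: "D (near c) = ?anc c" and Df: "D (far c) = insert c (?anc c)" for c by (simp_all add: near_def far_def)
  have nf: "near c \<noteq> far c" for c using Dn[of c] Df[of c] irr[of c] by (metis insertI1)
  have einj: "edge T c = edge T d \<longleftrightarrow> c = d" for c d
  proof
    assume "edge T c = edge T d"
    then consider "near c = near d" "far c = far d" | "near c = far d" "far c = near d"
      unfolding e by (auto simp: doubleton_eq_iff)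
    then show "c = d"
    proof cases
      case 1 then show ?thesis unfolding near_def far_def using irr[of c] by auto
    next
      case 2 then show ?thesis unfolding near_def far_def using irr[of d] by auto
    qed
  qed simp
  have coord: "c \<in> D u \<longleftrightarrow> c \<in> D v" if "(u, v) \<in> (adjacency (edges T - {edge T c}))\<^sup>*" for u v c
    using that
  proof (induction rule: rtrancl_induct)
    case (step y z)
    then obtain d where d: "{y, z} = edge T d" "d \<noteq> c" by (auto simp: edges_def)
    then have "y = near d \<and> z = far d \<or> y = far d \<and> z = near d" unfolding e by (auto simp: doubleton_eq_iff)
    then have "c \<in> D y \<longleftrightarrow> c \<in> D z" using d(2) Dn[of d] Df[of d] by auto
    then show ?case using step.IH by simp
  qed simp
  have acyclic: "\<not> graph_cycle (edges T) vs" for vs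
  proof
    assume "graph_cycle (edges T) vs"
    then have n: "3 \<le> length vs" and ds: "distinct vs"
      and cyc: "\<And>i. i < length vs \<Longrightarrow> {vs ! i, vs ! (Suc i mod length vs)} \<in> edges T" unfolding graph_cycle_def by blast+
    have "Suc 0 mod length vs = 1" "0 < length vs" using n by auto
    then have "{vs ! 0, vs ! 1} \<in> edges T" using cyc[of 0] by simp
    then obtain c where c: "{vs ! 0, vs ! 1} = edge T c" by (auto simp: edges_def)
    have ne: "vs \<noteq> []" using n by auto
    have vs_ne: "vs ! i \<noteq> vs ! k" if "i \<noteq> k" "i < length vs" "k < length vs" for i k
      using nth_eq_iff_index_eq[OF ds that(2,3)] that(1) by simp
    let ?R = "adjacency (edges T - {edge T c})"
    have path: "(vs ! 1, vs ! k) \<in> ?R\<^sup>*" if "1 \<le> k" "k < length vs" for k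
      using that
    proof (induction k)
      case (Suc k)
      show ?case
      proof (cases "k = 0")
        case False
        have "vs ! 0 \<noteq> vs ! k" "vs ! 0 \<noteq> vs ! Suc k" using vs_ne[of 0 k] vs_ne[of 0 "Suc k"] False Suc.prems ne by auto
        then have "{vs ! k, vs ! Suc k} \<noteq> edge T c" unfolding c[symmetric] by (auto simp: doubleton_eq_iff)
        moreover have "{vs ! k, vs ! Suc k} \<in> edges T" using cyc[of k] Suc.prems by simp
        ultimately have "(vs ! k, vs ! Suc k) \<in> ?R" by simp
        moreover have "(vs ! 1, vs ! k) \<in> ?R\<^sup>*" using Suc False by simp
        ultimately show ?thesis by (rule rtrancl_into_rtrancl[rotated])
      qed simp
    qed simp
    let ?l = "length vs - 1"
    have "Suc ?l = length vs" using n by simp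
    then have "Suc ?l mod length vs = 0" by simp
    then have l: "?l < length vs" "1 \<le> ?l" "Suc ?l mod length vs = 0" "?l \<noteq> 1" "?l \<noteq> 0" using n by auto
    have "vs ! ?l \<noteq> vs ! 1" using vs_ne[of ?l 1] l n ne by auto
    moreover have "vs ! ?l \<noteq> vs ! 0" using vs_ne[of ?l 0] l n ne by auto
    ultimately have "{vs ! ?l, vs ! 0} \<noteq> edge T c" unfolding c[symmetric] by (auto simp: doubleton_eq_iff)
    then have "(vs ! ?l, vs ! 0) \<in> ?R" using cyc[OF l(1)] l(3) by simp
    then have "(vs ! 1, vs ! 0) \<in> ?R\<^sup>*" by (rule rtrancl_into_rtrancl[OF path[OF l(2,1)]])
    then have "c \<in> D (vs ! 1) \<longleftrightarrow> c \<in> D (vs ! 0)" by (rule coord)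
    moreover have "vs ! 0 = near c \<and> vs ! 1 = far c \<or> vs ! 0 = far c \<and> vs ! 1 = near c"
      using c unfolding e by (auto simp: doubleton_eq_iff)
    ultimately show False using Dn[of c] Df[of c] irr[of c] by auto
  qed
  \<comment> \<open>a nonempty set of ancestors is the far endpoint of its smallest element\<close>
  have up: "j (ancestors F a) = j {} \<or> (\<exists>d. j (ancestors F a) = far d \<and> card (?anc d) < card (ancestors F a))" for a
  proof (cases "ancestors F a = {}")
    case False
    then obtain d where d: "ancestors F a = insert d (?anc d)" using anc_parent[OF F] by blast
    then have "card (?anc d) < card (ancestors F a)" using irr[of d] by simp
    then show ?thesis using d unfolding far_def by metis
  qed simp
  have near_far: "(near c, far c) \<in> adjacency (edges T)" for c by (simp add: edges_def e[symmetric])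
  have conn: "(far c, j {}) \<in> (adjacency (edges T))\<^sup>*" for c
  proof (induction "card (?anc c)" arbitrary: c rule: less_induct)
    case less
    have "(near c, j {}) \<in> (adjacency (edges T))\<^sup>*"
      using up[of "Fin c"] less.hyps unfolding near_def by auto
    moreover have "(far c, near c) \<in> adjacency (edges T)" using near_far[of c] by (simp add: insert_commute)
    ultimately show ?case by (rule converse_rtrancl_into_rtrancl[rotated])
  qed
  have conn': "(v, j {}) \<in> (adjacency (edges T))\<^sup>*" if v: "v \<in> vertices T" for v
  proof -
    obtain c where "v = near c \<or> v = far c" using v V by blast
    moreover have "(near c, j {}) \<in> (adjacency (edges T))\<^sup>*"
      using near_far[of c] conn[of c] by (rule converse_rtrancl_into_rtrancl)
    ultimately show ?thesis using conn by blast
  qed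
  have root: "j {} \<in> vertices T"
  proof -
    obtain c where c: "\<And>d. card (?anc c) \<le> card (?anc d)"
      using ex_has_least_nat[of "\<lambda>_. True" undefined "\<lambda>c. card (?anc c)"] by blast
    then have "j (?anc c) = j {}" using up[of "Fin c"] by (meson not_le)
    then have "near c = j {}" by (simp only: near_def)
    then show ?thesis unfolding V by (metis UnI1 rangeI)
  qed
  have card2: "card (edge T c) = 2" for c using nf[of c] by (simp add: e)
  have "is_tree (vertices T) (edges T)"
    unfolding is_tree_def
  proof (intro conjI ballI)
    show "finite (vertices T)" by (simp add: V)
    show "vertices T \<noteq> {}" using root by blast
    show "x \<subseteq> vertices T" "card x = 2" if x: "x \<in> edges T" for x
    proof -
      obtain c where "x = edge T c" using x by (auto simp: edges_def)
      then show "x \<subseteq> vertices T" "card x = 2" using card2 by (auto simp: e V)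
    qed
    show "(u, v) \<in> (adjacency (edges T))\<^sup>*" if "u \<in> vertices T" "v \<in> vertices T" for u v
      by (rule rtrancl_trans[OF conn'[OF that(1)] connected_sym[OF conn'[OF that(2)]]])
    show "\<nexists>vs. graph_cycle (edges T) vs" using acyclic by blast
  qed
  moreover have "bij_betw (edge T) UNIV (edges T)" using einj by (auto simp: bij_betw_def edges_def inj_on_def)
  ultimately have dl: "directed_labeled_tree T" by (simp add: directed_labeled_tree_def)
  have y: "j (ancestors F Minf) \<in> vertices T" using up[of Minf] root V by auto
  show "(T, j {}, j (ancestors F Minf)) \<in> tree_triples" using dl root y by (simp add: tree_triples_def)
  have hc: "c \<in> D (head T c) \<longleftrightarrow> \<not> F c Pinf" and tc: "c \<in> D (tail T c) \<longleftrightarrow> F c Pinf" for c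
    using Dn[of c] Df[of c] irr[of c] by (simp_all add: h t)
  have comp: "v \<in> pointed_component T c \<longleftrightarrow> (c \<in> D v \<longleftrightarrow> \<not> F c Pinf)" if v: "v \<in> vertices T" for v c
  proof (cases "v \<in> pointed_component T c")
    case True
    then have "(head T c, v) \<in> (adjacency (edges T - {edge T c}))\<^sup>*" by (simp add: pointed_component_def)
    from coord[OF this] show ?thesis using True hc by simp
  next
    case False
    from coord[OF other_side[OF dl v, THEN iffD1, OF False]] show ?thesis using False tc by auto
  qed
  show "table T (j {}) (j (ancestors F Minf)) = F"
  proof (intro ext)
    fix c a
    show "table T (j {}) (j (ancestors F Minf)) c a = F c a"
    proof (cases a)
      case (Fin d)
      show ?thesis
      proof (cases "c = d")
        case True
        have "\<not> F d (Fin d)" using F unfolding valid_table_def by blast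
        then show ?thesis using True Fin by (simp add: table_simps[OF dl])
      next
        case False
        have "c \<in> D (head T d) \<longleftrightarrow> c \<in> ?anc d" using False Dn[of d] Df[of d] by (simp add: h)
        then show ?thesis
          using False comp[OF head_in[OF dl, of d], of c] unfolding Fin table_simps[OF dl] by (auto simp: ancestors_def)
      qed
    next
      case Pinf
      show ?thesis using comp[OF root, of c] unfolding Pinf table_simps[OF dl] by simp
    next
      case Minf
      show ?thesis using comp[OF y, of c] unfolding Minf table_simps[OF dl] by (auto simp: ancestors_def)
    qed
  qed
qed

text \<open>The choice of a member of the class is immaterial by \<open>triple_iso_iff\<close>.\<close>

definition class_table :: "((nat, 'c) dtree \<times> nat \<times> nat) set \<Rightarrow> 'c \<Rightarrow> 'c extended \<Rightarrow> bool" where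
  "class_table C = (case SOME t. t \<in> C of (T, x, y) \<Rightarrow> table T x y)"

lemma triple_iso_equiv: "equiv tree_triples (triple_iso_rel :: ((('v, 'c::finite) dtree \<times> 'v \<times> 'v) \<times> _) set)"
proof (rule equivI)
  show "triple_iso_rel \<subseteq> tree_triples \<times> (tree_triples :: (('v, 'c) dtree \<times> 'v \<times> 'v) set)" by (auto simp: triple_iso_rel_def)
  show "refl_on tree_triples (triple_iso_rel :: ((('v, 'c) dtree \<times> 'v \<times> 'v) \<times> _) set)"
    by (auto simp: refl_on_def triple_iso_iff)
  show "sym (triple_iso_rel :: ((('v, 'c) dtree \<times> 'v \<times> 'v) \<times> _) set)"
    by (rule symI) (auto simp: triple_iso_iff)
  show "trans (triple_iso_rel :: ((('v, 'c) dtree \<times> 'v \<times> 'v) \<times> _) set)"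
    by (rule transI) (auto simp: triple_iso_iff)
qed

lemma class_table_eq:
  fixes C :: "((nat, 'c::finite) dtree \<times> nat \<times> nat) set"
  assumes C: "C \<in> triple_classes" and t: "(T, x, y) \<in> C"
  shows "(T, x, y) \<in> tree_triples" "class_table C = table T x y"
proof -
  obtain s where s: "s \<in> tree_triples" "C = triple_iso_rel `` {s}"
    using C unfolding triple_classes_def by (rule quotientE)
  obtain T0 x0 y0 where s0: "s = (T0, x0, y0)" by (cases s)
  have mem: "(T', x', y') \<in> C \<longleftrightarrow> (T', x', y') \<in> tree_triples \<and> table T0 x0 y0 = table T' x' y'" for T' x' y'
    using s unfolding s0 by (auto simp: triple_iso_iff)
  show "(T, x, y) \<in> tree_triples" using t mem by blast
  have "(SOME t. t \<in> C) \<in> C" using t by (rule someI)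
  then show "class_table C = table T x y"
    using t mem unfolding class_table_def by (cases "SOME t. t \<in> C") auto
qed

theorem triple_classes_tables:
  "bij_betw class_table (triple_classes :: ((nat, 'c::finite) dtree \<times> nat \<times> nat) set set) {F. valid_table F}"
proof (rule bij_betw_imageI)
  have ne: "\<exists>T x y. (T, x, y) \<in> C" if "C \<in> triple_classes" for C :: "((nat, 'c) dtree \<times> nat \<times> nat) set"
  proof -
    have "C \<noteq> {}" using in_quotient_imp_non_empty[OF triple_iso_equiv] that unfolding triple_classes_def by blast
    then show ?thesis by auto
  qed
  show "inj_on class_table (triple_classes :: ((nat, 'c) dtree \<times> nat \<times> nat) set set)"
  proof (rule inj_onI)
    fix C C' :: "((nat, 'c) dtree \<times> nat \<times> nat) set"
    assume C: "C \<in> triple_classes" "C' \<in> triple_classes" and e: "class_table C = class_table C'"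
    obtain T x y where t: "(T, x, y) \<in> C" using ne[OF C(1)] by blast
    obtain T' x' y' where t': "(T', x', y') \<in> C'" using ne[OF C(2)] by blast
    have "((T, x, y), (T', x', y')) \<in> triple_iso_rel"
      using class_table_eq[OF C(1) t] class_table_eq[OF C(2) t'] e by (simp add: triple_iso_iff)
    then show "C = C'"
      using quotient_eqI[OF triple_iso_equiv _ _ t t'] C unfolding triple_classes_def by blast
  qed
  show "class_table ` (triple_classes :: ((nat, 'c) dtree \<times> nat \<times> nat) set set) = {F. valid_table F}"
  proof (intro equalityI subsetI)
    fix F assume "F \<in> class_table ` (triple_classes :: ((nat, 'c) dtree \<times> nat \<times> nat) set set)"
    then obtain C :: "((nat, 'c) dtree \<times> nat \<times> nat) set" where C: "C \<in> triple_classes" "F = class_table C" by blast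
    obtain T x y where t: "(T, x, y) \<in> C" using ne[OF C(1)] by blast
    show "F \<in> {F. valid_table F}" using class_table_eq[OF C(1) t] tree_table_valid C(2) by simp
  next
    fix F :: "'c \<Rightarrow> 'c extended \<Rightarrow> bool" assume "F \<in> {F. valid_table F}"
    then have F: "valid_table F" by simp
    obtain j :: "'c set \<Rightarrow> nat" where j: "inj j"
      using finite_imp_inj_to_nat_seg[of "UNIV :: 'c set set"] by auto
    let ?t = "(table_tree j F, j {}, j (ancestors F Minf))"
    have t: "?t \<in> tree_triples" and e: "table (table_tree j F) (j {}) (j (ancestors F Minf)) = F"
      using table_tree_correct[OF F j] by auto
    have C: "triple_iso_rel `` {?t} \<in> triple_classes" unfolding triple_classes_def using t by (rule quotientI)
    have "?t \<in> triple_iso_rel `` {?t}" using t by (simp add: triple_iso_iff)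
    from class_table_eq(2)[OF C this] show "F \<in> class_table ` triple_classes" using C e by (metis imageI)
  qed
qed

section \<open>Counting tables\<close>

text \<open>The functions whose iterates take every point of \<open>A\<close> to \<open>B\<close> eventually, that is, forests on \<open>A \<union> B\<close> with
  set of roots \<open>B\<close>, given by their parent functions.\<close>

definition acyclic_into :: "'a set \<Rightarrow> 'a set \<Rightarrow> ('a \<Rightarrow> 'a) set" where
  "acyclic_into A B = {f \<in> A \<rightarrow>\<^sub>E A \<union> B. \<forall>Z\<subseteq>A. f ` Z \<subseteq> Z \<longrightarrow> Z = {}}"

text \<open>Derivative of the binomial formula, here by counting pairs of a subset and one of its elements.\<close>

lemma weighted_subset_sum:
  fixes b c :: nat
  assumes "finite A"
  shows "(\<Sum>K\<in>Pow A. card K * (b ^ card K * c ^ card (A - K))) = card A * b * (b + c) ^ (card A - 1)"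
proof -
  have base: "(\<Sum>K\<in>Pow S. b ^ card K * c ^ card (S - K)) = (b + c) ^ card S" if "finite S" for S :: "'a set"
    using prod_add[OF that, of "\<lambda>_. b" "\<lambda>_. c"] by simp
  have fK: "finite K" if "K \<in> Pow A" for K using that assms finite_subset by auto
  have "(\<Sum>K\<in>Pow A. card K * (b ^ card K * c ^ card (A - K))) =
      (\<Sum>K\<in>Pow A. \<Sum>x\<in>A. if x \<in> K then b ^ card K * c ^ card (A - K) else 0)"
  proof (rule sum.cong[OF refl])
    fix K assume K: "K \<in> Pow A"
    then have "A \<inter> {x. x \<in> K} = K" by auto
    then show "card K * (b ^ card K * c ^ card (A - K)) = (\<Sum>x\<in>A. if x \<in> K then b ^ card K * c ^ card (A - K) else 0)"
      using assms by (simp add: sum.If_cases)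
  qed
  also have "\<dots> = (\<Sum>x\<in>A. \<Sum>K\<in>Pow A. if x \<in> K then b ^ card K * c ^ card (A - K) else 0)"
    by (rule sum.swap)
  also have "\<dots> = (\<Sum>x\<in>A. b * (b + c) ^ (card A - 1))"
  proof (rule sum.cong[OF refl])
    fix x assume x: "x \<in> A"
    have "(\<Sum>K\<in>Pow A. if x \<in> K then b ^ card K * c ^ card (A - K) else 0) =
        (\<Sum>K\<in>{K\<in>Pow A. x \<in> K}. b ^ card K * c ^ card (A - K))"
      using assms by (simp add: sum.If_cases Int_def)
    also have "\<dots> = (\<Sum>K\<in>Pow (A - {x}). b * (b ^ card K * c ^ card (A - {x} - K)))"
    proof (rule sum.reindex_bij_witness[of _ "insert x" "\<lambda>K. K - {x}"])
      fix K assume K: "K \<in> {K\<in>Pow A. x \<in> K}"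
      then have f: "finite K" and xK: "x \<in> K" using fK by auto
      show "insert x (K - {x}) = K" using xK by blast
      show "K - {x} \<in> Pow (A - {x})" using K by blast
      have "card K = Suc (card (K - {x}))" using card_Suc_Diff1[OF f xK] by simp
      moreover have "A - {x} - (K - {x}) = A - K" using xK by blast
      ultimately show "b * (b ^ card (K - {x}) * c ^ card (A - {x} - (K - {x}))) = b ^ card K * c ^ card (A - K)" by simp
    qed (use x in auto)
    also have "\<dots> = b * (b + c) ^ (card A - 1)"
      using base[of "A - {x}"] assms x by (simp add: sum_distrib_left[symmetric])
    finally show "(\<Sum>K\<in>Pow A. if x \<in> K then b ^ card K * c ^ card (A - K) else 0) = b * (b + c) ^ (card A - 1)" .
  qed
  finally show ?thesis by simp
qed

text \<open>Cayley's formula for forests, by induction over the set \<open>K\<close> of points that are mapped into \<open>B\<close>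
  directly: the remaining points are mapped acyclically into \<open>K\<close>.\<close>

theorem card_acyclic_into:
  assumes "finite A" "finite B" "A \<inter> B = {}"
  shows "card (acyclic_into A B) = (if A = {} then 1 else card B * (card A + card B) ^ (card A - 1))"
  using assms
proof (induction "card A" arbitrary: A B rule: less_induct)
  case less
  show ?case
  proof (cases "A = {}")
    case True
    then have "acyclic_into A B = {\<lambda>x. undefined}" by (auto simp: acyclic_into_def)
    then show ?thesis using True by simp
  next
    case False
    let ?a = "card A" and ?b = "card B"
    have a0: "?a > 0" using False less.prems by (simp add: card_gt_0_iff)
    define G where "G K = {f \<in> acyclic_into A B. {x\<in>A. f x \<in> B} = K}" for K
    have fin: "finite (acyclic_into A B)"
    proof (rule finite_subset)
      show "acyclic_into A B \<subseteq> A \<rightarrow>\<^sub>E A \<union> B" unfolding acyclic_into_def by (rule Collect_subset)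
      show "finite (A \<rightarrow>\<^sub>E A \<union> B)" using less.prems by (intro finite_PiE) simp_all
    qed
    have "f \<in> (\<Union>K\<in>Pow A. G K)" if "f \<in> acyclic_into A B" for f
      using that unfolding G_def by (intro UN_I[of "{x\<in>A. f x \<in> B}"]) simp_all
    then have "acyclic_into A B = (\<Union>K\<in>Pow A. G K)" unfolding G_def by blast
    then have "card (acyclic_into A B) = card (\<Union>K\<in>Pow A. G K)" by simp
    also have "\<dots> = (\<Sum>K\<in>Pow A. card (G K))"
    proof (rule card_UN_disjoint)
      show "\<forall>K\<in>Pow A. finite (G K)" using fin unfolding G_def by simp
      show "\<forall>K\<in>Pow A. \<forall>K'\<in>Pow A. K \<noteq> K' \<longrightarrow> G K \<inter> G K' = {}" unfolding G_def by blast
    qed (use less.prems in simp)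
    finally have card_sum: "card (acyclic_into A B) = (\<Sum>K\<in>Pow A. card (G K))" .
    have G_term: "?a * card (G K) = card K * (?b ^ card K * ?a ^ card (A - K))" if K: "K \<in> Pow A" for K
    proof (cases "K = {}")
      case True
      have "f \<notin> G K" for f
      proof
        assume f: "f \<in> G K"
        then have "f ` A \<subseteq> A" using True unfolding G_def acyclic_into_def by (auto simp: PiE_iff)
        then show False using f False unfolding G_def acyclic_into_def by blast
      qed
      then have "G K = {}" by blast
      then show ?thesis using True by simp
    next
      case K0: False
      have KA: "K \<subseteq> A" and fK: "finite K" using K less.prems finite_subset by auto
      have "bij_betw (\<lambda>f. (restrict f K, restrict f (A - K))) (G K) ((K \<rightarrow>\<^sub>E B) \<times> acyclic_into (A - K) K)"
      proof (rule bij_betw_byWitness[of _ "\<lambda>(g, h). \<lambda>x\<in>A. if x \<in> K then g x else h x"])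
        show "\<forall>f\<in>G K. (case (restrict f K, restrict f (A - K)) of (g, h) \<Rightarrow> \<lambda>x\<in>A. if x \<in> K then g x else h x) = f"
        proof
          fix f assume "f \<in> G K"
          then have "f \<in> A \<rightarrow>\<^sub>E A \<union> B" by (simp add: G_def acyclic_into_def)
          then show "(case (restrict f K, restrict f (A - K)) of (g, h) \<Rightarrow> \<lambda>x\<in>A. if x \<in> K then g x else h x) = f"
            by (auto simp: fun_eq_iff PiE_iff extensional_def)
        qed
        show "\<forall>gh\<in>(K \<rightarrow>\<^sub>E B) \<times> acyclic_into (A - K) K.
          (restrict (case gh of (g, h) \<Rightarrow> \<lambda>x\<in>A. if x \<in> K then g x else h x) K,
           restrict (case gh of (g, h) \<Rightarrow> \<lambda>x\<in>A. if x \<in> K then g x else h x) (A - K)) = gh"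
        proof
          fix gh assume "gh \<in> (K \<rightarrow>\<^sub>E B) \<times> acyclic_into (A - K) K"
          then obtain g h where gh: "gh = (g, h)" "g \<in> K \<rightarrow>\<^sub>E B" "h \<in> A - K \<rightarrow>\<^sub>E A - K \<union> K"
            by (auto simp: acyclic_into_def)
          show "(restrict (case gh of (g, h) \<Rightarrow> \<lambda>x\<in>A. if x \<in> K then g x else h x) K,
           restrict (case gh of (g, h) \<Rightarrow> \<lambda>x\<in>A. if x \<in> K then g x else h x) (A - K)) = gh"
            using gh(2,3) KA unfolding gh(1) by (auto simp: fun_eq_iff PiE_iff extensional_def)
        qed
        show "(\<lambda>f. (restrict f K, restrict f (A - K))) ` G K \<subseteq> (K \<rightarrow>\<^sub>E B) \<times> acyclic_into (A - K) K"
        proof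
          fix gh assume "gh \<in> (\<lambda>f. (restrict f K, restrict f (A - K))) ` G K"
          then obtain f where f: "f \<in> G K" "gh = (restrict f K, restrict f (A - K))" by blast
          have fA: "f \<in> A \<rightarrow>\<^sub>E A \<union> B" and ac: "\<And>Z. Z \<subseteq> A \<Longrightarrow> f ` Z \<subseteq> Z \<Longrightarrow> Z = {}" and fK': "{x\<in>A. f x \<in> B} = K"
            using f(1) by (auto simp: G_def acyclic_into_def)
          have "restrict f K \<in> K \<rightarrow>\<^sub>E B" using fK' by auto
          moreover have "restrict f (A - K) \<in> A - K \<rightarrow>\<^sub>E A - K \<union> K" using fA fK' KA by (auto simp: PiE_iff)
          moreover have "Z = {}" if Z: "Z \<subseteq> A - K" "restrict f (A - K) ` Z \<subseteq> Z" for Z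
          proof -
            have "f ` Z = restrict f (A - K) ` Z" using Z(1) by (intro image_cong) auto
            then show ?thesis using ac[of Z] Z by auto
          qed
          ultimately show "gh \<in> (K \<rightarrow>\<^sub>E B) \<times> acyclic_into (A - K) K" unfolding f(2) acyclic_into_def by blast
        qed
        show "(\<lambda>(g, h). \<lambda>x\<in>A. if x \<in> K then g x else h x) ` ((K \<rightarrow>\<^sub>E B) \<times> acyclic_into (A - K) K) \<subseteq> G K"
        proof
          fix f assume "f \<in> (\<lambda>(g, h). \<lambda>x\<in>A. if x \<in> K then g x else h x) ` ((K \<rightarrow>\<^sub>E B) \<times> acyclic_into (A - K) K)"
          then obtain g h where f: "f = (\<lambda>x\<in>A. if x \<in> K then g x else h x)" and g: "g \<in> K \<rightarrow>\<^sub>E B"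
            and h: "h \<in> A - K \<rightarrow>\<^sub>E A - K \<union> K" and ac: "\<And>Z. Z \<subseteq> A - K \<Longrightarrow> h ` Z \<subseteq> Z \<Longrightarrow> Z = {}"
            by (auto simp: acyclic_into_def)
          have fK1: "f x = g x" "f x \<in> B" if "x \<in> K" for x using that KA g by (auto simp: f)
          have fK2: "f x = h x" "f x \<in> A" if "x \<in> A - K" for x using that KA h by (auto simp: f PiE_iff)
          have fA: "f \<in> A \<rightarrow>\<^sub>E A \<union> B"
          proof (rule PiE_I)
            show "f x \<in> A \<union> B" if "x \<in> A" for x using fK1(2)[of x] fK2(2)[of x] that by (cases "x \<in> K") auto
            show "f x = undefined" if "x \<notin> A" for x using that by (simp add: f)
          qed
          have pre: "{x\<in>A. f x \<in> B} = K" using fK1(2) fK2(2) KA less.prems(3) by blast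
          have "Z = {}" if Z: "Z \<subseteq> A" "f ` Z \<subseteq> Z" for Z
          proof -
            have ZK: "Z \<subseteq> A - K"
            proof
              fix x assume x: "x \<in> Z"
              then have "f x \<in> A" using Z by blast
              then have "x \<notin> K" using fK1(2)[of x] less.prems(3) by blast
              then show "x \<in> A - K" using x Z(1) by blast
            qed
            then have "h ` Z = f ` Z" using fK2(1) by (intro image_cong) auto
            then show ?thesis using ac[OF ZK] Z(2) by simp
          qed
          then show "f \<in> G K" using fA pre unfolding G_def acyclic_into_def by blast
        qed
      qed
      from bij_betw_same_card[OF this] have "card (G K) = card (K \<rightarrow>\<^sub>E B) * card (acyclic_into (A - K) K)"
        by (simp only: card_cartesian_product)
      moreover have "card (K \<rightarrow>\<^sub>E B) = ?b ^ card K" using fK by (simp add: card_PiE)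
      moreover have "card (acyclic_into (A - K) K) = (if A - K = {} then 1 else card K * (card (A - K) + card K) ^ (card (A - K) - 1))"
      proof (rule less.hyps)
        show "card (A - K) < card A" using KA K0 less.prems by (intro psubset_card_mono) auto
      qed (use less.prems fK in auto)
      moreover have sum: "card (A - K) + card K = ?a"
        using card_Diff_subset[OF fK KA] card_mono[OF less.prems(1) KA] by simp
      ultimately have G: "card (G K) = ?b ^ card K * (if A - K = {} then 1 else card K * ?a ^ (card (A - K) - 1))" by simp
      show ?thesis
      proof (cases "A - K = {}")
        case True
        then have "K = A" using KA by blast
        then show ?thesis using G by simp
      next
        case False
        have "card (A - K) \<noteq> 0" using less.prems(1) False by simp
        then obtain m where m: "card (A - K) = Suc m" by (rule not0_implies_Suc[THEN exE])
        then show ?thesis using G False by (simp add: mult_ac)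
      qed
    qed
    have "?a * card (acyclic_into A B) = (\<Sum>K\<in>Pow A. card K * (?b ^ card K * ?a ^ card (A - K)))"
      unfolding card_sum sum_distrib_left using G_term by (rule sum.cong[OF refl])
    also have "\<dots> = ?a * (?b * (?a + ?b) ^ (?a - 1))"
      using weighted_subset_sum[OF less.prems(1), of ?b ?a] by (simp add: add.commute mult.assoc)
    finally show ?thesis using a0 False by simp
  qed
qed

text \<open>Rooted forests on the colors, with \<open>None\<close> as the parent of a root.\<close>

definition parent_functions :: "('c \<Rightarrow> 'c option) set" where
  "parent_functions = {f. \<forall>Z. f ` Z \<subseteq> Some ` Z \<longrightarrow> Z = {}}"

lemma card_parent_functions:
  "card (parent_functions :: ('c::finite \<Rightarrow> 'c option) set) = (card (UNIV :: 'c set) + 1) ^ (card (UNIV :: 'c set) - 1)"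
proof -
  let ?A = "range Some :: 'c option set" and ?B = "{None} :: 'c option set"
  have "bij_betw (\<lambda>f. \<lambda>z\<in>?A. f (the z)) parent_functions (acyclic_into ?A ?B)"
  proof (rule bij_betw_byWitness[of _ "\<lambda>g c. g (Some c)"])
    show "\<forall>f\<in>parent_functions. (\<lambda>c. (\<lambda>z\<in>?A. f (the z)) (Some c)) = f" by simp
    show "\<forall>g\<in>acyclic_into ?A ?B. (\<lambda>z\<in>?A. g (Some (the z))) = g"
    proof
      fix g assume "g \<in> acyclic_into ?A ?B"
      then have g: "g \<in> ?A \<rightarrow>\<^sub>E ?A \<union> ?B" unfolding acyclic_into_def by simp
      show "(\<lambda>z\<in>?A. g (Some (the z))) = g"
        by (rule extensionalityI[of _ ?A]) (use PiE_ext g in \<open>auto simp: PiE_def\<close>)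
    qed
    have u: "?A \<union> ?B = UNIV" by (simp add: UNIV_option_conv)
    show "(\<lambda>f. \<lambda>z\<in>?A. f (the z)) ` parent_functions \<subseteq> acyclic_into ?A ?B"
    proof
      fix g assume "g \<in> (\<lambda>f. \<lambda>z\<in>?A. f (the z)) ` parent_functions"
      then obtain f where f: "f \<in> parent_functions" "g = (\<lambda>z\<in>?A. f (the z))" by blast
      have "Z = {}" if Z: "Z \<subseteq> ?A" "g ` Z \<subseteq> Z" for Z
      proof -
        have ZS: "Z = Some ` (the ` Z)" using Z(1) by force
        have "f ` (the ` Z) = g ` Z" using Z(1) unfolding image_image f(2) by (intro image_cong) auto
        then have "f ` (the ` Z) \<subseteq> Some ` (the ` Z)" using Z(2) ZS by simp
        then have "the ` Z = {}" using f(1) unfolding parent_functions_def by blast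
        then show ?thesis by simp
      qed
      then show "g \<in> acyclic_into ?A ?B" unfolding acyclic_into_def u f(2) by auto
    qed
    show "(\<lambda>g c. g (Some c)) ` acyclic_into ?A ?B \<subseteq> parent_functions"
    proof
      fix f assume "f \<in> (\<lambda>g c. g (Some c)) ` acyclic_into ?A ?B"
      then obtain g where g: "g \<in> acyclic_into ?A ?B" "f = (\<lambda>c. g (Some c))" by blast
      have "Z = {}" if Z: "f ` Z \<subseteq> Some ` Z" for Z
      proof -
        have "g ` (Some ` Z) \<subseteq> Some ` Z" using Z unfolding g(2) image_image .
        moreover have "g ` W \<subseteq> W \<Longrightarrow> W = {}" if "W \<subseteq> ?A" for W
          using g(1) that unfolding acyclic_into_def by simp
        ultimately have "Some ` Z = {}" using image_mono[OF subset_UNIV] by metis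
        then show ?thesis by simp
      qed
      then show "f \<in> parent_functions" unfolding parent_functions_def by blast
    qed
  qed
  then have "card (parent_functions :: ('c \<Rightarrow> 'c option) set) = card (acyclic_into ?A ?B)" by (rule bij_betw_same_card)
  also have "\<dots> = (card (UNIV :: 'c set) + 1) ^ (card (UNIV :: 'c set) - 1)"
    using card_acyclic_into[of ?A ?B] by (auto simp: card_image)
  finally show ?thesis .
qed

text \<open>A valid table is encoded by the directions of the edges relative to the root, the parent function
  of the forest, and the parent of the second marked vertex.\<close>

definition parent :: "('c \<Rightarrow> 'c extended \<Rightarrow> bool) \<Rightarrow> 'c extended \<Rightarrow> 'c option" where
  "parent F a = (if ancestors F a = {} then None else Some (THE d. ancestors F a = insert d (ancestors F (Fin d))))"

definition table_code :: "('c \<Rightarrow> 'c extended \<Rightarrow> bool) \<Rightarrow> 'c set \<times> ('c \<Rightarrow> 'c option) \<times> 'c option" where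
  "table_code F = ({c. F c Pinf}, \<lambda>c. parent F (Fin c), parent F Minf)"

lemma parent_cases:
  fixes F :: "'c::finite \<Rightarrow> 'c extended \<Rightarrow> bool"
  assumes F: "valid_table F"
  shows "parent F a = None \<longleftrightarrow> ancestors F a = {}"
    and "parent F a = Some d \<Longrightarrow> ancestors F a = insert d (ancestors F (Fin d)) \<and> d \<notin> ancestors F (Fin d)"
proof -
  show "parent F a = None \<longleftrightarrow> ancestors F a = {}" by (simp add: parent_def)
  assume p: "parent F a = Some d"
  then have ne: "ancestors F a \<noteq> {}" by (auto simp: parent_def)
  then have "d = (THE d. ancestors F a = insert d (ancestors F (Fin d)))" using p by (simp add: parent_def)
  then show "ancestors F a = insert d (ancestors F (Fin d)) \<and> d \<notin> ancestors F (Fin d)"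
    using theI'[OF anc_parent[OF F ne]] anc_irrefl[OF F] by simp
qed

lemma table_eqI:
  fixes F G :: "'c::finite \<Rightarrow> 'c extended \<Rightarrow> bool"
  assumes F: "valid_table F" and G: "valid_table G" and inf: "\<And>c. F c Pinf = G c Pinf"
    and anc: "\<And>a. a \<noteq> Pinf \<Longrightarrow> ancestors F a = ancestors G a"
  shows "F = G"
proof (intro ext)
  fix c a
  show "F c a = G c a"
  proof (cases "a = Pinf \<or> a = Fin c")
    case True
    moreover have "\<not> F c (Fin c)" "\<not> G c (Fin c)" using F G by (simp_all add: valid_table_def)
    ultimately show ?thesis using inf[of c] by auto
  next
    case False
    then have "c \<in> ancestors F a \<longleftrightarrow> c \<in> ancestors G a" using anc[of a] by simp
    then show ?thesis using False inf[of c] by (simp add: ancestors_def) blast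
  qed
qed

lemma table_code_inj: "inj_on table_code {F :: 'c::finite \<Rightarrow> 'c extended \<Rightarrow> bool. valid_table F}"
proof (rule inj_onI)
  fix F G :: "'c \<Rightarrow> 'c extended \<Rightarrow> bool"
  assume "F \<in> {F. valid_table F}" "G \<in> {F. valid_table F}" and e: "table_code F = table_code G"
  then have F: "valid_table F" and G: "valid_table G" by simp_all
  have inf: "F c Pinf = G c Pinf" for c using e unfolding table_code_def by auto
  have par: "parent F a = parent G a" if "a \<noteq> Pinf" for a
    using e that unfolding table_code_def by (cases a) (auto dest: fun_cong)
  have "ancestors F a = ancestors G a" if "a \<noteq> Pinf" for a
    using that
  proof (induction "card (ancestors F a)" arbitrary: a rule: less_induct)
    case less
    show ?case
    proof (cases "parent F a")
      case None
      then show ?thesis using par[OF less.prems] parent_cases(1)[OF F, of a] parent_cases(1)[OF G, of a] by simp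
    next
      case (Some d)
      have "ancestors F a = insert d (ancestors F (Fin d))" "d \<notin> ancestors F (Fin d)"
        using parent_cases(2)[OF F Some] by auto
      moreover have "ancestors G a = insert d (ancestors G (Fin d))"
        using parent_cases(2)[OF G, of a d] par[OF less.prems] Some by simp
      moreover have "ancestors F (Fin d) = ancestors G (Fin d)"
        using calculation by (intro less.hyps) auto
      ultimately show ?thesis by simp
    qed
  qed
  then show "F = G" by (rule table_eqI[OF F G inf])
qed

text \<open>The forest gives the ancestors of each color, and the directions tell on which side of an edge the
  root lies; together they determine the table.\<close>

lemma table_code_surj:
  fixes D :: "'c::finite set"
  assumes f: "f \<in> parent_functions"
  shows "\<exists>F. valid_table F \<and> table_code F = (D, f, y)"
proof -
  define R where "R = {(c, d). f c = Some d}"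
  have sv: "single_valued R" by (auto simp: R_def single_valued_def)
  have acyc: "(c, c) \<notin> R\<^sup>+" for c
  proof
    assume cc: "(c, c) \<in> R\<^sup>+"
    let ?Z = "{d. (c, d) \<in> R\<^sup>+}"
    have "f ` ?Z \<subseteq> Some ` ?Z"
    proof
      fix z assume "z \<in> f ` ?Z"
      then obtain d where d: "(c, d) \<in> R\<^sup>+" "z = f d" by blast
      have "(d, c) \<in> R\<^sup>*"
        using single_valued_confluent[OF sv trancl_into_rtrancl[OF d(1)] trancl_into_rtrancl[OF cc]]
          rtrancl_trancl_trancl cc d(1)
      proof (elim disjE)
        assume "(c, d) \<in> R\<^sup>*"
        obtain e where e: "(c, e) \<in> R" "(e, c) \<in> R\<^sup>*" using tranclD[OF cc] by blast
        have "(d, c) \<in> R\<^sup>* \<or> (c, d) \<in> R\<^sup>*" using \<open>(c, d) \<in> R\<^sup>*\<close> by blast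
        show ?thesis using \<open>(c, d) \<in> R\<^sup>*\<close>
        proof (induction rule: rtrancl_induct)
          case (step u v)
          have uc: "(u, c) \<in> R\<^sup>+"
          proof (cases "u = c")
            case False
            then show ?thesis using step.IH by (simp add: rtrancl_eq_or_trancl)
          qed (use cc in simp)
          obtain w where w: "(u, w) \<in> R" "(w, c) \<in> R\<^sup>*" using tranclD[OF uc] by blast
          have "w = v" using sv w(1) step.hyps(2) unfolding single_valued_def by blast
          then show ?case using w(2) by simp
        qed simp
      qed simp
      then have dc: "(d, c) \<in> R\<^sup>+" using cc by (rule rtrancl_trancl_trancl)
      obtain e where e: "(d, e) \<in> R" "(e, c) \<in> R\<^sup>*" using tranclD[OF dc] by blast
      have "(c, e) \<in> R\<^sup>+" using d(1) e(1) by (rule trancl_into_trancl)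
      then show "z \<in> Some ` ?Z" using e(1) d(2) unfolding R_def by auto
    qed
    then have "?Z = {}" using f unfolding parent_functions_def by blast
    then show False using cc by blast
  qed
  define anc where "anc a = (case a of Fin c \<Rightarrow> {d. (c, d) \<in> R\<^sup>+} | Minf \<Rightarrow> (case y of None \<Rightarrow> {} | Some d \<Rightarrow> {e. (d, e) \<in> R\<^sup>*}) | Pinf \<Rightarrow> {})" for a
  have chain: "d = e \<or> d \<in> anc (Fin e) \<or> e \<in> anc (Fin d)" if de: "d \<in> anc a" "e \<in> anc a" for d e a
  proof -
    obtain c where "(c, d) \<in> R\<^sup>*" "(c, e) \<in> R\<^sup>*"
      using de unfolding anc_def by (cases a) (auto split: option.splits dest: trancl_into_rtrancl)
    then have "(d, e) \<in> R\<^sup>* \<or> (e, d) \<in> R\<^sup>*" by (rule single_valued_confluent[OF sv])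
    then show ?thesis unfolding anc_def by (auto simp: rtrancl_eq_or_trancl)
  qed
  have trans: "e \<in> anc a" if "d \<in> anc a" "e \<in> anc (Fin d)" for d e a
    using that unfolding anc_def by (cases a) (auto split: option.splits intro: trancl_trans)
  have irr: "d \<notin> anc (Fin d)" for d using acyc unfolding anc_def by simp
  define F where "F c a \<longleftrightarrow> a \<noteq> Fin c \<and> ((c \<in> D) \<noteq> (c \<in> anc a))" for c a
  have F: "valid_table F"
    unfolding valid_table_def
  proof (intro conjI allI impI)
    show "\<not> F c (Fin c)" for c by (simp add: F_def)
    fix c d a assume cd: "c \<noteq> (d :: 'c)"
    show "F c a = F c (Fin d) \<or> F d a = F d (Fin c)"
    proof (cases "a = Fin c \<or> a = Fin d")
      case False
      have "(c \<in> anc a \<longleftrightarrow> c \<in> anc (Fin d)) \<or> (d \<in> anc a \<longleftrightarrow> d \<in> anc (Fin c))"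
        using chain[of c a d] trans[of c a d] trans[of d a c] trans[of c "Fin d" d] irr[of d] cd by blast
      then show ?thesis unfolding F_def using False cd by auto
    qed auto
  qed
  have Pinf: "F c Pinf \<longleftrightarrow> c \<in> D" for c by (simp add: F_def anc_def)
  have anc: "ancestors F a = anc a" for a
    unfolding ancestors_def Pinf using irr by (auto simp: F_def)
  have par: "parent F a = q" if q: "anc a = (case q of None \<Rightarrow> {} | Some d \<Rightarrow> insert d (anc (Fin d)))" for a q
  proof (cases q)
    case None
    then show ?thesis using q by (simp add: parent_def anc)
  next
    case (Some d)
    then have ne: "ancestors F a \<noteq> {}" and e: "ancestors F a = insert d (ancestors F (Fin d))" using q anc by auto
    have "(THE d. ancestors F a = insert d (ancestors F (Fin d))) = d"
      by (rule the1_equality[OF anc_parent[OF F ne] e])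
    then show ?thesis using ne Some by (simp add: parent_def)
  qed
  have "parent F (Fin c) = f c" for c
  proof (rule par)
    have "(c, e) \<in> R\<^sup>+ \<longleftrightarrow> (\<exists>d. f c = Some d \<and> (d = e \<or> (d, e) \<in> R\<^sup>+))" for e
    proof
      assume "(c, e) \<in> R\<^sup>+"
      then obtain d where "(c, d) \<in> R" "(d, e) \<in> R\<^sup>*" by (blast dest: tranclD)
      then show "\<exists>d. f c = Some d \<and> (d = e \<or> (d, e) \<in> R\<^sup>+)" unfolding R_def by (auto simp: rtrancl_eq_or_trancl)
    next
      assume "\<exists>d. f c = Some d \<and> (d = e \<or> (d, e) \<in> R\<^sup>+)"
      then obtain d where d: "(c, d) \<in> R" "d = e \<or> (d, e) \<in> R\<^sup>+" unfolding R_def by blast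
      from d(2) show "(c, e) \<in> R\<^sup>+"
      proof
        assume "d = e"
        then show ?thesis using d(1) by blast
      next
        assume "(d, e) \<in> R\<^sup>+"
        with d(1) show ?thesis by (rule trancl_into_trancl2)
      qed
    qed
    then show "anc (Fin c) = (case f c of None \<Rightarrow> {} | Some d \<Rightarrow> insert d (anc (Fin d)))"
      unfolding anc_def by (cases "f c") auto
  qed
  moreover have "parent F Minf = y"
    by (rule par) (auto simp: anc_def rtrancl_eq_or_trancl split: option.splits)
  ultimately have "table_code F = (D, f, y)" unfolding table_code_def by (simp add: Pinf)
  then show ?thesis using F by blast
qed

lemma card_triple_classes:
  "card (triple_classes :: ((nat, 'c::finite) dtree \<times> nat \<times> nat) set set) =
    (2 * card (UNIV :: 'c set) + 2) ^ card (UNIV :: 'c set)"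
proof -
  let ?n = "card (UNIV :: 'c set)"
  have n0: "0 < ?n" by (simp add: finite_UNIV_card_ge_0)
  have c1: "card (UNIV :: 'c set set) = 2 ^ ?n" using card_Pow[of "UNIV :: 'c set"] by simp
  have c2: "card (UNIV :: 'c option set) = ?n + 1" by (simp add: UNIV_option_conv card_image)
  have mem: "table_code F \<in> UNIV \<times> parent_functions \<times> UNIV" if "valid_table F" for F :: "'c \<Rightarrow> 'c extended \<Rightarrow> bool"
  proof -
    have "Z = {}" if Z: "(\<lambda>c. parent F (Fin c)) ` Z \<subseteq> Some ` Z" for Z
    proof (rule ccontr)
      assume "Z \<noteq> {}"
      then obtain c where c: "c \<in> Z" "\<And>d. d \<in> Z \<Longrightarrow> card (ancestors F (Fin c)) \<le> card (ancestors F (Fin d))"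
        using ex_has_least_nat[of "\<lambda>c. c \<in> Z" _ "\<lambda>c. card (ancestors F (Fin c))"] by blast
      then obtain d where d: "d \<in> Z" "parent F (Fin c) = Some d" using Z by blast
      then have "card (ancestors F (Fin c)) = Suc (card (ancestors F (Fin d)))"
        using parent_cases(2)[OF \<open>valid_table F\<close> d(2)] by simp
      then show False using c(2)[OF d(1)] by simp
    qed
    then show ?thesis unfolding table_code_def parent_functions_def by simp
  qed
  have "table_code ` {F :: 'c \<Rightarrow> 'c extended \<Rightarrow> bool. valid_table F} = UNIV \<times> parent_functions \<times> UNIV"
  proof (intro equalityI subsetI)
    fix t :: "'c set \<times> ('c \<Rightarrow> 'c option) \<times> 'c option" assume "t \<in> UNIV \<times> parent_functions \<times> UNIV"
    then obtain D f y where t: "t = (D, f, y)" "f \<in> parent_functions" by auto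
    obtain F where "valid_table F" "table_code F = (D, f, y)" using table_code_surj[OF t(2)] by blast
    then show "t \<in> table_code ` {F. valid_table F}" using t(1) by (intro image_eqI[of _ _ F]) simp_all
  qed (use mem in blast)
  then have "bij_betw table_code {F :: 'c \<Rightarrow> 'c extended \<Rightarrow> bool. valid_table F} (UNIV \<times> parent_functions \<times> UNIV)"
    using table_code_inj by (simp add: bij_betw_def)
  then have "card {F :: 'c \<Rightarrow> 'c extended \<Rightarrow> bool. valid_table F} =
      card (UNIV \<times> parent_functions \<times> UNIV :: ('c set \<times> ('c \<Rightarrow> 'c option) \<times> 'c option) set)"
    by (rule bij_betw_same_card)
  also have "\<dots> = 2 ^ ?n * ((?n + 1) ^ (?n - 1) * (?n + 1))"
    unfolding card_cartesian_product c1 c2 card_parent_functions ..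
  also have "(?n + 1) ^ (?n - 1) * (?n + 1) = (?n + 1) ^ ?n"
    unfolding power_Suc2[symmetric] using n0 by simp
  also have "2 ^ ?n * (?n + 1) ^ ?n = (2 * ?n + 2) ^ ?n" by (simp add: power_mult_distrib[symmetric])
  finally show ?thesis using bij_betw_same_card[OF triple_classes_tables[where 'c='c]] by simp
qed

section \<open>Measures from tables\<close>

context measure_table
begin

text \<open>The group of definition is the stabilizer of a unique finite set, over which the weights are summed.\<close>

definition mu :: "('s, 'x) gset \<Rightarrow> int" where
  "mu X = total (supp (defgrp X)) (pts X) (act X)"

lemma mu_hat: "hat A X \<Longrightarrow> mu X = total A (pts X) (act X)"
  using hatD(1,4)[of A X] by (simp add: mu_def)

lemma mu_restrict: "hat A X \<Longrightarrow> fin E \<Longrightarrow> A \<subseteq> E \<Longrightarrow> mu X = total E (pts X) (act X)"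
  using total_restrict[OF hatD(2,3)] mu_hat by metis

lemma total_transfer:
  assumes s: "smooth A X a" and f: "bij_betw f X Y"
    and eq: "\<And>g x. g \<in> stab A \<Longrightarrow> x \<in> X \<Longrightarrow> f (a g x) = b g (f x)"
  shows "total A Y b = total A X a"
proof -
  have sY: "smooth A Y b" by (rule smooth_transfer(1)[OF s f]) (rule eq)
  have "pt_supp A b (f x) = pt_supp A a x" if "x \<in> X" for x
    by (rule smooth_transfer(2)[OF s f _ that]) (rule eq)
  then have "orbit_sum (stab A) a X (\<lambda>x. weight A (pt_supp A a x)) = orbit_sum (stab A) b Y (\<lambda>x. weight A (pt_supp A b x))"
    by (intro orbit_sum_iso[OF smooth_fin[OF s] smooth_acts[OF s] smooth_acts[OF sY] f eq pt_weight_invariant[OF sY]]) simp_all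
  then show ?thesis by (simp add: total_def)
qed

lemma mu_transitive:
  assumes X: "hat A X" and x: "x \<in> pts X" and o: "orb (stab A) (act X) x = pts X"
  shows "mu X = weight A (pt_supp A (act X) x)"
  unfolding mu_hat[OF X] total_def
  by (rule orbit_sum_single[OF hatD(4)[OF X] smooth_acts[OF hatD(2)[OF X]] pt_weight_invariant[OF hatD(2)[OF X]] x o])

lemma mu_iso:
  assumes X: "hat A X" and Y: "hat B Y" and iso: "gset_iso L H X Y"
  shows "mu X = mu Y"
proof -
  obtain W f where W: "open_subgroup L H W" "W \<subseteq> defgrp X" "W \<subseteq> defgrp Y" and f: "bij_betw f (pts X) (pts Y)"
    and eq: "\<forall>g\<in>W. \<forall>x\<in>pts X. f (act X g x) = act Y g (f x)" using iso unfolding gset_iso_def by blast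
  obtain E where E: "fin E" "W = stab E" using W(1) unfolding open_subgroup_iff by blast
  have AE: "A \<subseteq> E" and BE: "B \<subseteq> E"
    using W(2,3) E hatD(1)[OF X] hatD(1)[OF Y] stab_le_iff[OF hatD(4)[OF X] E(1)] stab_le_iff[OF hatD(4)[OF Y] E(1)] by auto
  have "total E (pts Y) (act Y) = total E (pts X) (act X)"
    by (rule total_transfer[OF smooth_restrict(1)[OF hatD(2)[OF X] E(1) AE] f]) (use eq E(2) in blast)
  then show ?thesis using mu_restrict[OF X E(1) AE] mu_restrict[OF Y E(1) BE] by simp
qed

lemma mu_one: "mu (gset_one L H) = 1"
proof -
  have "orb (stab {}) (act (gset_one L H)) () = pts (gset_one L H)" by (auto simp: gset_one_def orb_def intro: ident_H)
  moreover have "pt_supp {} (act (gset_one L H)) () = {}"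
    by (rule pt_suppI) (simp_all add: point_stab_def)
  ultimately show ?thesis using mu_transitive[OF hat_one, of "()"] by (simp add: gset_one_def)
qed

lemma mu_conj:
  assumes X: "hat A X" and g: "g \<in> H" shows "mu (gset_conj L H g X) = mu X"
proof -
  note c = hat_conj[OF X g] and p = gset_conj_simps(1)[OF X g]
  note A = hatD(4)[OF X] and ac = smooth_acts[OF hatD(2)[OF X]]
  have o: "orb (stab (g ` A)) (act (gset_conj L H g X)) = orb (stab A) (act X)" by (rule ext) (rule c(3))
  have "weight (g ` A) (pt_supp (g ` A) (act (gset_conj L H g X)) (SOME x. x \<in> Q)) = weight A (pt_supp A (act X) (SOME x. x \<in> Q))"
    if Q: "Q \<in> orb (stab A) (act X) ` pts X" for Q
  proof -
    obtain x where x: "x \<in> pts X" "Q = orb (stab A) (act X) x" using Q by blast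
    have y: "(SOME x. x \<in> Q) \<in> pts X" using orbit_rep[OF A ac x(1)] orb_subset[OF ac x(1)] x(2) by blast
    show ?thesis
      using c(2)[OF y] weight_image[OF g pt_supp_props(1,3)[OF hatD(2)[OF X] y]] by simp
  qed
  then show ?thesis unfolding mu_hat[OF c(1)] mu_hat[OF X] total_def orbit_sum_def o p by (intro sum.cong) simp_all
qed

lemma mu_coprod:
  assumes X: "hat A X" and Y: "hat B Y" shows "mu (gset_coprod X Y) = mu X + mu Y"
proof -
  let ?c = "act (gset_coprod X Y)" and ?E = "A \<union> B"
  note c = hat_coprod[OF X Y]
  have E: "fin ?E" "A \<subseteq> ?E" "B \<subseteq> ?E" using hatD(4)[OF X] hatD(4)[OF Y] by auto
  note sX = smooth_restrict(1)[OF hatD(2)[OF X] E(1,2)] and sY = smooth_restrict(1)[OF hatD(2)[OF Y] E(1,3)]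
  have bX: "bij_betw Inl (pts X) (Inl ` pts X)" and bY: "bij_betw Inr (pts Y) (Inr ` pts Y)" by (auto simp: bij_betw_def)
  have tX: "smooth ?E (Inl ` pts X) ?c" "total ?E (Inl ` pts X) ?c = mu X"
    using smooth_transfer(1)[OF sX bX, of ?c] total_transfer[OF sX bX, of ?c] c(2) mu_restrict[OF X E(1,2)] by simp_all
  have tY: "smooth ?E (Inr ` pts Y) ?c" "total ?E (Inr ` pts Y) ?c = mu Y"
    using smooth_transfer(1)[OF sY bY, of ?c] total_transfer[OF sY bY, of ?c] c(3) mu_restrict[OF Y E(1,3)] by simp_all
  have p: "pts (gset_coprod X Y) = Inl ` pts X \<union> Inr ` pts Y" by (simp add: gset_coprod_def Plus_def)
  have f: "finite (orb (stab ?E) ?c ` Inl ` pts X)" "finite (orb (stab ?E) ?c ` Inr ` pts Y)"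
    using hatD(3)[OF c(1)] unfolding p image_Un by simp_all
  have "total ?E (pts (gset_coprod X Y)) ?c = total ?E (Inl ` pts X) ?c + total ?E (Inr ` pts Y) ?c"
    unfolding total_def p by (rule orbit_sum_Un[OF E(1) smooth_acts[OF tX(1)] f(1) smooth_acts[OF tY(1)] f(2)]) auto
  then show ?thesis using tX(2) tY(2) mu_hat[OF c(1)] by simp
qed

text \<open>For transitive sets the three values are weights of extensions \<open>A \<subseteq> B\<close>, \<open>C \<subseteq> B\<close> and \<open>A \<subseteq> C\<close>, so this is
  the multiplicativity of weights in chains.\<close>

lemma mu_fiber:
  assumes X: "transitive_gset L H U X" and Y: "transitive_gset L H U Y" and f: "gset_map U f X Y" and y: "y \<in> pts Y"
  shows "mu X = mu (gset_fiber L f X Y y) * mu Y"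
proof -
  obtain A where A: "U = stab A" "hat A X" "\<And>x. x \<in> pts X \<Longrightarrow> orb (stab A) (act X) x = pts X" "pts X \<noteq> {}"
    using transitiveD[OF X] by metis
  obtain B where B: "U = stab B" "hat B Y" "\<And>y. y \<in> pts Y \<Longrightarrow> orb (stab B) (act Y) y = pts Y"
    using transitiveD[OF Y] by metis
  have BA: "B = A" using A(1) B(1) stab_eq_iff[OF hatD(4)[OF A(2)] hatD(4)[OF B(2)]] by simp
  note hY = B(2)[unfolded BA] and oY = B(3)[unfolded BA]
  have f': "gset_map (stab A) f X Y" using f A(1) by simp
  let ?C = "pt_supp A (act Y) y" and ?F = "gset_fiber L f X Y y"
  let ?B = "\<lambda>x. pt_supp A (act X) x"
  obtain x where x: "x \<in> pts X" "f x = y" using map_surj[OF A(2,4) hY oY f' y] by blast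
  then have xF: "x \<in> pts ?F" by (simp add: gset_fiber_def)
  have F: "hat ?C ?F" "orb (stab ?C) (act ?F) x = pts ?F" "pt_supp ?C (act ?F) x = ?B x" "?C \<subseteq> ?B x"
    using hat_fiber[OF A(2) A(3) hY f' y] xF by simp_all
  have "mu ?F = weight ?C (?B x)" using mu_transitive[OF F(1) xF F(2)] F(3) by simp
  moreover have "mu Y = weight A ?C" by (rule mu_transitive[OF hY y oY[OF y]])
  moreover have "mu X = weight A (?B x)" by (rule mu_transitive[OF A(2) x(1) A(3)[OF x(1)]])
  moreover have "weight A (?B x) = weight A ?C * weight ?C (?B x)"
    by (rule weight_trans[OF pt_supp_props(1)[OF hatD(2)[OF A(2)] x(1)] pt_supp_props(3)[OF hatD(2)[OF hY] y] F(4)])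
  ultimately show ?thesis by simp
qed

theorem mu_is_measure: "is_measure L H mu"
  unfolding is_measure_def
proof (intro conjI allI ballI impI)
  fix X Y :: "('s, nat) gset" assume a: "finitary_gset L H X \<and> finitary_gset L H Y \<and> gset_iso L H X Y"
  then have "finitary_gset L H X" "finitary_gset L H Y" by simp_all
  then have f: "finitary_gset L H X" "finitary_gset L H Y" by simp_all
  obtain A where A: "hat A X" using f(1) by (rule finitaryE)
  obtain B where B: "hat B Y" using f(2) by (rule finitaryE)
  note h = A B
  show "mu X = mu Y" by (rule mu_iso[OF h]) (use a in simp)
next
  fix X :: "('s, nat) gset" assume a: "finitary_gset L H X \<and> gset_iso L H X (gset_one L H)"
  then have "finitary_gset L H X" by simp
  then obtain A where h: "hat A X" by (rule finitaryE)
  show "mu X = 1" using mu_iso[OF h hat_one] a mu_one by simp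
next
  fix X :: "('s, nat) gset" and g assume g: "g \<in> H" and "finitary_gset L H X"
  then obtain A where "hat A X" by (elim finitaryE)
  then show "mu (gset_conj L H g X) = mu X" by (rule mu_conj[OF _ g])
next
  fix X Y Z :: "('s, nat) gset"
  assume "finitary_gset L H X \<and> finitary_gset L H Y \<and> finitary_gset L H Z \<and> gset_iso L H Z (gset_coprod X Y)"
  then have f: "finitary_gset L H X" "finitary_gset L H Y" "finitary_gset L H Z" and iso: "gset_iso L H Z (gset_coprod X Y)"
    by simp_all
  obtain A where A: "hat A X" using f(1) by (rule finitaryE)
  obtain B where B: "hat B Y" using f(2) by (rule finitaryE)
  obtain C where C: "hat C Z" using f(3) by (rule finitaryE)
  note h = A B C
  show "mu Z = mu X + mu Y" using mu_iso[OF h(3) hat_coprod(1)[OF h(1,2)] iso] mu_coprod[OF h(1,2)] by simp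
next
  fix U f and X Y :: "('s, nat) gset" and y
  assume "transitive_gset L H U X \<and> transitive_gset L H U Y \<and> gset_map U f X Y" "y \<in> pts Y"
  then show "mu X = mu (gset_fiber L f X Y y) * mu Y" using mu_fiber[of U X Y f y] by simp
qed

end

subsection \<open>Tables give measures\<close>

definition table_eta :: "('c \<Rightarrow> 'c extended \<Rightarrow> bool) \<Rightarrow> 'c extended \<Rightarrow> 'c extended \<Rightarrow> 'c \<Rightarrow> int" where
  "table_eta F a b c = of_bool (F c a) - of_bool (F c b) - of_bool (b = Fin c)"

text \<open>The three terms telescope.\<close>

lemma table_eta_split:
  assumes "valid_table F"
  shows "table_eta F a b d = table_eta F a (Fin c) d + table_eta F (Fin c) b d + (if c = d then 1 else 0)"
  by (simp add: table_eta_def)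

text \<open>Up to the deltas the difference of both sides is a product of a difference \<open>F c x - F c d\<close> and a difference
  \<open>F d x - F d c\<close>, where \<open>x\<close> is one of the ends; validity makes one of the factors vanish.\<close>

lemma table_eta_swap:
  assumes F: "valid_table F"
  shows "table_eta F a b c * table_eta F (Fin c) b d = table_eta F a b d * table_eta F a (Fin d) c"
proof (cases "c = d")
  case True
  have "\<not> F d (Fin d)" using F by (simp add: valid_table_def)
  then show ?thesis using True by (cases "b = Fin d") (simp_all add: table_eta_def of_bool_def)
next
  case False
  have n: "\<not> F c (Fin c)" "\<not> F d (Fin d)" using F by (simp_all add: valid_table_def)
  have v: "F c x = F c (Fin d) \<or> F d x = F d (Fin c)" for x using F False unfolding valid_table_def by blast
  consider "b = Fin c" | "b = Fin d" | "b \<noteq> Fin c" "b \<noteq> Fin d" by blast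
  then show ?thesis
  proof cases
    case 1 then show ?thesis using v[of a] False n by (auto simp: table_eta_def of_bool_def)
  next
    case 2 then show ?thesis using v[of a] False n by (auto simp: table_eta_def of_bool_def)
  next
    case 3 then show ?thesis using v[of a] v[of b] False by (auto simp: table_eta_def of_bool_def)
  qed
qed

lemma tree_eta: "eta T x y = table_eta (table T x y)"
proof (intro ext)
  fix a b c
  have "S_table T x y c e = of_bool (table T x y c e)" for e
    unfolding table_def by (cases e) auto
  then show "eta T x y a b c = table_eta (table T x y) a b c" by (simp add: eta_def table_eta_def)
qed

context colored_line
begin

lemma table_measure: "valid_table F \<Longrightarrow> measure_table cyc \<sigma> (table_eta F)"
  by (intro measure_table.intro measure_table_axioms.intro)
    (simp_all add: colored_line_axioms table_eta_split table_eta_swap)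

end

context measure_table
begin

text \<open>The recursion for \<open>nu\<close> removes the points of a tuple from right to left.\<close>

lemma weight_word:
  assumes "fin C" "set xs \<subseteq> L" "set xs \<inter> C = {}" "sorted_wrt (\<prec>) xs"
    and "\<And>x. x \<in> set xs \<Longrightarrow> lo C x = a \<and> hi C x = b"
    and "\<And>x y. x \<in> set xs \<Longrightarrow> y \<in> set xs \<Longrightarrow> same_cut C x y"
    and eta: "eta T u v = \<eta>"
  shows "weight C (C \<union> set xs) = nu T u v a b (map \<sigma> xs)"
  using assms(1-6)
proof (induction xs arbitrary: C b rule: rev_induct)
  case Nil
  then show ?case by (simp add: nu_simps)
next
  case (snoc z xs)
  have z: "z \<in> L" "z \<notin> C" and less: "\<And>x. x \<in> set xs \<Longrightarrow> x \<prec> z" and s: "sorted_wrt (\<prec>) xs"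
    using snoc.prems by (auto simp: sorted_wrt_append)
  have B: "fin (C \<union> set (xs @ [z]))" using snoc.prems(1,2) by (simp add: fin_def)
  have sub: "C \<subseteq> C \<union> set (xs @ [z])" by blast
  let ?C = "insert z C"
  have "weight C (C \<union> set (xs @ [z])) = weight1 C z * weight ?C (?C \<union> set xs)"
    using weight_insert[OF B sub, of z] z by simp
  moreover have "weight1 C z = \<eta> a b (\<sigma> z)" using snoc.prems(5)[of z] by (simp add: weight1_def)
  moreover have "weight ?C (?C \<union> set xs) = nu T u v a (Fin (\<sigma> z)) (map \<sigma> xs)"
  proof (rule snoc.IH)
    show "fin ?C" "set xs \<subseteq> L" "sorted_wrt (\<prec>) xs" using snoc.prems(1,2) z s by auto
    show "set xs \<inter> ?C = {}"
    proof -
      have "z \<notin> set xs" using less[of z] less_irrefl by metis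
      then show ?thesis using snoc.prems(3) by auto
    qed
    show "lo ?C x = a \<and> hi ?C x = Fin (\<sigma> z)" if x: "x \<in> set xs" for x
    proof -
      have cut: "same_cut C x z" using snoc.prems(6) x by simp
      have "\<not> z \<prec> x" using less[OF x] less_asym by blast
      then show ?thesis
        using lo_hi_insert_near(2)[OF snoc.prems(1) cut less[OF x]] lo_hi_insert_near(3)[OF snoc.prems(1) cut] snoc.prems(5)[of x] x by simp
    qed
    show "same_cut ?C x y" if "x \<in> set xs" "y \<in> set xs" for x y
      using snoc.prems(6)[of x y] less[OF that(1)] less[OF that(2)] that less_asym[of x z] less_asym[of y z]
      by (simp add: same_cut_def)
  qed
  ultimately show ?case by (simp add: nu_simps eta)
qed

lemma mu_word:
  assumes i: "interval_ends cyc p l r" and eta: "eta T u v = \<eta>"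
  shows "mu (word_gset cyc \<sigma> p l r w) = nu T u v (map_extended \<sigma> l) (map_extended \<sigma> r) w"
proof -
  let ?B = "{x. Fin x \<in> {l, r}}" and ?X = "word_gset cyc \<sigma> p l r w"
  note X = hat_word[OF i, where w = w]
  obtain xs where xs: "xs \<in> pts ?X" using X(2) by blast
  then have t: "set xs \<subseteq> line_interval cyc p l r" "sorted_wrt (\<prec>) xs" "map \<sigma> xs = w"
    by (simp_all add: word_gset_def word_tuples_def)
  note lh = interval_lo_hi[OF i]
  have "mu ?X = weight ?B (?B \<union> set xs)" using mu_transitive[OF X(1) xs X(4)[OF xs]] X(3)[OF xs] by simp
  also have "\<dots> = nu T u v (map_extended \<sigma> l) (map_extended \<sigma> r) (map \<sigma> xs)"
  proof (rule weight_word[OF ends_fin[OF i] _ _ t(2) _ _ eta])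
    show "set xs \<subseteq> L" using t(1) lh(4) by blast
    show "set xs \<inter> ?B = {}" using t(1) lh(3) by blast
    show "lo ?B x = map_extended \<sigma> l \<and> hi ?B x = map_extended \<sigma> r" if "x \<in> set xs" for x
      using lh(1,2)[of x] that t(1) by blast
    show "same_cut ?B x y" if "x \<in> set xs" "y \<in> set xs" for x y
      using lh(5)[of x y] that t(1) by blast
  qed
  finally show ?thesis using t(3) by simp
qed

lemma mu_tree_measure:
  assumes "eta T u v = \<eta>" shows "is_tree_measure cyc \<sigma> p T u v mu"
  unfolding is_tree_measure_def
proof (intro conjI allI impI)
  show "is_measure L H mu" by (rule mu_is_measure)
  fix l r w and X :: "('s, nat) gset"
  assume a: "interval_ends cyc p l r \<and> finitary_gset L H X \<and> gset_iso L H X (word_gset cyc \<sigma> p l r w)"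
  then have "finitary_gset L H X" by simp
  then obtain A where "hat A X" by (rule finitaryE)
  from mu_iso[OF this hat_word(1)] a show "mu X = nu T u v (map_extended \<sigma> l) (map_extended \<sigma> r) w"
    using mu_word[OF _ assms] by simp
qed

end

lemma tree_measure_exists:
  assumes "colored_line cyc \<sigma>" "(T, x, y) \<in> tree_triples"
  shows "\<exists>\<mu>. is_tree_measure cyc \<sigma> p T x y \<mu>"
proof -
  interpret colored_line cyc \<sigma> p by fact
  interpret measure_table cyc \<sigma> p "table_eta (table T x y)"
    by (rule table_measure[OF tree_table_valid[OF assms(2)]])
  show ?thesis using mu_tree_measure[OF tree_eta] by blast
qed

section \<open>Generators and relations for the ring of measures\<close>

context colored_line
begin

subsection \<open>Isomorphism classes\<close>

lemma countable_line: "countable L" by (rule countable_subset[OF subset_UNIV countable])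

lemma gset_iso_refl: "hat A X \<Longrightarrow> gset_iso L H X X"
  unfolding gset_iso_def
  by (intro exI[of _ "stab A"] exI[of _ id]) (simp add: stab_open[OF hatD(4)] hatD(1))

lemma gset_isoI:
  assumes "fin E" "stab E \<subseteq> defgrp X" "stab E \<subseteq> defgrp Y" "bij_betw f (pts X) (pts Y)"
    "\<And>g x. g \<in> stab E \<Longrightarrow> x \<in> pts X \<Longrightarrow> f (act X g x) = act Y g (f x)"
  shows "gset_iso L H X Y"
  unfolding gset_iso_def by (intro exI[of _ "stab E"] exI[of _ f] conjI ballI stab_open assms)

lemma gset_isoE:
  assumes "gset_iso L H X Y"
  obtains E f where "fin E" "stab E \<subseteq> defgrp X" "stab E \<subseteq> defgrp Y" "bij_betw f (pts X) (pts Y)"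
    "\<And>g x. g \<in> stab E \<Longrightarrow> x \<in> pts X \<Longrightarrow> f (act X g x) = act Y g (f x)"
proof -
  obtain W f where W: "open_subgroup L H W" "W \<subseteq> defgrp X" "W \<subseteq> defgrp Y" "bij_betw f (pts X) (pts Y)"
    "\<forall>g\<in>W. \<forall>x\<in>pts X. f (act X g x) = act Y g (f x)" using assms unfolding gset_iso_def by blast
  obtain E where "fin E" "W = stab E" using W(1) unfolding open_subgroup_iff by blast
  then show ?thesis using that[of E f] W by blast
qed

lemma gset_iso_sym:
  assumes X: "hat A X" and iso: "gset_iso L H X Y" shows "gset_iso L H Y X"
proof -
  obtain E f where E: "fin E" "stab E \<subseteq> defgrp X" "stab E \<subseteq> defgrp Y" and f: "bij_betw f (pts X) (pts Y)"
    and eq: "\<And>g x. g \<in> stab E \<Longrightarrow> x \<in> pts X \<Longrightarrow> f (act X g x) = act Y g (f x)"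
    using gset_isoE[OF iso] by blast
  have inj: "inj_on f (pts X)" using f by (rule bij_betw_imp_inj_on)
  show ?thesis
  proof (rule gset_isoI[OF E(1,3,2) bij_betw_inv_into[OF f]])
    fix g y assume g: "g \<in> stab E" and y: "y \<in> pts Y"
    define x where "x = inv_into (pts X) f y"
    have x: "x \<in> pts X" "f x = y" using f y unfolding x_def bij_betw_def by (auto simp: inv_into_into f_inv_into_f)
    have "g \<in> stab A" using g E(2) hatD(1)[OF X] by blast
    then have "act X g x \<in> pts X" using acts_closed[OF smooth_acts[OF hatD(2)[OF X]]] x(1) by blast
    then show "inv_into (pts X) f (act Y g y) = act X g (inv_into (pts X) f y)"
      using eq[OF g x(1)] x inv_into_f_f[OF inj] by (simp flip: x_def) (metis)
  qed
qed

lemma gset_iso_trans: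
  assumes "gset_iso L H X Y" "gset_iso L H Y Z" shows "gset_iso L H X Z"
proof -
  obtain E f where E: "fin E" "stab E \<subseteq> defgrp X" "stab E \<subseteq> defgrp Y" and f: "bij_betw f (pts X) (pts Y)"
    and eq: "\<And>g x. g \<in> stab E \<Longrightarrow> x \<in> pts X \<Longrightarrow> f (act X g x) = act Y g (f x)"
    using gset_isoE[OF assms(1)] by blast
  obtain E' f' where E': "fin E'" "stab E' \<subseteq> defgrp Y" "stab E' \<subseteq> defgrp Z" and f': "bij_betw f' (pts Y) (pts Z)"
    and eq': "\<And>g x. g \<in> stab E' \<Longrightarrow> x \<in> pts Y \<Longrightarrow> f' (act Y g x) = act Z g (f' x)"
    using gset_isoE[OF assms(2)] by blast
  show ?thesis
  proof (rule gset_isoI[of "E \<union> E'" X Z "f' \<circ> f"])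
    show "fin (E \<union> E')" using E(1) E'(1) by simp
    show "stab (E \<union> E') \<subseteq> defgrp X" "stab (E \<union> E') \<subseteq> defgrp Z" using E(2) E'(3) unfolding stab_Un by auto
    show "bij_betw (f' \<circ> f) (pts X) (pts Z)" by (rule bij_betw_trans[OF f f'])
    fix g x assume g: "g \<in> stab (E \<union> E')" and x: "x \<in> pts X"
    have fx: "f x \<in> pts Y" by (rule bij_betw_apply[OF f x])
    have g': "g \<in> stab E" "g \<in> stab E'" using g unfolding stab_Un by auto
    show "(f' \<circ> f) (act X g x) = act Z g ((f' \<circ> f) x)" using eq[OF g'(1) x] eq'[OF g'(2) fx] by simp
  qed
qed

abbreviation (input) "var X \<equiv> gset_var L H X"
abbreviation (input) "\<R> \<equiv> carrier (theta_poly_ring L H)"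
abbreviation (input) "J \<equiv> theta_ideal L H"

lemma var_eq:
  assumes X: "hat A X" and Y: "hat B Y" and iso: "gset_iso L H X Y" shows "var X = var Y"
proof -
  have "gset_iso L H X Z \<longleftrightarrow> gset_iso L H Y Z" for Z :: "('s, nat) gset"
    using gset_iso_trans[OF iso, of Z] gset_iso_trans[OF gset_iso_sym[OF X iso], of Z] by blast
  then show ?thesis by (simp add: gset_var_def gset_class_def)
qed

lemma nat_copy:
  assumes "finitary_gset L H X"
  obtains Y :: "('s, nat) gset" where "finitary_gset L H Y" "gset_iso L H X Y"
  using finitary_gset_nat_copy[OF countable_line subgroup_H assms] by blast

lemma gen_ring_eq: "\<R> = carrier (int_poly_ring {gset_class L H X | X :: ('s, nat) gset. finitary_gset L H X})"
  by (simp add: theta_poly_ring_def)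

lemma var_closed:
  assumes X: "finitary_gset L H X" shows "var X \<in> \<R>"
proof -
  obtain A where A: "hat A X" using X by (rule finitaryE)
  obtain Y :: "('s, nat) gset" where Y: "finitary_gset L H Y" "gset_iso L H X Y" by (rule nat_copy[OF X])
  obtain B where B: "hat B Y" using Y(1) by (rule finitaryE)
  have "var Y \<in> \<R>" unfolding gen_ring_eq gset_var_def using Y(1) by (intro poly_var_closed) blast
  then show ?thesis using var_eq[OF A B Y(2)] by simp
qed

subsection \<open>Congruence modulo the relations\<close>

lemmas gen_closed = poly_add_closed[where V = "{gset_class L H X | X :: ('s, nat) gset. finitary_gset L H X}", folded gen_ring_eq]
  poly_mult_closed[where V = "{gset_class L H X | X :: ('s, nat) gset. finitary_gset L H X}", folded gen_ring_eq]
  poly_diff_closed[where V = "{gset_class L H X | X :: ('s, nat) gset. finitary_gset L H X}", folded gen_ring_eq]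
  poly_uminus_closed[where V = "{gset_class L H X | X :: ('s, nat) gset. finitary_gset L H X}", folded gen_ring_eq]
  poly_of_int_closed[where V = "{gset_class L H X | X :: ('s, nat) gset. finitary_gset L H X}", folded gen_ring_eq]
  poly_one_closed[where V = "{gset_class L H X | X :: ('s, nat) gset. finitary_gset L H X}", folded gen_ring_eq]
  poly_zero_closed[where V = "{gset_class L H X | X :: ('s, nat) gset. finitary_gset L H X}", folded gen_ring_eq]

lemmas gen_sum_prod_closed = poly_sum_closed[where V = "{gset_class L H X | X :: ('s, nat) gset. finitary_gset L H X}", folded gen_ring_eq]
  poly_prod_closed[where V = "{gset_class L H X | X :: ('s, nat) gset. finitary_gset L H X}", folded gen_ring_eq]

lemma cring_gen: "cring (theta_poly_ring L H)" unfolding theta_poly_ring_def by (rule cring_int_poly_ring)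

lemma gen_ring_simps:
  "a \<otimes>\<^bsub>theta_poly_ring L H\<^esub> b = a * b" "a \<oplus>\<^bsub>theta_poly_ring L H\<^esub> b = a + b"
  "\<one>\<^bsub>theta_poly_ring L H\<^esub> = 1" "\<zero>\<^bsub>theta_poly_ring L H\<^esub> = 0"
  by (simp_all add: theta_poly_ring_def int_poly_ring_simps(2-))

lemma relations_closed: "theta_relations L H \<subseteq> \<R>"
proof
  fix r assume "r \<in> theta_relations L H"
  then consider "r = var (gset_one L H) - 1"
    | g and X :: "('s, nat) gset" where "g \<in> H" "finitary_gset L H X" "r = var (gset_conj L H g X) - var X"
    | X Y :: "('s, nat) gset" where "finitary_gset L H X" "finitary_gset L H Y" "r = var (gset_coprod X Y) - (var X + var Y)"
    | U f y and X Y :: "('s, nat) gset" where "transitive_gset L H U X" "transitive_gset L H U Y" "gset_map U f X Y" "y \<in> pts Y"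
      "r = var X - var (gset_fiber L f X Y y) * var Y"
    unfolding theta_relations_def by blast
  then show "r \<in> \<R>"
  proof cases
    case 1 then show ?thesis using var_closed[OF finitary_one] by (simp add: gen_closed)
  next
    case 2 then show ?thesis using var_closed[OF finitary_conj[OF 2(2,1)]] var_closed[OF 2(2)] by (simp add: gen_closed)
  next
    case 3 then show ?thesis using var_closed[OF finitary_coprod[OF 3(1,2)]] var_closed[OF 3(1)] var_closed[OF 3(2)] by (simp add: gen_closed)
  next
    case 4
    have "finitary_gset L H X" "finitary_gset L H Y" using 4(1,2) by (simp_all add: transitive_gset_def)
    then show ?thesis using var_closed[OF finitary_fiber[OF 4(1-4)]] 4(5) by (simp add: gen_closed var_closed)
  qed
qed

lemma ideal_J: "ideal J (theta_poly_ring L H)"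
  unfolding theta_ideal_def by (rule ring.genideal_ideal[OF cring.axioms(1)[OF cring_gen] relations_closed])

lemma J_add: "a \<in> J \<Longrightarrow> b \<in> J \<Longrightarrow> a + b \<in> J"
  using additive_subgroup.a_closed[OF ideal.axioms(1)[OF ideal_J]] by (simp add: gen_ring_simps)

lemma J_mult: "a \<in> \<R> \<Longrightarrow> b \<in> J \<Longrightarrow> a * b \<in> J"
  using ideal.I_l_closed[OF ideal_J, of b a] by (simp add: gen_ring_simps)

lemma J_zero: "0 \<in> J"
  using additive_subgroup.zero_closed[OF ideal.axioms(1)[OF ideal_J]] by (simp add: gen_ring_simps)

lemma J_uminus: "a \<in> J \<Longrightarrow> - a \<in> J"
  using J_mult[OF gen_closed(5)[of "-1"], of a] by simp

lemma J_diff: "a \<in> J \<Longrightarrow> b \<in> J \<Longrightarrow> a - b \<in> J"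
  using J_add[OF _ J_uminus, of a b] by simp

lemma relation_J: "r \<in> theta_relations L H \<Longrightarrow> r \<in> J"
  unfolding theta_ideal_def using ring.genideal_self[OF cring.axioms(1)[OF cring_gen] relations_closed] by blast

text \<open>Equality in \<open>\<Theta>(H)\<close> of the elements represented by two polynomials.\<close>

definition eqv (infix "\<approx>" 50) where "a \<approx> b \<longleftrightarrow> a - b \<in> theta_ideal L H"

lemma eqv_refl [simp]: "a \<approx> a" by (simp add: eqv_def J_zero)
lemma eqv_sym: "a \<approx> b \<Longrightarrow> b \<approx> a" unfolding eqv_def using J_uminus[of "a - b"] by simp
lemma eqv_trans [trans]: "a \<approx> b \<Longrightarrow> b \<approx> r \<Longrightarrow> a \<approx> r" unfolding eqv_def using J_add[of "a - b" "b - r"] by simp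
lemma eqv_add: "a \<approx> b \<Longrightarrow> a' \<approx> b' \<Longrightarrow> a + a' \<approx> b + b'"
  unfolding eqv_def using J_add[of "a - b" "a' - b'"] by (simp add: algebra_simps)
lemma eqv_diff: "a \<approx> b \<Longrightarrow> a' \<approx> b' \<Longrightarrow> a - a' \<approx> b - b'"
  unfolding eqv_def using J_diff[of "a - b" "a' - b'"] by (simp add: algebra_simps)
lemma eqv_mult: "a \<approx> b \<Longrightarrow> a' \<approx> b' \<Longrightarrow> a \<in> \<R> \<Longrightarrow> b' \<in> \<R> \<Longrightarrow> a * a' \<approx> b * b'"
  unfolding eqv_def using J_add[OF J_mult[of a "a' - b'"] J_mult[of b' "a - b"]] by (simp add: algebra_simps)
lemma eqv_sum: "(\<And>i. i \<in> K \<Longrightarrow> f i \<approx> g i) \<Longrightarrow> sum f K \<approx> sum g K"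
  by (induction K rule: infinite_finite_induct) (simp_all add: eqv_add)
lemma eqv_zero: "a \<approx> 0 \<longleftrightarrow> a \<in> J" by (simp add: eqv_def)

lemma var_one: "var (gset_one L H) \<approx> 1"
  unfolding eqv_def by (rule relation_J) (simp add: theta_relations_def)

lemma var_conj: "g \<in> H \<Longrightarrow> finitary_gset L H X \<Longrightarrow> var (gset_conj L H g X) \<approx> var X" for X :: "('s, nat) gset"
  unfolding eqv_def by (rule relation_J) (auto simp: theta_relations_def)

lemma var_coprod: "finitary_gset L H X \<Longrightarrow> finitary_gset L H Y \<Longrightarrow> var (gset_coprod X Y) \<approx> var X + var Y"
  for X Y :: "('s, nat) gset"
  unfolding eqv_def by (rule relation_J) (auto simp: theta_relations_def)

lemma var_fiber:
  fixes X Y :: "('s, nat) gset"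
  assumes "transitive_gset L H U X" "transitive_gset L H U Y" "gset_map U f X Y" "y \<in> pts Y"
  shows "var X \<approx> var (gset_fiber L f X Y y) * var Y"
  unfolding eqv_def by (rule relation_J) (use assms in \<open>auto simp: theta_relations_def\<close>)

subsection \<open>Transitive sets with points in the natural numbers\<close>

text \<open>The finite sets are enumerated since the symbols of \<open>\<Theta>(H)\<close> and the arguments of measures are sets of
  natural numbers.\<close>

definition set_code :: "'s set \<Rightarrow> nat" where
  "set_code = (SOME f. inj_on f {A. fin A})"

lemma set_code_inj: "inj_on set_code {A. fin A}"
proof -
  have "countable {A. fin A}" unfolding fin_def by (rule countable_Collect_finite_subset[OF countable_line])
  then show ?thesis unfolding set_code_def countable_def by (rule someI_ex)
qed

text \<open>The set of translates of \<open>B\<close> under \<open>stab A\<close>, which is the coset space \<open>stab A / stab B\<close>.\<close>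

definition coset_gset :: "'s set \<Rightarrow> 's set \<Rightarrow> ('s, nat) gset" where
  "coset_gset A B = \<lparr>defgrp = stab A, pts = set_code ` translates A B,
     act = (\<lambda>g. \<lambda>n\<in>set_code ` translates A B. set_code (g ` inv_into {A. fin A} set_code n))\<rparr>"

lemma coset_gset:
  assumes B: "fin B" "A \<subseteq> B"
  shows "bij_betw set_code (translates A B) (pts (coset_gset A B))"
    and "S \<in> translates A B \<Longrightarrow> act (coset_gset A B) g (set_code S) = set_code (g ` S)"
    and "hat A (coset_gset A B)" and "finitary_gset L H (coset_gset A B)"
    and "S \<in> translates A B \<Longrightarrow> pt_supp A (act (coset_gset A B)) (set_code S) = S"
    and "n \<in> pts (coset_gset A B) \<Longrightarrow> orb (stab A) (act (coset_gset A B)) n = pts (coset_gset A B)"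
    and "pts (coset_gset A B) \<noteq> {}"
proof -
  let ?X = "coset_gset A B"
  note T = translates_action[OF B] and A = fin_subset[OF B]
  have sub: "translates A B \<subseteq> {A. fin A}" using translates_fin[OF B(1)] by blast
  have p: "pts ?X = set_code ` translates A B" by (simp add: coset_gset_def)
  show bij: "bij_betw set_code (translates A B) (pts ?X)"
    using inj_on_subset[OF set_code_inj sub] p by (simp add: bij_betw_def)
  show act: "act ?X g (set_code S) = set_code (g ` S)" if "S \<in> translates A B" for S g
    using that sub inv_into_f_f[OF set_code_inj, of S] by (auto simp: coset_gset_def)
  have t1: "smooth A (pts ?X) (act ?X)"
    by (rule smooth_transfer(1)[OF T(1) bij]) (simp add: act)
  show supp: "pt_supp A (act ?X) (set_code S) = S" if S: "S \<in> translates A B" for S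
  proof -
    have "pt_supp A (act ?X) (set_code S) = pt_supp A (`) S"
      by (rule smooth_transfer(2)[OF T(1) bij _ S]) (simp add: act)
    then show ?thesis using T(2)[OF S] by simp
  qed
  have "finite (orb (stab A) (act ?X) ` pts ?X)"
    by (rule smooth_transfer(3)[OF T(1) bij]) (simp_all add: act T(4))
  then show h: "hat A ?X" unfolding hat_def using t1 by (simp add: coset_gset_def)
  show "finitary_gset L H ?X" by (rule finitaryI[OF h]) (simp add: coset_gset_def)
  show "pts ?X \<noteq> {}" using translates_self[OF A fin_line[OF B(1)]] p by blast
  show "orb (stab A) (act ?X) n = pts ?X" if n: "n \<in> pts ?X" for n
  proof -
    obtain S where S: "S \<in> translates A B" "n = set_code S" using n p by blast
    have "orb (stab A) (act ?X) n = set_code ` orb (stab A) (`) S"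
      unfolding orb_def image_image S(2) using act[OF S(1)] by simp
    then show ?thesis using T(3)[OF S(1)] p by simp
  qed
qed

lemma transitive_gsetI:
  assumes f: "finitary_gset L H X" and h: "hat A X" and ne: "pts X \<noteq> {}"
    and o: "\<And>x. x \<in> pts X \<Longrightarrow> orb (stab A) (act X) x = pts X"
  shows "transitive_gset L H (stab A) X"
proof -
  have d: "defgrp X = stab A" by (rule hatD(1)[OF h])
  have "group_action (perm_group L (stab A)) (pts X) (act X)" using f d by (simp add: finitary_gset_def)
  moreover have "\<exists>g\<in>carrier (perm_group L (stab A)). act X g x = y" if "x \<in> pts X" "y \<in> pts X" for x y
  proof -
    have "y \<in> orb (stab A) (act X) x" using o that by simp
    then show ?thesis unfolding orb_def perm_group_simps by blast
  qed
  ultimately have "transitive_action (perm_group L (stab A)) (pts X) (act X)"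
    by (simp add: transitive_action_def transitive_action_axioms_def)
  then show ?thesis using f d ne by (simp add: transitive_gset_def)
qed

lemma coset_transitive: "fin B \<Longrightarrow> A \<subseteq> B \<Longrightarrow> transitive_gset L H (stab A) (coset_gset A B)"
  by (rule transitive_gsetI[OF coset_gset(4) coset_gset(3) coset_gset(7) coset_gset(6)])

lemma var_transitive:
  assumes X: "hat A X" and x: "x \<in> pts X" and o: "orb (stab A) (act X) x = pts X"
  shows "var X = var (coset_gset A (pt_supp A (act X) x))"
proof -
  let ?B = "pt_supp A (act X) x"
  note s = hatD(2)[OF X]
  note B = pt_supp_props[OF s x]
  note C = coset_gset[OF B(1,3)]
  have bij: "bij_betw (pt_supp A (act X)) (pts X) (translates A ?B)"
    using transitive_iso_translates(1)[OF s x] o by simp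
  show ?thesis
  proof (rule var_eq[OF X C(3)], rule gset_isoI[OF hatD(4)[OF X] _ _ bij_betw_trans[OF bij C(1)]])
    show "stab A \<subseteq> defgrp X" using hatD(1)[OF X] by simp
    show "stab A \<subseteq> defgrp (coset_gset A ?B)" using hatD(1)[OF C(3)] by simp
    fix g y assume g: "g \<in> stab A" and y: "y \<in> pts X"
    have "pt_supp A (act X) y \<in> translates A ?B" by (rule bij_betw_apply[OF bij y])
    then show "(set_code \<circ> pt_supp A (act X)) (act X g y) = act (coset_gset A ?B) g ((set_code \<circ> pt_supp A (act X)) y)"
      using pt_supp_act[OF s y g] C(2) by simp
  qed
qed

lemma var_coset_self:
  assumes A: "fin A" shows "var (coset_gset A A) \<approx> 1"
proof -
  note C = coset_gset[OF A order_refl]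
  have T: "translates A A = {A}" unfolding translates_def using stab_image stab_ident[OF fin_line[OF A]] by blast
  have p: "pts (coset_gset A A) = {set_code A}" by (simp add: coset_gset_def T)
  have "gset_iso L H (coset_gset A A) (gset_one L H)"
  proof (rule gset_isoI[OF A])
    show "stab A \<subseteq> defgrp (coset_gset A A)" using hatD(1)[OF C(3)] by simp
    show "stab A \<subseteq> defgrp (gset_one L H)" using stab_antimono[of "{}" A] by (simp add: gset_one_def)
    show "bij_betw (\<lambda>_. ()) (pts (coset_gset A A)) (pts (gset_one L H))" by (simp add: p gset_one_def bij_betw_def)
  qed simp
  from var_eq[OF C(3) hat_one this] show ?thesis using var_one by simp
qed

text \<open>The map from translates of \<open>B\<close> to translates of \<open>B' \<subseteq> B\<close> has as fiber over \<open>B'\<close> the orbit of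
  \<open>B\<close> under \<open>stab B'\<close>.\<close>

lemma var_coset_mult:
  assumes B: "fin B" "B' \<subseteq> B" and A: "A \<subseteq> B'"
  shows "var (coset_gset A B) \<approx> var (coset_gset B' B) * var (coset_gset A B')"
proof -
  have B': "fin B'" by (rule fin_subset[OF B])
  have AB: "A \<subseteq> B" using A B(2) by blast
  have fA: "fin A" by (rule fin_subset[OF B' A])
  let ?X = "coset_gset A B" and ?Y = "coset_gset A B'"
  note X = coset_gset[OF B(1) AB] and Y = coset_gset[OF B' A]
  define f where "f n = set_code (subtranslate A B B' (inv_into {A. fin A} set_code n))" for n
  have f: "f (set_code S) = set_code (subtranslate A B B' S)" if "S \<in> translates A B" for S
    unfolding f_def using inv_into_f_f[OF set_code_inj, of S] translates_fin[OF B(1) that] by simp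
  have map: "gset_map (stab A) f ?X ?Y"
    unfolding gset_map_def
  proof (intro conjI ballI funcsetI)
    fix n assume "n \<in> pts ?X"
    then obtain S where S: "S \<in> translates A B" "n = set_code S" by (auto simp: coset_gset_def)
    note id = stab_ident[OF fin_line[OF fA]]
    have ST: "subtranslate A B B' S \<in> translates A B'" by (rule subtranslate_equivariant(1)[OF fA B id S(1)])
    show "f n \<in> pts ?Y" using f[OF S(1)] S(2) ST by (simp add: coset_gset_def)
    fix g assume g: "g \<in> stab A"
    have gS: "g ` S \<in> translates A B" by (rule acts_closed[OF smooth_acts[OF translates_action(1)[OF B(1) AB]] g S(1)])
    show "f (act ?X g n) = act ?Y g (f n)"
      unfolding S(2) X(2)[OF S(1)] f[OF S(1)] f[OF gS] Y(2)[OF ST]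
      using subtranslate_equivariant(2)[OF fA B g S(1)] by simp
  qed
  let ?y = "set_code B'" and ?x = "set_code B"
  have TB: "B \<in> translates A B" "B' \<in> translates A B'" using translates_self[OF fA] fin_line[OF B(1)] fin_line[OF B'] by blast+
  have y: "?y \<in> pts ?Y" and x: "?x \<in> pts ?X" using TB by (simp_all add: coset_gset_def)
  have "subtranslate A B B' (ident ` B) = ident ` B'" by (rule subtranslate_image[OF B stab_ident[OF fin_line[OF fA]]])
  then have fx: "f ?x = ?y" using f[OF TB(1)] fin_line[OF B(1)] fin_line[OF B'] by simp
  let ?F = "gset_fiber L f ?X ?Y ?y"
  have xF: "?x \<in> pts ?F" using x fx by (simp add: gset_fiber_def)
  have supp: "pt_supp A (act ?Y) ?y = B'" "pt_supp A (act ?X) ?x = B" using Y(5)[OF TB(2)] X(5)[OF TB(1)] by auto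
  have F: "hat B' ?F" "orb (stab B') (act ?F) ?x = pts ?F" "pt_supp B' (act ?F) ?x = B"
    using hat_fiber[OF X(3) X(6) Y(3) map y] xF supp by simp_all
  have "var ?F = var (coset_gset B' B)" using var_transitive[OF F(1) xF F(2)] F(3) by simp
  then show ?thesis using var_fiber[OF coset_transitive[OF B(1) AB] coset_transitive[OF B' A] map y] by simp
qed

subsection \<open>Decomposition into orbits\<close>

definition sub_gset :: "'s set \<Rightarrow> ('s, 'x) gset \<Rightarrow> 'x set \<Rightarrow> ('s, 'x) gset" where
  "sub_gset E X U = \<lparr>defgrp = stab E, pts = U, act = (\<lambda>g. restrict (act X g) U)\<rparr>"

lemma sub_gset:
  assumes X: "hat A X" and E: "fin E" "A \<subseteq> E" and U: "U \<subseteq> pts X"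
    and st: "\<And>g x. g \<in> stab E \<Longrightarrow> x \<in> U \<Longrightarrow> act X g x \<in> U"
  shows "hat E (sub_gset E X U)" and "finitary_gset L H (sub_gset E X U)"
    and "x \<in> U \<Longrightarrow> pt_supp E (act (sub_gset E X U)) x = pt_supp E (act X) x"
    and "x \<in> U \<Longrightarrow> orb (stab E) (act (sub_gset E X U)) x = orb (stab E) (act X) x"
proof -
  note sE = smooth_restrict(1)[OF hatD(2)[OF X] E]
  have sU: "smooth E U (act X)" by (rule smooth_subset[OF sE U st])
  have eq: "id (act X g x) = act (sub_gset E X U) g (id x)" if "x \<in> U" for g x using that by (simp add: sub_gset_def)
  have s: "smooth E U (act (sub_gset E X U))" by (rule smooth_transfer(1)[OF sU bij_betw_id]) (rule eq)
  show supp: "x \<in> U \<Longrightarrow> pt_supp E (act (sub_gset E X U)) x = pt_supp E (act X) x"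
    using smooth_transfer(2)[OF sU bij_betw_id, of "act (sub_gset E X U)" x] eq by simp
  show orb: "orb (stab E) (act (sub_gset E X U)) x = orb (stab E) (act X) x" if "x \<in> U" for x
    using that by (simp add: orb_def sub_gset_def)
  have "orb (stab E) (act (sub_gset E X U)) ` U \<subseteq> orb (stab E) (act X) ` pts X" using orb U by auto
  then have "finite (orb (stab E) (act (sub_gset E X U)) ` U)"
    using finite_orbits_restrict[OF hatD(2,3)[OF X] E] finite_subset by blast
  then show h: "hat E (sub_gset E X U)" using s by (simp add: hat_def sub_gset_def)
  show "finitary_gset L H (sub_gset E X U)" by (rule finitaryI[OF h]) (simp add: sub_gset_def)
qed

lemma var_sub_Un:
  fixes X :: "('s, nat) gset"
  assumes X: "hat A X" and E: "fin E" "A \<subseteq> E" and U: "U \<subseteq> pts X" and U': "U' \<subseteq> pts X" and disj: "U \<inter> U' = {}"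
    and st: "\<And>g x. g \<in> stab E \<Longrightarrow> x \<in> U \<Longrightarrow> act X g x \<in> U"
    and st': "\<And>g x. g \<in> stab E \<Longrightarrow> x \<in> U' \<Longrightarrow> act X g x \<in> U'"
  shows "var (sub_gset E X (U \<union> U')) \<approx> var (sub_gset E X U) + var (sub_gset E X U')"
proof -
  let ?Z = "sub_gset E X (U \<union> U')" and ?P = "sub_gset E X U" and ?Q = "sub_gset E X U'"
  have hP: "hat E ?P" "finitary_gset L H ?P" using sub_gset(1,2)[OF X E U st] by simp_all
  have hQ: "hat E ?Q" "finitary_gset L H ?Q" using sub_gset(1,2)[OF X E U' st'] by simp_all
  have hZ: "hat E ?Z"
  proof (rule sub_gset(1)[OF X E])
    show "U \<union> U' \<subseteq> pts X" using U U' by blast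
    fix g x assume g: "g \<in> stab E" and "x \<in> U \<union> U'"
    then show "act X g x \<in> U \<union> U'" using st[OF g] st'[OF g] by blast
  qed
  define f where "f x = (if x \<in> U then Inl x else Inr x)" for x
  have "gset_iso L H ?Z (gset_coprod ?P ?Q)"
  proof (rule gset_isoI[OF E(1)])
    show "stab E \<subseteq> defgrp ?Z" "stab E \<subseteq> defgrp (gset_coprod ?P ?Q)" by (simp_all add: sub_gset_def gset_coprod_def)
    have p: "pts ?Z = U \<union> U'" "pts (gset_coprod ?P ?Q) = Inl ` U \<union> Inr ` U'"
      by (simp_all add: sub_gset_def gset_coprod_def Plus_def)
    show "bij_betw f (pts ?Z) (pts (gset_coprod ?P ?Q))"
      unfolding p
    proof (rule bij_betw_imageI)
      show "inj_on f (U \<union> U')" unfolding f_def by (rule inj_onI) (auto split: if_splits)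
      show "f ` (U \<union> U') = Inl ` U \<union> Inr ` U'" unfolding f_def using disj by (auto simp: image_iff)
    qed
    fix g x assume g: "g \<in> stab E" and x: "x \<in> pts ?Z"
    consider "x \<in> U" | "x \<in> U'" "x \<notin> U" using x p by blast
    then show "f (act ?Z g x) = act (gset_coprod ?P ?Q) g (f x)"
    proof cases
      case 1 then show ?thesis using st[OF g 1] by (simp add: f_def sub_gset_def gset_coprod_def Plus_def)
    next
      case 2
      then have "act X g x \<notin> U" using st'[OF g 2(1)] disj by blast
      then show ?thesis using 2 by (simp add: f_def sub_gset_def gset_coprod_def Plus_def)
    qed
  qed
  from var_eq[OF hZ hat_coprod(1)[OF hP(1) hQ(1)] this] show ?thesis using var_coprod[OF hP(2) hQ(2)] by simp
qed

text \<open>Additivity, orbit by orbit, over a group of definition \<open>stab E\<close> that may be smaller than the given one.\<close>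

lemma var_decomposition:
  fixes X :: "('s, nat) gset"
  assumes X: "hat A X" and E: "fin E" "A \<subseteq> E"
  shows "var X \<approx> orbit_sum (stab E) (act X) (pts X) (\<lambda>x. var (coset_gset E (pt_supp E (act X) x)))"
proof -
  note sE = smooth_restrict(1)[OF hatD(2)[OF X] E]
  note acE = smooth_acts[OF sE]
  let ?\<phi> = "\<lambda>x. var (coset_gset E (pt_supp E (act X) x))"
  let ?O = "orb (stab E) (act X) ` pts X"
  have fO: "finite ?O" by (rule finite_orbits_restrict[OF hatD(2,3)[OF X] E])
  have st: "act X g x \<in> Q" if "Q \<in> ?O" "x \<in> Q" "g \<in> stab E" for Q g x
  proof -
    obtain z where z: "z \<in> pts X" "Q = orb (stab E) (act X) z" using \<open>Q \<in> ?O\<close> by blast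
    then have "x \<in> pts X" "orb (stab E) (act X) x = Q"
      using that(2) orb_subset[OF acE z(1)] orb_eq[OF E(1) acE z(1)] by blast+
    then show ?thesis using that(3) unfolding orb_def by blast
  qed
  have sub: "\<Union>\<Q> \<subseteq> pts X" if "\<Q> \<subseteq> ?O" for \<Q> using that orb_subset[OF acE] by blast
  have main: "\<Q> \<subseteq> ?O \<Longrightarrow> var (sub_gset E X (\<Union>\<Q>)) \<approx> (\<Sum>Q\<in>\<Q>. ?\<phi> (SOME x. x \<in> Q))" if "finite \<Q>" for \<Q>
    using that
  proof (induction rule: finite_induct)
    case empty
    have "var (sub_gset E X ({} \<union> {})) \<approx> var (sub_gset E X {}) + var (sub_gset E X {})"
      by (rule var_sub_Un[OF X E]) simp_all
    then have "var (sub_gset E X {}) - (var (sub_gset E X {}) + var (sub_gset E X {})) \<in> J" by (simp add: eqv_def)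
    from J_uminus[OF this] show ?case by (simp add: eqv_zero)
  next
    case (insert Q \<Q>)
    have Q: "Q \<in> ?O" and \<Q>: "\<Q> \<subseteq> ?O" using insert.prems by auto
    obtain z where z: "z \<in> pts X" "Q = orb (stab E) (act X) z" using Q by blast
    have disj: "Q \<inter> \<Union>\<Q> = {}"
    proof (rule ccontr)
      assume "Q \<inter> \<Union>\<Q> \<noteq> {}"
      then obtain x R where x: "x \<in> Q" "x \<in> R" "R \<in> \<Q>" by blast
      obtain z' where z': "z' \<in> pts X" "R = orb (stab E) (act X) z'" using x(3) \<Q> by blast
      have "orb (stab E) (act X) x = Q" "orb (stab E) (act X) x = R"
        using orb_eq[OF E(1) acE z(1)] orb_eq[OF E(1) acE z'(1)] x z z' by blast+
      then show False using x(3) insert.hyps(2) by blast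
    qed
    have QX: "Q \<subseteq> pts X" using sub[of "{Q}"] Q by simp
    have "var (sub_gset E X (\<Union>(insert Q \<Q>))) \<approx> var (sub_gset E X Q) + var (sub_gset E X (\<Union>\<Q>))"
      unfolding Union_insert
    proof (rule var_sub_Un[OF X E QX sub[OF \<Q>] disj])
      fix g x assume g: "g \<in> stab E"
      show "act X g x \<in> Q" if x: "x \<in> Q" by (rule st[OF Q x g])
      show "act X g x \<in> \<Union>\<Q>" if x: "x \<in> \<Union>\<Q>"
      proof -
        obtain R where R: "R \<in> \<Q>" "x \<in> R" using x by blast
        show ?thesis using st[OF subsetD[OF \<Q> R(1)] R(2) g] R(1) by blast
      qed
    qed
    also have "var (sub_gset E X Q) + var (sub_gset E X (\<Union>\<Q>)) \<approx> ?\<phi> (SOME x. x \<in> Q) + (\<Sum>Q\<in>\<Q>. ?\<phi> (SOME x. x \<in> Q))"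
    proof (rule eqv_add[OF _ insert.IH[OF \<Q>]])
      define x where "x = (SOME x. x \<in> Q)"
      have x: "x \<in> Q" unfolding x_def z(2) by (rule orbit_rep[OF E(1) acE z(1)])
      have stQ: "act X g y \<in> Q" if "g \<in> stab E" "y \<in> Q" for g y using st[OF Q that(2,1)] .
      have h: "hat E (sub_gset E X Q)" by (rule sub_gset(1)[OF X E QX stQ])
      have "orb (stab E) (act X) x = Q" using orb_eq[OF E(1) acE z(1)] x z(2) by simp
      then have "orb (stab E) (act (sub_gset E X Q)) x = Q" using sub_gset(4)[OF X E QX stQ x] by simp
      moreover have "pt_supp E (act (sub_gset E X Q)) x = pt_supp E (act X) x" by (rule sub_gset(3)[OF X E QX stQ x])
      ultimately have "var (sub_gset E X Q) = ?\<phi> x" using var_transitive[OF h, of x] x by (simp add: sub_gset_def)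
      then show "var (sub_gset E X Q) \<approx> ?\<phi> (SOME x. x \<in> Q)" unfolding x_def by simp
    qed
    finally show ?case using insert.hyps by simp
  qed
  have U: "\<Union>?O = pts X" using orb_refl[OF E(1) acE] orb_subset[OF acE] by blast
  have hs: "hat E (sub_gset E X (pts X))"
    by (rule sub_gset(1)[OF X E order_refl]) (rule acts_closed[OF acE])
  have "gset_iso L H X (sub_gset E X (pts X))"
  proof (rule gset_isoI[OF E(1)])
    show "stab E \<subseteq> defgrp X" using hatD(1)[OF X] stab_antimono[OF E(2)] by simp
    show "stab E \<subseteq> defgrp (sub_gset E X (pts X))" by (simp add: sub_gset_def)
    show "bij_betw id (pts X) (pts (sub_gset E X (pts X)))" by (simp add: sub_gset_def)
  qed (simp add: sub_gset_def)
  then have "var X = var (sub_gset E X (pts X))" by (rule var_eq[OF X hs])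
  then show ?thesis using main[OF fO order_refl] unfolding orbit_sum_def U by simp
qed

text \<open>Hence the ring is generated by the classes of orbits of a single point.\<close>

lemma var_generated:
  assumes sum: "\<And>a b. N a \<Longrightarrow> N b \<Longrightarrow> N (a + b)" and mult: "\<And>a b. N a \<Longrightarrow> N b \<Longrightarrow> N (a * b)"
    and zero: "N 0" and one: "N 1"
    and cong: "\<And>a b. N a \<Longrightarrow> b \<in> \<R> \<Longrightarrow> b \<approx> a \<Longrightarrow> N b"
    and point: "\<And>A x. fin A \<Longrightarrow> x \<in> L \<Longrightarrow> x \<notin> A \<Longrightarrow> N (var (coset_gset A (insert x A)))"
    and X: "finitary_gset L H (X :: ('s, nat) gset)"
  shows "N (var X)"
proof -
  have coset: "N (var (coset_gset A B))" if "fin B" "A \<subseteq> B" for A B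
    using that
  proof (induction "card (B - A)" arbitrary: B)
    case 0
    then have "B - A = {}" using fin_finite[OF fin_Diff[OF 0(2), of A]] by simp
    then have BA: "B = A" using 0 by blast
    show ?case using cong[OF one var_closed[OF coset_gset(4)[OF 0(2,3)]]] var_coset_self 0(2) BA by simp
  next
    case (Suc n)
    obtain z where z: "z \<in> B" "z \<notin> A" using Suc.hyps(2) by (metis Diff_iff all_not_in_conv card.empty nat.distinct(1))
    let ?B = "B - {z}"
    have B: "insert z ?B = B" "A \<subseteq> ?B" "?B \<subseteq> B" "z \<notin> ?B" using z Suc.prems(2) by auto
    have fB: "fin ?B" by (rule fin_Diff[OF Suc.prems(1)])
    have "B - A = insert z (?B - A)" "z \<notin> ?B - A" using z by auto
    then have "n = card (?B - A)" using Suc.hyps(2) fin_finite[OF fin_Diff[OF fB, of A]] by simp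
    then have "N (var (coset_gset A ?B))" using Suc.hyps(1) fB B(2) by blast
    moreover have "N (var (coset_gset ?B B))" using point[OF fB fin_mem[OF Suc.prems(1) z(1)] B(4)] B(1) by simp
    ultimately have "N (var (coset_gset ?B B) * var (coset_gset A ?B))" using mult by blast
    then show ?case by (rule cong[OF _ var_closed[OF coset_gset(4)[OF Suc.prems]] var_coset_mult[OF Suc.prems(1) B(3,2)]])
  qed
  obtain A where A: "hat A X" using X by (rule finitaryE)
  have Nsum: "N (sum f K)" if "\<And>i. i \<in> K \<Longrightarrow> N (f i)" for f :: "nat set \<Rightarrow> _" and K
    using that by (induction K rule: infinite_finite_induct) (simp_all add: zero sum)
  note s = hatD(2)[OF A] and fA = hatD(4)[OF A]
  have "N (orbit_sum (stab A) (act X) (pts X) (\<lambda>x. var (coset_gset A (pt_supp A (act X) x))))"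
    unfolding orbit_sum_def
  proof (rule Nsum)
    fix Q assume "Q \<in> orb (stab A) (act X) ` pts X"
    then obtain x where x: "x \<in> pts X" "Q = orb (stab A) (act X) x" by blast
    have "(SOME x. x \<in> Q) \<in> pts X"
      using orbit_rep[OF fA smooth_acts[OF s] x(1)] orb_subset[OF smooth_acts[OF s] x(1)] x(2) by blast
    from pt_supp_props[OF s this] show "N (var (coset_gset A (pt_supp A (act X) (SOME x. x \<in> Q))))" by (intro coset)
  qed
  then show ?thesis by (rule cong[OF _ var_closed[OF X] var_decomposition[OF A fA order_refl]])
qed

end

section \<open>Classes of orbits of a point\<close>

context colored_line
begin

text \<open>The class of the orbit of \<open>x\<close> under the stabilizer of \<open>A\<close>.\<close>

definition point_var :: "'s set \<Rightarrow> 's \<Rightarrow> ((('s, nat) gset set \<Rightarrow>\<^sub>0 nat) \<Rightarrow>\<^sub>0 int)" where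
  "point_var A x = var (coset_gset A (insert x A))"

lemma point_var_closed: "fin A \<Longrightarrow> x \<in> L \<Longrightarrow> point_var A x \<in> \<R>"
  unfolding point_var_def by (rule var_closed[OF coset_gset(4)]) auto

lemma var_coset_translate:
  assumes B: "fin B" "A \<subseteq> B" and g: "g \<in> stab A"
  shows "var (coset_gset A (g ` B)) = var (coset_gset A B)"
proof -
  note C = coset_gset[OF B]
  have T: "g ` B \<in> translates A B" unfolding translates_def using g by blast
  then have x: "set_code (g ` B) \<in> pts (coset_gset A B)" by (simp add: coset_gset_def)
  show ?thesis using var_transitive[OF C(3) x C(6)[OF x]] C(5)[OF T] by simp
qed

lemma point_translates:
  assumes C: "fin C" and y: "y \<in> L"
  shows "translates C (insert y C) = (\<lambda>z. insert z C) ` {z. same_type C y z}"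
    and "y \<notin> C \<Longrightarrow> inj_on (\<lambda>z. insert z C) {z. same_type C y z}"
proof -
  have im: "h ` insert y C = insert (h y) C" if h: "h \<in> stab C" for h
    using stab_image[OF h] by simp
  show "translates C (insert y C) = (\<lambda>z. insert z C) ` {z. same_type C y z}"
  proof (intro equalityI subsetI)
    fix S assume "S \<in> translates C (insert y C)"
    then obtain h where h: "h \<in> stab C" "S = h ` insert y C" unfolding translates_def by blast
    then show "S \<in> (\<lambda>z. insert z C) ` {z. same_type C y z}"
      using im[OF h(1)] stab_same_type[OF C h(1) y] by simp
  next
    fix S assume "S \<in> (\<lambda>z. insert z C) ` {z. same_type C y z}"
    then obtain z where z: "same_type C y z" "S = insert z C" by blast
    obtain h where h: "h \<in> stab C" "h y = z" using move_point[OF C y z(1)] by blast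
    have "S = h ` insert y C" using im[OF h(1)] h(2) z(2) by simp
    then show "S \<in> translates C (insert y C)" unfolding translates_def using h(1) by blast
  qed
  show "inj_on (\<lambda>z. insert z C) {z. same_type C y z}" if "y \<notin> C"
  proof (rule inj_onI)
    fix z w assume a: "z \<in> {z. same_type C y z}" "w \<in> {z. same_type C y z}" "insert z C = insert w C"
    have n: "v \<notin> C" if "same_type C y v" for v
    proof
      assume v: "v \<in> C"
      then have "\<not> v \<prec> y" "\<not> y \<prec> v" using that unfolding same_type_def by auto
      then show False using less_total[OF y fin_mem[OF C v]] v \<open>y \<notin> C\<close> by blast
    qed
    from n[of z] n[of w] a show "z = w" by (simp add: insert_ident) (metis insert_iff)
  qed
qed

text \<open>Under the hypothesis \<open>stab A\<close> acts transitively on the orbit of \<open>x\<close> under \<open>stab N\<close>, so both classes belong to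
  the same hat-set. It holds when \<open>N\<close> consists of the neighbors of \<open>x\<close> in \<open>A\<close>.\<close>

lemma point_var_subset:
  assumes A: "fin A" "N \<subseteq> A" and x: "x \<in> L"
    and same: "\<And>z. same_type N x z \<Longrightarrow> same_type A x z"
  shows "point_var N x \<approx> point_var A x"
proof -
  have N: "fin N" by (rule fin_subset[OF A])
  have B: "fin (insert x N)" "N \<subseteq> insert x N" using N x by auto
  let ?X = "coset_gset N (insert x N)"
  note X = coset_gset[OF B]
  let ?\<phi> = "\<lambda>n. var (coset_gset A (pt_supp A (act ?X) n))"
  let ?n = "set_code (insert x N)"
  have T: "insert x N \<in> translates N (insert x N)" by (rule translates_self[OF N fin_line[OF B(1)]])
  have n: "?n \<in> pts ?X" using T by (simp add: coset_gset_def)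
  note s = smooth_restrict[OF hatD(2)[OF X(3)] A]
  have inv: "invariant (stab A) (act ?X) (pts ?X) ?\<phi>"
    unfolding invariant_def
  proof (intro ballI)
    fix g m assume g: "g \<in> stab A" and m: "m \<in> pts ?X"
    show "?\<phi> (act ?X g m) = ?\<phi> m"
      unfolding pt_supp_act[OF s(1) m g] using pt_supp_props[OF s(1) m] by (intro var_coset_translate g)
  qed
  have "pts ?X \<subseteq> orb (stab A) (act ?X) ?n"
  proof
    fix m assume "m \<in> pts ?X"
    then obtain z where z: "same_type N x z" "m = set_code (insert z N)"
      unfolding coset_gset_def using point_translates(1)[OF N x] by auto
    obtain h where h: "h \<in> stab A" "h x = z" using move_point[OF A(1) x same[OF z(1)]] by blast
    have "h \<in> stab N" using h(1) stab_antimono[OF A(2)] by blast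
    then have "h ` insert x N = insert z N" using h(2) stab_image by simp
    then have "act ?X h ?n = m" using X(2)[OF T] z(2) by simp
    then show "m \<in> orb (stab A) (act ?X) ?n" unfolding orb_def using h(1) by blast
  qed
  then have o: "orb (stab A) (act ?X) ?n = pts ?X"
    using orb_subset[OF smooth_acts[OF s(1)] n] by blast
  have "pt_supp A (act ?X) ?n = insert x A" using s(2)[OF n] X(5)[OF T] A(2) by auto
  then have "orbit_sum (stab A) (act ?X) (pts ?X) ?\<phi> = point_var A x"
    using orbit_sum_single[OF A(1) smooth_acts[OF s(1)] inv n o] by (simp add: point_var_def)
  then show ?thesis using var_decomposition[OF X(3) A] by (simp add: point_var_def)
qed

text \<open>An element \<open>g\<close> conjugates the action of \<open>stab A\<close> on the orbit of \<open>x\<close> into that of \<open>stab (g ` A)\<close> on the orbit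
  of \<open>g x\<close>.\<close>

lemma point_var_image:
  assumes A: "fin A" and x: "x \<in> L" and g: "g \<in> H"
  shows "point_var (g ` A) (g x) \<approx> point_var A x"
proof -
  have B: "fin (insert x A)" "A \<subseteq> insert x A" using A x by auto
  let ?X = "coset_gset A (insert x A)"
  note X = coset_gset[OF B]
  let ?n = "set_code (insert x A)"
  have T: "insert x A \<in> translates A (insert x A)" by (rule translates_self[OF A fin_line[OF B(1)]])
  have n: "?n \<in> pts ?X" using T by (simp add: coset_gset_def)
  note c = hat_conj[OF X(3) g]
  have p: "pts (gset_conj L H g ?X) = pts ?X" by (rule gset_conj_simps(1)[OF X(3) g])
  have "var (gset_conj L H g ?X) = var (coset_gset (g ` A) (g ` insert x A))"
    using var_transitive[OF c(1), of ?n] c(2)[OF n] c(3)[of ?n] p n X(5)[OF T] X(6)[OF n] by simp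
  then show ?thesis unfolding point_var_def using eqv_sym[OF var_conj[OF g X(4)]] eqv_sym by simp
qed

lemma neighbors:
  assumes A: "fin A" and x: "x \<in> L" "x \<notin> A"
  obtains l r where "interval_ends cyc p l r" "x \<in> line_interval cyc p l r"
    "map_extended \<sigma> l = lo A x" "map_extended \<sigma> r = hi A x" "{u. Fin u \<in> {l, r}} \<subseteq> A"
    "\<forall>z. same_type {u. Fin u \<in> {l, r}} x z \<longrightarrow> same_type A x z"
proof -
  have "\<exists>l. l \<in> insert Minf (Fin ` {a\<in>A. a \<prec> x}) \<and> map_extended \<sigma> l = lo A x \<and> (\<forall>a\<in>A. a \<prec> x \<longrightarrow> (\<exists>m. l = Fin m \<and> (a = m \<or> a \<prec> m)))"
  proof (cases "{a\<in>A. a \<prec> x} = {}")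
    case True
    have "lo A x = Minf" unfolding lo_def True by simp
    then show ?thesis using True by (intro exI[of _ Minf]) auto
  next
    case False
    obtain m where m: "m \<in> {a\<in>A. a \<prec> x}" "\<forall>a\<in>{a\<in>A. a \<prec> x}. a = m \<or> a \<prec> m"
      using finite_has_greatest[of "{a\<in>A. a \<prec> x}"] False fin_finite[OF A] fin_line[OF A] by auto
    have "lo A x = Fin (\<sigma> m)" unfolding lo_def by (rule lower_typeI[OF m(1)]) (use m(2) in blast)
    then show ?thesis using m by (intro exI[of _ "Fin m"]) auto
  qed
  then obtain l where l0: "l \<in> insert Minf (Fin ` {a\<in>A. a \<prec> x}) \<and> map_extended \<sigma> l = lo A x \<and>
    (\<forall>a\<in>A. a \<prec> x \<longrightarrow> (\<exists>m. l = Fin m \<and> (a = m \<or> a \<prec> m)))" by (elim exE)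
  note l = l0[THEN conjunct1] l0[THEN conjunct2, THEN conjunct1] l0[THEN conjunct2, THEN conjunct2, rule_format]
  have "\<exists>r. r \<in> insert Pinf (Fin ` {a\<in>A. x \<prec> a}) \<and> map_extended \<sigma> r = hi A x \<and> (\<forall>a\<in>A. x \<prec> a \<longrightarrow> (\<exists>m. r = Fin m \<and> (a = m \<or> m \<prec> a)))"
  proof (cases "{a\<in>A. x \<prec> a} = {}")
    case True
    have "hi A x = Pinf" unfolding hi_def True by simp
    then show ?thesis using True by (intro exI[of _ Pinf]) auto
  next
    case False
    obtain m where m: "m \<in> {a\<in>A. x \<prec> a}" "\<forall>a\<in>{a\<in>A. x \<prec> a}. a = m \<or> m \<prec> a"
      using finite_has_least[of "{a\<in>A. x \<prec> a}"] False fin_finite[OF A] fin_line[OF A] by auto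
    have "hi A x = Fin (\<sigma> m)" unfolding hi_def by (rule upper_typeI[OF m(1)]) (use m(2) in blast)
    then show ?thesis using m by (intro exI[of _ "Fin m"]) auto
  qed
  then obtain r where r0: "r \<in> insert Pinf (Fin ` {a\<in>A. x \<prec> a}) \<and> map_extended \<sigma> r = hi A x \<and>
    (\<forall>a\<in>A. x \<prec> a \<longrightarrow> (\<exists>m. r = Fin m \<and> (a = m \<or> m \<prec> a)))" by (elim exE)
  note r = r0[THEN conjunct1] r0[THEN conjunct2, THEN conjunct1] r0[THEN conjunct2, THEN conjunct2, rule_format]
  have l': "u \<in> A \<and> u \<prec> x" if "l = Fin u" for u using l(1) that by auto
  have r': "u \<in> A \<and> x \<prec> u" if "r = Fin u" for u using r(1) that by auto
  have i: "interval_ends cyc p l r"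
    unfolding interval_ends_def using l(1) r(1) fin_line[OF A] less_trans[of _ x] by auto
  show thesis
  proof (rule that[OF i _ l(2) r(2)])
    show "x \<in> line_interval cyc p l r" unfolding interval_iff[OF i] using l' r' x(1) by blast
    show "{u. Fin u \<in> {l, r}} \<subseteq> A" using l' r' by auto
    show "\<forall>z. same_type {u. Fin u \<in> {l, r}} x z \<longrightarrow> same_type A x z"
    proof (intro allI impI)
    fix z assume z: "same_type {u. Fin u \<in> {l, r}} x z"
    have lz: "u \<prec> z" if "l = Fin u" for u using z that l'[OF that] unfolding same_type_def by auto
    have rz: "z \<prec> u" if "r = Fin u" for u using z that r'[OF that] unfolding same_type_def by auto
    have down: "a \<prec> z" if "a \<in> A" "a \<prec> x" for a
      using l(3)[OF that] lz less_trans by blast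
    have up: "z \<prec> a" if "a \<in> A" "x \<prec> a" for a
      using r(3)[OF that] rz less_trans by blast
    have "(a \<prec> x \<longleftrightarrow> a \<prec> z) \<and> (x \<prec> a \<longleftrightarrow> z \<prec> a)" if a: "a \<in> A" for a
    proof -
      have "a \<prec> x \<or> x \<prec> a" using less_total[OF fin_mem[OF A a] x(1)] a x(2) by blast
      then show ?thesis using down[OF a] up[OF a] less_asym by metis
    qed
    then show "same_type A x z" using z by (simp add: same_type_def)
    qed
  qed
qed

text \<open>By homogeneity, the class depends only on the color of the point and on the colors of its neighbors.\<close>

lemma point_var_cong:
  assumes A: "fin A" "x \<in> L" "x \<notin> A" and A': "fin A'" "x' \<in> L" "x' \<notin> A'"
    and lo: "lo A x = lo A' x'" and hi: "hi A x = hi A' x'" and c: "\<sigma> x = \<sigma> x'"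
  shows "point_var A x \<approx> point_var A' x'"
proof -
  obtain l r where i: "interval_ends cyc p l r" and x: "x \<in> line_interval cyc p l r"
    and t: "map_extended \<sigma> l = lo A x" "map_extended \<sigma> r = hi A x" and N: "{u. Fin u \<in> {l, r}} \<subseteq> A"
    and same: "\<forall>z. same_type {u. Fin u \<in> {l, r}} x z \<longrightarrow> same_type A x z" by (rule neighbors[OF A])
  obtain l' r' where i': "interval_ends cyc p l' r'" and x': "x' \<in> line_interval cyc p l' r'"
    and t': "map_extended \<sigma> l' = lo A' x'" "map_extended \<sigma> r' = hi A' x'" and N': "{u. Fin u \<in> {l', r'}} \<subseteq> A'"
    and same': "\<forall>z. same_type {u. Fin u \<in> {l', r'}} x' z \<longrightarrow> same_type A' x' z" by (rule neighbors[OF A'])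
  let ?N = "{u. Fin u \<in> {l, r}}" and ?N' = "{u. Fin u \<in> {l', r'}}"
  have eq: "map_extended \<sigma> l = map_extended \<sigma> l'" "map_extended \<sigma> r = map_extended \<sigma> r'" using t t' lo hi by simp_all
  have between: "(\<forall>u. l = Fin u \<longrightarrow> u \<prec> x)" "(\<forall>u. r = Fin u \<longrightarrow> x \<prec> u)" "(\<forall>u. l' = Fin u \<longrightarrow> u \<prec> x')" "(\<forall>u. r' = Fin u \<longrightarrow> x' \<prec> u)"
    using x x' unfolding interval_iff[OF i] interval_iff[OF i'] by blast+
  define R where "R = {(u, v). (Fin u, Fin v) \<in> {(l, l'), (Fin x, Fin x'), (r, r')}}"
  have lcase: "(l = Minf \<and> l' = Minf) \<or> (\<exists>u u'. l = Fin u \<and> l' = Fin u' \<and> \<sigma> u = \<sigma> u' \<and> u \<prec> x \<and> u' \<prec> x')"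
    using i i' eq(1) between unfolding interval_ends_def by (cases l; cases l') auto
  have rcase: "(r = Pinf \<and> r' = Pinf) \<or> (\<exists>u u'. r = Fin u \<and> r' = Fin u' \<and> \<sigma> u = \<sigma> u' \<and> x \<prec> u \<and> x' \<prec> u')"
    using i i' eq(2) between unfolding interval_ends_def by (cases r; cases r') auto
  have "partial_iso R \<and> (\<forall>g. (\<forall>(u, v)\<in>R. g u = v) \<longrightarrow> g ` ?N = ?N' \<and> g x = x')"
  proof -
    consider "l = Minf" "l' = Minf" "r = Pinf" "r' = Pinf"
      | u u' where "l = Fin u" "l' = Fin u'" "\<sigma> u = \<sigma> u'" "u \<prec> x" "u' \<prec> x'" "r = Pinf" "r' = Pinf"
      | v v' where "l = Minf" "l' = Minf" "r = Fin v" "r' = Fin v'" "\<sigma> v = \<sigma> v'" "x \<prec> v" "x' \<prec> v'"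
      | u u' v v' where "l = Fin u" "l' = Fin u'" "\<sigma> u = \<sigma> u'" "u \<prec> x" "u' \<prec> x'" "r = Fin v" "r' = Fin v'" "\<sigma> v = \<sigma> v'" "x \<prec> v" "x' \<prec> v'"
      using lcase rcase by metis
    then show ?thesis
    proof cases
      case 1
      have R: "R = {(x, x')}" unfolding R_def 1 by auto
      have N: "?N = {}" "?N' = {}" unfolding 1 by auto
      show ?thesis unfolding N R partial_iso_def using A(2) A'(2) c by simp
    next
      case 2
      have R: "R = {(u, u'), (x, x')}" unfolding R_def 2 by auto
      have N: "?N = {u}" "?N' = {u'}" unfolding 2 by auto
      show ?thesis unfolding N R partial_iso_def
        using A(2) A'(2) c 2(3-5) less_in_line less_asym[OF 2(4)] less_asym[OF 2(5)] by simp
    next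
      case 3
      have R: "R = {(x, x'), (v, v')}" unfolding R_def 3 by auto
      have N: "?N = {v}" "?N' = {v'}" unfolding 3 by auto
      show ?thesis unfolding N R partial_iso_def
        using A(2) A'(2) c 3(5-7) less_in_line less_asym[OF 3(6)] less_asym[OF 3(7)] by simp
    next
      case 4
      have R: "R = {(u, u'), (x, x'), (v, v')}" unfolding R_def 4 by auto
      have N: "?N = {u, v}" "?N' = {u', v'}" unfolding 4 by auto
      have uv: "u \<prec> v" "u' \<prec> v'" using 4 less_trans by blast+
      show ?thesis unfolding N R partial_iso_def
        using A(2) A'(2) c 4(3-5) 4(8-10) uv less_in_line
          less_asym[OF 4(4)] less_asym[OF 4(5)] less_asym[OF 4(9)] less_asym[OF 4(10)] less_asym[OF uv(1)] less_asym[OF uv(2)] by simp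
    qed
  qed
  then have R: "partial_iso R" and im: "\<And>g. (\<forall>(u, v)\<in>R. g u = v) \<Longrightarrow> g ` ?N = ?N' \<and> g x = x'" by blast+
  obtain g where g: "g \<in> H" "\<forall>u v. (u, v) \<in> R \<longrightarrow> g u = v" using homogeneous[OF R] by blast
  have gN: "g ` ?N = ?N'" "g x = x'" using im[of g] g(2) by blast+
  have "point_var A x \<approx> point_var ?N x" by (rule eqv_sym[OF point_var_subset[OF A(1) N A(2) same[rule_format]]])
  also have "point_var ?N x \<approx> point_var ?N' x'"
    using eqv_sym[OF point_var_image[OF fin_subset[OF A(1) N] A(2) g(1)]] unfolding gN .
  also have "point_var ?N' x' \<approx> point_var A' x'" by (rule point_var_subset[OF A'(1) N' A'(2) same'[rule_format]])
  finally show ?thesis .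
qed

subsection \<open>The two relations between these classes\<close>

text \<open>The class of the orbit of any point of color \<open>c\<close> whose neighbors have types \<open>a\<close> and \<open>b\<close>; by
  \<open>point_var_cong\<close> it is well defined modulo the relations.\<close>

definition typed_var :: "'c extended \<Rightarrow> 'c extended \<Rightarrow> 'c \<Rightarrow> ((('s, nat) gset set \<Rightarrow>\<^sub>0 nat) \<Rightarrow>\<^sub>0 int)" where
  "typed_var a b c = (let (A, x) = SOME (A, x). fin A \<and> x \<in> L \<and> x \<notin> A \<and> lo A x = a \<and> hi A x = b \<and> \<sigma> x = c
     in point_var A x)"

lemma typed_var_witness:
  assumes "fin A" "x \<in> L" "x \<notin> A"
  obtains A' x' where "fin A'" "x' \<in> L" "x' \<notin> A'" "lo A' x' = lo A x" "hi A' x' = hi A x" "\<sigma> x' = \<sigma> x"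
    "typed_var (lo A x) (hi A x) (\<sigma> x) = point_var A' x'"
proof -
  let ?P = "\<lambda>(A', x'). fin A' \<and> x' \<in> L \<and> x' \<notin> A' \<and> lo A' x' = lo A x \<and> hi A' x' = hi A x \<and> \<sigma> x' = \<sigma> x"
  obtain A' x' where e: "Eps ?P = (A', x')" by (cases "Eps ?P")
  have "?P (Eps ?P)" by (rule someI[of ?P "(A, x)"]) (use assms in simp)
  then have "?P (A', x')" unfolding e .
  then show ?thesis using that[of A' x'] e by (simp add: typed_var_def)
qed

lemma point_var_typed:
  assumes A: "fin A" "x \<in> L" "x \<notin> A"
  shows "point_var A x \<approx> typed_var (lo A x) (hi A x) (\<sigma> x)" and "typed_var (lo A x) (hi A x) (\<sigma> x) \<in> \<R>"
proof -
  obtain A' x' where w: "fin A'" "x' \<in> L" "x' \<notin> A'" "lo A' x' = lo A x" "hi A' x' = hi A x" "\<sigma> x' = \<sigma> x"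
    "typed_var (lo A x) (hi A x) (\<sigma> x) = point_var A' x'" by (rule typed_var_witness[OF A])
  show "point_var A x \<approx> typed_var (lo A x) (hi A x) (\<sigma> x)" unfolding w(7)
    using point_var_cong[OF A w(1-3)] w(4-6) by simp
  show "typed_var (lo A x) (hi A x) (\<sigma> x) \<in> \<R>" unfolding w(7) by (rule point_var_closed[OF w(1,2)])
qed

lemma two_points:
  assumes "a \<noteq> Pinf" "b \<noteq> Minf"
  obtains C x y where "fin C" "x \<in> L" "x \<notin> C" "y \<in> L" "y \<notin> C" "x \<prec> y" "\<sigma> x = c" "\<sigma> y = d"
    "lo C x = a" "hi C x = b" "same_cut C x y"
proof -
  have point: "\<exists>z\<in>L. \<sigma> z = k" for k
    using line_nonempty color_above less_in_line by blast
  obtain l where l: "l \<in> insert Minf (Fin ` L)" "map_extended \<sigma> l = a"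
  proof (cases a)
    case (Fin k)
    obtain z where "z \<in> L" "\<sigma> z = k" using point by blast
    then show ?thesis using that[of "Fin z"] Fin by simp
  qed (use that[of Minf] assms(1) in simp_all)
  have "\<exists>r. interval_ends cyc p l r \<and> map_extended \<sigma> r = b"
  proof (cases b)
    case b: (Fin k)
    show ?thesis
    proof (cases l)
      case (Fin u)
      then have "u \<in> L" using l(1) by auto
      then obtain z where "u \<prec> z" "\<sigma> z = k" using color_above by blast
      then show ?thesis using Fin l(1) b less_in_line by (intro exI[of _ "Fin z"]) (auto simp: interval_ends_def)
    next
      case Minf
      obtain z where "z \<in> L" "\<sigma> z = k" using point by blast
      then show ?thesis using Minf b by (intro exI[of _ "Fin z"]) (auto simp: interval_ends_def)
    qed (use l(1) in auto)
  next
    case Pinf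
    then show ?thesis using l(1) by (intro exI[of _ Pinf]) (auto simp: interval_ends_def)
  qed (use assms(2) in simp)
  then obtain r where r: "interval_ends cyc p l r" "map_extended \<sigma> r = b" by blast
  obtain xs where "xs \<in> pts (word_gset cyc \<sigma> p l r [c, d])" using hat_word(2)[OF r(1)] by blast
  then have xs: "set xs \<subseteq> line_interval cyc p l r" "sorted_wrt (\<prec>) xs" "map \<sigma> xs = [c, d]"
    by (simp_all add: word_gset_def word_tuples_def)
  then obtain x y where xy: "xs = [x, y]" "\<sigma> x = c" "\<sigma> y = d" by (auto simp: map_eq_Cons_conv)
  have x: "x \<in> line_interval cyc p l r" and y: "y \<in> line_interval cyc p l r" and less: "x \<prec> y" using xs xy(1) by simp_all
  note X = interval_lo_hi[OF r(1) x] and Y = interval_lo_hi[OF r(1) y]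
  show thesis
    using that[OF ends_fin[OF r(1)] X(4,3) Y(4,3) less xy(2,3)] X(1,2) X(5)[OF y] l(2) r(2) by simp
qed

lemma typed_var_closed: assumes ab: "a \<noteq> Pinf" "b \<noteq> Minf" shows "typed_var a b c \<in> \<R>"
proof -
  obtain C x y where C: "fin C" "x \<in> L" "x \<notin> C" "\<sigma> x = c" "lo C x = a" "hi C x = b" by (rule two_points[OF ab])
  show ?thesis using point_var_typed(2)[OF C(1-3)] C(4-6) by simp
qed

text \<open>Over the stabilizer of \<open>insert e C\<close> the orbit of \<open>y\<close> decomposes into the points below \<open>e\<close>, those above \<open>e\<close>, and
  \<open>e\<close> itself if it has the color of \<open>y\<close>.\<close>

lemma point_var_split:
  assumes C: "fin C" and y: "y \<in> L" "y \<notin> C" and e: "e \<in> L" "e \<notin> C" and cut: "same_cut C y e"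
  shows "point_var C y \<approx> typed_var (lo C y) (Fin (\<sigma> e)) (\<sigma> y) + typed_var (Fin (\<sigma> e)) (hi C y) (\<sigma> y) + of_bool (\<sigma> e = \<sigma> y)"
proof -
  define E where "E = insert e C"
  have E: "fin E" "C \<subseteq> E" using C e by (auto simp: E_def)
  have B: "fin (insert y C)" "C \<subseteq> insert y C" using C y by auto
  let ?X = "coset_gset C (insert y C)" and ?Y = "{z. same_type C y z}"
  note X = coset_gset[OF B]
  let ?\<psi> = "\<lambda>n. var (coset_gset E (pt_supp E (act ?X) n))"
  note s = smooth_restrict[OF hatD(2)[OF X(3)] E]
  note PT = point_translates[OF C y(1)]
  let ?f = "\<lambda>z. set_code (insert z C)"
  have T: "insert z C \<in> translates C (insert y C)" if "same_type C y z" for z using that PT(1) by blast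
  have "orbit_sum (stab E) (\<lambda>g x. g x) ?Y (point_var E) = orbit_sum (stab E) (act ?X) (pts ?X) ?\<psi>"
  proof (rule orbit_sum_iso[OF E(1) acts_points[OF C E(2,1) y(1)] smooth_acts[OF s(1)]])
    have "bij_betw (\<lambda>z. insert z C) ?Y (translates C (insert y C))"
      using PT(1) PT(2)[OF y(2)] by (simp add: bij_betw_def)
    from bij_betw_trans[OF this X(1)] show "bij_betw ?f ?Y (pts ?X)" by (simp add: comp_def)
    show "?f (g z) = act ?X g (?f z)" if g: "g \<in> stab E" and z: "z \<in> ?Y" for g z
    proof -
      have "g \<in> stab C" using g stab_antimono[OF E(2)] by blast
      then have "g ` insert z C = insert (g z) C" using stab_image by simp
      then show ?thesis using X(2)[OF T, of z g] z by simp
    qed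
    show "invariant (stab E) (act ?X) (pts ?X) ?\<psi>"
      unfolding invariant_def
    proof (intro ballI)
      fix g m assume g: "g \<in> stab E" and m: "m \<in> pts ?X"
      show "?\<psi> (act ?X g m) = ?\<psi> m"
        unfolding pt_supp_act[OF s(1) m g] using pt_supp_props[OF s(1) m] by (intro var_coset_translate g)
    qed
    show "point_var E z = ?\<psi> (?f z)" if z: "z \<in> ?Y" for z
    proof -
      have Tz: "insert z C \<in> translates C (insert y C)" using T z by simp
      then have "?f z \<in> pts ?X" by (simp add: coset_gset_def)
      then have "pt_supp E (act ?X) (?f z) = E \<union> insert z C" using s(2) X(5)[OF Tz] by simp
      also have "\<dots> = insert z E" using E(2) by blast
      finally show ?thesis by (simp add: point_var_def)
    qed
  qed
  then have dec: "point_var C y \<approx> orbit_sum (stab E) (\<lambda>g x. g x) ?Y (point_var E)"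
    using var_decomposition[OF X(3) E] by (simp add: point_var_def)
  have inv: "invariant (stab E) (\<lambda>g x. g x) ?Y (point_var E)"
    unfolding invariant_def
  proof (intro ballI)
    fix g z assume g: "g \<in> stab E" and z: "z \<in> ?Y"
    have "fin (insert z E)" using E(1) z by (simp add: same_type_def)
    from var_coset_translate[OF this _ g] show "point_var E (g z) = point_var E z"
      using stab_image[OF g] by (simp add: point_var_def subset_insertI)
  qed
  obtain y1 y2 where
    y1: "y1 \<in> L \<and> y1 \<notin> E \<and> \<sigma> y1 = \<sigma> y \<and> lo E y1 = lo C y \<and> hi E y1 = Fin (\<sigma> e)" and
    y2: "y2 \<in> L \<and> y2 \<notin> E \<and> \<sigma> y2 = \<sigma> y \<and> lo E y2 = Fin (\<sigma> e) \<and> hi E y2 = hi C y" and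
    sum: "\<forall>\<phi> :: 's \<Rightarrow> ((('s, nat) gset set \<Rightarrow>\<^sub>0 nat) \<Rightarrow>\<^sub>0 int). invariant (stab E) (\<lambda>g x. g x) ?Y \<phi> \<longrightarrow>
      orbit_sum (stab E) (\<lambda>g x. g x) ?Y \<phi> = \<phi> y1 + \<phi> y2 + (if \<sigma> e = \<sigma> y then \<phi> e else 0)"
    using point_orbits[OF C y e(1) cut, folded E_def] by blast
  have self: "(if \<sigma> e = \<sigma> y then point_var E e else 0) \<approx> of_bool (\<sigma> e = \<sigma> y)"
    using var_coset_self[OF E(1)] by (simp add: point_var_def E_def)
  have "orbit_sum (stab E) (\<lambda>g x. g x) ?Y (point_var E) \<approx>
      typed_var (lo C y) (Fin (\<sigma> e)) (\<sigma> y) + typed_var (Fin (\<sigma> e)) (hi C y) (\<sigma> y) + of_bool (\<sigma> e = \<sigma> y)"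
    using sum[rule_format, OF inv] eqv_add[OF eqv_add[OF point_var_typed(1)[OF E(1), of y1] point_var_typed(1)[OF E(1), of y2]] self] y1 y2 by simp
  with dec show ?thesis by (rule eqv_trans)
qed

lemma typed_var_split:
  assumes ab: "a \<noteq> Pinf" "b \<noteq> Minf"
  shows "typed_var a b d \<approx> typed_var a (Fin c) d + typed_var (Fin c) b d + of_bool (c = d)"
proof -
  obtain C y e where C: "fin C" "y \<in> L" "y \<notin> C" "e \<in> L" "e \<notin> C" "y \<prec> e" "\<sigma> y = d" "\<sigma> e = c"
    "lo C y = a" "hi C y = b" "same_cut C y e" by (rule two_points[OF ab])
  have "typed_var a b d \<approx> point_var C y" using eqv_sym[OF point_var_typed(1)[OF C(1-3)]] C(7,9,10) by simp
  also have "\<dots> \<approx> typed_var a (Fin c) d + typed_var (Fin c) b d + of_bool (c = d)"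
    using point_var_split[OF C(1-5,11)] C(7-10) by simp
  finally show ?thesis .
qed

text \<open>Both sides are the class of the pairs \<open>x \<prec> y\<close> of colors \<open>c\<close>, \<open>d\<close> in an interval, computed by adding \<open>x\<close>
  first or \<open>y\<close> first.\<close>

lemma typed_var_swap:
  assumes ab: "a \<noteq> Pinf" "b \<noteq> Minf"
  shows "typed_var a b c * typed_var (Fin c) b d \<approx> typed_var a b d * typed_var a (Fin d) c"
proof -
  obtain C x y where C: "fin C" "x \<in> L" "x \<notin> C" "y \<in> L" "y \<notin> C" "x \<prec> y" "\<sigma> x = c" "\<sigma> y = d"
    "lo C x = a" "hi C x = b" "same_cut C x y" by (rule two_points[OF ab])
  have nyx: "\<not> y \<prec> x" by (rule less_asym[OF C(6)])
  have ne: "x \<noteq> y" using C(6) by auto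
  have cut': "same_cut C y x" using C(11) by (auto simp: same_cut_def)
  have loy: "lo C y = a" "hi C y = b" using same_cut_lo_hi[OF C(11)] C(9,10) by simp_all
  have Cx: "fin (insert x C)" and Cy: "fin (insert y C)" and Cxy: "fin (insert y (insert x C))" using C by simp_all
  have X: "point_var C x \<approx> typed_var a b c" using point_var_typed(1)[OF C(1-3)] C(7,9,10) by simp
  have Y: "point_var C y \<approx> typed_var a b d" using point_var_typed(1)[OF C(1,4,5)] C(8) loy by simp
  have XY: "point_var (insert x C) y \<approx> typed_var (Fin c) b d"
    using point_var_typed(1)[OF Cx C(4)] lo_hi_insert_near(1)[OF C(1) cut' C(6)] lo_hi_insert_near(4)[OF C(1) cut' nyx]
      C(5,7,8) ne loy by simp
  have YX: "point_var (insert y C) x \<approx> typed_var a (Fin d) c"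
    using point_var_typed(1)[OF Cy C(2)] lo_hi_insert_near(2)[OF C(1) C(11) C(6)] lo_hi_insert_near(3)[OF C(1) C(11) nyx]
      C(3,7-10) ne by simp
  let ?v = "var (coset_gset C (insert y (insert x C)))"
  have t: "typed_var (Fin c) b d \<in> \<R>" "typed_var a b c \<in> \<R>" "typed_var a b d \<in> \<R>" "typed_var a (Fin d) c \<in> \<R>"
    using ab by (simp_all add: typed_var_closed)
  have "?v \<approx> point_var (insert x C) y * point_var C x"
    using var_coset_mult[OF Cxy, of "insert x C" C] by (simp add: point_var_def subset_insertI)
  also have "\<dots> \<approx> typed_var (Fin c) b d * typed_var a b c"
    by (rule eqv_mult[OF XY X point_var_closed[OF Cx C(4)] t(2)])
  finally have 1: "?v \<approx> typed_var a b c * typed_var (Fin c) b d" by (simp add: mult.commute)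
  have "?v \<approx> point_var (insert y C) x * point_var C y"
    using var_coset_mult[OF Cxy, of "insert y C" C] by (simp add: point_var_def subset_insertI insert_commute)
  also have "\<dots> \<approx> typed_var a (Fin d) c * typed_var a b d"
    by (rule eqv_mult[OF YX Y point_var_closed[OF Cy C(2)] t(3)])
  finally have 2: "?v \<approx> typed_var a b d * typed_var a (Fin d) c" by (simp add: mult.commute)
  show ?thesis by (rule eqv_trans[OF eqv_sym[OF 1] 2])
qed

end

section \<open>Idempotents indexed by tables\<close>

lemma finite_extended: "finite (UNIV :: 'c::finite extended set)"
proof -
  have "(UNIV :: 'c extended set) = insert Pinf (insert Minf (range Fin))"
  proof (rule UNIV_eq_I)
    show "x \<in> insert Pinf (insert Minf (range Fin))" for x :: "'c extended" by (cases x) simp_all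
  qed
  then show ?thesis by (rule ssubst) simp
qed

context colored_line
begin

text \<open>The element that takes the value \<open>S\<^bsub>c,a\<^esub>\<close> under the measure of a tree. The three
  formulas invert \<open>\<eta>\<^bsub>a,b\<^esub>(c) = S\<^bsub>c,a\<^esub> - S\<^bsub>c,b\<^esub> - \<delta>\<^bsub>b,c\<^esub>\<close> when one of the endpoints has color \<open>c\<close>.\<close>

definition toward :: "'c \<Rightarrow> 'c extended \<Rightarrow> ((('s, nat) gset set \<Rightarrow>\<^sub>0 nat) \<Rightarrow>\<^sub>0 int)" where
  "toward c a = (case a of
     Fin b \<Rightarrow> - typed_var (Fin c) (Fin b) c - of_bool (b = c)
   | Pinf \<Rightarrow> - typed_var (Fin c) Pinf c
   | Minf \<Rightarrow> typed_var Minf (Fin c) c + 1)"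

definition toward_eta :: "'c extended \<Rightarrow> 'c extended \<Rightarrow> 'c \<Rightarrow> ((('s, nat) gset set \<Rightarrow>\<^sub>0 nat) \<Rightarrow>\<^sub>0 int)" where
  "toward_eta a b c = toward c a - toward c b - of_bool (b = Fin c)"

lemma of_bool_closed: "of_bool b \<in> \<R>"
  by (cases b) (simp_all add: gen_closed)

lemma toward_closed: "toward c a \<in> \<R>"
  unfolding toward_def by (cases a) (simp_all add: gen_closed of_bool_closed typed_var_closed)

lemma toward_eta_closed: "toward_eta a b c \<in> \<R>"
  unfolding toward_eta_def by (intro gen_closed(3) toward_closed of_bool_closed)

lemma eqv_by_diff: "u \<approx> v \<Longrightarrow> a - b = u - v \<Longrightarrow> a \<approx> b"
  by (simp add: eqv_def)

text \<open>Cutting at a point of the same color gives \<open>t = 2 t + 1\<close>.\<close>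

lemma typed_var_same: "typed_var (Fin c) (Fin c) c \<approx> - 1"
  by (rule eqv_by_diff[OF eqv_sym[OF typed_var_split[of "Fin c" "Fin c" c c]]]) simp_all

lemma toward_self: "toward c (Fin c) \<approx> 0"
  by (rule eqv_by_diff[OF eqv_sym[OF typed_var_same[of c]]]) (simp add: toward_def)

lemma typed_var_right_end:
  assumes "a \<noteq> Pinf" shows "typed_var a (Fin c) c \<approx> toward c a - 1"
proof (cases a)
  case (Fin b)
  have "typed_var (Fin c) (Fin b) c + typed_var (Fin b) (Fin c) c + of_bool (b = c) \<approx> - 1"
    by (rule eqv_trans[OF eqv_sym[OF typed_var_split] typed_var_same]) simp_all
  then show ?thesis unfolding Fin by (rule eqv_by_diff) (simp add: toward_def)
qed (use assms in \<open>simp_all add: toward_def\<close>)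

lemma typed_var_left_end: "b \<noteq> Minf \<Longrightarrow> typed_var (Fin c) b c = - toward c b - of_bool (b = Fin c)"
  by (cases b) (simp_all add: toward_def)

lemma typed_var_toward:
  assumes ab: "a \<noteq> Pinf" "b \<noteq> Minf" shows "typed_var a b c \<approx> toward_eta a b c"
proof -
  have "typed_var a b c \<approx> typed_var a (Fin c) c + typed_var (Fin c) b c + 1"
    using typed_var_split[OF ab, of c c] by simp
  also have "\<dots> \<approx> (toward c a - 1) + typed_var (Fin c) b c + 1"
    by (intro eqv_add typed_var_right_end[OF ab(1)] eqv_refl)
  also have "\<dots> = toward_eta a b c" by (simp add: toward_eta_def typed_var_left_end[OF ab(2)])
  finally show ?thesis .
qed

lemma toward_eta_swap:
  assumes ab: "a \<noteq> Pinf" "b \<noteq> Minf"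
  shows "toward_eta a b c * toward_eta (Fin c) b d \<approx> toward_eta a b d * toward_eta a (Fin d) c"
proof -
  have "toward_eta a b c * toward_eta (Fin c) b d \<approx> typed_var a b c * typed_var (Fin c) b d"
    by (intro eqv_mult eqv_sym[OF typed_var_toward] toward_eta_closed typed_var_closed) (use ab in simp_all)
  also have "\<dots> \<approx> typed_var a b d * typed_var a (Fin d) c" by (rule typed_var_swap[OF ab])
  also have "\<dots> \<approx> toward_eta a b d * toward_eta a (Fin d) c"
    by (intro eqv_mult typed_var_toward toward_eta_closed typed_var_closed) (use ab in simp_all)
  finally show ?thesis .
qed

text \<open>Idempotence is the swap relation for two points of the same color next to an endpoint of that color.\<close>

lemma toward_idem: "toward c a * toward c a \<approx> toward c a"
proof -
  let ?z = "toward c (Fin c)" and ?s = "toward c a"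
  have sq: "w * w \<approx> w * (- 1)" if u: "u * u \<approx> u * (- 1)" "u \<approx> w" "u \<in> \<R>" "w \<in> \<R>" for u w
  proof -
    have m: "- 1 \<in> \<R>" using gen_closed(5)[of "- 1"] by simp
    have "w * w \<approx> u * u" by (rule eqv_sym[OF eqv_mult[OF u(2,2,3,4)]])
    from eqv_trans[OF eqv_trans[OF this u(1)] eqv_mult[OF u(2) eqv_refl u(3) m]] show ?thesis .
  qed
  show ?thesis
  proof (cases "a = Pinf")
    case False
    have "?s - 1 - ?z \<approx> ?s - 1 - 0" by (intro eqv_diff eqv_refl toward_self)
    then have h: "?s - ?z - 1 \<approx> ?s - 1" by (simp add: algebra_simps)
    have h': "(?s - ?z - 1) * (?s - ?z - 1) \<approx> (?s - ?z - 1) * (- 1)"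
      using eqv_sym[OF toward_eta_swap[OF False, of "Fin c" c c]] by (simp add: toward_eta_def)
    have "(?s - 1) * (?s - 1) \<approx> (?s - 1) * (- 1)"
      by (rule sq[OF h' h]) (simp_all add: gen_closed toward_closed)
    then show ?thesis by (rule eqv_by_diff) (simp add: algebra_simps)
  next
    case True
    have h: "?z - ?s \<approx> 0 - ?s" by (intro eqv_diff eqv_refl toward_self)
    have h': "(?z - ?s) * (?z - ?s) \<approx> (?z - ?s) * (- 1)"
      using toward_eta_swap[of "Fin c" Pinf c c] True by (simp add: toward_eta_def)
    have "(0 - ?s) * (0 - ?s) \<approx> (0 - ?s) * (- 1)"
      by (rule sq[OF h' h]) (simp_all add: gen_closed toward_closed)
    then show ?thesis by simp
  qed
qed

text \<open>The atom of the Boolean algebra of idempotents generated by the elements \<open>toward c a\<close> at which exactly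
  those with \<open>(c, a) \<in> X\<close> are 1.\<close>

definition table_idem :: "('c \<times> 'c extended) set \<Rightarrow> ((('s, nat) gset set \<Rightarrow>\<^sub>0 nat) \<Rightarrow>\<^sub>0 int)" where
  "table_idem X = (\<Prod>(c, a)\<in>X. toward c a) * (\<Prod>(c, a)\<in>- X. 1 - toward c a)"

abbreviation (input) "set_table X \<equiv> (\<lambda>c a. (c, a) \<in> X)"

lemma finite_cells: "finite (X :: ('c \<times> 'c extended) set)"
  by (rule finite_subset[OF subset_UNIV]) (simp add: finite_Prod_UNIV finite_extended)

lemma table_idem_closed: "table_idem X \<in> \<R>"
  unfolding table_idem_def by (intro gen_closed(2) gen_sum_prod_closed(2)) (auto intro: gen_closed toward_closed)

lemma sum_table_idem: "(\<Sum>X\<in>UNIV. table_idem X) = 1"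
proof -
  have "(\<Prod>i\<in>UNIV. (case i of (c, a) \<Rightarrow> toward c a) + (case i of (c, a) \<Rightarrow> 1 - toward c a)) =
      (\<Sum>X\<in>Pow UNIV. (\<Prod>(c, a)\<in>X. toward c a) * (\<Prod>(c, a)\<in>UNIV - X. 1 - toward c a))"
    by (rule prod_add[OF finite_cells])
  then show ?thesis by (simp add: table_idem_def case_prod_beta Compl_eq_Diff_UNIV)
qed

text \<open>Multiplication by \<open>q\<close> on the ideal generated by \<open>table_idem X\<close>. It is by an integer for every \<open>q\<close>
  (\<open>scalar_exists\<close>), so that this ideal is spanned by \<open>table_idem X\<close> as an abelian group.\<close>

definition scalar :: "('c \<times> 'c extended) set \<Rightarrow> ((('s, nat) gset set \<Rightarrow>\<^sub>0 nat) \<Rightarrow>\<^sub>0 int) \<Rightarrow> int \<Rightarrow> bool" where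
  "scalar X q n \<longleftrightarrow> q \<in> \<R> \<and> q * table_idem X \<approx> of_int n * table_idem X"

lemma scalar_of_int: "scalar X (of_int n) n"
  by (simp add: scalar_def gen_closed)

lemma scalar_add: "scalar X q m \<Longrightarrow> scalar X r n \<Longrightarrow> scalar X (q + r) (m + n)"
  unfolding scalar_def using eqv_add[of "q * table_idem X" _ "r * table_idem X"] by (simp add: gen_closed distrib_right)

lemma scalar_diff: "scalar X q m \<Longrightarrow> scalar X r n \<Longrightarrow> scalar X (q - r) (m - n)"
  unfolding scalar_def using eqv_diff[of "q * table_idem X" _ "r * table_idem X"] by (simp add: gen_closed left_diff_distrib)

lemma scalar_mult: assumes q: "scalar X q m" and r: "scalar X r n" shows "scalar X (q * r) (m * n)"
proof -
  let ?e = "table_idem X"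
  have qr: "q \<in> \<R>" "r \<in> \<R>" "q * ?e \<approx> of_int m * ?e" "r * ?e \<approx> of_int n * ?e" using q r by (simp_all add: scalar_def)
  have c: "of_int m * ?e \<in> \<R>" "of_int n * ?e \<in> \<R>" by (simp_all add: gen_closed table_idem_closed)
  have "q * (r * ?e) \<approx> q * (of_int n * ?e)" by (rule eqv_mult[OF eqv_refl qr(4,1) c(2)])
  also have "q * (of_int n * ?e) = of_int n * (q * ?e)" by (simp add: ac_simps)
  also have "of_int n * (q * ?e) \<approx> of_int n * (of_int m * ?e)"
    by (rule eqv_mult[OF eqv_refl qr(3) gen_closed(5) c(1)])
  finally show ?thesis using qr by (simp add: scalar_def gen_closed ac_simps)
qed

lemma scalar_cong: "scalar X q n \<Longrightarrow> r \<in> \<R> \<Longrightarrow> r \<approx> q \<Longrightarrow> scalar X r n"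
  unfolding scalar_def using eqv_trans[OF eqv_mult[OF _ eqv_refl _ table_idem_closed]] by blast

lemma scalar_toward: "scalar X (toward c a) (of_bool ((c, a) \<in> X))"
proof -
  let ?s = "toward c a"
  have one: "1 \<in> \<R>" by (rule gen_closed(6))
  show ?thesis
  proof (cases "(c, a) \<in> X")
    case True
    let ?r = "(\<Prod>(c, a)\<in>X - {(c, a)}. toward c a) * (\<Prod>(c, a)\<in>- X. 1 - toward c a)"
    have e: "table_idem X = ?s * ?r"
      unfolding table_idem_def prod.remove[OF finite_cells True] by (simp add: mult.assoc)
    have r: "?r \<in> \<R>" by (intro gen_closed(2) gen_sum_prod_closed(2)) (auto intro: gen_closed toward_closed)
    have "(?s * ?s) * ?r \<approx> ?s * ?r"
      by (intro eqv_mult toward_idem eqv_refl gen_closed(2) toward_closed r)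
    then show ?thesis using True by (simp add: scalar_def toward_closed e mult.assoc)
  next
    case False
    let ?r = "(\<Prod>(c, a)\<in>X. toward c a) * (\<Prod>(c, a)\<in>- X - {(c, a)}. 1 - toward c a)"
    have F: "(c, a) \<in> - X" using False by simp
    have e: "table_idem X = (1 - ?s) * ?r"
      unfolding table_idem_def prod.remove[OF finite_cells F] by (simp add: ac_simps)
    have r: "?r \<in> \<R>" by (intro gen_closed(2) gen_sum_prod_closed(2)) (auto intro: gen_closed toward_closed)
    have "?s * (1 - ?s) \<approx> 0"
      by (rule eqv_by_diff[OF eqv_sym[OF toward_idem[of c a]]]) (simp add: algebra_simps)
    then have "(?s * (1 - ?s)) * ?r \<approx> 0 * ?r"
      by (intro eqv_mult eqv_refl gen_closed(2,3) toward_closed r one)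
    then show ?thesis using False by (simp add: scalar_def toward_closed e mult.assoc)
  qed
qed

lemma scalar_toward_eta: "scalar X (toward_eta a b c) (table_eta (set_table X) a b c)"
proof -
  have "scalar X (of_bool (b = Fin c)) (of_bool (b = Fin c))"
    using scalar_of_int[of X "of_bool (b = Fin c)"] by (cases "b = Fin c") simp_all
  then show ?thesis unfolding toward_eta_def table_eta_def
    by (intro scalar_diff scalar_toward)
qed

lemma scalar_unique:
  assumes "scalar X q m" "scalar X r n" "q \<approx> r" and mn: "m - n = 1 \<or> m - n = - 1"
  shows "table_idem X \<approx> 0"
proof -
  have "scalar X q n" using assms by (intro scalar_cong[OF assms(2)]) (simp_all add: scalar_def)
  then have "of_int m * table_idem X \<approx> of_int n * table_idem X"
    using assms(1) eqv_trans[OF eqv_sym] unfolding scalar_def by blast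
  then have J: "of_int (m - n) * table_idem X \<in> J" by (simp add: eqv_def left_diff_distrib)
  show ?thesis using mn
  proof
    assume "m - n = 1" then show ?thesis using J by (simp add: eqv_zero)
  next
    assume "m - n = - 1" then show ?thesis using J_uminus[OF J] by (simp add: eqv_zero)
  qed
qed

text \<open>Where the table condition fails at \<open>c\<close>, \<open>d\<close>, \<open>a\<close>, the swap relation for the colors \<open>c\<close>, \<open>d\<close> multiplies the
  idempotent by \<open>1\<close> on one side more, or less, than on the other. The interval is chosen with left end of type
  \<open>a\<close> and right end of color \<open>d\<close>, or, if \<open>a\<close> is \<open>Pinf\<close>, with left end of color \<open>c\<close> and right end \<open>Pinf\<close>.\<close>

lemma table_idem_invalid:
  assumes "\<not> valid_table (set_table X)" shows "table_idem X \<approx> 0"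
proof (cases "\<exists>c. (c, Fin c) \<in> X")
  case True
  then obtain c where c: "(c, Fin c) \<in> X" by blast
  show ?thesis
    by (rule scalar_unique[OF scalar_toward[of X c "Fin c"] _ toward_self, of 0])
      (use scalar_of_int[of X 0] c in simp_all)
next
  case False
  let ?F = "set_table X"
  obtain c d a where cd: "c \<noteq> d" "?F c a \<noteq> ?F c (Fin d)" "?F d a \<noteq> ?F d (Fin c)"
    using assms False unfolding valid_table_def by blast
  have n: "\<not> ?F c (Fin c)" "\<not> ?F d (Fin d)" using False by blast+
  have use_swap: "table_idem X \<approx> 0" if "a' \<noteq> Pinf" "b' \<noteq> Minf"
    "table_eta ?F a' b' c * table_eta ?F (Fin c) b' d - table_eta ?F a' b' d * table_eta ?F a' (Fin d) c \<in> {1, - 1}" for a' b'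
    by (rule scalar_unique[OF scalar_mult[OF scalar_toward_eta scalar_toward_eta]
      scalar_mult[OF scalar_toward_eta scalar_toward_eta] toward_eta_swap[OF that(1,2), of c d]]) (use that(3) in simp)
  show ?thesis
  proof (cases "a = Pinf")
    case a: False
    show ?thesis by (rule use_swap[of a "Fin d"]) (use a cd n in \<open>auto simp: table_eta_def of_bool_def\<close>)
  next
    case True
    show ?thesis by (rule use_swap[of "Fin c" Pinf]) (use True cd n in \<open>auto simp: table_eta_def of_bool_def\<close>)
  qed
qed

lemma scalar_exists:
  assumes q: "q \<in> \<R>" shows "\<exists>n. scalar X q n"
proof -
  let ?N = "\<lambda>q. \<exists>n. scalar X q n"
  have N: "?N (q + r) \<and> ?N (q * r)" if q: "?N q" and r: "?N r" for q r
  proof -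
    obtain m where m: "scalar X q m" using q by (elim exE)
    obtain n where n: "scalar X r n" using r by (elim exE)
    show ?thesis using scalar_add[OF m n] scalar_mult[OF m n] by (intro conjI exI)
  qed
  have var: "?N (var Y)" if Y: "finitary_gset L H (Y :: ('s, nat) gset)" for Y
  proof (rule var_generated[OF _ _ _ _ _ _ Y])
    show "?N (q + r)" if "?N q" "?N r" for q r by (rule N[OF that, THEN conjunct1])
    show "?N (q * r)" if "?N q" "?N r" for q r by (rule N[OF that, THEN conjunct2])
    show "?N 0" using scalar_of_int[of X 0] by (intro exI) simp
    show "?N 1" using scalar_of_int[of X 1] by (intro exI) simp
    show "?N r" if q: "?N q" and r: "r \<in> \<R>" "r \<approx> q" for q r
    proof -
      obtain m where m: "scalar X q m" using q by (elim exE)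
      show ?thesis by (rule exI, rule scalar_cong[OF m r])
    qed
    fix A x assume A: "fin A" "x \<in> L" "x \<notin> A"
    have lh: "lo A x \<noteq> Pinf" "hi A x \<noteq> Minf" by (simp_all add: lo_def hi_def lower_type_def upper_type_def)
    have "point_var A x \<approx> toward_eta (lo A x) (hi A x) (\<sigma> x)"
      by (rule eqv_trans[OF point_var_typed(1)[OF A] typed_var_toward[OF lh]])
    show "?N (var (coset_gset A (insert x A)))"
      unfolding point_var_def[symmetric]
      by (rule exI, rule scalar_cong[OF scalar_toward_eta point_var_closed[OF A(1,2)]]) fact
  qed
  show ?thesis
  proof (rule int_poly_induct[OF q[unfolded gen_ring_eq]])
    show "?N (of_int n)" for n by (rule exI, rule scalar_of_int)
    show "?N (poly_var v)" if v: "v \<in> {gset_class L H X | X :: ('s, nat) gset. finitary_gset L H X}" for v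
    proof -
      obtain Y :: "('s, nat) gset" where Y: "finitary_gset L H Y" "v = gset_class L H Y" using v by blast
      show ?thesis using var[OF Y(1)] unfolding gset_var_def Y(2) .
    qed
    show "?N (q + r)" if "?N q" "?N r" for q r by (rule N[OF that, THEN conjunct1])
    show "?N (q * r)" if "?N q" "?N r" for q r by (rule N[OF that, THEN conjunct2])
  qed
qed

text \<open>Multiply \<open>q\<close> by the partition of unity into table idempotents.\<close>

lemma table_expansion:
  assumes q: "q \<in> \<R>"
  shows "\<exists>n. q \<approx> (\<Sum>X | valid_table (set_table X). of_int (n X) * table_idem X)"
proof -
  have "\<forall>X. \<exists>n. scalar X q n" by (intro allI scalar_exists[OF q])
  from choice[OF this] obtain n where n: "\<forall>X. scalar X q (n X)" by (elim exE)
  have "q = (\<Sum>X\<in>UNIV. q * table_idem X)" using sum_table_idem by (simp flip: sum_distrib_left)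
  also have "\<dots> \<approx> (\<Sum>X\<in>UNIV. if valid_table (set_table X) then of_int (n X) * table_idem X else 0)"
  proof (rule eqv_sum)
    fix X :: "('c \<times> 'c extended) set"
    show "q * table_idem X \<approx> (if valid_table (set_table X) then of_int (n X) * table_idem X else 0)"
    proof (cases "valid_table (set_table X)")
      case True then show ?thesis using n[rule_format, of X] by (simp add: scalar_def)
    next
      case False
      have "q * table_idem X \<approx> q * 0" by (intro eqv_mult eqv_refl table_idem_invalid[OF False] q gen_closed(7))
      then show ?thesis using False by simp
    qed
  qed
  also have "\<dots> = (\<Sum>X | valid_table (set_table X). of_int (n X) * table_idem X)"
    by (simp add: sum.If_cases finite_cells Finite_Set.finite_set)
  finally show ?thesis by blast
qed

end

section \<open>Evaluation at a measure\<close>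

lemma finite_triple_classes: "finite (triple_classes :: ((nat, 'c::finite) dtree \<times> nat \<times> nat) set set)"
  using card_triple_classes[where 'c = 'c] by (intro card_ge_0_finite) simp

context colored_line
begin

text \<open>A measure is constant on an isomorphism class, so it does not matter which member is chosen.\<close>

definition class_value :: "(('s, nat) gset \<Rightarrow> int) \<Rightarrow> ('s, nat) gset set \<Rightarrow> int" where
  "class_value \<mu> K = \<mu> (SOME Y. Y \<in> K)"

definition measure_eval :: "(('s, nat) gset \<Rightarrow> int) \<Rightarrow> ((('s, nat) gset set \<Rightarrow>\<^sub>0 nat) \<Rightarrow>\<^sub>0 int) \<Rightarrow> int" where
  "measure_eval \<mu> = poly_eval (class_value \<mu>)"

lemmas measure_eval_simps = poly_eval_add[where x = "class_value _", folded measure_eval_def]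
  poly_eval_mult[where x = "class_value _", folded measure_eval_def]
  poly_eval_diff[where x = "class_value _", folded measure_eval_def]
  poly_eval_uminus[where x = "class_value _", folded measure_eval_def]
  poly_eval_of_int[where x = "class_value _", folded measure_eval_def]
  poly_eval_one[where x = "class_value _", folded measure_eval_def]
  poly_eval_zero[where x = "class_value _", folded measure_eval_def]
  poly_eval_sum[where x = "class_value _", folded measure_eval_def]
  poly_eval_prod[where x = "class_value _", folded measure_eval_def]

lemma measure_eval_of_bool: "measure_eval \<mu> (of_bool b) = of_bool b"
  by (cases b) (simp_all add: measure_eval_simps)

lemma measureD:
  assumes "is_measure L H (\<mu> :: ('s, nat) gset \<Rightarrow> int)"
  shows "finitary_gset L H X \<Longrightarrow> finitary_gset L H Y \<Longrightarrow> gset_iso L H X Y \<Longrightarrow> \<mu> X = \<mu> Y"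
    and "finitary_gset L H X \<Longrightarrow> gset_iso L H X (gset_one L H) \<Longrightarrow> \<mu> X = 1"
    and "g \<in> H \<Longrightarrow> finitary_gset L H X \<Longrightarrow> \<mu> (gset_conj L H g X) = \<mu> X"
    and "finitary_gset L H X \<Longrightarrow> finitary_gset L H Y \<Longrightarrow> finitary_gset L H Z \<Longrightarrow>
      gset_iso L H Z (gset_coprod X Y) \<Longrightarrow> \<mu> Z = \<mu> X + \<mu> Y"
    and "transitive_gset L H U X \<Longrightarrow> transitive_gset L H U Y \<Longrightarrow> gset_map U f X Y \<Longrightarrow> y \<in> pts Y \<Longrightarrow>
      \<mu> X = \<mu> (gset_fiber L f X Y y) * \<mu> Y"
proof -
  note m = assms[unfolded is_measure_def]
  show "finitary_gset L H X \<Longrightarrow> finitary_gset L H Y \<Longrightarrow> gset_iso L H X Y \<Longrightarrow> \<mu> X = \<mu> Y"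
    using m[THEN conjunct1, rule_format, of X Y] by simp
  show "finitary_gset L H X \<Longrightarrow> gset_iso L H X (gset_one L H) \<Longrightarrow> \<mu> X = 1"
    using m[THEN conjunct2, THEN conjunct1, rule_format, of X] by simp
  show "g \<in> H \<Longrightarrow> finitary_gset L H X \<Longrightarrow> \<mu> (gset_conj L H g X) = \<mu> X"
    using m[THEN conjunct2, THEN conjunct2, THEN conjunct1, rule_format, of g X] by simp
  show "finitary_gset L H X \<Longrightarrow> finitary_gset L H Y \<Longrightarrow> finitary_gset L H Z \<Longrightarrow>
      gset_iso L H Z (gset_coprod X Y) \<Longrightarrow> \<mu> Z = \<mu> X + \<mu> Y"
    using m[THEN conjunct2, THEN conjunct2, THEN conjunct2, THEN conjunct1, rule_format, of X Y Z] by simp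
  show "transitive_gset L H U X \<Longrightarrow> transitive_gset L H U Y \<Longrightarrow> gset_map U f X Y \<Longrightarrow> y \<in> pts Y \<Longrightarrow>
      \<mu> X = \<mu> (gset_fiber L f X Y y) * \<mu> Y"
    using m[THEN conjunct2, THEN conjunct2, THEN conjunct2, THEN conjunct2, rule_format, of U X Y f y] by simp
qed

lemma measure_eval_var:
  assumes \<mu>: "is_measure L H \<mu>" and X: "finitary_gset L H X"
    and Y: "finitary_gset L H (Y :: ('s, nat) gset)" and iso: "gset_iso L H X Y"
  shows "measure_eval \<mu> (var X) = \<mu> Y"
proof -
  let ?Z = "SOME Z. Z \<in> gset_class L H X"
  have "Y \<in> gset_class L H X" using Y iso by (simp add: gset_class_def)
  then have "?Z \<in> gset_class L H X" by (rule someI)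
  then have Z: "finitary_gset L H ?Z" "gset_iso L H X ?Z" by (simp_all add: gset_class_def)
  obtain A where A: "hat A X" using X by (rule finitaryE)
  have "\<mu> ?Z = \<mu> Y" by (rule measureD(1)[OF \<mu> Z(1) Y gset_iso_trans[OF gset_iso_sym[OF A Z(2)] iso]])
  then show ?thesis by (simp add: measure_eval_def gset_var_def poly_eval_var class_value_def)
qed

lemma measure_eval_self:
  assumes "is_measure L H \<mu>" "finitary_gset L H (X :: ('s, nat) gset)"
  shows "measure_eval \<mu> (var X) = \<mu> X"
proof -
  obtain A where A: "hat A X" using assms(2) by (rule finitaryE)
  show ?thesis by (rule measure_eval_var[OF assms assms(2) gset_iso_refl[OF A]])
qed

lemma measure_eval_relations:
  assumes \<mu>: "is_measure L H \<mu>" and r: "r \<in> theta_relations L H"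
  shows "measure_eval \<mu> r = 0"
proof -
  from r consider "r = var (gset_one L H) - 1"
    | g and X :: "('s, nat) gset" where "g \<in> H" "finitary_gset L H X" "r = var (gset_conj L H g X) - var X"
    | X Y :: "('s, nat) gset" where "finitary_gset L H X" "finitary_gset L H Y" "r = var (gset_coprod X Y) - (var X + var Y)"
    | U f y and X Y :: "('s, nat) gset" where "transitive_gset L H U X" "transitive_gset L H U Y" "gset_map U f X Y" "y \<in> pts Y"
      "r = var X - var (gset_fiber L f X Y y) * var Y"
    unfolding theta_relations_def by blast
  then show ?thesis
  proof cases
    case 1
    obtain Y :: "('s, nat) gset" where Y: "finitary_gset L H Y" "gset_iso L H (gset_one L H) Y" by (rule nat_copy[OF finitary_one])
    have "\<mu> Y = 1" by (rule measureD(2)[OF \<mu> Y(1) gset_iso_sym[OF hat_one Y(2)]])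
    then show ?thesis using measure_eval_var[OF \<mu> finitary_one Y] 1 by (simp add: measure_eval_simps)
  next
    case 2
    show ?thesis using measureD(3)[OF \<mu> 2(1,2)] measure_eval_self[OF \<mu> 2(2)]
      measure_eval_self[OF \<mu> finitary_conj[OF 2(2,1)]] 2(3) by (simp add: measure_eval_simps)
  next
    case 3
    note f = finitary_coprod[OF 3(1,2)]
    obtain Z :: "('s, nat) gset" where Z: "finitary_gset L H Z" "gset_iso L H (gset_coprod X Y) Z" by (rule nat_copy[OF f])
    obtain A where A: "hat A (gset_coprod X Y)" using f by (rule finitaryE)
    have "\<mu> Z = \<mu> X + \<mu> Y" by (rule measureD(4)[OF \<mu> 3(1,2) Z(1) gset_iso_sym[OF A Z(2)]])
    then show ?thesis using measure_eval_var[OF \<mu> f Z] measure_eval_self[OF \<mu> 3(1)] measure_eval_self[OF \<mu> 3(2)] 3(3)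
      by (simp add: measure_eval_simps)
  next
    case 4
    have f: "finitary_gset L H X" "finitary_gset L H Y" using 4(1,2) by (simp_all add: transitive_gset_def)
    show ?thesis using measureD(5)[OF \<mu> 4(1-4)] measure_eval_self[OF \<mu> f(1)] measure_eval_self[OF \<mu> f(2)]
      measure_eval_self[OF \<mu> finitary_fiber[OF 4(1-4)]] 4(5) by (simp add: measure_eval_simps)
  qed
qed

text \<open>A family of measures evaluates polynomials to families of integers. The axioms of a measure say that the
  defining relations go to zero.\<close>

lemma eval_kernel_ideal:
  assumes \<mu>: "\<And>i. i \<in> I \<Longrightarrow> is_measure L H (\<mu> i)"
  defines "h \<equiv> (\<lambda>q. \<lambda>i\<in>I. measure_eval (\<mu> i) q)"
  shows "ring_hom_ring (theta_poly_ring L H) (int_power_ring I) h"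
    and "J \<subseteq> a_kernel (theta_poly_ring L H) (int_power_ring I) h"
    and "q \<in> a_kernel (theta_poly_ring L H) (int_power_ring I) h \<longleftrightarrow> q \<in> \<R> \<and> (\<forall>i\<in>I. measure_eval (\<mu> i) q = 0)"
proof -
  show h: "ring_hom_ring (theta_poly_ring L H) (int_power_ring I) h"
    unfolding h_def measure_eval_def theta_poly_ring_def by (rule eval_hom)
  have k: "q \<in> a_kernel (theta_poly_ring L H) (int_power_ring I) h \<longleftrightarrow> q \<in> \<R> \<and> (\<forall>i\<in>I. measure_eval (\<mu> i) q = 0)" for q
    unfolding a_kernel_def' h_def by (simp add: int_power_ring_def restrict_def fun_eq_iff) metis
  then show "q \<in> a_kernel (theta_poly_ring L H) (int_power_ring I) h \<longleftrightarrow> q \<in> \<R> \<and> (\<forall>i\<in>I. measure_eval (\<mu> i) q = 0)" .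
  show "J \<subseteq> a_kernel (theta_poly_ring L H) (int_power_ring I) h"
    unfolding theta_ideal_def
  proof (rule ring.genideal_minimal[OF cring.axioms(1)[OF cring_gen] ring_hom_ring.kernel_is_ideal[OF h]], rule subsetI)
    fix r assume r: "r \<in> theta_relations L H"
    then have "r \<in> \<R>" using relations_closed by blast
    then show "r \<in> a_kernel (theta_poly_ring L H) (int_power_ring I) h"
      unfolding k using measure_eval_relations[OF \<mu> r] by simp
  qed
qed

lemma measure_eval_J:
  assumes \<mu>: "is_measure L H \<mu>" and q: "q \<in> J" shows "measure_eval \<mu> q = 0"
  using subsetD[OF eval_kernel_ideal(2)[of "{()}" "\<lambda>_. \<mu>"] q] eval_kernel_ideal(3)[of "{()}" "\<lambda>_. \<mu>" q] \<mu> by simp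

lemma measure_eval_cong: "is_measure L H \<mu> \<Longrightarrow> q \<approx> r \<Longrightarrow> measure_eval \<mu> q = measure_eval \<mu> r"
  using measure_eval_J[of \<mu> "q - r"] by (simp add: eqv_def measure_eval_simps)

subsection \<open>The measure of a tree\<close>

lemma tree_measureD:
  assumes "is_tree_measure cyc \<sigma> p T u v \<mu>"
  shows "is_measure L H \<mu>"
    and "interval_ends cyc p l r \<Longrightarrow> finitary_gset L H X \<Longrightarrow> gset_iso L H X (word_gset cyc \<sigma> p l r w) \<Longrightarrow>
      \<mu> X = nu T u v (map_extended \<sigma> l) (map_extended \<sigma> r) w"
  using assms unfolding is_tree_measure_def by simp_all

lemma finitary_word: "interval_ends cyc p l r \<Longrightarrow> finitary_gset L H (word_gset cyc \<sigma> p l r w)"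
  by (rule finitaryI[OF hat_word(1)]) (simp_all add: word_gset_def)

text \<open>Up to isomorphism the orbit of \<open>z\<close> is the set \<open>I\<^sup>w\<close> for the interval \<open>I\<close> between the neighbors of \<open>z\<close> and the
  one-letter word \<open>w\<close>.\<close>

lemma tree_measure_point:
  assumes \<mu>: "is_tree_measure cyc \<sigma> p T u v \<mu>" and A: "fin A" "z \<in> L" "z \<notin> A"
  shows "measure_eval \<mu> (point_var A z) = eta T u v (lo A z) (hi A z) (\<sigma> z)"
proof -
  note m = tree_measureD(1)[OF \<mu>]
  obtain l r where i: "interval_ends cyc p l r" and z: "z \<in> line_interval cyc p l r"
    and t: "map_extended \<sigma> l = lo A z" "map_extended \<sigma> r = hi A z" and N: "{u. Fin u \<in> {l, r}} \<subseteq> A"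
    and same: "\<forall>z'. same_type {u. Fin u \<in> {l, r}} z z' \<longrightarrow> same_type A z z'" by (rule neighbors[OF A])
  let ?N = "{u. Fin u \<in> {l, r}}"
  let ?X = "word_gset cyc \<sigma> p l r [\<sigma> z]"
  note X = hat_word[OF i, where w = "[\<sigma> z]"]
  have f: "finitary_gset L H ?X" by (rule finitary_word[OF i])
  have zX: "[z] \<in> pts ?X" using z by (simp add: word_gset_def word_tuples_def)
  have "var ?X = point_var ?N z" unfolding point_var_def using var_transitive[OF X(1) zX X(4)[OF zX]] X(3)[OF zX] by simp
  moreover have "point_var ?N z \<approx> point_var A z" by (rule point_var_subset[OF A(1) N A(2) same[rule_format]])
  ultimately have e: "measure_eval \<mu> (point_var A z) = measure_eval \<mu> (var ?X)"
    using measure_eval_cong[OF m] by metis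
  obtain Y :: "('s, nat) gset" where Y: "finitary_gset L H Y" "gset_iso L H ?X Y" by (rule nat_copy[OF f])
  have "\<mu> Y = nu T u v (lo A z) (hi A z) ([] @ [\<sigma> z])"
    using tree_measureD(2)[OF \<mu> i Y(1) gset_iso_sym[OF X(1) Y(2)]] t by simp
  then show ?thesis using e measure_eval_var[OF m f Y] unfolding nu_simps by simp
qed

text \<open>The classes of point orbits generate the ring, and their values are prescribed.\<close>

lemma tree_measure_agree:
  assumes \<mu>: "is_tree_measure cyc \<sigma> p T u v \<mu>" "is_tree_measure cyc \<sigma> p T u v \<mu>'" and X: "finitary_gset L H X"
  shows "\<mu> X = \<mu>' X"
proof -
  note m = tree_measureD(1)[OF \<mu>(1)] tree_measureD(1)[OF \<mu>(2)]
  have "measure_eval \<mu> (var X) = measure_eval \<mu>' (var X)"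
  proof (rule var_generated[where N = "\<lambda>q. measure_eval \<mu> q = measure_eval \<mu>' q", OF _ _ _ _ _ _ X])
    show "measure_eval \<mu> r = measure_eval \<mu>' r" if "measure_eval \<mu> q = measure_eval \<mu>' q" "r \<approx> q" for q r
      using that(1) measure_eval_cong[OF m(1) that(2)] measure_eval_cong[OF m(2) that(2)] by simp
    show "measure_eval \<mu> (var (coset_gset A (insert x A))) = measure_eval \<mu>' (var (coset_gset A (insert x A)))"
      if "fin A" "x \<in> L" "x \<notin> A" for A x
      using tree_measure_point[OF \<mu>(1) that] tree_measure_point[OF \<mu>(2) that] by (simp add: point_var_def)
  qed (simp_all add: measure_eval_simps)
  then show ?thesis using measure_eval_self[OF m(1) X] measure_eval_self[OF m(2) X] by simp
qed

lemma tree_measure_cong: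
  assumes \<mu>: "is_tree_measure cyc \<sigma> p T u v \<mu>" and eq: "\<And>X. finitary_gset L H X \<Longrightarrow> \<mu>' X = \<mu> X"
  shows "is_tree_measure cyc \<sigma> p T u v \<mu>'"
proof -
  note m = measureD[OF tree_measureD(1)[OF \<mu>]]
  have "is_measure L H \<mu>'"
    unfolding is_measure_def
  proof (intro conjI allI ballI impI)
    fix X Y :: "('s, nat) gset"
    assume "finitary_gset L H X \<and> finitary_gset L H Y \<and> gset_iso L H X Y"
    then show "\<mu>' X = \<mu>' Y" using m(1) eq by simp
  next
    fix X :: "('s, nat) gset"
    assume "finitary_gset L H X \<and> gset_iso L H X (gset_one L H)"
    then show "\<mu>' X = 1" using m(2) eq by simp
  next
    fix X :: "('s, nat) gset" and g
    assume g: "g \<in> H" and X: "finitary_gset L H X"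
    show "\<mu>' (gset_conj L H g X) = \<mu>' X" using m(3)[OF g X] eq[OF X] eq[OF finitary_conj[OF X g]] by simp
  next
    fix X Y Z :: "('s, nat) gset"
    assume "finitary_gset L H X \<and> finitary_gset L H Y \<and> finitary_gset L H Z \<and> gset_iso L H Z (gset_coprod X Y)"
    then show "\<mu>' Z = \<mu>' X + \<mu>' Y" using m(4) eq by simp
  next
    fix U and X Y :: "('s, nat) gset" and f y
    assume a: "transitive_gset L H U X \<and> transitive_gset L H U Y \<and> gset_map U f X Y" and y: "y \<in> pts Y"
    then have t: "transitive_gset L H U X" "transitive_gset L H U Y" "gset_map U f X Y" by simp_all
    have f: "finitary_gset L H X" "finitary_gset L H Y" using t(1,2) by (simp_all add: transitive_gset_def)
    show "\<mu>' X = \<mu>' (gset_fiber L f X Y y) * \<mu>' Y"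
      using m(5)[OF t y] eq[OF f(1)] eq[OF f(2)] eq[OF finitary_fiber[OF t y]] by simp
  qed
  then show ?thesis unfolding is_tree_measure_def using tree_measureD(2)[OF \<mu>] eq by simp
qed

lemma tree_measure_unique:
  assumes "(T, u, v) \<in> tree_triples"
  shows "\<exists>!\<mu>. \<mu> \<in> extensional {X. finitary_gset L H X} \<and> is_tree_measure cyc \<sigma> p T u v \<mu>"
proof -
  obtain \<mu> where \<mu>: "is_tree_measure cyc \<sigma> p T u v \<mu>"
    using tree_measure_exists[OF colored_line_axioms assms] by blast
  show ?thesis
  proof (rule ex1I[of _ "restrict \<mu> {X. finitary_gset L H X}"], intro conjI)
    show "restrict \<mu> {X. finitary_gset L H X} \<in> extensional {X. finitary_gset L H X}" by simp
    show "is_tree_measure cyc \<sigma> p T u v (restrict \<mu> {X. finitary_gset L H X})"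
      by (rule tree_measure_cong[OF \<mu>]) simp
    fix \<mu>' assume \<mu>': "\<mu>' \<in> extensional {X. finitary_gset L H X} \<and> is_tree_measure cyc \<sigma> p T u v \<mu>'"
    show "\<mu>' = restrict \<mu> {X. finitary_gset L H X}"
    proof
      fix X show "\<mu>' X = restrict \<mu> {X. finitary_gset L H X} X"
        using tree_measure_agree[OF conjunct2[OF \<mu>'] \<mu>, of X] extensional_arb[OF conjunct1[OF \<mu>'], of X]
        by (cases "finitary_gset L H X") simp_all
    qed
  qed
qed

lemma tree_measure_typed:
  assumes \<mu>: "is_tree_measure cyc \<sigma> p T u v \<mu>" and ab: "a \<noteq> Pinf" "b \<noteq> Minf"
  shows "measure_eval \<mu> (typed_var a b c) = eta T u v a b c"
proof -
  obtain A x y where A: "fin A" "x \<in> L" "x \<notin> A" "\<sigma> x = c" "lo A x = a" "hi A x = b" by (rule two_points[OF ab])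
  show ?thesis
    using tree_measure_point[OF \<mu> A(1-3)] measure_eval_cong[OF tree_measureD(1)[OF \<mu>] point_var_typed(1)[OF A(1-3)]] A(4-6)
    by simp
qed

lemma tree_measure_toward:
  assumes \<mu>: "is_tree_measure cyc \<sigma> p T u v \<mu>" and t: "(T, u, v) \<in> tree_triples"
  shows "measure_eval \<mu> (toward c a) = of_bool (table T u v c a)"
proof -
  have n: "\<not> table T u v c (Fin c)" using tree_table_valid[OF t] by (simp add: valid_table_def)
  show ?thesis
    unfolding toward_def using n
    by (cases a) (simp_all add: measure_eval_simps measure_eval_of_bool tree_measure_typed[OF \<mu>] tree_eta table_eta_def)
qed

lemma tree_measure_table_idem:
  assumes \<mu>: "is_tree_measure cyc \<sigma> p T u v \<mu>" and t: "(T, u, v) \<in> tree_triples"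
  shows "measure_eval \<mu> (table_idem X) = of_bool (set_table X = table T u v)"
proof -
  have e: "measure_eval \<mu> (table_idem X) =
      (\<Prod>(c, a)\<in>X. of_bool (table T u v c a)) * (\<Prod>(c, a)\<in>- X. 1 - of_bool (table T u v c a))"
    by (simp add: table_idem_def measure_eval_simps case_prod_beta tree_measure_toward[OF \<mu> t])
  show ?thesis
  proof (cases "set_table X = table T u v")
    case True
    have f: "table T u v c a \<longleftrightarrow> (c, a) \<in> X" for c a
      using fun_cong[OF fun_cong[OF True, of c], of a] by simp
    have "(\<Prod>(c, a)\<in>X. of_bool (table T u v c a)) = (1 :: int)" "(\<Prod>(c, a)\<in>- X. 1 - of_bool (table T u v c a)) = (1 :: int)"
      unfolding f by (auto intro: prod.neutral)
    then show ?thesis unfolding e using True by simp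
  next
    case False
    then obtain c a where ca: "((c, a) \<in> X) \<noteq> table T u v c a" by (auto simp: fun_eq_iff)
    show ?thesis
    proof (cases "(c, a) \<in> X")
      case True
      then have "(\<Prod>(c, a)\<in>X. of_bool (table T u v c a)) = (0 :: int)"
        using ca by (intro prod_zero[OF finite_cells] bexI[of _ "(c, a)"]) simp_all
      then show ?thesis unfolding e using False by simp
    next
      case n: False
      then have "(\<Prod>(c, a)\<in>- X. 1 - of_bool (table T u v c a)) = (0 :: int)"
        using ca by (intro prod_zero[OF finite_cells] bexI[of _ "(c, a)"]) simp_all
      then show ?thesis unfolding e using False by simp
    qed
  qed
qed

subsection \<open>The isomorphism\<close>

lemma class_measure:
  fixes K :: "((nat, 'c) dtree \<times> nat \<times> nat) set"
  assumes K: "K \<in> triple_classes"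
  shows "\<exists>\<mu>. is_measure L H \<mu> \<and> (\<forall>(T, u, v)\<in>K. is_tree_measure cyc \<sigma> p T u v \<mu>) \<and>
    (\<forall>X. measure_eval \<mu> (table_idem X) = of_bool (set_table X = class_table K))"
proof -
  have v: "valid_table (class_table K)" using bij_betw_apply[OF triple_classes_tables K] by simp
  interpret measure_table cyc \<sigma> p "table_eta (class_table K)" by (rule table_measure[OF v])
  have t: "is_tree_measure cyc \<sigma> p T u v mu" if "(T, u, v) \<in> K" for T u v
    by (rule mu_tree_measure) (simp add: tree_eta class_table_eq(2)[OF K that])
  have "K \<noteq> {}" using in_quotient_imp_non_empty[OF triple_iso_equiv] K unfolding triple_classes_def by blast
  then obtain T u v where T: "(T, u, v) \<in> K" by auto
  have "measure_eval mu (table_idem X) = of_bool (set_table X = class_table K)" for X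
    using tree_measure_table_idem[OF t[OF T] class_table_eq(1)[OF K T]] class_table_eq(2)[OF K T] by simp
  then show ?thesis using t mu_is_measure by (intro exI[of _ mu]) auto
qed

text \<open>Evaluation at the measures of all triples kills the relations. It sends the idempotent of a valid table to
  the unit vector of the corresponding class, hence is surjective, and by \<open>table_expansion\<close> an element with all
  values zero is a combination of valid idempotents with zero coefficients.\<close>

lemma theta_iso:
  "\<exists>\<Phi> \<in> ring_iso (Theta L H) (int_power_ring (triple_classes :: ((nat, 'c) dtree \<times> nat \<times> nat) set set)).
     \<forall>K \<in> triple_classes. \<forall>(T, u, v) \<in> K. \<exists>\<mu>.
       is_tree_measure cyc \<sigma> p T u v \<mu> \<and> measure_hom L H \<mu> (\<lambda>\<xi>. \<Phi> \<xi> K)"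
proof -
  let ?I = "triple_classes :: ((nat, 'c) dtree \<times> nat \<times> nat) set set"
  have "\<forall>K\<in>?I. \<exists>\<mu>. is_measure L H \<mu> \<and> (\<forall>(T, u, v)\<in>K. is_tree_measure cyc \<sigma> p T u v \<mu>) \<and>
    (\<forall>X. measure_eval \<mu> (table_idem X) = of_bool (set_table X = class_table K))"
    using class_measure by (rule ballI)
  from bchoice[OF this] obtain m where m0: "\<forall>K\<in>?I. is_measure L H (m K) \<and> (\<forall>(T, u, v)\<in>K. is_tree_measure cyc \<sigma> p T u v (m K)) \<and>
    (\<forall>X. measure_eval (m K) (table_idem X) = of_bool (set_table X = class_table K))" by (elim exE)
  have m: "is_measure L H (m K)" if "K \<in> ?I" for K using m0 that by simp
  have idem: "measure_eval (m K) (table_idem X) = of_bool (set_table X = class_table K)" if "K \<in> ?I" for K X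
    using m0 that by simp
  define h where "h = (\<lambda>q. \<lambda>K\<in>?I. measure_eval (m K) q)"
  define cells where "cells K = {(c, a). class_table K c a}" for K :: "((nat, 'c) dtree \<times> nat \<times> nat) set"
  have cells: "set_table X = class_table K \<longleftrightarrow> X = cells K" for X K
    unfolding cells_def by (auto simp: fun_eq_iff)
  have inj: "cells K = cells K' \<longleftrightarrow> K = K'" if "K \<in> ?I" "K' \<in> ?I" for K K'
    using that cells[of "cells K" K'] cells[of "cells K" K] bij_betw_imp_inj_on[OF triple_classes_tables]
    by (metis inj_onD)
  note hom = eval_kernel_ideal[where I = ?I and \<mu> = m, OF m, folded h_def]
  have hv: "h q K = measure_eval (m K) q" if "K \<in> ?I" for q K using that by (simp add: h_def)
  have finI: "finite ?I" by (rule finite_triple_classes)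
  have finite_tables: "finite {X :: ('c \<times> 'c extended) set. valid_table (set_table X)}"
    by (rule finite_subset[OF subset_UNIV]) (simp add: Finite_Set.finite_set finite_cells)
  have ker: "a_kernel (theta_poly_ring L H) (int_power_ring ?I) h = J"
  proof (rule equalityI[OF _ hom(2)], rule subsetI)
    fix q assume "q \<in> a_kernel (theta_poly_ring L H) (int_power_ring ?I) h"
    then have q: "q \<in> \<R>" and z: "\<And>K. K \<in> ?I \<Longrightarrow> measure_eval (m K) q = 0" using hom(3) by simp_all
    obtain n where n: "q \<approx> (\<Sum>X | valid_table (set_table X). of_int (n X) * table_idem X)"
      using table_expansion[OF q] by (elim exE)
    have "n X = 0" if X: "valid_table (set_table X)" for X
    proof -
      obtain K where K: "K \<in> ?I" "class_table K = set_table X"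
        using bij_betw_imp_surj_on[OF triple_classes_tables] X by (metis (no_types, lifting) imageE mem_Collect_eq)
      have "0 = measure_eval (m K) (\<Sum>X | valid_table (set_table X). of_int (n X) * table_idem X)"
        using measure_eval_cong[OF m[OF K(1)] n] z[OF K(1)] by simp
      also have "\<dots> = (\<Sum>Y | valid_table (set_table Y). if Y = X then n Y else 0)"
        unfolding measure_eval_simps idem[OF K(1)] K(2)
        by (rule sum.cong) (auto simp: fun_eq_iff)
      also have "\<dots> = n X" using X finite_tables by simp
      finally show ?thesis by simp
    qed
    then have "q \<approx> 0" using n by simp
    then show "q \<in> J" by (simp add: eqv_zero)
  qed
  have surj: "h ` carrier (theta_poly_ring L H) = carrier (int_power_ring ?I)"
  proof (intro equalityI subsetI)
    fix u assume "u \<in> h ` carrier (theta_poly_ring L H)"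
    then show "u \<in> carrier (int_power_ring ?I)" by (auto simp: h_def int_power_ring_def)
  next
    fix u assume u: "u \<in> carrier (int_power_ring ?I)"
    define q where "q = (\<Sum>K\<in>?I. of_int (u K) * table_idem (cells K))"
    have q: "q \<in> \<R>" unfolding q_def by (intro gen_sum_prod_closed(1) gen_closed table_idem_closed)
    have "h q = u"
    proof
      fix K show "h q K = u K"
      proof (cases "K \<in> ?I")
        case True
        have t: "measure_eval (m K) (of_int (u K') * table_idem (cells K')) = (if K' = K then u K' else 0)"
          if K': "K' \<in> ?I" for K'
          using idem[OF True, of "cells K'"] cells[of "cells K'" K] inj[OF K' True] by (simp add: measure_eval_simps)
        have "h q K = (\<Sum>K'\<in>?I. if K' = K then u K' else 0)"
          unfolding hv[OF True] q_def measure_eval_simps(8) by (rule sum.cong[OF refl t])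
        then show ?thesis using True finI by simp
      next
        case False
        then show ?thesis using u by (auto simp: h_def int_power_ring_def PiE_def extensional_def)
      qed
    qed
    then show "u \<in> h ` carrier (theta_poly_ring L H)" using q by blast
  qed
  define \<Phi> where "\<Phi> = (\<lambda>\<xi>. the_elem (h ` \<xi>))"
  have Th: "Theta L H = theta_poly_ring L H Quot a_kernel (theta_poly_ring L H) (int_power_ring ?I) h"
    unfolding ker Theta_def ..
  have iso: "\<Phi> \<in> ring_iso (Theta L H) (int_power_ring ?I)"
    unfolding \<Phi>_def Th by (rule ring_hom_ring.FactRing_iso_set[OF hom(1) surj])
  then have \<Phi>: "\<Phi> \<in> ring_hom (Theta L H) (int_power_ring ?I)" by (simp add: ring_iso_def)
  have mh: "measure_hom L H (m K) (\<lambda>\<xi>. \<Phi> \<xi> K)" if K: "K \<in> ?I" for K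
    unfolding measure_hom_def
  proof (intro conjI allI impI)
    show "(\<lambda>\<xi>. \<Phi> \<xi> K) \<in> ring_hom (Theta L H) \<Z>"
      using ring_hom_mult[OF \<Phi>] ring_hom_add[OF \<Phi>] ring_hom_one[OF \<Phi>] K
      by (intro ring_hom_memI) (simp_all add: int_power_ring_def)
    fix X :: "('s, nat) gset" assume X: "finitary_gset L H X"
    have "\<Phi> (theta_symbol L H X) = h (var X)"
      using ring_hom_ring.the_elem_simp[OF hom(1) var_closed[OF X]] unfolding \<Phi>_def theta_symbol_def ker .
    then show "\<Phi> (theta_symbol L H X) K = m K X" using hv[OF K] measure_eval_self[OF m[OF K] X] by simp
  qed
  show ?thesis
  proof (rule bexI[OF _ iso], intro ballI)
    fix K t assume K: "K \<in> ?I" and t: "t \<in> K"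
    have "\<forall>(T, u, v)\<in>K. is_tree_measure cyc \<sigma> p T u v (m K)" using m0 K by simp
    with t show "case t of (T, u, v) \<Rightarrow> \<exists>\<mu>. is_tree_measure cyc \<sigma> p T u v \<mu> \<and> measure_hom L H \<mu> (\<lambda>\<xi>. \<Phi> \<xi> K)"
      using mh[OF K] by (cases t) auto
  qed
qed

end

theorem theorem6p1:
  fixes cyc :: "'s \<Rightarrow> 's \<Rightarrow> 's \<Rightarrow> bool" and \<sigma> :: "'s \<Rightarrow> 'c::finite" and p :: 's
  assumes "colored_circle cyc \<sigma>"
  shows
    "(\<forall>(T :: ('v, 'c) dtree, x, y) \<in> tree_triples.
        \<exists>!\<mu>. \<mu> \<in> extensional {X. finitary_gset (line p) (line_auts cyc \<sigma> p) X} \<and>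
             is_tree_measure cyc \<sigma> p T x y \<mu>) \<and>
     (\<exists>\<Phi> \<in> ring_iso (Theta (line p) (line_auts cyc \<sigma> p))
              (int_power_ring (triple_classes :: ((nat, 'c) dtree \<times> nat \<times> nat) set set)).
        \<forall>C \<in> triple_classes. \<forall>(T, x, y) \<in> C. \<exists>\<mu>.
          is_tree_measure cyc \<sigma> p T x y \<mu> \<and>
          measure_hom (line p) (line_auts cyc \<sigma> p) \<mu> (\<lambda>\<xi>. \<Phi> \<xi> C)) \<and>
     Theta (line p) (line_auts cyc \<sigma> p) \<simeq>
       int_power_ring {..<(2 * card (UNIV :: 'c set) + 2) ^ card (UNIV :: 'c set)}"
proof -
  interpret colored_line cyc \<sigma> p by (rule colored_line.intro[OF assms])
  let ?I = "triple_classes :: ((nat, 'c) dtree \<times> nat \<times> nat) set set"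
  let ?n = "(2 * card (UNIV :: 'c set) + 2) ^ card (UNIV :: 'c set)"
  obtain f where "bij_betw f ?I {0..<card ?I}" using ex_bij_betw_finite_nat[OF finite_triple_classes] by blast
  then have f: "bij_betw f ?I {..<?n}" unfolding card_triple_classes atLeast0LessThan .
  obtain \<Phi> where \<Phi>: "\<Phi> \<in> ring_iso (Theta L H) (int_power_ring ?I)" using theta_iso by (elim bexE)
  have "Theta L H \<simeq> int_power_ring {..<?n}"
    unfolding is_ring_iso_def using ring_iso_set_trans[OF \<Phi> int_power_ring_reindex[OF f]] by blast
  moreover have "\<forall>(T :: ('v, 'c) dtree, x, y) \<in> tree_triples.
        \<exists>!\<mu>. \<mu> \<in> extensional {X. finitary_gset L H X} \<and> is_tree_measure cyc \<sigma> p T x y \<mu>"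
  proof
    fix t :: "('v, 'c) dtree \<times> 'v \<times> 'v" assume "t \<in> tree_triples"
    then show "case t of (T, x, y) \<Rightarrow> \<exists>!\<mu>. \<mu> \<in> extensional {X. finitary_gset L H X} \<and> is_tree_measure cyc \<sigma> p T x y \<mu>"
      by (cases t) (simp only: prod.case tree_measure_unique)
  qed
  ultimately show ?thesis using theta_iso by (intro conjI)
qed

end
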